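(* Let $X$ be a complete simplicial toric variety of dimension $n$ over an algebraically closed field $\mathbb K$ with torsion-free class group and homogeneous coordinate ring $S=\mathbb K[x_1,\dots,x_r]$. Let $Y$ be a zero-dimensional complete intersection subscheme of $X$ such that $I(Y)$ is generated by $n$ homogeneous polynomials with semi-ample degrees $\alpha_1,\dots,\alpha_n$. If for each $j\in\{1,\dots,r\}$ there is a non-zerodivisor in $S/I(Y)$ of degree $\beta_j$, then $$\alpha_1+\cdots+\alpha_n+\mathbb N\beta\subseteq\mathrm{reg}(Y).$$
   Context: Let $\Sigma$ be the fan of $X$ with rays $\rho_1,\dots,\rho_r$ and corresponding torus-invariant prime Weil divisors $D_1,\dots,D_r$. Put $\mathcal A=\mathrm{Cl}(X)$. The homogeneous coordinate ring $S=\mathbb K[x_1,\dots,x_r]=\bigoplus_{\alpha\in\mathcal A}S_\alpha$ is graded by $\deg(x_j)=\beta_j:=[D_j]\in\mathcal A$; "homogeneous" refers to this grading. $\mathbb N\beta\subset\mathcal A$ is the semigroup (with $0$) generated by $\beta_1,\dots,\beta_r$. The irrelevant ideal is $B=\langle\prod_{\rho_i\not\subset\sigma}x_i:\sigma\in\Sigma\rangle$, and $J:B^\infty=\{F\in S:F\cdot B^k\subseteq J\text{ for some }k\ge0\}$. For a closed subscheme $Y\subset X$, $I(Y)\subset S$ is the homogeneous ideal associated with $Y$: for reduced $Y$ it is the unique radical $B$-saturated homogeneous ideal defining $Y$; for a general closed $Y$ it is the unique homogeneous ideal defining $Y$ that is Pic-generated (generated by homogeneous polynomials with degrees in $\mathrm{Pic}(X)$)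 and Pic-saturated ($J_\alpha=(J:B^\infty)_\alpha$ for all $\alpha\in\mathrm{Pic}(X)$). $Y$ is a complete intersection if $I(Y)$ is generated by a regular sequence of homogeneous polynomials $F_1,\dots,F_k$, $k$ being the codimension of $Y$ in $X$. The multigraded Hilbert function is $H_Y(\alpha)=\dim_{\mathbb K}(S/I(Y))_\alpha$. For zero-dimensional $Y$, $\deg(Y)=\dim_{\mathbb K}\Gamma(Y,\mathcal O_Y)$, and the multigraded regularity of $Y$ is $\mathrm{reg}(Y)=\{\alpha\in\mathbb N\beta: H_Y(\alpha)=\deg(Y)\}$. A degree $\alpha\in\mathcal A$ is semi-ample if it is the class of a Cartier divisor $D$ with $\mathcal O(D)$ generated by global sections. *)

theory Defs
  imports
    "HOL-Analysis.Analysis"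
    "HOL-Library.Poly_Mapping"
    "HOL-Library.Set_Algebras"
    "HOL-Library.Function_Algebras"
    "HOL-Library.Extended_Nat"
    "HOL-Computational_Algebra.Polynomial"
begin

section \<open>Submodules, ideals, quotient dimension\<close>

text \<open>
  All rings below are subrings \<open>R\<close> of an ambient commutative ring, given by their carrier
  sets; \<open>R = UNIV\<close> for the homogeneous coordinate ring.
\<close>

definition submodule_over :: "'a::comm_ring_1 set \<Rightarrow> 'a set \<Rightarrow> bool" where
  "submodule_over R M \<longleftrightarrow>
     0 \<in> M \<and> (\<forall>x\<in>M. \<forall>y\<in>M. x + y \<in> M) \<and> (\<forall>a\<in>R. \<forall>x\<in>M. a * x \<in> M)"

definition ideal_in :: "'a::comm_ring_1 set \<Rightarrow> 'a set \<Rightarrow> bool" where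
  "ideal_in R I \<longleftrightarrow> I \<subseteq> R \<and> submodule_over R I"

definition prime_in :: "'a::comm_ring_1 set \<Rightarrow> 'a set \<Rightarrow> bool" where
  "prime_in R P \<longleftrightarrow>
     ideal_in R P \<and> P \<noteq> R \<and> (\<forall>a\<in>R. \<forall>b\<in>R. a * b \<in> P \<longrightarrow> a \<in> P \<or> b \<in> P)"

abbreviation ideal_gen :: "'a::comm_ring_1 set \<Rightarrow> 'a set" where
  "ideal_gen G \<equiv> ideal_in UNIV hull G"

fun ideal_power :: "'a::comm_ring_1 set \<Rightarrow> nat \<Rightarrow> 'a set" where
  "ideal_power I 0 = UNIV"
| "ideal_power I (Suc k) = ideal_gen {f * g | f g. f \<in> I \<and> g \<in> ideal_power I k}"

definition saturation :: "'a::comm_ring_1 set \<Rightarrow> 'a set \<Rightarrow> 'a set" where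
  "saturation J I = {F. \<exists>k. \<forall>G \<in> ideal_power I k. F * G \<in> J}"

definition radical_ideal :: "'a::comm_ring_1 set \<Rightarrow> bool" where
  "radical_ideal J \<longleftrightarrow> (\<forall>F k. F ^ k \<in> J \<longrightarrow> F \<in> J)"

definition nonzerodivisor_mod :: "'a::comm_ring_1 \<Rightarrow> 'a set \<Rightarrow> bool" where
  "nonzerodivisor_mod h J \<longleftrightarrow> (\<forall>G. h * G \<in> J \<longrightarrow> G \<in> J)"

definition regular_sequence :: "'a::comm_ring_1 list \<Rightarrow> bool" where
  "regular_sequence Fs \<longleftrightarrow>
     ideal_gen (set Fs) \<noteq> UNIV \<and>
     (\<forall>i < length Fs. nonzerodivisor_mod (Fs ! i) (ideal_gen (set (take i Fs))))"

text \<open>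
  Dimension of the quotient \<open>V / W\<close> of vector spaces with scalar multiplication \<open>smul\<close>:
  the supremum of the sizes of finite subsets of \<open>V\<close> that are linearly independent modulo \<open>W\<close>.
\<close>

definition quotient_dim ::
    "('k::field \<Rightarrow> 'v::comm_monoid_add \<Rightarrow> 'v) \<Rightarrow> 'v set \<Rightarrow> 'v set \<Rightarrow> enat" where
  "quotient_dim smul V W =
     (SUP B \<in> {B. finite B \<and> B \<subseteq> V \<and>
                  (\<forall>c. (\<Sum>b\<in>B. smul (c b) b) \<in> W \<longrightarrow> (\<forall>b\<in>B. c b = 0))}. enat (card B))"

definition pm_scale :: "'k::field \<Rightarrow> ('e::comm_monoid_add \<Rightarrow>\<^sub>0 'k) \<Rightarrow> ('e \<Rightarrow>\<^sub>0 'k)" where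
  "pm_scale c p = Poly_Mapping.single 0 c * p"


section \<open>Fans\<close>

text \<open>
  The lattice of one-parameter subgroups is \<open>int ^ 'n\<close>, sitting inside \<open>real ^ 'n\<close>; the
  character lattice is its dual, also \<open>int ^ 'n\<close>, the pairing being the dot product.
\<close>

definition of_lat :: "int ^ 'n \<Rightarrow> real ^ 'n::finite" where
  "of_lat v = (\<chi> i. real_of_int (v $ i))"

definition rational_polyhedral_cone :: "(real ^ 'n::finite) set \<Rightarrow> bool" where
  "rational_polyhedral_cone \<sigma> \<longleftrightarrow>
     (\<exists>V :: (int ^ 'n) set. finite V \<and> \<sigma> = convex_cone hull (of_lat ` V))"

definition strongly_convex :: "(real ^ 'n::finite) set \<Rightarrow> bool" where
  "strongly_convex \<sigma> \<longleftrightarrow> \<sigma> \<inter> uminus ` \<sigma> = {0}"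

definition fan :: "(real ^ 'n::finite) set set \<Rightarrow> bool" where
  "fan \<Sigma> \<longleftrightarrow>
     finite \<Sigma> \<and> \<Sigma> \<noteq> {} \<and>
     (\<forall>\<sigma>\<in>\<Sigma>. rational_polyhedral_cone \<sigma> \<and> strongly_convex \<sigma>) \<and>
     (\<forall>\<sigma>\<in>\<Sigma>. \<forall>\<tau>. \<tau> face_of \<sigma> \<and> \<tau> \<noteq> {} \<longrightarrow> \<tau> \<in> \<Sigma>) \<and>
     (\<forall>\<sigma>\<in>\<Sigma>. \<forall>\<tau>\<in>\<Sigma>. (\<sigma> \<inter> \<tau>) face_of \<sigma> \<and> (\<sigma> \<inter> \<tau>) face_of \<tau>)"

text \<open>The toric variety of a fan is complete iff the fan covers the whole space.\<close>

definition complete_fan :: "(real ^ 'n::finite) set set \<Rightarrow> bool" where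
  "complete_fan \<Sigma> \<longleftrightarrow> \<Union>\<Sigma> = UNIV"

definition simplicial_fan :: "(real ^ 'n::finite) set set \<Rightarrow> bool" where
  "simplicial_fan \<Sigma> \<longleftrightarrow>
     (\<forall>\<sigma>\<in>\<Sigma>. \<exists>B. finite B \<and> independent B \<and> \<sigma> = convex_cone hull B)"

text \<open>\<open>u\<close> enumerates, without repetition, the primitive generators of the rays of \<open>\<Sigma>\<close>.\<close>

definition ray_generators ::
    "(real ^ 'n::finite) set set \<Rightarrow> ('r::finite \<Rightarrow> int ^ 'n) \<Rightarrow> bool" where
  "ray_generators \<Sigma> u \<longleftrightarrow>
     bij_betw (\<lambda>j. convex_cone hull {of_lat (u j)}) UNIV {\<rho>\<in>\<Sigma>. dim \<rho> = 1} \<and>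
     (\<forall>j. Gcd (range (\<lambda>i. u j $ i)) = 1)"


section \<open>Divisors and the class group\<close>

text \<open>
  \<open>int ^ 'r\<close> is the group of torus-invariant Weil divisors, \<open>D\<close> standing for
  \<open>\<Sum>\<^sub>j (D $ j) D\<^sub>j\<close>. The class group is its quotient by the divisors of characters. A class is
  a coset; classes are added by adding cosets elementwise.
\<close>

definition char_div :: "('r::finite \<Rightarrow> int ^ 'n::finite) \<Rightarrow> int ^ 'n \<Rightarrow> int ^ 'r" where
  "char_div u m = (\<chi> j. \<Sum>i\<in>UNIV. m $ i * u j $ i)"

definition div_class :: "('r::finite \<Rightarrow> int ^ 'n::finite) \<Rightarrow> int ^ 'r \<Rightarrow> (int ^ 'r) set" where
  "div_class u D = D +o range (char_div u)"

definition Cl :: "('r::finite \<Rightarrow> int ^ 'n::finite) \<Rightarrow> (int ^ 'r) set set" where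
  "Cl u = range (div_class u)"

definition torsion_free_Cl :: "('r::finite \<Rightarrow> int ^ 'n::finite) \<Rightarrow> bool" where
  "torsion_free_Cl u \<longleftrightarrow>
     (\<forall>D. \<forall>k>0. div_class u (of_nat k *s D) = div_class u 0 \<longrightarrow> div_class u D = div_class u 0)"

definition beta :: "('r::finite \<Rightarrow> int ^ 'n::finite) \<Rightarrow> 'r \<Rightarrow> (int ^ 'r) set" where
  "beta u j = div_class u (axis j 1)"

inductive_set N_beta :: "('r::finite \<Rightarrow> int ^ 'n::finite) \<Rightarrow> (int ^ 'r) set set"
  for u where
  zero: "div_class u 0 \<in> N_beta u"
| add: "\<gamma> \<in> N_beta u \<Longrightarrow> \<gamma> + beta u j \<in> N_beta u"

text \<open>
  A torus-invariant divisor is Cartier iff its restriction to every \<open>U\<^sub>\<sigma>\<close> is the divisor of a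
  character; every Cartier divisor is linearly equivalent to a torus-invariant one.
\<close>

definition cartier ::
    "(real ^ 'n::finite) set set \<Rightarrow> ('r::finite \<Rightarrow> int ^ 'n) \<Rightarrow> int ^ 'r \<Rightarrow> bool" where
  "cartier \<Sigma> u D \<longleftrightarrow>
     (\<forall>\<sigma>\<in>\<Sigma>. \<exists>m. \<forall>j. of_lat (u j) \<in> \<sigma> \<longrightarrow> char_div u m $ j = D $ j)"

definition Pic ::
    "(real ^ 'n::finite) set set \<Rightarrow> ('r::finite \<Rightarrow> int ^ 'n) \<Rightarrow> (int ^ 'r) set set" where
  "Pic \<Sigma> u = {div_class u D | D. cartier \<Sigma> u D}"

text \<open>
  \<open>(int ^ 'n) \<Rightarrow>\<^sub>0 'k\<close> is the ring of Laurent polynomials, i.e. the coordinate ring of the torus.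
  \<open>chart \<sigma>\<close> is its subring of functions regular on the affine chart \<open>U\<^sub>\<sigma>\<close>, and
  \<open>sections u D \<sigma>\<close> is the submodule of sections of \<open>O(D)\<close> over \<open>U\<^sub>\<sigma>\<close>.
\<close>

definition chart :: "(real ^ 'n::finite) set \<Rightarrow> ((int ^ 'n) \<Rightarrow>\<^sub>0 'k::field) set" where
  "chart \<sigma> = {f. \<forall>m \<in> Poly_Mapping.keys f. \<forall>v\<in>\<sigma>. 0 \<le> of_lat m \<bullet> v}"

definition sections ::
    "('r::finite \<Rightarrow> int ^ 'n::finite) \<Rightarrow> int ^ 'r \<Rightarrow> (real ^ 'n) set \<Rightarrow>
     ((int ^ 'n) \<Rightarrow>\<^sub>0 'k::field) set" where
  "sections u D \<sigma> =
     {f. \<forall>m \<in> Poly_Mapping.keys f. \<forall>j. of_lat (u j) \<in> \<sigma> \<longrightarrow> 0 \<le> char_div u m $ j + D $ j}"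

text \<open>The type argument fixes the base field.\<close>

definition globally_generated ::
    "'k::field itself \<Rightarrow> (real ^ 'n::finite) set set \<Rightarrow> ('r::finite \<Rightarrow> int ^ 'n) \<Rightarrow>
     int ^ 'r \<Rightarrow> bool" where
  "globally_generated K \<Sigma> u D \<longleftrightarrow>
     (\<forall>\<sigma>\<in>\<Sigma>. submodule_over (chart \<sigma>) hull (\<Inter>\<tau>\<in>\<Sigma>. sections u D \<tau>)
            = (sections u D \<sigma> :: ((int ^ 'n) \<Rightarrow>\<^sub>0 'k) set))"

definition semi_ample ::
    "'k::field itself \<Rightarrow> (real ^ 'n::finite) set set \<Rightarrow> ('r::finite \<Rightarrow> int ^ 'n) \<Rightarrow>
     (int ^ 'r) set \<Rightarrow> bool" where
  "semi_ample K \<Sigma> u \<alpha> \<longleftrightarrow>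
     (\<exists>D. cartier \<Sigma> u D \<and> globally_generated K \<Sigma> u D \<and> \<alpha> = div_class u D)"


section \<open>The homogeneous coordinate ring\<close>

text \<open>The polynomial ring with variables \<open>x\<^sub>j\<close>, \<open>j :: 'r\<close>, is \<open>('r \<Rightarrow>\<^sub>0 nat) \<Rightarrow>\<^sub>0 'k\<close>.\<close>

type_synonym ('r, 'k) cox = "('r \<Rightarrow>\<^sub>0 nat) \<Rightarrow>\<^sub>0 'k"

definition expo :: "('r::finite \<Rightarrow>\<^sub>0 nat) \<Rightarrow> int ^ 'r" where
  "expo t = (\<chi> j. int (Poly_Mapping.lookup t j))"

definition S_deg ::
    "('r::finite \<Rightarrow> int ^ 'n::finite) \<Rightarrow> (int ^ 'r) set \<Rightarrow> ('r, 'k::field) cox set" where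
  "S_deg u \<alpha> = {F. \<forall>t \<in> Poly_Mapping.keys F. div_class u (expo t) = \<alpha>}"

definition homogeneous ::
    "('r::finite \<Rightarrow> int ^ 'n::finite) \<Rightarrow> ('r, 'k::field) cox \<Rightarrow> bool" where
  "homogeneous u F \<longleftrightarrow> (\<exists>\<alpha> \<in> Cl u. F \<in> S_deg u \<alpha>)"

definition homogeneous_ideal ::
    "('r::finite \<Rightarrow> int ^ 'n::finite) \<Rightarrow> ('r, 'k::field) cox set \<Rightarrow> bool" where
  "homogeneous_ideal u J \<longleftrightarrow> J = ideal_gen {F \<in> J. homogeneous u F}"

text \<open>Exponent of the monomial \<open>\<Prod> x\<^sub>j\<close> over all \<open>j\<close> whose ray is not contained in \<open>\<sigma>\<close>.\<close>

definition hat_expo ::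
    "('r::finite \<Rightarrow> int ^ 'n::finite) \<Rightarrow> (real ^ 'n) set \<Rightarrow> ('r \<Rightarrow>\<^sub>0 nat)" where
  "hat_expo u \<sigma> = (\<Sum>j \<in> {j. of_lat (u j) \<notin> \<sigma>}. Poly_Mapping.single j 1)"

definition irrelevant_ideal ::
    "(real ^ 'n::finite) set set \<Rightarrow> ('r::finite \<Rightarrow> int ^ 'n) \<Rightarrow> ('r, 'k::field) cox set" where
  "irrelevant_ideal \<Sigma> u = ideal_gen {Poly_Mapping.single (hat_expo u \<sigma>) 1 | \<sigma>. \<sigma> \<in> \<Sigma>}"

definition Pic_generated ::
    "(real ^ 'n::finite) set set \<Rightarrow> ('r::finite \<Rightarrow> int ^ 'n) \<Rightarrow>
     ('r, 'k::field) cox set \<Rightarrow> bool" where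
  "Pic_generated \<Sigma> u J \<longleftrightarrow> J = ideal_gen {F \<in> J. \<exists>\<alpha> \<in> Pic \<Sigma> u. F \<in> S_deg u \<alpha>}"

definition Pic_saturated ::
    "(real ^ 'n::finite) set set \<Rightarrow> ('r::finite \<Rightarrow> int ^ 'n) \<Rightarrow>
     ('r, 'k::field) cox set \<Rightarrow> bool" where
  "Pic_saturated \<Sigma> u J \<longleftrightarrow>
     (\<forall>\<alpha> \<in> Pic \<Sigma> u. J \<inter> S_deg u \<alpha> = saturation J (irrelevant_ideal \<Sigma> u) \<inter> S_deg u \<alpha>)"


section \<open>Closed subschemes\<close>

text \<open>
  A closed subscheme is given by its (quasi-coherent) ideal sheaf: an ideal \<open>Y \<sigma>\<close> of every
  \<open>chart \<sigma>\<close>, \<open>\<sigma> \<in> \<Sigma>\<close>, such that restricting to the open subset \<open>U\<^sub>\<tau>\<close> of \<open>U\<^sub>\<sigma>\<close>, for \<open>\<tau>\<close> a face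
  of \<open>\<sigma>\<close>, extends the ideal. As \<open>U\<^sub>\<sigma> \<inter> U\<^sub>\<tau> = U\<^bsub>\<sigma> \<inter> \<tau>\<^esub>\<close>, this includes the gluing condition.
  Values of \<open>Y\<close> outside \<open>\<Sigma>\<close> are irrelevant.
\<close>

type_synonym ('n, 'k) subscheme = "(real ^ 'n) set \<Rightarrow> ((int ^ 'n) \<Rightarrow>\<^sub>0 'k) set"

definition closed_subscheme ::
    "(real ^ 'n::finite) set set \<Rightarrow> ('n, 'k::field) subscheme \<Rightarrow> bool" where
  "closed_subscheme \<Sigma> Y \<longleftrightarrow>
     (\<forall>\<sigma>\<in>\<Sigma>. ideal_in (chart \<sigma>) (Y \<sigma>)) \<and>
     (\<forall>\<sigma>\<in>\<Sigma>. \<forall>\<tau>\<in>\<Sigma>. \<tau> face_of \<sigma> \<longrightarrow> Y \<tau> = ideal_in (chart \<tau>) hull (Y \<sigma>))"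

definition reduced_subscheme ::
    "(real ^ 'n::finite) set set \<Rightarrow> ('n, 'k::field) subscheme \<Rightarrow> bool" where
  "reduced_subscheme \<Sigma> Y \<longleftrightarrow>
     (\<forall>\<sigma>\<in>\<Sigma>. \<forall>f \<in> chart \<sigma>. \<forall>k. f ^ k \<in> Y \<sigma> \<longrightarrow> f \<in> Y \<sigma>)"

text \<open>
  The dimension of a scheme is the supremum of the Krull dimensions of the rings of an affine
  cover, here of the rings \<open>chart \<sigma> / Y \<sigma>\<close>. The empty scheme has no dimension.
\<close>

definition prime_chain_lengths ::
    "(real ^ 'n::finite) set set \<Rightarrow> ('n, 'k::field) subscheme \<Rightarrow> nat set" where
  "prime_chain_lengths \<Sigma> Y =
     {d. \<exists>\<sigma>\<in>\<Sigma>. \<exists>P. (\<forall>i\<le>d. prime_in (chart \<sigma>) (P i) \<and> Y \<sigma> \<subseteq> P i) \<and> (\<forall>i<d. P i \<subset> P (Suc i))}"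

definition has_dimension ::
    "(real ^ 'n::finite) set set \<Rightarrow> ('n, 'k::field) subscheme \<Rightarrow> nat \<Rightarrow> bool" where
  "has_dimension \<Sigma> Y d \<longleftrightarrow>
     d \<in> prime_chain_lengths \<Sigma> Y \<and> (\<forall>e \<in> prime_chain_lengths \<Sigma> Y. e \<le> d)"

text \<open>
  \<open>\<Gamma>(Y, O\<^sub>Y)\<close> consists of the families of elements of the rings \<open>chart \<sigma> / Y \<sigma>\<close> agreeing on
  overlaps; \<open>section_families\<close> are families of representatives, \<open>zero_families\<close> those which
  represent zero.
\<close>

definition section_families ::
    "(real ^ 'n::finite) set set \<Rightarrow> ('n, 'k::field) subscheme \<Rightarrow>
     ((real ^ 'n) set \<Rightarrow> ((int ^ 'n) \<Rightarrow>\<^sub>0 'k)) set" where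
  "section_families \<Sigma> Y =
     {f. (\<forall>\<sigma>\<in>\<Sigma>. f \<sigma> \<in> chart \<sigma>) \<and> (\<forall>\<sigma>\<in>\<Sigma>. \<forall>\<tau>\<in>\<Sigma>. f \<sigma> - f \<tau> \<in> Y (\<sigma> \<inter> \<tau>))}"

definition zero_families ::
    "(real ^ 'n::finite) set set \<Rightarrow> ('n, 'k::field) subscheme \<Rightarrow>
     ((real ^ 'n) set \<Rightarrow> ((int ^ 'n) \<Rightarrow>\<^sub>0 'k)) set" where
  "zero_families \<Sigma> Y = {f. \<forall>\<sigma>\<in>\<Sigma>. f \<sigma> \<in> Y \<sigma>}"

definition degree_of ::
    "(real ^ 'n::finite) set set \<Rightarrow> ('n, 'k::field) subscheme \<Rightarrow> enat" where
  "degree_of \<Sigma> Y =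
     quotient_dim (\<lambda>c f \<sigma>. pm_scale c (f \<sigma>)) (section_families \<Sigma> Y) (zero_families \<Sigma> Y)"


section \<open>The ideal of a closed subscheme\<close>

text \<open>
  Both the polynomial ring and the ring of Laurent polynomials map to the Laurent polynomial
  ring \<open>(int ^ 'r) \<Rightarrow>\<^sub>0 'k\<close> in the variables \<open>x\<^sub>j\<close>: the former by inclusion, the latter by
  \<open>\<chi>\<^sup>m \<mapsto> \<Prod> x\<^sub>j\<close> to the power of the order of \<open>\<chi>\<^sup>m\<close> along \<open>D\<^sub>j\<close>. Under this identification
  \<open>chart \<sigma>\<close> is the degree-zero part of the localization of \<open>S\<close> at the monomial
  \<open>hat_expo u \<sigma>\<close>, and \<open>subscheme_of u J \<sigma>\<close> is the degree-zero part of the localization of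
  \<open>J\<close>.
\<close>

definition push :: "('a \<Rightarrow> 'b) \<Rightarrow> ('a \<Rightarrow>\<^sub>0 'k::field) \<Rightarrow> ('b \<Rightarrow>\<^sub>0 'k)" where
  "push h p = (\<Sum>t \<in> Poly_Mapping.keys p. Poly_Mapping.single (h t) (Poly_Mapping.lookup p t))"

definition subscheme_of ::
    "('r::finite \<Rightarrow> int ^ 'n::finite) \<Rightarrow> ('r, 'k::field) cox set \<Rightarrow> ('n, 'k) subscheme" where
  "subscheme_of u J \<sigma> =
     {f \<in> chart \<sigma>. \<exists>F\<in>J. \<exists>k.
        push expo F
        = Poly_Mapping.single (of_nat k *s expo (hat_expo u \<sigma>)) 1 * push (char_div u) f}"

definition defines_subscheme ::
    "(real ^ 'n::finite) set set \<Rightarrow> ('r::finite \<Rightarrow> int ^ 'n) \<Rightarrow>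
     ('r, 'k::field) cox set \<Rightarrow> ('n, 'k) subscheme \<Rightarrow> bool" where
  "defines_subscheme \<Sigma> u J Y \<longleftrightarrow> homogeneous_ideal u J \<and> (\<forall>\<sigma>\<in>\<Sigma>. subscheme_of u J \<sigma> = Y \<sigma>)"

text \<open>
  \<open>is_ideal_of \<Sigma> u Y J\<close> says that \<open>J\<close> is the ideal \<open>I(Y)\<close>. For reduced \<open>Y\<close> the two standard
  normalizations (radical and \<open>B\<close>-saturated, or Pic-generated and Pic-saturated) can differ when
  \<open>X\<close> is singular; both are admitted.
\<close>

definition is_ideal_of ::
    "(real ^ 'n::finite) set set \<Rightarrow> ('r::finite \<Rightarrow> int ^ 'n) \<Rightarrow>
     ('n, 'k::field) subscheme \<Rightarrow> ('r, 'k) cox set \<Rightarrow> bool" where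
  "is_ideal_of \<Sigma> u Y J \<longleftrightarrow>
     defines_subscheme \<Sigma> u J Y \<and>
     (reduced_subscheme \<Sigma> Y \<and> radical_ideal J \<and> saturation J (irrelevant_ideal \<Sigma> u) = J
      \<or> Pic_generated \<Sigma> u J \<and> Pic_saturated \<Sigma> u J)"

text \<open>
  In the following three definitions \<open>J\<close> is the ideal of \<open>Y\<close>. As \<open>X\<close> is irreducible of dimension
  \<open>CARD('n)\<close>, the codimension of \<open>Y\<close> is \<open>CARD('n)\<close> minus its dimension.
\<close>

definition complete_intersection ::
    "(real ^ 'n::finite) set set \<Rightarrow> ('r::finite \<Rightarrow> int ^ 'n) \<Rightarrow>
     ('n, 'k::field) subscheme \<Rightarrow> ('r, 'k) cox set \<Rightarrow> bool" where
  "complete_intersection \<Sigma> u Y J \<longleftrightarrow>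
     (\<exists>d Fs. has_dimension \<Sigma> Y d \<and> length Fs + d = CARD('n) \<and>
             (\<forall>F \<in> set Fs. homogeneous u F) \<and> regular_sequence Fs \<and> J = ideal_gen (set Fs))"

definition hilbert_function ::
    "('r::finite \<Rightarrow> int ^ 'n::finite) \<Rightarrow> ('r, 'k::field) cox set \<Rightarrow> (int ^ 'r) set \<Rightarrow> enat" where
  "hilbert_function u J \<alpha> = quotient_dim pm_scale (S_deg u \<alpha>) (J \<inter> S_deg u \<alpha>)"

definition reg ::
    "(real ^ 'n::finite) set set \<Rightarrow> ('r::finite \<Rightarrow> int ^ 'n) \<Rightarrow>
     ('n, 'k::field) subscheme \<Rightarrow> ('r, 'k) cox set \<Rightarrow> (int ^ 'r) set set" where
  "reg \<Sigma> u Y J = {\<alpha> \<in> N_beta u. hilbert_function u J \<alpha> = degree_of \<Sigma> Y}"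

end

theory Submission
  imports Defs "HOL-Real_Asymp.Real_Asymp"
begin

text \<open>
  Let \<open>I = I(Y)\<close>, let \<open>\<alpha>\<^sub>0\<close> be the sum of the \<open>\<alpha>\<^sub>i\<close>, and let \<open>H\<close> be the Hilbert function of
  \<open>S / I\<close>. As \<open>I\<close> is generated by a regular sequence with the same degrees \<open>\<alpha>\<^sub>i\<close>, \<open>H(\<alpha>)\<close> is the
  alternating sum of the dimensions of \<open>S\<close> in the degrees \<open>\<alpha> - \<Sum>\<^sub>i\<^sub>\<in>\<^sub>J \<alpha>\<^sub>i\<close>, which count lattice
  points of polytopes. For nef degrees these counts are polynomial of total degree at most \<open>n\<close> (proved via a decomposition of
  the polytopes into signed cones), so \<open>H(t \<alpha>\<^sub>0)\<close> does not depend on \<open>t \<ge> 1\<close>. The common value is positive,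
  and this forces \<open>\<alpha>\<^sub>0\<close> to be big: every \<open>\<alpha>\<^sub>0 - \<beta>\<^sub>j\<close> is effective. Multiplication by products of the
  given nonzerodivisors embeds \<open>S / I\<close> in degree \<open>\<alpha>\<^sub>0\<close> into degree \<open>\<alpha>\<^sub>0 + \<gamma>\<close> and the latter into degree
  \<open>t \<alpha>\<^sub>0\<close> for large \<open>t\<close>, so \<open>H(\<alpha>\<^sub>0 + \<gamma>) = H(\<alpha>\<^sub>0)\<close>.

  Finally \<open>H(\<alpha>\<^sub>0)\<close> is the degree of \<open>Y\<close>. A product \<open>g\<close> of the nonzerodivisors of degree \<open>\<alpha>\<^sub>0\<close>
  is locally a unit on the zero-dimensional scheme \<open>Y\<close>, and \<open>F \<mapsto> F / g\<close> maps \<open>S / I\<close> in degree \<open>\<alpha>\<^sub>0\<close>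
  to the global sections of \<open>O\<^sub>Y\<close>. It is injective because \<open>I\<close> is saturated in Cartier degrees, and
  surjective because multiplication by \<open>g\<close> is bijective in the degrees \<open>t \<alpha>\<^sub>0\<close> and powers of the generators of the
  irrelevant ideal generate the unit ideal after inverting \<open>g\<close>.
\<close>

section \<open>Degrees of piecewise linear maps on a complete simplicial fan\<close>

text \<open>Two obstacles shape the argument. On a simplicial variety the classes
  \<open>\<beta>\<^sub>j\<close> need not be Cartier, while \<open>I(Y)\<close> is in general known
  to be saturated only in Cartier degrees; so local data are compared with \<open>S\<close> only in
  multiples of \<open>\<alpha>\<^sub>0\<close>, and other degrees are reached through
  nonzerodivisors. Moreover, the given generators of \<open>I(Y)\<close> need not be the regular
  sequence from the definition of a complete intersection. As \<open>S\<close> has only constants in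
  degree 0, a graded Nakayama argument shows that both families have the same degrees. No Ehrhart
  polynomial is constructed: it is enough that mixed differences of lattice point counts vanish.
  Those of order \<open>n + 1\<close> always do, which makes \<open>H(t \<alpha>\<^sub>0)\<close>
  constant. Those of order \<open>n\<close> vanish if all polytopes involved are flat in one
  direction, and this happens when some \<open>\<alpha>\<^sub>0 - \<beta>\<^sub>j\<close> is not
  effective; hence bigness. Cones contain infinitely many lattice points, so the decomposition is
  summed with a decaying exponential weight, and the weight is removed in a limit, where the poles
  of single cones cancel against the zeros of the difference operator.\<close>

lemma avoid_subspaces:
  fixes O1 :: "'a::euclidean_space set"
  assumes "finite F" "\<And>S. S \<in> F \<Longrightarrow> subspace S \<and> dim S < DIM('a)" "open O1" "O1 \<noteq> {}"
  shows "\<exists>x\<in>O1. \<forall>S\<in>F. x \<notin> S"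
proof -
  have "negligible (\<Union>F)"
    using assms(1,2) by (intro negligible_Union) (auto intro: negligible_lowdim)
  then have "\<not> O1 \<subseteq> \<Union>F"
    using assms(3,4) negligible_subset open_not_negligible by blast
  then show ?thesis by blast
qed

text \<open>
  A segment from \<open>c\<close> to \<open>b\<close> meets the open positive orthant in an interval, hence has at most one
  entry and one exit. The condition in the \<open>i\<close>-th summand says that the segment crosses the
  hyperplane of the \<open>i\<close>-th coordinate at a point of a facet of the orthant, and the sign
  distinguishes exits from entries.
\<close>

lemma crossing_count:
  fixes c b :: "'r \<Rightarrow> real"
  assumes s: "finite s" and nz: "\<And>i. i \<in> s \<Longrightarrow> c i \<noteq> 0 \<and> b i \<noteq> 0"
    and gen: "\<And>i k. i \<in> s \<Longrightarrow> k \<in> s \<Longrightarrow> i \<noteq> k \<Longrightarrow> c i * b k \<noteq> c k * b i"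
  shows "of_bool (\<forall>i\<in>s. c i > 0) - of_bool (\<forall>i\<in>s. b i > 0)
    = (\<Sum>i\<in>s. sgn (c i) * of_bool (c i * b i < 0 \<and> (\<forall>k\<in>s-{i}. c k * \<bar>b i\<bar> + b k * \<bar>c i\<bar> > 0)))"
proof -
  define P where "P i \<longleftrightarrow> c i * b i < 0 \<and> (\<forall>k\<in>s-{i}. c k * \<bar>b i\<bar> + b k * \<bar>c i\<bar> > 0)" for i
  \<comment> \<open>Up to positive scaling the points of the open segment are
    \<open>\<rho> * c + b\<close> with \<open>\<rho> > 0\<close>, and \<open>\<rho> i\<close> is
    where the \<open>i\<close>-th coordinate vanishes. Inside the orthant, indices in
    \<open>E\<close> give lower bounds for the parameter and those in \<open>G\<close> upper bounds,
    while one in \<open>Z\<close> excludes the orthant altogether.\<close>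
  define \<rho> where "\<rho> i = - b i / c i" for i
  define E where "E = {i\<in>s. c i > 0 \<and> b i < 0}"
  define G where "G = {i\<in>s. c i < 0 \<and> b i > 0}"
  define Z where "Z = {i\<in>s. c i < 0 \<and> b i < 0}"
  have fin: "finite E" "finite G" using s by (auto simp: E_def G_def)
  \<comment> \<open>The facet condition is homogeneous to avoid division; divided by
    \<open>\<bar>c i\<bar>\<close> it is positivity of the \<open>k\<close>-th coordinate at the
    parameter \<open>\<rho> i\<close>.\<close>
  have cond: "c k * \<bar>b i\<bar> + b k * \<bar>c i\<bar> > 0 \<longleftrightarrow> c k * \<rho> i + b k > 0" if "i \<in> s" "c i * b i < 0" for i k
  proof -
    have ci: "\<bar>c i\<bar> > 0" using nz that by auto
    have "\<bar>b i\<bar> = \<rho> i * \<bar>c i\<bar>" using that nz[of i] unfolding \<rho>_def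
      by (auto simp: abs_if mult_less_0_iff)
    then have "c k * \<bar>b i\<bar> + b k * \<bar>c i\<bar> = (c k * \<rho> i + b k) * \<bar>c i\<bar>"
      by (simp add: algebra_simps)
    then show ?thesis using ci by (simp add: zero_less_mult_iff)
  qed
  have cE: "c k * \<rho> i + b k > 0 \<longleftrightarrow> \<rho> i > \<rho> k" if "k \<in> E" for i k
    using that unfolding \<rho>_def E_def by (auto simp: field_simps)
  have cG: "c k * \<rho> i + b k > 0 \<longleftrightarrow> \<rho> i < \<rho> k" if "k \<in> G" for i k
  proof -
    have ck: "c k < 0" using that by (auto simp: G_def)
    have "c k * \<rho> i + b k = c k * (\<rho> i - \<rho> k)"
      using ck by (simp add: \<rho>_def field_simps)
    then show ?thesis using ck by (simp add: zero_less_mult_iff)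
  qed
  have rpos: "\<rho> i > 0" if "i \<in> E \<union> G" for i
    using that unfolding \<rho>_def E_def G_def by (auto simp: divide_pos_neg divide_neg_pos)
  have cpos: "c k * \<rho> i + b k > 0" if "k \<in> s - (E \<union> G \<union> Z)" "i \<in> E \<union> G" for i k
  proof -
    have "c k > 0" "b k > 0" using that nz[of k] unfolding E_def G_def Z_def by force+
    then show ?thesis using rpos[OF that(2)] by (simp add: add_pos_pos)
  qed
  have neg: "\<not> c k * \<rho> i + b k > 0" if "k \<in> Z" "i \<in> E \<union> G" for i k
  proof -
    have "c k < 0" "b k < 0" using that by (auto simp: Z_def)
    then show ?thesis using rpos[OF that(2)]
      by (metis add_neg_neg mult_neg_pos not_less_iff_gr_or_eq)
  qed
  have EG: "c i * b i < 0 \<longleftrightarrow> i \<in> E \<union> G" if "i \<in> s" for i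
    using that nz[OF that] by (auto simp: E_def G_def mult_less_0_iff)
  \<comment> \<open>The crossing point must respect all other bounds: for \<open>i\<close> in
    \<open>E\<close> it is the greatest lower bound, for \<open>i\<close> in \<open>G\<close> the
    least upper bound, and lower bounds stay below upper ones there.\<close>
  have Pi: "P i \<longleftrightarrow> i \<in> E \<union> G \<and> Z = {} \<and> (\<forall>k\<in>E-{i}. \<rho> i > \<rho> k) \<and> (\<forall>k\<in>G-{i}. \<rho> i < \<rho> k)"
    if i: "i \<in> s" for i
  proof (cases "i \<in> E \<union> G")
    case False then show ?thesis using EG[OF i] by (auto simp: P_def)
  next
    case True
    have "P i \<longleftrightarrow> (\<forall>k\<in>s-{i}. c k * \<rho> i + b k > 0)"
      using True EG[OF i] cond[OF i] by (simp add: P_def)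
    also have "\<dots> \<longleftrightarrow> Z = {} \<and> (\<forall>k\<in>E-{i}. \<rho> i > \<rho> k) \<and> (\<forall>k\<in>G-{i}. \<rho> i < \<rho> k)" (is "?L = ?R")
    proof
      assume L: ?L
      have "Z = {}"
      proof (rule ccontr)
        assume "Z \<noteq> {}" then obtain k where k: "k \<in> Z" by blast
        then have "k \<in> s - {i}" using True by (auto simp: Z_def E_def G_def)
        then show False using L neg[OF k True] by blast
      qed
      moreover have "E \<subseteq> s" "G \<subseteq> s" by (auto simp: E_def G_def)
      ultimately show ?R using L cE cG by blast
    next
      assume R: ?R
      show ?L
      proof
        fix k assume k: "k \<in> s - {i}"
        consider "k \<in> E" | "k \<in> G" | "k \<in> s - (E \<union> G \<union> Z)" using R k by blast
        then show "c k * \<rho> i + b k > 0" using R k cE cG cpos[OF _ True] by cases auto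
      qed
    qed
    finally show ?thesis using True by simp
  qed
  have dis: "E \<inter> G = {}" by (auto simp: E_def G_def)
  have inj: "\<rho> i \<noteq> \<rho> k" if "i \<in> s" "k \<in> s" "i \<noteq> k" for i k
    using gen[OF that] nz that by (auto simp: \<rho>_def field_simps)
  have subs: "E \<subseteq> s" "G \<subseteq> s" by (auto simp: E_def G_def)
  have sumE: "(\<Sum>i\<in>E. of_bool (P i)) = (of_bool (Z = {} \<and> E \<noteq> {} \<and> (\<forall>i\<in>E. \<forall>k\<in>G. \<rho> i < \<rho> k)) :: real)"
  proof (cases "E = {}")
    case False
    have "Max (\<rho> ` E) \<in> \<rho> ` E" using fin False by (intro Max_in) auto
    then obtain e where e0: "e \<in> E" "\<rho> e = Max (\<rho> ` E)" by force
    have e: "e \<in> E" "\<And>i. i \<in> E \<Longrightarrow> \<rho> i \<le> \<rho> e"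
      using e0 fin by auto
    have le: "\<rho> i < \<rho> e" if "i \<in> E - {e}" for i
      using e(2)[of i] inj[of i e] that e(1) subs by force
    have "P i \<longleftrightarrow> i = e \<and> P e" if i: "i \<in> E" for i
    proof (cases "i = e")
      case False
      have ii: "i \<in> s" using i subs by blast
      have "\<not> P i"
      proof
        assume "P i"
        then have "\<forall>k\<in>E-{i}. \<rho> k < \<rho> i" unfolding Pi[OF ii] by simp
        moreover have "e \<in> E-{i}" using False e(1) by simp
        moreover have "\<rho> i < \<rho> e" using le i False by simp
        ultimately show False by (meson less_asym)
      qed
      then show ?thesis using False by simp
    qed simp
    then have "(\<Sum>i\<in>E. of_bool (P i)) = (\<Sum>i\<in>E. if i = e then of_bool (P e) else (0::real))"
      by (intro sum.cong) auto
    also have "\<dots> = of_bool (P e)" using e fin by simp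
    also have "P e \<longleftrightarrow> Z = {} \<and> E \<noteq> {} \<and> (\<forall>i\<in>E. \<forall>k\<in>G. \<rho> i < \<rho> k)"
    proof -
      have "e \<notin> G" using e(1) dis by blast
      then have "(\<forall>k\<in>G-{e}. \<rho> e < \<rho> k) \<longleftrightarrow> (\<forall>i\<in>E. \<forall>k\<in>G. \<rho> i < \<rho> k)"
        using e by (force intro: le_less_trans less_le_trans)
      moreover have es: "e \<in> s" using e(1) subs by blast
      ultimately show ?thesis unfolding Pi[OF es] using e(1) le by blast
    qed
    finally show ?thesis .
  qed simp
  have sumG: "(\<Sum>i\<in>G. of_bool (P i)) = (of_bool (Z = {} \<and> G \<noteq> {} \<and> (\<forall>i\<in>E. \<forall>k\<in>G. \<rho> i < \<rho> k)) :: real)"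
  proof (cases "G = {}")
    case False
    have "Min (\<rho> ` G) \<in> \<rho> ` G" using fin False by (intro Min_in) auto
    then obtain e where e0: "e \<in> G" "\<rho> e = Min (\<rho> ` G)" by force
    have e: "e \<in> G" "\<And>i. i \<in> G \<Longrightarrow> \<rho> e \<le> \<rho> i"
      using e0 fin by auto
    have le: "\<rho> e < \<rho> i" if "i \<in> G - {e}" for i
      using e(2)[of i] inj[of i e] that e(1) subs by force
    have "P i \<longleftrightarrow> i = e \<and> P e" if i: "i \<in> G" for i
    proof (cases "i = e")
      case False
      have ii: "i \<in> s" using i subs by blast
      have "\<not> P i"
      proof
        assume "P i"
        then have "\<forall>k\<in>G-{i}. \<rho> i < \<rho> k" unfolding Pi[OF ii] by simp
        moreover have "e \<in> G-{i}" using False e(1) by simp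
        moreover have "\<rho> e < \<rho> i" using le i False by simp
        ultimately show False by (meson less_asym)
      qed
      then show ?thesis using False by simp
    qed simp
    then have "(\<Sum>i\<in>G. of_bool (P i)) = (\<Sum>i\<in>G. if i = e then of_bool (P e) else (0::real))"
      by (intro sum.cong) auto
    also have "\<dots> = of_bool (P e)" using e fin by simp
    also have "P e \<longleftrightarrow> Z = {} \<and> G \<noteq> {} \<and> (\<forall>i\<in>E. \<forall>k\<in>G. \<rho> i < \<rho> k)"
    proof -
      have "e \<notin> E" using e(1) dis by blast
      then have "(\<forall>k\<in>E-{e}. \<rho> k < \<rho> e) \<longleftrightarrow> (\<forall>i\<in>E. \<forall>k\<in>G. \<rho> i < \<rho> k)"
        using e by (force intro: le_less_trans less_le_trans)
      moreover have es: "e \<in> s" using e(1) subs by blast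
      ultimately show ?thesis unfolding Pi[OF es] using e(1) le by blast
    qed
    finally show ?thesis .
  qed simp
  have "(\<Sum>i\<in>s. sgn (c i) * of_bool (P i)) = (\<Sum>i\<in>E \<union> G. sgn (c i) * of_bool (P i))"
    using s subs Pi by (intro sum.mono_neutral_right) auto
  also have "\<dots> = (\<Sum>i\<in>E. sgn (c i) * of_bool (P i)) + (\<Sum>i\<in>G. sgn (c i) * of_bool (P i))"
    using fin dis by (intro sum.union_disjoint) auto
  also have "(\<Sum>i\<in>E. sgn (c i) * of_bool (P i)) = (\<Sum>i\<in>E. of_bool (P i))"
    by (intro sum.cong) (auto simp: E_def)
  also have "(\<Sum>i\<in>G. sgn (c i) * of_bool (P i)) = - (\<Sum>i\<in>G. of_bool (P i))"
    by (subst sum_negf[symmetric], intro sum.cong) (auto simp: G_def)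
  also note sumE also note sumG
  \<comment> \<open>With bounds of both kinds, entry and exit cancel. Otherwise \<open>c\<close>
    lies in the orthant iff there is no upper bound and \<open>b\<close> iff there is no lower
    one.\<close>
  also have "of_bool (Z = {} \<and> E \<noteq> {} \<and> (\<forall>i\<in>E. \<forall>k\<in>G. \<rho> i < \<rho> k))
      + - of_bool (Z = {} \<and> G \<noteq> {} \<and> (\<forall>i\<in>E. \<forall>k\<in>G. \<rho> i < \<rho> k))
     = (of_bool (Z = {} \<and> G = {}) - of_bool (Z = {} \<and> E = {}) :: real)"
    by (cases "E = {}"; cases "G = {}"; cases "Z = {}") auto
  also have "(Z = {} \<and> G = {}) = (\<forall>i\<in>s. c i > 0)"
    using nz by (auto simp: Z_def G_def) (metis linorder_neqE_linordered_idom)+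
  also have "(Z = {} \<and> E = {}) = (\<forall>i\<in>s. b i > 0)"
    using nz by (auto simp: Z_def E_def) (metis linorder_neqE_linordered_idom)+
  finally show ?thesis by (simp add: P_def)
qed

lemma convex_cone_hull_image:
  fixes U :: "'i \<Rightarrow> 'a::real_vector"
  assumes "finite t"
  shows "convex_cone hull (U ` t) = {y. \<exists>a. (\<forall>j. 0 \<le> a j) \<and> y = (\<Sum>j\<in>t. a j *\<^sub>R U j)}" (is "_ = ?C")
proof
  show "?C \<subseteq> convex_cone hull (U ` t)"
  proof
    fix y assume "y \<in> ?C"
    then obtain a where a: "\<forall>j. 0 \<le> a j" "y = (\<Sum>j\<in>t. a j *\<^sub>R U j)" by auto
    have "(\<Sum>j\<in>t'. a j *\<^sub>R U j) \<in> convex_cone hull (U ` t)" if "t' \<subseteq> t" for t'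
      using finite_subset[OF that assms] that
    proof (induction t' rule: finite_induct)
      case empty then show ?case by (simp add: convex_cone_hull_contains_0)
    next
      case (insert j t')
      then show ?case using a
        by (simp add: convex_cone_hull_add convex_cone_hull_mul hull_inc)
    qed
    then show "y \<in> convex_cone hull (U ` t)" using a by blast
  qed
  have "U ` t \<subseteq> ?C"
  proof
    fix y assume "y \<in> U ` t"
    then obtain j where j: "j \<in> t" "y = U j" by blast
    have "y = (\<Sum>k\<in>t. (if k = j then 1 else 0) *\<^sub>R U k)"
      using j assms by (simp add: if_distrib[of "\<lambda>c. c *\<^sub>R _"] cong: if_cong)
    then show "y \<in> ?C" by (auto intro!: exI[of _ "\<lambda>k. if k = j then 1 else 0"])
  qed
  moreover have "convex_cone ?C"
    unfolding convex_cone_iff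
  proof (intro conjI ballI allI impI)
    show "0 \<in> ?C" by (auto intro!: exI[of _ "\<lambda>_. 0"])
    show "a + b \<in> ?C" if ab: "a \<in> ?C" "b \<in> ?C" for a b
    proof -
      obtain f g where "\<forall>j. 0 \<le> f j" "a = (\<Sum>j\<in>t. f j *\<^sub>R U j)" "\<forall>j. 0 \<le> g j" "b = (\<Sum>j\<in>t. g j *\<^sub>R U j)"
        using ab by auto
      then show ?thesis
        by (auto intro!: exI[of _ "\<lambda>j. f j + g j"] simp: scaleR_left_distrib sum.distrib)
    qed
    show "c *\<^sub>R a \<in> ?C" if ab: "a \<in> ?C" "0 \<le> c" for a c
    proof -
      obtain f where "\<forall>j. 0 \<le> f j" "a = (\<Sum>j\<in>t. f j *\<^sub>R U j)"
        using ab by auto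
      then show ?thesis using ab
        by (auto intro!: exI[of _ "\<lambda>j. c * f j"] simp: scaleR_right.sum)
    qed
  qed
  ultimately show "convex_cone hull (U ` t) \<subseteq> ?C" by (simp add: hull_minimal)
qed

text \<open>A fan reduced to its combinatorics: cones are sets of ray indices, and
  \<open>inter\<close> says that a common point of two cones uses only rays belonging to
  both.\<close>

locale simplicial_complete_fan =
  fixes U :: "'r::finite \<Rightarrow> 'a::euclidean_space" and K :: "'r set set"
  assumes indep: "s \<in> K \<Longrightarrow> (\<Sum>j\<in>s. a j *\<^sub>R U j) = 0 \<Longrightarrow> j \<in> s \<Longrightarrow> a j = 0"
    and cover: "\<exists>s\<in>K. \<exists>a. (\<forall>j. 0 \<le> a j) \<and> x = (\<Sum>j\<in>s. a j *\<^sub>R U j)"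
    and inter: "s \<in> K \<Longrightarrow> t \<in> K \<Longrightarrow> (\<forall>j. 0 \<le> a j) \<Longrightarrow> (\<forall>j. 0 \<le> b j) \<Longrightarrow>
      (\<Sum>j\<in>s. a j *\<^sub>R U j) = (\<Sum>j\<in>t. b j *\<^sub>R U j) \<Longrightarrow> j \<in> s \<Longrightarrow> a j > 0 \<Longrightarrow> j \<in> t"
begin

definition max_cones :: "'r set set" where "max_cones = {s \<in> K. card s = DIM('a)}"

text \<open>Coordinates with respect to the rays of \<open>s\<close>. They have a meaning only for
  \<open>s\<close> in \<open>max_cones\<close> and indices in \<open>s\<close>; the choice leaves
  the other values open, hence the premises of the lemmas below.\<close>

definition coef :: "'r set \<Rightarrow> 'a \<Rightarrow> 'r \<Rightarrow> real" where
  "coef s x = (SOME a. x = (\<Sum>j\<in>s. a j *\<^sub>R U j))"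

lemma comb_unique:
  assumes "s \<in> K" "(\<Sum>j\<in>s. a j *\<^sub>R U j) = (\<Sum>j\<in>s. b j *\<^sub>R U j)" "j \<in> s"
  shows "a j = b j"
proof -
  have "(\<Sum>j\<in>s. (a j - b j) *\<^sub>R U j) = 0"
    using assms(2) by (simp add: scaleR_left_diff_distrib sum_subtractf)
  then show ?thesis using indep[of s "\<lambda>j. a j - b j" j] assms by simp
qed

lemma inj_indep: assumes "s \<in> K" shows "inj_on U s" "independent (U ` s)"
proof -
  show inj: "inj_on U s"
  proof (rule inj_onI, rule ccontr)
    fix i j assume ij: "i \<in> s" "j \<in> s" "U i = U j" "i \<noteq> j"
    let ?a = "\<lambda>k. if k = i then 1 else if k = j then -1 else (0::real)"
    have "(\<Sum>k\<in>s. ?a k *\<^sub>R U k) = (\<Sum>k\<in>{i,j}. ?a k *\<^sub>R U k)"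
      using ij by (intro sum.mono_neutral_right) auto
    also have "\<dots> = 0" using ij by simp
    finally show False using indep[OF assms, of ?a i] ij by simp
  qed
  show "independent (U ` s)"
    unfolding independent_explicit_module
  proof (intro allI impI)
    fix t u v assume t: "finite t" "t \<subseteq> U ` s" "(\<Sum>v\<in>t. u v *\<^sub>R v) = 0" "v \<in> t"
    let ?a = "\<lambda>j. if U j \<in> t then u (U j) else 0"
    have "(\<Sum>j\<in>s. ?a j *\<^sub>R U j) = (\<Sum>j\<in>{j\<in>s. U j \<in> t}. u (U j) *\<^sub>R U j)"
      by (intro sum.mono_neutral_cong_right) auto
    also have "\<dots> = (\<Sum>v\<in>t. u v *\<^sub>R v)"
      using t inj by (intro sum.reindex_bij_betw)
        (auto simp: bij_betw_def inj_on_def)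
    finally show "u v = 0" using indep[OF assms, of ?a] t by force
  qed
qed

lemma card_K: "s \<in> K \<Longrightarrow> card s \<le> DIM('a)"
  using inj_indep[of s] independent_card_le card_image by metis

lemma coef:
  assumes "s \<in> max_cones" shows "x = (\<Sum>j\<in>s. coef s x j *\<^sub>R U j)"
proof -
  have sK: "s \<in> K" and c: "card s = DIM('a)" using assms by (auto simp: max_cones_def)
  have "card (U ` s) = DIM('a)" using c inj_indep[OF sK] card_image by metis
  then have "span (U ` s) = UNIV"
    using card_ge_dim_independent[of "U ` s" UNIV] inj_indep(2)[OF sK] by auto
  then have "x \<in> span (U ` s)" by simp
  then obtain u where "x = (\<Sum>v\<in>U ` s. u v *\<^sub>R v)"
    by (auto simp: span_finite)
  then have "x = (\<Sum>j\<in>s. u (U j) *\<^sub>R U j)"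
    using inj_indep(1)[OF sK] by (simp add: sum.reindex)
  then have "\<exists>a. x = (\<Sum>j\<in>s. a j *\<^sub>R U j)" by (rule exI[of _ "\<lambda>j. u (U j)"])
  then show ?thesis unfolding coef_def by (rule someI_ex)
qed

lemma coef_unique:
  assumes "s \<in> max_cones" "x = (\<Sum>j\<in>s. a j *\<^sub>R U j)" "j \<in> s"
  shows "coef s x j = a j"
  using comb_unique[of s "coef s x" a j] assms coef[OF assms(1), of x] by (auto simp: max_cones_def)

lemma coef_add:
  assumes "s \<in> max_cones" "j \<in> s" shows "coef s (x + y) j = coef s x j + coef s y j"
proof (rule coef_unique[OF assms(1) _ assms(2)])
  show "x + y = (\<Sum>j\<in>s. (coef s x j + coef s y j) *\<^sub>R U j)"
    using coef[OF assms(1), of x] coef[OF assms(1), of y] by (simp add: scaleR_left_distrib sum.distrib)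
qed

lemma coef_scale:
  assumes "s \<in> max_cones" "j \<in> s" shows "coef s (c *\<^sub>R x) j = c * coef s x j"
proof (rule coef_unique[OF assms(1) _ assms(2)])
  have "c *\<^sub>R x = c *\<^sub>R (\<Sum>j\<in>s. coef s x j *\<^sub>R U j)"
    using coef[OF assms(1), of x] by simp
  then show "c *\<^sub>R x = (\<Sum>j\<in>s. (c * coef s x j) *\<^sub>R U j)" by (simp add: scaleR_right.sum)
qed

lemma coef_U:
  assumes "s \<in> max_cones" "j \<in> s" "i \<in> s" shows "coef s (U i) j = (if i = j then 1 else 0)"
  using assms by (intro coef_unique[of s _ "\<lambda>j. if i = j then 1 else 0"]) (auto simp: if_distrib[of "\<lambda>c. c *\<^sub>R _"] cong: if_cong)

lemma coef_zero: assumes "s \<in> max_cones" "j \<in> s" shows "coef s 0 j = 0"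
  using coef_scale[OF assms, of 0 0] by simp

lemma coef_sum:
  assumes "s \<in> max_cones" "j \<in> s" shows "coef s (\<Sum>i\<in>A. f i) j = (\<Sum>i\<in>A. coef s (f i) j)"
  by (induction A rule: infinite_finite_induct) (auto simp: coef_zero coef_add assms)

text \<open>All small sets of rays are excluded, not only those spanning cones of the fan. There are
  still finitely many of them, so \<open>avoid_subspaces\<close> provides generic points.\<close>

definition generic :: "'a \<Rightarrow> bool" where
  "generic x \<longleftrightarrow> (\<forall>t. card t < DIM('a) \<longrightarrow> x \<notin> span (U ` t))"

lemma generic_coef:
  assumes "generic x" "s \<in> max_cones" "j \<in> s" shows "coef s x j \<noteq> 0"
proof
  assume 0: "coef s x j = 0"
  have "x = (\<Sum>i\<in>s-{j}. coef s x i *\<^sub>R U i)"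
    using coef[OF assms(2), of x] 0 assms(3) by (subst (asm) sum.remove[of s j]) auto
  then have "x \<in> span (U ` (s - {j}))"
    by (metis (no_types, lifting) imageI span_base span_scale span_sum)
  moreover have "card (s - {j}) < DIM('a)"
    using assms by (simp add: max_cones_def)
  ultimately show False using assms(1) by (auto simp: generic_def)
qed

text \<open>Completeness puts \<open>x\<close> into some cone, and a cone with fewer rays would
  contradict genericity. Two maximal cones with \<open>x\<close> in their interiors have the same
  rays by \<open>inter\<close>, applied in both directions.\<close>

lemma generic_unique_cone:
  assumes "generic x" shows "\<exists>!s. s \<in> max_cones \<and> (\<forall>j\<in>s. coef s x j > 0)"
proof (rule ex_ex1I)
  obtain s a where s: "s \<in> K" and a: "\<forall>j. 0 \<le> a j" "x = (\<Sum>j\<in>s. a j *\<^sub>R U j)"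
    using cover by blast
  have "x \<in> span (U ` s)"
    unfolding a by (intro span_sum span_scale span_base) auto
  then have "card s = DIM('a)"
    using assms card_K[OF s] unfolding generic_def by force
  then have sM: "s \<in> max_cones" using s by (simp add: max_cones_def)
  have "coef s x j > 0" if "j \<in> s" for j
    using coef_unique[OF sM a(2) that] generic_coef[OF assms sM that] a(1) by (metis less_eq_real_def)
  then show "\<exists>s. s \<in> max_cones \<and> (\<forall>j\<in>s. coef s x j > 0)" using sM by blast
next
  have sub: "s \<subseteq> t" if st: "s \<in> max_cones" "t \<in> max_cones" "\<forall>j\<in>s. coef s x j > 0" "\<forall>j\<in>t. coef t x j > 0" for s t
  proof
    fix j assume j: "j \<in> s"
    let ?a = "\<lambda>j. if j \<in> s then coef s x j else 0"
    let ?b = "\<lambda>j. if j \<in> t then coef t x j else 0"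
    show "j \<in> t"
    proof (rule inter[of s t ?a ?b])
      have "(\<Sum>j\<in>s. ?a j *\<^sub>R U j) = x" using coef[OF st(1), of x] by simp
      moreover have "(\<Sum>j\<in>t. ?b j *\<^sub>R U j) = x" using coef[OF st(2), of x] by simp
      ultimately show "(\<Sum>j\<in>s. ?a j *\<^sub>R U j) = (\<Sum>j\<in>t. ?b j *\<^sub>R U j)" by simp
    qed (use st j in \<open>auto simp: max_cones_def less_imp_le\<close>)
  qed
  show "s = t" if "s \<in> max_cones \<and> (\<forall>j\<in>s. coef s x j > 0)" "t \<in> max_cones \<and> (\<forall>j\<in>t. coef t x j > 0)" for s t
    using sub that by blast
qed

text \<open>
  A flag \<open>(s, i)\<close> stands for the facet of the maximal cone \<open>s\<close> opposite to the ray \<open>i\<close>; adjacent flags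
  give the same facet, seen from its two sides.
\<close>

definition flags :: "('r set \<times> 'r) set" where "flags = {(s, i). s \<in> max_cones \<and> i \<in> s}"

definition adj :: "'r set \<times> 'r \<Rightarrow> 'r set \<times> 'r \<Rightarrow> bool" where
  "adj x y \<longleftrightarrow> x \<in> flags \<and> y \<in> flags \<and> fst x - {snd x} = fst y - {snd y} \<and> fst x \<noteq> fst y"

lemma adj_sym: "adj x y \<Longrightarrow> adj y x" by (auto simp: adj_def)

text \<open>Change of coordinates across a facet. The \<open>i\<close>-th coordinate in
  \<open>s\<close> vanishes on the common facet, so it is a multiple of the \<open>k\<close>-th
  coordinate in \<open>t\<close>; the factor is its value at \<open>U k\<close>.\<close>

lemma adj_coef:
  assumes "adj (s, i) (t, k)" shows "coef s x i = coef s (U k) i * coef t x k"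
    and "j \<in> s - {i} \<Longrightarrow> coef s x j = coef t x j + coef t x k * coef s (U k) j"
proof -
  from assms have st: "s \<in> max_cones" "t \<in> max_cones" "i \<in> s" "k \<in> t" "t - {k} = s - {i}"
    by (auto simp: adj_def flags_def)
  have x: "x = coef t x k *\<^sub>R U k + (\<Sum>j\<in>s-{i}. coef t x j *\<^sub>R U j)"
    using coef[OF st(2), of x] st by (subst (asm) sum.remove[of t k]) auto
  have *: "coef s x j = coef t x k * coef s (U k) j + (\<Sum>l\<in>s-{i}. coef t x l * coef s (U l) j)" if "j \<in> s" for j
    by (subst x) (simp add: coef_add coef_scale coef_sum st that)
  have "(\<Sum>l\<in>s-{i}. coef t x l * coef s (U l) i) = 0"
    using st by (intro sum.neutral) (auto simp: coef_U)
  then show "coef s x i = coef s (U k) i * coef t x k" using *[OF st(3)] by simp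
  show "coef s x j = coef t x j + coef t x k * coef s (U k) j" if j: "j \<in> s - {i}"
  proof -
    have "(\<Sum>l\<in>s-{i}. coef t x l * coef s (U l) j) = (\<Sum>l\<in>s-{i}. if l = j then coef t x j else 0)"
      using st j by (intro sum.cong) (auto simp: coef_U)
    also have "\<dots> = coef t x j" using j by simp
    finally show ?thesis using *[of j] j by simp
  qed
qed

text \<open>Two maximal cones on the same side of a common facet would share interior points, and
  then \<open>inter\<close> would force them to have the same rays.\<close>

lemma facet_side_unique:
  assumes "adj (s, i) (t, k)" shows "coef s (U k) i < 0"
proof (rule ccontr)
  assume neg: "\<not> coef s (U k) i < 0"
  from assms have st: "s \<in> max_cones" "t \<in> max_cones" "i \<in> s" "k \<in> t" "t - {k} = s - {i}" "s \<noteq> t"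
    by (auto simp: adj_def flags_def)
  have "1 = coef s (U k) i * coef t (U i) k"
    using adj_coef(1)[OF assms, of "U i"] st by (simp add: coef_U)
  then have pos: "coef s (U k) i > 0" using neg by (metis less_eq_real_def linorder_not_le mult_zero_left zero_neq_one)
  \<comment> \<open>\<open>A\<close> exceeds every coordinate of \<open>U k\<close> in absolute
    value, so adding \<open>A\<close> times the facet rays makes all facet coordinates of
    \<open>p\<close> in \<open>s\<close> positive.\<close>
  define A where "A = 1 + (\<Sum>j\<in>s. \<bar>coef s (U k) j\<bar>)"
  have Ale: "\<bar>coef s (U k) j\<bar> < A" if "j \<in> s" for j
    using member_le_sum[of j s "\<lambda>j. \<bar>coef s (U k) j\<bar>"] that by (simp add: A_def)
  define p where "p = U k + A *\<^sub>R (\<Sum>j\<in>s-{i}. U j)"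
  have cp: "coef s p j = coef s (U k) j + A * (if j = i then 0 else 1)" if "j \<in> s" for j
  proof -
    have "(\<Sum>l\<in>s-{i}. coef s (U l) j) = (\<Sum>l\<in>s-{i}. if l = j then 1 else 0)"
      using st that by (intro sum.cong) (auto simp: coef_U)
    also have "\<dots> = (if j = i then 0 else 1)" using that by (simp add: sum.delta)
    finally show ?thesis using that st by (simp add: p_def coef_add coef_scale coef_sum)
  qed
  have ppos: "coef s p j > 0" if "j \<in> s" for j
    using cp[OF that] pos Ale[OF that] by auto
  have A: "A > 0" using Ale[OF st(3)] by linarith
  let ?b = "\<lambda>j. if j = k then 1 else A"
  have pt: "p = (\<Sum>j\<in>t. ?b j *\<^sub>R U j)"
  proof -
    have "(\<Sum>j\<in>t-{k}. ?b j *\<^sub>R U j) = (\<Sum>j\<in>s-{i}. A *\<^sub>R U j)"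
      unfolding st(5) by (intro sum.cong) (use st in auto)
    then show ?thesis using sum.remove[of t k "\<lambda>j. ?b j *\<^sub>R U j"] st(4)
      by (simp add: p_def scaleR_right.sum)
  qed
  let ?a = "\<lambda>j. if j \<in> s then coef s p j else 0"
  have "s \<subseteq> t"
  proof
    fix j assume j: "j \<in> s"
    show "j \<in> t"
    proof (rule inter[of s t ?a ?b])
      have "(\<Sum>j\<in>s. ?a j *\<^sub>R U j) = p" using coef[OF st(1), of p] by simp
      then show "(\<Sum>j\<in>s. ?a j *\<^sub>R U j) = (\<Sum>j\<in>t. ?b j *\<^sub>R U j)" using pt by simp
    qed (use st j ppos A in \<open>auto simp: max_cones_def less_imp_le\<close>)
  qed
  moreover have "card s = card t" using st by (simp add: max_cones_def)
  ultimately show False using card_subset_eq[of t s] st(6) by simp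
qed

text \<open>Points just beyond the facet lie in cones of the fan, infinitely many of them in the
  same cone \<open>t\<close>. That cone is closed, so it contains the interior point
  \<open>p\<close> of the facet and hence all facet rays; since it also reaches beyond the facet it
  has a further ray, and for reasons of dimension only one.\<close>

lemma facet_other_side:
  assumes "x \<in> flags" shows "\<exists>y. adj x y"
proof -
  obtain s i where x: "x = (s, i)" and s: "s \<in> max_cones" "i \<in> s" using assms by (auto simp: flags_def)
  define p where "p = (\<Sum>j\<in>s-{i}. U j)"
  define q where "q e = p - e *\<^sub>R U i" for e :: real
  define C where "C t = {y. \<exists>a. (\<forall>j. 0 \<le> a j) \<and> y = (\<Sum>j\<in>t. a j *\<^sub>R U j)}" for t :: "'r set"
  have Ccl: "closed (C t)" for t
    unfolding C_def convex_cone_hull_image[OF finite, symmetric] by (intro closed_convex_cone_hull) simp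
  have "\<exists>t\<in>K. q (1 / Suc m) \<in> C t" for m :: nat
    using cover[of "q (1 / Suc m)"] by (auto simp: C_def)
  then obtain T where T: "\<And>m::nat. T m \<in> K \<and> q (1 / Suc m) \<in> C (T m)" by metis
  have "\<exists>t. infinite {m. T m = t}"
    using pigeonhole_infinite[of UNIV T] by auto
  then obtain t where t: "infinite {m. T m = t}" by blast
  then obtain r where r: "strict_mono (r :: nat \<Rightarrow> nat)" "\<And>m. r m \<in> {m. T m = t}"
    using infinite_enumerate by blast
  have qC: "q (1 / Suc (r m)) \<in> C t" for m using T r(2)[of m] by auto
  have tK: "t \<in> K" using T r(2)[of 0] by auto
  have "(\<lambda>m. q (1 / Suc m)) \<longlonglongrightarrow> q 0"
  proof -
    have "(\<lambda>m. 1 / real (Suc m)) \<longlonglongrightarrow> 0"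
      using LIMSEQ_inverse_real_of_nat by (simp add: inverse_eq_divide)
    from tendsto_diff[OF tendsto_const tendsto_scaleR[OF this tendsto_const], of p "U i"]
    show ?thesis by (simp add: q_def)
  qed
  then have "(\<lambda>m. q (1 / Suc (r m))) \<longlonglongrightarrow> q 0"
    using LIMSEQ_subseq_LIMSEQ[OF _ r(1), of "\<lambda>m. q (1 / Suc m)" "q 0"] by (simp add: o_def)
  from closed_sequentially[OF Ccl qC this] have "q 0 \<in> C t" .
  then obtain b where b: "\<forall>j. 0 \<le> b j" "p = (\<Sum>j\<in>t. b j *\<^sub>R U j)" by (auto simp: C_def q_def)
  have sub: "s - {i} \<subseteq> t"
  proof
    fix j assume j: "j \<in> s - {i}"
    have "(\<Sum>j\<in>s. (if j \<in> s - {i} then 1 else 0) *\<^sub>R U j) = p"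
      unfolding p_def by (intro sum.mono_neutral_cong_right) auto
    then show "j \<in> t" using inter[of s t "\<lambda>j. if j \<in> s - {i} then 1 else 0" b j] s tK b j
      by (auto simp: max_cones_def)
  qed
  define e where "e = 1 / real (Suc (r 0))"
  have e: "e > 0" "q e \<in> C t" using qC[of 0] by (auto simp: e_def)
  then obtain a where a: "\<forall>j. 0 \<le> a j" "q e = (\<Sum>j\<in>t. a j *\<^sub>R U j)" by (auto simp: C_def)
  have cq: "coef s (q e) i = - e"
  proof -
    have "coef s p i = 0" unfolding p_def using s by (simp add: coef_sum coef_U)
    then show ?thesis unfolding q_def
      using coef_add[OF s, of p "(-e) *\<^sub>R U i"] coef_scale[OF s, of "-e" "U i"] coef_U[OF s(1,2,2)] by simp
  qed
  have "\<not> t \<subseteq> s"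
  proof
    assume ts: "t \<subseteq> s"
    have "q e = (\<Sum>j\<in>s. (if j \<in> t then a j else 0) *\<^sub>R U j)"
      unfolding a(2) using ts by (intro sum.mono_neutral_cong_left) auto
    then have "coef s (q e) i = (if i \<in> t then a i else 0)"
      using coef_unique[OF s(1) _ s(2)] by simp
    then show False using cq e a(1) by (metis le_minus_iff less_le_not_le neg_0_le_iff_le order_refl)
  qed
  then obtain k where k: "k \<in> t" "k \<notin> s" by blast
  have "insert k (s - {i}) \<subseteq> t" using k sub by blast
  moreover have "card (insert k (s - {i})) = DIM('a)"
    using s k by (auto simp: max_cones_def card_Diff_singleton card_insert_if card_gt_0_iff Suc_diff_1 simp del: card_Diff_insert)
  ultimately have teq: "t = insert k (s - {i})"
    using card_K[OF tK] by (metis card_seteq finite)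
  have "adj x (t, k)"
    unfolding adj_def flags_def x using s tK teq k \<open>card (insert k (s - {i})) = DIM('a)\<close>
    by (auto simp: max_cones_def)
  then show ?thesis by blast
qed

text \<open>If two cones other than \<open>s\<close> contained the facet, both would lie on the side
  opposite to \<open>s\<close>, hence on the same side of it, which \<open>facet_side_unique\<close>
  forbids.\<close>

lemma adj_unique: assumes "adj x y" "adj x z" shows "y = z"
proof -
  obtain s i where x: "x = (s, i)" by force
  obtain t k where y: "y = (t, k)" by force
  obtain v l where z: "z = (v, l)" by force
  have 1: "coef s (U k) i < 0" "coef s (U l) i < 0"
    using facet_side_unique assms x y z by auto
  have "coef s (U l) i = coef s (U k) i * coef t (U l) k"
    using adj_coef(1)[of s i t k "U l"] assms x y by simp
  then have pos: "coef t (U l) k > 0" using 1 by (metis mult_less_0_iff not_less_iff_gr_or_eq)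
  have "t = v"
  proof (rule ccontr)
    assume "t \<noteq> v"
    then have "adj y z" using assms x y z by (auto simp: adj_def)
    then show False using facet_side_unique[of t k v l] y z pos by simp
  qed
  moreover have "k = l"
    using assms x y z \<open>t = v\<close> by (auto simp: adj_def flags_def)
  ultimately show ?thesis using y z by simp
qed

definition partner where "partner x = (THE y. adj x y)"

lemma partner: assumes "x \<in> flags" shows "adj x (partner x)" "partner x \<in> flags" "partner (partner x) = x"
proof -
  obtain y where y: "adj x y" using facet_other_side[OF assms] by blast
  then have p: "partner x = y" unfolding partner_def using adj_unique by blast
  show "adj x (partner x)" "partner x \<in> flags" using p y by (auto simp: adj_def)
  show "partner (partner x) = x"
    using p adj_sym[OF y] adj_unique unfolding partner_def by (metis the_equality)
qed

end

section \<open>Degrees of flipped piecewise linear maps and signed cones\<close>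

context simplicial_complete_fan begin

definition flip :: "'r set \<Rightarrow> 'r \<Rightarrow> real" where "flip N j = (if j \<in> N then -1 else 1)"

text \<open>
  The degree over \<open>x\<close> of the map that is linear on the cones of the fan and sends \<open>U j\<close> to
  \<open>- U j\<close> for \<open>j \<in> N\<close> and to \<open>U j\<close> otherwise.
\<close>

definition pl_degree :: "'r set \<Rightarrow> 'a \<Rightarrow> real" where
  "pl_degree N x = (\<Sum>s\<in>max_cones. (-1) ^ card (s \<inter> N) * of_bool (\<forall>j\<in>s. flip N j * coef s x j > 0))"

lemma flip_simps: "flip N j \<noteq> 0" "flip N j * flip N j = 1" "\<bar>flip N j\<bar> = 1"
  by (auto simp: flip_def)

text \<open>Along the segment from \<open>x\<close> to \<open>y\<close> a summand changes only where
  the segment meets the image of a facet, and the two flags of a facet contribute opposite amounts.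
  The premise \<open>xy\<close> keeps the segment off the spans of at most
  \<open>DIM('a) - 2\<close> rays, so that no two coordinates in a cone vanish at the same
  moment.\<close>

lemma pl_degree_invariant:
  assumes x: "generic x" and y: "generic y"
    and xy: "\<And>t. card t + 1 < DIM('a) \<Longrightarrow> y \<notin> span (insert x (U ` t))"
  shows "pl_degree N x = pl_degree N y"
proof -
  \<comment> \<open>The condition of \<open>crossing_count\<close> for flipped coordinates: the flip
    of \<open>i\<close> drops out of the product and of the absolute values.\<close>
  define P where "P s i \<longleftrightarrow> coef s x i * coef s y i < 0 \<and>
    (\<forall>k\<in>s-{i}. flip N k * (coef s x k * \<bar>coef s y i\<bar> + coef s y k * \<bar>coef s x i\<bar>) > 0)" for s i
  \<comment> \<open>The factor \<open>flip N i\<close> of the crossing sign is absorbed into the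
    power of -1, which thereby depends only on the facet \<open>s - {i}\<close>.\<close>
  define f where "f s i = (-1) ^ card ((s - {i}) \<inter> N) * (sgn (coef s x i) * of_bool (P s i))" for s i
  have step: "(-1) ^ card (s \<inter> N) * of_bool (\<forall>j\<in>s. flip N j * coef s x j > 0)
      - (-1) ^ card (s \<inter> N) * of_bool (\<forall>j\<in>s. flip N j * coef s y j > 0) = (\<Sum>i\<in>s. f s i)"
    if s: "s \<in> max_cones" for s
  proof -
    have nz: "coef s x i \<noteq> 0" "coef s y i \<noteq> 0" if "i \<in> s" for i
      using generic_coef s x y that by auto
    have gen: "coef s x i * coef s y k \<noteq> coef s x k * coef s y i" if ik: "i \<in> s" "k \<in> s" "i \<noteq> k" for i k
    proof
      assume eq: "coef s x i * coef s y k = coef s x k * coef s y i"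
      define r where "r = coef s y i / coef s x i"
      have "(\<Sum>j\<in>s. (coef s y j - r * coef s x j) *\<^sub>R U j)
          = (\<Sum>j\<in>s. coef s y j *\<^sub>R U j) - r *\<^sub>R (\<Sum>j\<in>s. coef s x j *\<^sub>R U j)"
        by (simp add: scaleR_left_diff_distrib sum_subtractf scaleR_right.sum)
      also have "\<dots> = y - r *\<^sub>R x" by (simp only: coef[OF s, symmetric])
      finally have "y - r *\<^sub>R x = (\<Sum>j\<in>s. (coef s y j - r * coef s x j) *\<^sub>R U j)" by simp
      also have "\<dots> = (\<Sum>j\<in>s-{i,k}. (coef s y j - r * coef s x j) *\<^sub>R U j)"
      proof (rule sum.mono_neutral_right)
        have "coef s y i - r * coef s x i = 0" "coef s y k - r * coef s x k = 0"
          using nz[OF ik(1)] eq by (auto simp: r_def field_simps)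
        then show "\<forall>j\<in>s - (s - {i, k}). (coef s y j - r * coef s x j) *\<^sub>R U j = 0" by auto
      qed auto
      finally have e: "y = (\<Sum>j\<in>s-{i,k}. (coef s y j - r * coef s x j) *\<^sub>R U j) + r *\<^sub>R x"
        by (metis diff_add_cancel)
      have "(\<Sum>j\<in>s-{i,k}. (coef s y j - r * coef s x j) *\<^sub>R U j) + r *\<^sub>R x \<in> span (insert x (U ` (s-{i,k})))"
        by (intro span_add span_sum span_scale span_base) auto
      then have "y \<in> span (insert x (U ` (s - {i,k})))" using e by simp
      moreover have "card (s - {i,k}) + 1 < DIM('a)"
      proof -
        have "card {i,k} = 2" using ik by simp
        moreover have "card {i,k} \<le> card s" using ik by (intro card_mono) auto
        moreover have "card (s - {i,k}) = card s - card {i,k}" using ik by (intro card_Diff_subset) auto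
        ultimately show ?thesis using s by (simp add: max_cones_def)
      qed
      ultimately show False using xy by blast
    qed
    have "of_bool (\<forall>j\<in>s. flip N j * coef s x j > 0) - of_bool (\<forall>j\<in>s. flip N j * coef s y j > 0)
      = (\<Sum>i\<in>s. sgn (flip N i * coef s x i) * of_bool (flip N i * coef s x i * (flip N i * coef s y i) < 0 \<and>
          (\<forall>k\<in>s-{i}. flip N k * coef s x k * \<bar>flip N i * coef s y i\<bar> + flip N k * coef s y k * \<bar>flip N i * coef s x i\<bar> > 0)))"
    proof (rule crossing_count)
      show "flip N i * coef s x i \<noteq> 0 \<and> flip N i * coef s y i \<noteq> 0" if "i \<in> s" for i
        using nz that flip_simps by simp
      show "flip N i * coef s x i * (flip N k * coef s y k) \<noteq> flip N k * coef s x k * (flip N i * coef s y i)"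
        if "i \<in> s" "k \<in> s" "i \<noteq> k" for i k
      proof -
        have "flip N i * flip N k * (coef s x i * coef s y k) \<noteq> flip N i * flip N k * (coef s x k * coef s y i)"
          using gen[OF that] flip_simps by simp
        then show ?thesis by (simp add: mult_ac)
      qed
    qed simp
    also have "\<dots> = (\<Sum>i\<in>s. flip N i * (sgn (coef s x i) * of_bool (P s i)))"
    proof (rule sum.cong[OF refl])
      fix i assume "i \<in> s"
      have e1: "flip N i * coef s x i * (flip N i * coef s y i) = coef s x i * coef s y i"
        by (simp add: flip_def)
      have e2: "flip N k * coef s x k * \<bar>flip N i * coef s y i\<bar> + flip N k * coef s y k * \<bar>flip N i * coef s x i\<bar>
         = flip N k * (coef s x k * \<bar>coef s y i\<bar> + coef s y k * \<bar>coef s x i\<bar>)" for k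
        by (simp add: abs_mult flip_simps algebra_simps)
      have e3: "sgn (flip N i * coef s x i) = flip N i * sgn (coef s x i)" by (simp add: flip_def sgn_minus)
      show "sgn (flip N i * coef s x i) * of_bool (flip N i * coef s x i * (flip N i * coef s y i) < 0 \<and>
          (\<forall>k\<in>s-{i}. flip N k * coef s x k * \<bar>flip N i * coef s y i\<bar> + flip N k * coef s y k * \<bar>flip N i * coef s x i\<bar> > 0))
        = flip N i * (sgn (coef s x i) * of_bool (P s i))"
        unfolding e1 e2 e3 P_def by simp
    qed
    finally have "(-1) ^ card (s \<inter> N) * (of_bool (\<forall>j\<in>s. flip N j * coef s x j > 0) - of_bool (\<forall>j\<in>s. flip N j * coef s y j > 0))
      = (\<Sum>i\<in>s. (-1) ^ card (s \<inter> N) * flip N i * (sgn (coef s x i) * of_bool (P s i)))"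
      by (simp add: sum_distrib_left mult.assoc)
    also have "\<dots> = (\<Sum>i\<in>s. f s i)"
    proof (rule sum.cong[OF refl])
      fix i assume i: "i \<in> s"
      have "(-1) ^ card (s \<inter> N) * flip N i = (-1) ^ card ((s - {i}) \<inter> N)"
      proof (cases "i \<in> N")
        case True
        then have "s \<inter> N = insert i ((s - {i}) \<inter> N)" using i by auto
        then have "card (s \<inter> N) = Suc (card ((s - {i}) \<inter> N))" by simp
        then show ?thesis using True by (simp add: flip_def)
      next
        case False
        then have "s \<inter> N = (s - {i}) \<inter> N" by auto
        then show ?thesis using False by (simp add: flip_def)
      qed
      then show "(-1) ^ card (s \<inter> N) * flip N i * (sgn (coef s x i) * of_bool (P s i)) = f s i"
        by (simp add: f_def)
    qed
    finally show ?thesis by (simp add: algebra_simps)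
  qed
  have anti: "f (fst (partner z)) (snd (partner z)) = - f (fst z) (snd z)" if z: "z \<in> flags" for z
  proof -
    obtain s i where zz: "z = (s, i)" by force
    obtain t k where pz: "partner z = (t, k)" by force
    have adj: "adj (s, i) (t, k)" using partner(1)[OF z] zz pz by simp
    then have st: "s \<in> max_cones" "t \<in> max_cones" "i \<in> s" "k \<in> t" "t - {k} = s - {i}"
      by (auto simp: adj_def flags_def)
    define a where "a = coef s (U k) i"
    have a: "a < 0" unfolding a_def by (rule facet_side_unique[OF adj])
    have ci: "coef s w i = a * coef t w k" for w unfolding a_def by (rule adj_coef(1)[OF adj])
    have cj: "coef s w j = coef t w j + coef t w k * coef s (U k) j" if "j \<in> s - {i}" for w j
      using adj_coef(2)[OF adj that] .
    have "P s i \<longleftrightarrow> P t k"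
    proof (cases "coef t x k * coef t y k < 0")
      case True
      have "coef s x j * \<bar>coef s y i\<bar> + coef s y j * \<bar>coef s x i\<bar> = \<bar>a\<bar> * (coef t x j * \<bar>coef t y k\<bar> + coef t y j * \<bar>coef t x k\<bar>)"
        if j: "j \<in> s - {i}" for j
      proof -
        \<comment> \<open>At the crossing point the coordinate along \<open>U k\<close> vanishes. So
          the correction term of \<open>adj_coef\<close> disappears there, and the facet coordinates
          in \<open>s\<close> and \<open>t\<close> agree up to the factor
          \<open>\<bar>a\<bar>\<close>.\<close>
        have 0: "coef t x k * \<bar>coef t y k\<bar> + coef t y k * \<bar>coef t x k\<bar> = 0"
          using True by (auto simp: mult_less_0_iff)
        have "coef s x j * \<bar>coef s y i\<bar> + coef s y j * \<bar>coef s x i\<bar>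
          = \<bar>a\<bar> * (coef t x j * \<bar>coef t y k\<bar> + coef t y j * \<bar>coef t x k\<bar>) +
             \<bar>a\<bar> * coef s (U k) j * (coef t x k * \<bar>coef t y k\<bar> + coef t y k * \<bar>coef t x k\<bar>)"
          unfolding cj[OF j, of x] cj[OF j, of y] ci abs_mult by (simp add: algebra_simps)
        then show ?thesis using 0 by simp
      qed
      then have 1: "flip N j * (coef s x j * \<bar>coef s y i\<bar> + coef s y j * \<bar>coef s x i\<bar>) > 0 \<longleftrightarrow>
         flip N j * (coef t x j * \<bar>coef t y k\<bar> + coef t y j * \<bar>coef t x k\<bar>) > 0" if "j \<in> s - {i}" for j
        using a that by (simp add: zero_less_mult_iff flip_def mult_less_0_iff)
      have "coef s x i * coef s y i = (a * a) * (coef t x k * coef t y k)" by (simp add: ci)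
      moreover have "a * a > 0" using a by (simp add: mult_neg_neg)
      ultimately have "coef s x i * coef s y i < 0" using True by (metis mult_pos_neg)
      then show ?thesis unfolding P_def using True st(5) 1 by simp
    next
      case False
      have "coef s x i * coef s y i = (a * a) * (coef t x k * coef t y k)" by (simp add: ci)
      moreover have "a * a > 0" using a by (simp add: mult_neg_neg)
      ultimately have "\<not> coef s x i * coef s y i < 0" using False by (simp add: mult_less_0_iff)
      then show ?thesis using False by (simp add: P_def)
    qed
    moreover have "sgn (coef s x i) = - sgn (coef t x k)" using a by (simp add: ci sgn_mult)
    ultimately show ?thesis using st(5) using pz by (simp add: f_def zz)
  qed
  have "pl_degree N x - pl_degree N y = (\<Sum>s\<in>max_cones. \<Sum>i\<in>s. f s i)"
    unfolding pl_degree_def sum_subtractf[symmetric] using step by (intro sum.cong) auto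
  also have "\<dots> = (\<Sum>(s,i)\<in>Sigma max_cones (\<lambda>s. s). f s i)" by (subst sum.Sigma) auto
  also have "Sigma max_cones (\<lambda>s. s) = flags" by (auto simp: flags_def)
  finally have 1: "pl_degree N x - pl_degree N y = (\<Sum>z\<in>flags. f (fst z) (snd z))"
    by (simp add: case_prod_beta)
  \<comment> \<open>Reindexing by the involution \<open>partner\<close> shows that the sum is its
    own negative.\<close>
  also have "\<dots> = (\<Sum>z\<in>flags. f (fst (partner z)) (snd (partner z)))"
    by (rule sum.reindex_bij_witness[of _ partner partner]) (auto simp: partner)
  also have "\<dots> = - (\<Sum>z\<in>flags. f (fst z) (snd z))"
    using anti by (simp add: sum_negf)
  finally show ?thesis using 1 by simp
qed

text \<open>
  This is the Lawrence-Varchenko decomposition of a polytope into cones flipped towards \<open>x\<close>, evaluated at a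
  point with coordinates \<open>w\<close>. If some \<open>w k\<close> is negative, then all \<open>L s\<close> are negative on
  an open set, and the piecewise linear map misses this set, so its degree is 0.
\<close>

theorem signed_cone_decomposition:
  assumes x: "generic x"
    and L: "\<And>s j. s \<in> max_cones \<Longrightarrow> j \<in> s \<Longrightarrow> L s \<bullet> U j = w j"
    and Lle: "\<And>s j. s \<in> max_cones \<Longrightarrow> L s \<bullet> U j \<le> w j"
  shows "of_bool (\<forall>j. w j \<ge> 0) =
    (\<Sum>s\<in>max_cones. (-1) ^ card {j\<in>s. coef s x j < 0} * of_bool (\<forall>j\<in>s. w j < 0 \<longleftrightarrow> coef s x j < 0) :: real)"
proof -
  define N where "N = {j. w j < 0}"
  have "(\<Sum>s\<in>max_cones. (-1) ^ card {j\<in>s. coef s x j < 0} * of_bool (\<forall>j\<in>s. w j < 0 \<longleftrightarrow> coef s x j < 0)) = pl_degree N x"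
    unfolding pl_degree_def
  proof (rule sum.cong[OF refl])
    fix s assume s: "s \<in> max_cones"
    have eq: "(\<forall>j\<in>s. w j < 0 \<longleftrightarrow> coef s x j < 0) \<longleftrightarrow> (\<forall>j\<in>s. flip N j * coef s x j > 0)"
    proof (rule ball_cong[OF refl])
      fix j assume "j \<in> s"
      then have "coef s x j \<noteq> 0" by (rule generic_coef[OF x s])
      then show "(w j < 0 \<longleftrightarrow> coef s x j < 0) \<longleftrightarrow> flip N j * coef s x j > 0"
        by (cases "w j < 0") (auto simp: flip_def N_def)
    qed
    have "{j\<in>s. coef s x j < 0} = s \<inter> N" if "\<forall>j\<in>s. w j < 0 \<longleftrightarrow> coef s x j < 0"
      using that by (auto simp: N_def)
    then show "(-1) ^ card {j\<in>s. coef s x j < 0} * of_bool (\<forall>j\<in>s. w j < 0 \<longleftrightarrow> coef s x j < 0) =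
       ((-1) ^ card (s \<inter> N) * of_bool (\<forall>j\<in>s. flip N j * coef s x j > 0) :: real)"
      unfolding eq[symmetric] by (cases "\<forall>j\<in>s. w j < 0 \<longleftrightarrow> coef s x j < 0") auto
  qed
  also have "pl_degree N x = of_bool (\<forall>j. w j \<ge> 0)"
  proof (cases "N = {}")
    \<comment> \<open>Nothing is flipped, so the map is the identity and \<open>x\<close> has a
      single preimage, counted with sign 1.\<close>
    case True
    obtain s0 where s0: "s0 \<in> max_cones" "\<forall>j\<in>s0. coef s0 x j > 0"
      and uni: "\<And>s. s \<in> max_cones \<Longrightarrow> \<forall>j\<in>s. coef s x j > 0 \<Longrightarrow> s = s0"
      using generic_unique_cone[OF x] by blast
    have "pl_degree N x = (\<Sum>s\<in>max_cones. if s = s0 then 1 else 0)"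
      unfolding pl_degree_def
    proof (rule sum.cong[OF refl])
      fix s assume "s \<in> max_cones"
      then have "(\<forall>j\<in>s. coef s x j > 0) \<longleftrightarrow> s = s0" using uni s0 by blast
      then show "(-1) ^ card (s \<inter> N) * of_bool (\<forall>j\<in>s. flip N j * coef s x j > 0) = (if s = s0 then 1 else (0::real))"
        by (simp add: True flip_def)
    qed
    also have "\<dots> = 1" using s0 by simp
    finally show ?thesis using True by (simp add: N_def not_less)
  next
    case False
    then obtain k where k: "w k < 0" by (auto simp: N_def)
    \<comment> \<open>Nonempty because every \<open>L s\<close> is at most \<open>w k < 0\<close> at
      \<open>U k\<close>. Openness leaves room to choose \<open>y\<close> generic and outside the
      subspaces through \<open>x\<close> that \<open>pl_degree_invariant\<close> excludes.\<close>
    define O1 where "O1 = (\<Inter>s\<in>max_cones. {y. L s \<bullet> y < 0})"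
    have "open O1" unfolding O1_def by (intro open_INT) (auto simp: open_halfspace_lt)
    moreover have "U k \<in> O1" using Lle k by (auto simp: O1_def intro: le_less_trans)
    moreover define F where "F = (\<lambda>t. span (U ` t)) ` {t. card t < DIM('a)} \<union>
        (\<lambda>t. span (insert x (U ` t))) ` {t. card t + 1 < DIM('a)}"
    have "subspace S \<and> dim S < DIM('a)" if "S \<in> F" for S
    proof -
      consider t where "card t < DIM('a)" "S = span (U ` t)" | t where "card t + 1 < DIM('a)" "S = span (insert x (U ` t))"
        using \<open>S \<in> F\<close> by (auto simp: F_def)
      then show ?thesis
      proof cases
        case 1
        have "dim S \<le> card (U ` t)" unfolding 1 dim_span by (intro dim_le_card') auto
        also have "\<dots> \<le> card t" by (intro card_image_le) auto
        finally show ?thesis using 1 by simp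
      next
        case 2
        have "dim S \<le> card (insert x (U ` t))" unfolding 2 dim_span by (intro dim_le_card') auto
        also have "\<dots> \<le> card (U ` t) + 1" by (simp add: card_insert_if)
        also have "\<dots> \<le> card t + 1" by (simp add: card_image_le)
        finally show ?thesis using 2 by simp
      qed
    qed
    moreover have "finite F" by (simp add: F_def)
    ultimately obtain y where y: "y \<in> O1" "\<forall>S\<in>F. y \<notin> S"
      using avoid_subspaces[of F O1] by blast
    have gy: "generic y" using y(2) by (auto simp: generic_def F_def)
    have "pl_degree N x = pl_degree N y"
      by (rule pl_degree_invariant[OF x gy]) (use y(2) in \<open>auto simp: F_def\<close>)
    also have "\<dots> = 0"
      unfolding pl_degree_def
    proof (rule sum.neutral, rule ballI)
      fix s assume s: "s \<in> max_cones"
      have "\<not> (\<forall>j\<in>s. flip N j * coef s y j > 0)"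
      proof
        assume p: "\<forall>j\<in>s. flip N j * coef s y j > 0"
        \<comment> \<open>The flips follow the signs of \<open>w\<close>, so on a flipped cone every
          \<open>coef s y j * w j\<close> is nonnegative.\<close>
        have "L s \<bullet> y = (\<Sum>j\<in>s. coef s y j * w j)"
          by (subst coef[OF s, of y]) (simp add: inner_sum_right L[OF s])
        also have "\<dots> \<ge> 0"
          using p by (intro sum_nonneg) (auto simp: flip_def N_def split: if_splits simp: mult_neg_neg less_imp_le)
        finally show False using y(1) s by (auto simp: O1_def)
      qed
      then show "(-1) ^ card (s \<inter> N) * of_bool (\<forall>j\<in>s. flip N j * coef s y j > 0) = (0::real)" by simp
    qed
    finally show ?thesis using k by (auto simp: not_le)
  qed
  finally show ?thesis by simp
qed

lemma exists_generic: "\<exists>x. generic x"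
proof -
  have "subspace S \<and> dim S < DIM('a)" if S: "S \<in> (\<lambda>t. span (U ` t)) ` {t. card t < DIM('a)}" for S
  proof -
    obtain t where t: "card t < DIM('a)" "S = span (U ` t)" using S by auto
    have "dim S \<le> card (U ` t)" unfolding t dim_span by (intro dim_le_card') auto
    also have "\<dots> \<le> card t" by (intro card_image_le) auto
    finally show ?thesis using t by simp
  qed
  then obtain x where "\<forall>S\<in>(\<lambda>t. span (U ` t)) ` {t. card t < DIM('a)}. x \<notin> S"
    using avoid_subspaces[of "(\<lambda>t. span (U ` t)) ` {t. card t < DIM('a)}" UNIV] by auto
  then show ?thesis by (auto simp: generic_def)
qed

end

section \<open>Lattice points of nef polytopes\<close>

lemma of_lat_add: "of_lat (x + y) = of_lat x + of_lat y"
  by (simp add: of_lat_def vec_eq_iff)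

lemma of_lat_diff: "of_lat (x - y) = of_lat x - of_lat y"
  by (simp add: of_lat_def vec_eq_iff)

lemma of_lat_0 [simp]: "of_lat 0 = 0"
  by (simp add: of_lat_def vec_eq_iff)

lemma of_lat_inject [simp]: "of_lat x = of_lat y \<longleftrightarrow> x = y"
  by (simp add: of_lat_def vec_eq_iff)

lemma inner_of_lat: "of_lat m \<bullet> of_lat (u j) = real_of_int (char_div u m $ j)"
  by (simp add: of_lat_def char_div_def inner_vec_def)

lemma char_div_add: "char_div u (x + y) = char_div u x + char_div u y"
  by (simp add: char_div_def vec_eq_iff algebra_simps sum.distrib)

lemma char_div_diff: "char_div u (x - y) = char_div u x - char_div u y"
  by (simp add: char_div_def vec_eq_iff algebra_simps sum_subtractf)

lemma char_div_0 [simp]: "char_div u 0 = 0"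
  by (simp add: char_div_def vec_eq_iff)

lemma char_div_sum: "char_div u (sum f A) = (\<Sum>i\<in>A. char_div u (f i))"
  by (induction A rule: infinite_finite_induct) (auto simp: char_div_add)

lemma finite_int_box: "finite {m :: int ^ 'n::finite. \<forall>i. \<bar>m $ i\<bar> \<le> B i}"
proof -
  have "{m :: int ^ 'n. \<forall>i. \<bar>m $ i\<bar> \<le> B i} \<subseteq> (\<lambda>f. \<chi> i. f i) ` (PiE UNIV (\<lambda>i. {-B i..B i}))"
  proof
    fix m :: "int ^ 'n" assume "m \<in> {m. \<forall>i. \<bar>m $ i\<bar> \<le> B i}"
    then have "\<bar>m $ i\<bar> \<le> B i" for i by simp
    then have "(\<lambda>i. m $ i) \<in> PiE UNIV (\<lambda>i. {-B i..B i})" by (auto simp: abs_le_iff) (smt (verit))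
    then show "m \<in> (\<lambda>f. \<chi> i. f i) ` (PiE UNIV (\<lambda>i. {-B i..B i}))"
      by (intro image_eqI[of _ _ "\<lambda>i. m $ i"]) auto
  qed
  moreover have "finite (PiE UNIV (\<lambda>i::'n. {-B i..B i}))" by (intro finite_PiE) auto
  ultimately show ?thesis using finite_subset by blast
qed

lemma prod_one_minus:
  fixes f :: "'i \<Rightarrow> real"
  assumes "finite A" shows "(\<Prod>i\<in>A. 1 - f i) = (\<Sum>J\<in>Pow A. (-1) ^ card J * prod f J)"
proof -
  have "(\<Prod>i\<in>A. 1 - f i) = (\<Prod>i\<in>A. - f i + 1)" by simp
  also have "\<dots> = (\<Sum>J\<in>Pow A. (\<Prod>i\<in>J. - f i) * (\<Prod>i\<in>A-J. 1))" using assms by (rule prod_add)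
  also have "\<dots> = (\<Sum>J\<in>Pow A. (-1) ^ card J * prod f J)" by (simp add: prod_uminus)
  finally show ?thesis .
qed

text \<open>The lattice points of the polytope of \<open>D\<close>, that is, the monomials of degree \<open>div_class u D\<close>.\<close>

definition lat :: "('r::finite \<Rightarrow> int ^ 'n::finite) \<Rightarrow> int ^ 'r \<Rightarrow> (int ^ 'n) set" where
  "lat u D = {m. \<forall>j. 0 \<le> char_div u m $ j + D $ j}"

locale lattice_fan = simplicial_complete_fan "\<lambda>j. of_lat (u j) :: real ^ 'n::finite" K
  for u :: "'r::finite \<Rightarrow> int ^ 'n" and K
begin

text \<open>\<open>p s\<close> is the vertex of the polytope of \<open>D\<close> belonging to the maximal cone \<open>s\<close>.\<close>

definition nef_vertices :: "int ^ 'r \<Rightarrow> ('r set \<Rightarrow> int ^ 'n) \<Rightarrow> bool" where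
  "nef_vertices D p \<longleftrightarrow> (\<forall>s\<in>max_cones. p s \<in> lat u D \<and> (\<forall>j\<in>s. char_div u (p s) $ j + D $ j = 0))"

lemma nef_vertices_add:
  "nef_vertices D p \<Longrightarrow> nef_vertices E q \<Longrightarrow> nef_vertices (D + E) (\<lambda>s. p s + q s)"
  unfolding nef_vertices_def lat_def
  by (simp add: char_div_add) (smt (verit, best))

lemma nef_vertices_0: "nef_vertices 0 (\<lambda>s. 0)"
  by (simp add: nef_vertices_def lat_def)

lemma nef_vertices_sum:
  assumes "\<And>i. i \<in> J \<Longrightarrow> nef_vertices (D i) (p i)"
  shows "nef_vertices (\<Sum>i\<in>J. D i) (\<lambda>s. \<Sum>i\<in>J. p i s)"
  using assms
proof (induction J rule: infinite_finite_induct)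
  case (insert x F)
  then show ?case using nef_vertices_add[of "D x" "p x" "\<Sum>i\<in>F. D i" "\<lambda>s. \<Sum>i\<in>F. p i s"] by simp
qed (auto simp: nef_vertices_0)

text \<open>By completeness both \<open>axis i 1\<close> and its negative are nonnegative
  combinations of rays, so the inequalities defining \<open>lat\<close> bound every coordinate on
  both sides.\<close>

lemma finite_lat: "finite (lat u D)"
proof -
  have "\<exists>B::int. \<forall>m\<in>lat u D. \<bar>m $ i\<bar> \<le> B" for i
  proof -
    obtain s a where a: "\<forall>j. 0 \<le> a j" "axis i 1 = (\<Sum>j\<in>s. a j *\<^sub>R of_lat (u j))"
      using cover[of "axis i 1"] by blast
    obtain s' a' where a': "\<forall>j. 0 \<le> a' j" "- axis i 1 = (\<Sum>j\<in>s'. a' j *\<^sub>R of_lat (u j))"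
      using cover[of "- axis i 1"] by blast
    define B where "B = (\<Sum>j\<in>s. a j * real_of_int (D $ j))"
    define B' where "B' = (\<Sum>j\<in>s'. a' j * real_of_int (D $ j))"
    have "\<bar>m $ i\<bar> \<le> \<lceil>\<bar>B\<bar> + \<bar>B'\<bar>\<rceil>" if m: "m \<in> lat u D" for m
    proof -
      have ge: "real_of_int (char_div u m $ j) \<ge> - real_of_int (D $ j)" for j
      proof -
        have "0 \<le> char_div u m $ j + D $ j" using m by (simp add: lat_def)
        then show ?thesis by linarith
      qed
      have mi: "real_of_int (m $ i) = of_lat m \<bullet> axis i 1" by (simp add: inner_axis of_lat_def)
      also have "\<dots> = (\<Sum>j\<in>s. a j * real_of_int (char_div u m $ j))"
        unfolding a(2) by (simp add: inner_sum_right inner_of_lat)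
      also have "\<dots> \<ge> (\<Sum>j\<in>s. a j * (- real_of_int (D $ j)))"
        by (intro sum_mono mult_left_mono ge) (use a in auto)
      finally have 1: "real_of_int (m $ i) \<ge> - B" by (simp add: B_def sum_negf)
      have "- real_of_int (m $ i) = of_lat m \<bullet> (- axis i 1)" using mi by simp
      also have "\<dots> = (\<Sum>j\<in>s'. a' j * real_of_int (char_div u m $ j))"
        unfolding a'(2) by (simp add: inner_sum_right inner_of_lat)
      also have "\<dots> \<ge> (\<Sum>j\<in>s'. a' j * (- real_of_int (D $ j)))"
        by (intro sum_mono mult_left_mono ge) (use a' in auto)
      finally have 2: "- real_of_int (m $ i) \<ge> - B'" by (simp add: B'_def sum_negf)
      have "real_of_int \<bar>m $ i\<bar> \<le> \<bar>B\<bar> + \<bar>B'\<bar>" using 1 2 by linarith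
      then show ?thesis by linarith
    qed
    then show ?thesis by blast
  qed
  then obtain B where "\<And>i. \<forall>m\<in>lat u D. \<bar>m $ i\<bar> \<le> B i" by metis
  then have "lat u D \<subseteq> {m. \<forall>i. \<bar>m $ i\<bar> \<le> B i}" by blast
  then show ?thesis using finite_int_box finite_subset by blast
qed

text \<open>The half-open cone that enters the decomposition after translation to a vertex. Strict
  inequalities sit exactly where \<open>coef s x j < 0\<close>, so the pairing with \<open>x\<close>
  is a sum of nonnegative terms. The vector \<open>v\<close> cuts out a hyperplane, and
  \<open>v = 0\<close> imposes nothing.\<close>

definition signed_cone :: "real ^ 'n \<Rightarrow> real ^ 'n \<Rightarrow> 'r set \<Rightarrow> (int ^ 'n) set" where
  "signed_cone v x s = {m. of_lat m \<bullet> v = 0 \<and> (\<forall>j\<in>s. char_div u m $ j < 0 \<longleftrightarrow> coef s x j < 0)}"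

lemma inner_coef:
  assumes "s \<in> max_cones"
  shows "of_lat m \<bullet> x = (\<Sum>j\<in>s. coef s x j * real_of_int (char_div u m $ j))"
  by (subst coef[OF assms, of x]) (simp add: inner_sum_right inner_of_lat)

lemma eq_0_if_char_div_0:
  assumes "s \<in> max_cones" "\<And>j. j \<in> s \<Longrightarrow> char_div u m $ j = 0" shows "m = 0"
proof -
  have "of_lat m \<bullet> of_lat m = 0" using assms inner_coef[OF assms(1), of m "of_lat m"] by simp
  then show ?thesis using of_lat_inject[of m 0] by simp
qed

text \<open>The signs of the ray pairings are prescribed in the cone, so a point is determined by
  their absolute values, and for \<open>v \<noteq> 0\<close> one of these is determined by the
  others. Dominating the weight by a product of powers gives a product of geometric series. Only a
  bound results, as the rays of a simplicial cone need not form a lattice basis.\<close>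

lemma signed_cone_sum_bound:
  assumes x: "generic x" and s: "s \<in> max_cones"
  obtains J where "J \<subseteq> s" "card J = CARD('n) - (if v = 0 then 0 else 1)"
    "\<And>e X. e > 0 \<Longrightarrow> finite X \<Longrightarrow> X \<subseteq> signed_cone v x s \<Longrightarrow>
       (\<Sum>m\<in>X. exp (- e * (of_lat m \<bullet> x))) \<le> (\<Prod>j\<in>J. 1 / (1 - exp (- e * \<bar>coef s x j\<bar>)))"
proof -
  have cs: "card s = CARD('n)" using s by (simp add: max_cones_def)
  have "\<exists>J. J \<subseteq> s \<and> card J = CARD('n) - (if v = 0 then 0 else 1) \<and>
     (\<forall>m. of_lat m \<bullet> v = 0 \<longrightarrow> (\<forall>j\<in>J. char_div u m $ j = 0) \<longrightarrow> m = 0)"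
  proof (cases "v = 0")
    case True
    then show ?thesis using eq_0_if_char_div_0[OF s] cs by (intro exI[of _ s]) auto
  next
    case False
    have "\<exists>k\<in>s. coef s v k \<noteq> 0"
    proof (rule ccontr)
      assume "\<not> ?thesis"
      then have "v = 0" by (subst coef[OF s, of v]) simp
      then show False using False by simp
    qed
    \<comment> \<open>The equation \<open>of_lat m \<bullet> v = 0\<close> can be solved for the
      pairing with this ray, which is therefore left out of \<open>J\<close>.\<close>
    then obtain k where k: "k \<in> s" "coef s v k \<noteq> 0" by blast
    have "m = 0" if m: "of_lat m \<bullet> v = 0" "\<forall>j\<in>s-{k}. char_div u m $ j = 0" for m
    proof (rule eq_0_if_char_div_0[OF s])
      have "of_lat m \<bullet> v = (\<Sum>j\<in>s. coef s v j * real_of_int (char_div u m $ j))" by (rule inner_coef[OF s])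
      also have "\<dots> = coef s v k * real_of_int (char_div u m $ k) + (\<Sum>j\<in>s-{k}. coef s v j * real_of_int (char_div u m $ j))"
        using k by (intro sum.remove) auto
      also have "(\<Sum>j\<in>s-{k}. coef s v j * real_of_int (char_div u m $ j)) = 0"
        using m(2) by (intro sum.neutral) auto
      finally have "char_div u m $ k = 0" using m(1) k by simp
      then show "char_div u m $ j = 0" if "j \<in> s" for j using m(2) that by (cases "j = k") auto
    qed
    then show ?thesis using k cs False by (intro exI[of _ "s - {k}"]) auto
  qed
  then obtain J where J: "J \<subseteq> s" "card J = CARD('n) - (if v = 0 then 0 else 1)"
     "\<And>m. of_lat m \<bullet> v = 0 \<Longrightarrow> \<forall>j\<in>J. char_div u m $ j = 0 \<Longrightarrow> m = 0" by blast
  show ?thesis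
  proof (rule that[OF J(1,2)])
    fix e :: real and X assume e: "e > 0" and X: "finite X" "X \<subseteq> signed_cone v x s"
    define q where "q j = exp (- e * \<bar>coef s x j\<bar>)" for j
    define \<phi> where "\<phi> m = (\<lambda>j\<in>J. nat \<bar>char_div u m $ j\<bar>)" for m
    have q: "0 < q j" "q j < 1" if "j \<in> J" for j
      using generic_coef[OF x s, of j] that J(1) e by (auto simp: q_def)
    have inj: "inj_on \<phi> X"
    proof (rule inj_onI)
      fix m m' assume m: "m \<in> X" "m' \<in> X" "\<phi> m = \<phi> m'"
      have "m - m' = 0"
      proof (rule J(3))
        show "of_lat (m - m') \<bullet> v = 0" 
        proof -
          have "m \<in> signed_cone v x s" "m' \<in> signed_cone v x s" using m X by blast+
          then show ?thesis by (simp add: of_lat_diff inner_diff_left signed_cone_def)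
        qed
        show "\<forall>j\<in>J. char_div u (m - m') $ j = 0"
        proof
          fix j assume j: "j \<in> J"
          have "\<bar>char_div u m $ j\<bar> = \<bar>char_div u m' $ j\<bar>"
            using m(3) j unfolding \<phi>_def by (metis (no_types, lifting) abs_ge_zero nat_eq_iff2 nat_0_le restrict_apply')
          moreover have "char_div u m $ j < 0 \<longleftrightarrow> char_div u m' $ j < 0"
          proof -
            have "m \<in> signed_cone v x s" "m' \<in> signed_cone v x s" "j \<in> s" using m X j J(1) by blast+
            then show ?thesis by (simp add: signed_cone_def)
          qed
          ultimately have "char_div u m $ j = char_div u m' $ j" by linarith
          then show "char_div u (m - m') $ j = 0" by (simp add: char_div_diff)
        qed
      qed
      then show "m = m'" by simp
    qed
    obtain B where B: "\<And>m j. m \<in> X \<Longrightarrow> j \<in> J \<Longrightarrow> \<phi> m j \<le> B"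
    proof -
      have fin: "finite ((\<lambda>(m,j). \<phi> m j) ` (X \<times> J))" using X(1) by simp
      show thesis
      proof (rule that[of "Max ((\<lambda>(m,j). \<phi> m j) ` (X \<times> J))"])
        fix m j assume "m \<in> X" "j \<in> J"
        then have "\<phi> m j \<in> (\<lambda>(m,j). \<phi> m j) ` (X \<times> J)" by force
        then show "\<phi> m j \<le> Max ((\<lambda>(m,j). \<phi> m j) ` (X \<times> J))" by (rule Max_ge[OF fin])
      qed
    qed
    have "exp (- e * (of_lat m \<bullet> x)) \<le> (\<Prod>j\<in>J. q j ^ \<phi> m j)" if m: "m \<in> X" for m
    proof -
      have ms: "m \<in> signed_cone v x s" using m X by blast
      have "of_lat m \<bullet> x = (\<Sum>j\<in>s. coef s x j * real_of_int (char_div u m $ j))" by (rule inner_coef[OF s])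
      also have "\<dots> = (\<Sum>j\<in>s. \<bar>coef s x j\<bar> * real_of_int \<bar>char_div u m $ j\<bar>)"
      proof (rule sum.cong[OF refl])
        fix j assume "j \<in> s"
        then have "char_div u m $ j < 0 \<longleftrightarrow> coef s x j < 0" using ms by (simp add: signed_cone_def)
        then show "coef s x j * real_of_int (char_div u m $ j) = \<bar>coef s x j\<bar> * real_of_int \<bar>char_div u m $ j\<bar>"
          by (cases "coef s x j < 0") auto
      qed
      also have "\<dots> \<ge> (\<Sum>j\<in>J. \<bar>coef s x j\<bar> * real_of_int \<bar>char_div u m $ j\<bar>)"
        by (rule sum_mono2) (use J(1) in auto)
      finally have "exp (- e * (of_lat m \<bullet> x)) \<le> exp (- e * (\<Sum>j\<in>J. \<bar>coef s x j\<bar> * real_of_int \<bar>char_div u m $ j\<bar>))"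
        using e by simp
      also have "- e * (\<Sum>j\<in>J. \<bar>coef s x j\<bar> * real_of_int \<bar>char_div u m $ j\<bar>) = (\<Sum>j\<in>J. real (\<phi> m j) * (- e * \<bar>coef s x j\<bar>))"
        unfolding sum_distrib_left by (intro sum.cong) (auto simp: \<phi>_def mult_ac)
      also have "exp \<dots> = (\<Prod>j\<in>J. q j ^ \<phi> m j)"
        by (subst exp_sum) (auto simp: q_def exp_of_nat_mult[symmetric])
      finally show ?thesis .
    qed
    then have "(\<Sum>m\<in>X. exp (- e * (of_lat m \<bullet> x))) \<le> (\<Sum>m\<in>X. \<Prod>j\<in>J. q j ^ \<phi> m j)"
      by (rule sum_mono)
    also have "\<dots> = (\<Sum>f\<in>\<phi> ` X. \<Prod>j\<in>J. q j ^ f j)"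
      using inj by (simp add: sum.reindex)
    also have "\<dots> \<le> (\<Sum>f\<in>PiE J (\<lambda>_. {..B}). \<Prod>j\<in>J. q j ^ f j)"
    proof (rule sum_mono2)
      show "finite (PiE J (\<lambda>_. {..B}))" by (intro finite_PiE) auto
      show "\<phi> ` X \<subseteq> PiE J (\<lambda>_. {..B})"
      proof
        fix f assume "f \<in> \<phi> ` X"
        then obtain m where m: "m \<in> X" "f = \<phi> m" by blast
        then show "f \<in> PiE J (\<lambda>_. {..B})" using B[OF m(1)] unfolding m(2) by (auto simp: \<phi>_def PiE_def)
      qed
      show "0 \<le> (\<Prod>j\<in>J. q j ^ b j)" for b using q by (intro prod_nonneg) (auto simp: less_imp_le)
    qed
    also have "\<dots> = (\<Prod>j\<in>J. \<Sum>k\<in>{..B}. q j ^ k)"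
      by (rule prod_sum_PiE[symmetric]) auto
    also have "\<dots> \<le> (\<Prod>j\<in>J. 1 / (1 - q j))"
    proof (rule prod_mono)
      fix j assume j: "j \<in> J"
      have "(\<Sum>k\<in>{..B}. q j ^ k) = (1 - q j ^ Suc B) / (1 - q j)"
        using q[OF j] by (simp add: sum_gp0)
      also have "\<dots> \<le> 1 / (1 - q j)" using q[OF j] by (intro divide_right_mono) auto
      finally show "0 \<le> (\<Sum>k\<le>B. q j ^ k) \<and> (\<Sum>k\<le>B. q j ^ k) \<le> 1 / (1 - q j)"
        using q[OF j] by (auto intro: sum_nonneg simp: less_imp_le)
    qed
    finally show "(\<Sum>m\<in>X. exp (- e * (of_lat m \<bullet> x))) \<le> (\<Prod>j\<in>J. 1 / (1 - exp (- e * \<bar>coef s x j\<bar>)))"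
      by (simp add: q_def)
  qed
qed

text \<open>
  Lattice points \<open>m\<close> are counted with weight \<open>exp (- e * (of_lat m \<bullet> x))\<close>, and \<open>e\<close> tends to 0.
  The sum over one signed cone is of order \<open>1 / e\<close> to the power of its dimension, while each direction of the
  difference contributes a factor of order \<open>e\<close>. For \<open>v \<noteq> 0\<close> all polytopes lie in
  hyperplanes orthogonal to \<open>v\<close>, which lowers the dimension by one.
\<close>

theorem mixed_difference_lattice_points:
  assumes I: "finite I" and D0: "nef_vertices D0 p0" and D: "\<And>i. i \<in> I \<Longrightarrow> nef_vertices (D i) (p i)"
    and flat: "\<And>J m m'. J \<subseteq> I \<Longrightarrow> m \<in> lat u (D0 + (\<Sum>i\<in>J. D i)) \<Longrightarrow> m' \<in> lat u (D0 + (\<Sum>i\<in>J. D i)) \<Longrightarrow>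
        of_lat m \<bullet> v = of_lat m' \<bullet> v"
    and dim: "card I > CARD('n) - (if v = 0 then 0 else 1)"
  shows "(\<Sum>J\<in>Pow I. (-1) ^ card J * real (card (lat u (D0 + (\<Sum>i\<in>J. D i))))) = 0"
proof -
  obtain x where x: "generic x" using exists_generic by blast
  define E where "E J = D0 + (\<Sum>i\<in>J. D i)" for J
  have flat': "of_lat m \<bullet> v = of_lat m' \<bullet> v" if "J \<subseteq> I" "m \<in> lat u (E J)" "m' \<in> lat u (E J)" for J m m'
    using flat[OF that(1)] that(2,3) unfolding E_def by blast
  define P where "P J s = p0 s + (\<Sum>i\<in>J. p i s)" for J s
  have nefE: "nef_vertices (E J) (P J)" if "J \<subseteq> I" for J
    unfolding E_def P_def using that D by (intro nef_vertices_add[OF D0] nef_vertices_sum) auto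
  define sg where "sg s = (-1::real) ^ card {j\<in>s. coef s x j < 0}" for s
  define w where "w e m = exp (- e * (of_lat m \<bullet> x))" for e :: real and m :: "int ^ 'n"
  \<comment> \<open>The weighted count of one signed cone. It does not depend on \<open>J\<close>:
    the polytope enters only through the translation factor \<open>w e (P J s)\<close>.\<close>
  define c where "c e s = infsum (w e) (signed_cone v x s)" for e s
  have "\<forall>s\<in>max_cones. \<exists>J. J \<subseteq> s \<and> card J = CARD('n) - (if v = 0 then 0 else 1) \<and>
     (\<forall>e>0. w e summable_on signed_cone v x s \<and> 0 \<le> c e s \<and> c e s \<le> (\<Prod>j\<in>J. 1 / (1 - exp (- e * \<bar>coef s x j\<bar>))))"
  proof
    fix s assume s: "s \<in> max_cones"
    obtain J where J: "J \<subseteq> s" "card J = CARD('n) - (if v = 0 then 0 else 1)"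
      "\<And>e X. e > 0 \<Longrightarrow> finite X \<Longrightarrow> X \<subseteq> signed_cone v x s \<Longrightarrow>
       (\<Sum>m\<in>X. w e m) \<le> (\<Prod>j\<in>J. 1 / (1 - exp (- e * \<bar>coef s x j\<bar>)))"
      using signed_cone_sum_bound[OF x s, of v] unfolding w_def by blast
    have "w e summable_on signed_cone v x s \<and> 0 \<le> c e s \<and> c e s \<le> (\<Prod>j\<in>J. 1 / (1 - exp (- e * \<bar>coef s x j\<bar>)))"
      if e: "e > 0" for e
    proof -
      have sm: "w e summable_on signed_cone v x s"
      proof (rule nonneg_bdd_above_summable_on)
        show "bdd_above (sum (w e) ` {F. F \<subseteq> signed_cone v x s \<and> finite F})"
          by (rule bdd_aboveI[of _ "\<Prod>j\<in>J. 1 / (1 - exp (- e * \<bar>coef s x j\<bar>))"]) (use J(3)[OF e] in auto)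
      qed (simp add: w_def)
      moreover have "0 \<le> c e s" unfolding c_def by (intro infsum_nonneg) (simp add: w_def)
      moreover have "c e s \<le> (\<Prod>j\<in>J. 1 / (1 - exp (- e * \<bar>coef s x j\<bar>)))"
        unfolding c_def by (rule infsum_le_finite_sums[OF sm]) (rule J(3)[OF e])
      ultimately show ?thesis by blast
    qed
    then show "\<exists>J. J \<subseteq> s \<and> card J = CARD('n) - (if v = 0 then 0 else 1) \<and>
     (\<forall>e>0. w e summable_on signed_cone v x s \<and> 0 \<le> c e s \<and> c e s \<le> (\<Prod>j\<in>J. 1 / (1 - exp (- e * \<bar>coef s x j\<bar>))))"
      using J by blast
  qed
  from bchoice[OF this] obtain Js where Jall: "\<forall>s\<in>max_cones. Js s \<subseteq> s \<and> card (Js s) = CARD('n) - (if v = 0 then 0 else 1) \<and>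
     (\<forall>e>0. w e summable_on signed_cone v x s \<and> 0 \<le> c e s \<and> c e s \<le> (\<Prod>j\<in>Js s. 1 / (1 - exp (- e * \<bar>coef s x j\<bar>))))"
    by blast
  then have Js: "\<And>s. s \<in> max_cones \<Longrightarrow> card (Js s) = CARD('n) - (if v = 0 then 0 else 1)"
      "\<And>s. s \<in> max_cones \<Longrightarrow> Js s \<subseteq> s"
    and sm: "\<And>s e. s \<in> max_cones \<Longrightarrow> e > 0 \<Longrightarrow> w e summable_on signed_cone v x s"
    and c0: "\<And>s e. s \<in> max_cones \<Longrightarrow> e > 0 \<Longrightarrow> 0 \<le> c e s"
    and cle: "\<And>s e. s \<in> max_cones \<Longrightarrow> e > 0 \<Longrightarrow> c e s \<le> (\<Prod>j\<in>Js s. 1 / (1 - exp (- e * \<bar>coef s x j\<bar>)))"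
    by blast+
  have w_add: "w e (m + m') = w e m * w e m'" for e m m'
    by (simp add: w_def of_lat_add inner_add_left ring_distribs exp_add exp_diff exp_minus divide_inverse)
  have decomp: "(\<Sum>m\<in>lat u (E J). w e m) = (\<Sum>s\<in>max_cones. sg s * (w e (P J s) * c e s))"
    if e: "e > 0" and JI: "J \<subseteq> I" for e J
  proof -
    note nE = nefE[OF JI]
    define h where "h s m = sg s * (of_bool (m - P J s \<in> signed_cone v x s) * w e m)" for s m
    have hs: "(h s has_sum (sg s * (w e (P J s) * c e s))) UNIV" if s: "s \<in> max_cones" for s
    proof -
      have "(w e has_sum c e s) (signed_cone v x s)"
        unfolding c_def using sm[OF s e] by simp
      then have "((\<lambda>m. w e (P J s) * w e m) has_sum (w e (P J s) * c e s)) (signed_cone v x s)"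
        by (rule has_sum_cmult_right)
      also have "?this \<longleftrightarrow> (w e has_sum (w e (P J s) * c e s)) ((\<lambda>m. P J s + m) ` signed_cone v x s)"
        by (subst has_sum_reindex) (auto simp: o_def w_add)
      also have "\<dots> \<longleftrightarrow> ((\<lambda>m. of_bool (m - P J s \<in> signed_cone v x s) * w e m) has_sum (w e (P J s) * c e s)) UNIV"
      proof (rule has_sum_cong_neutral)
        fix m assume "m \<in> UNIV - (\<lambda>m. P J s + m) ` signed_cone v x s"
        then have "m - P J s \<notin> signed_cone v x s"
          by (metis (no_types, lifting) DiffD2 add.commute diff_add_cancel image_eqI)
        then show "of_bool (m - P J s \<in> signed_cone v x s) * w e m = 0" by simp
      qed auto
      finally show ?thesis unfolding h_def by (rule has_sum_cmult_right)
    qed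
    have "((\<lambda>m. \<Sum>s\<in>max_cones. h s m) has_sum (\<Sum>s\<in>max_cones. sg s * (w e (P J s) * c e s))) UNIV"
    proof -
      have "finite T \<Longrightarrow> T \<subseteq> max_cones \<Longrightarrow> ((\<lambda>m. \<Sum>s\<in>T. h s m) has_sum (\<Sum>s\<in>T. sg s * (w e (P J s) * c e s))) UNIV" for T
        by (induction T rule: finite_induct) (auto intro!: has_sum_add hs)
      then show ?thesis by simp
    qed
    moreover have "(\<Sum>s\<in>max_cones. h s m) = of_bool (m \<in> lat u (E J)) * w e m" for m
    proof -
      \<comment> \<open>\<open>W j\<close> is the slack of \<open>m\<close> in the
        \<open>j\<close>-th inequality of the polytope, and \<open>L s\<close> measures
        \<open>m\<close> from the vertex of \<open>s\<close>. Their values differ by the slack of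
        that vertex, which is nonnegative and vanishes for \<open>j \<in> s\<close>, as the
        decomposition requires.\<close>
      define L where "L s = of_lat (m - P J s)" for s
      define W where "W j = real_of_int (char_div u m $ j + E J $ j)" for j
      have LW: "L s \<bullet> of_lat (u j) = W j - real_of_int (char_div u (P J s) $ j + E J $ j)" for s j
        by (simp add: L_def W_def inner_of_lat char_div_diff)
      have "of_bool (\<forall>j. W j \<ge> 0) =
         (\<Sum>s\<in>max_cones. (-1) ^ card {j\<in>s. coef s x j < 0} * of_bool (\<forall>j\<in>s. W j < 0 \<longleftrightarrow> coef s x j < 0) :: real)"
      proof (rule signed_cone_decomposition[OF x])
        fix s j assume s: "s \<in> max_cones"
        show "L s \<bullet> of_lat (u j) = W j" if "j \<in> s"
          using nE s that unfolding LW nef_vertices_def by simp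
        have "0 \<le> char_div u (P J s) $ j + E J $ j" using nE s unfolding nef_vertices_def lat_def by simp
        then show "L s \<bullet> of_lat (u j) \<le> W j" unfolding LW by simp
      qed
      also have "(\<forall>j. W j \<ge> 0) \<longleftrightarrow> m \<in> lat u (E J)" by (simp only: W_def lat_def of_int_0_le_iff mem_Collect_eq)
      finally have 1: "of_bool (m \<in> lat u (E J)) = (\<Sum>s\<in>max_cones. sg s * of_bool (\<forall>j\<in>s. W j < 0 \<longleftrightarrow> coef s x j < 0))"
        by (simp add: sg_def)
      have 2: "(\<forall>j\<in>s. W j < 0 \<longleftrightarrow> coef s x j < 0) \<longleftrightarrow> (\<forall>j\<in>s. char_div u (m - P J s) $ j < 0 \<longleftrightarrow> coef s x j < 0)"
        if s: "s \<in> max_cones" for s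
      proof -
        have "char_div u (m - P J s) $ j = char_div u m $ j + E J $ j" if "j \<in> s" for j
        proof -
          have "char_div u (P J s) $ j + E J $ j = 0" using nE s that unfolding nef_vertices_def by blast
          then show ?thesis by (simp add: char_div_diff)
        qed
        then show ?thesis by (simp add: W_def flip: of_int_add)
      qed
      show ?thesis
      \<comment> \<open>All vertices have the same pairing with \<open>v\<close>. Either
        \<open>m\<close> shares it and the hyperplane condition in \<open>signed_cone\<close> is
        automatic, or \<open>m\<close> lies neither in a translated cone nor in the
        polytope.\<close>
      proof (cases "\<exists>s\<in>max_cones. of_lat (m - P J s) \<bullet> v = 0")
        case True
        then obtain s0 where s0: "s0 \<in> max_cones" "of_lat (m - P J s0) \<bullet> v = 0" by blast
        have "of_lat (m - P J s) \<bullet> v = 0" if "s \<in> max_cones" for s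
        proof -
          have "P J s \<in> lat u (E J)" "P J s0 \<in> lat u (E J)" using nE that s0 by (auto simp: nef_vertices_def)
          then have "of_lat (P J s) \<bullet> v = of_lat (P J s0) \<bullet> v" using flat'[OF JI] by blast
          then show ?thesis using s0 by (simp add: of_lat_diff inner_diff_left)
        qed
        then have "m - P J s \<in> signed_cone v x s \<longleftrightarrow> (\<forall>j\<in>s. W j < 0 \<longleftrightarrow> coef s x j < 0)" if "s \<in> max_cones" for s
          unfolding 2[OF that] using that by (simp add: signed_cone_def)
        then have "(\<Sum>s\<in>max_cones. h s m) = (\<Sum>s\<in>max_cones. sg s * of_bool (\<forall>j\<in>s. W j < 0 \<longleftrightarrow> coef s x j < 0) * w e m)"
          unfolding h_def by (intro sum.cong[OF refl]) (simp only: mult.assoc)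
        also have "\<dots> = of_bool (m \<in> lat u (E J)) * w e m" unfolding 1 by (rule sum_distrib_right[symmetric])
        finally show ?thesis .
      next
        case False
        then have h0: "(\<Sum>s\<in>max_cones. h s m) = 0" by (intro sum.neutral) (auto simp: h_def signed_cone_def)
        have "m \<notin> lat u (E J)"
        proof
          assume m: "m \<in> lat u (E J)"
          obtain s where s: "s \<in> max_cones" using generic_unique_cone[OF x] by blast
          then have "P J s \<in> lat u (E J)" using nE by (auto simp: nef_vertices_def)
          then have "of_lat m \<bullet> v = of_lat (P J s) \<bullet> v" using flat'[OF JI] m by blast
          then have "of_lat (m - P J s) \<bullet> v = 0" by (simp add: of_lat_diff inner_diff_left)
          then show False using False s by blast
        qed
        then show ?thesis using h0 by simp
      qed
    qed
    ultimately have 1: "((\<lambda>m. of_bool (m \<in> lat u (E J)) * w e m) has_sum (\<Sum>s\<in>max_cones. sg s * (w e (P J s) * c e s))) UNIV"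
      by simp
    have "((\<lambda>m. of_bool (m \<in> lat u (E J)) * w e m) has_sum (\<Sum>m\<in>lat u (E J). w e m)) UNIV"
      by (rule has_sum_finite_neutralI[OF finite_lat]) auto
    then show ?thesis using 1 has_sum_unique by blast
  qed
  define \<Delta> where "\<Delta> e = (\<Sum>J\<in>Pow I. (-1) ^ card J * (\<Sum>m\<in>lat u (E J). w e m))" for e
  \<comment> \<open>Vertices add up along with the divisors and \<open>w e\<close> is
    multiplicative, so for each maximal cone the alternating sum over \<open>J\<close> factors into
    a product over the directions.\<close>
  have \<Delta>: "\<Delta> e = (\<Sum>s\<in>max_cones. sg s * (w e (p0 s) * (\<Prod>i\<in>I. 1 - w e (p i s)) * c e s))" if e: "e > 0" for e
  proof -
    have wP: "w e (P J s) = w e (p0 s) * (\<Prod>i\<in>J. w e (p i s))" if "J \<subseteq> I" for J s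
    proof -
      have "w e (\<Sum>i\<in>J. p i s) = (\<Prod>i\<in>J. w e (p i s))" for J
        by (induction J rule: infinite_finite_induct) (auto simp: w_add, auto simp: w_def)
      then show ?thesis by (simp add: P_def w_add)
    qed
    have "\<Delta> e = (\<Sum>J\<in>Pow I. \<Sum>s\<in>max_cones. sg s * (w e (p0 s) * ((-1) ^ card J * (\<Prod>i\<in>J. w e (p i s))) * c e s))"
      unfolding \<Delta>_def
    proof (rule sum.cong[OF refl])
      fix J assume "J \<in> Pow I" then have J: "J \<subseteq> I" by simp
      show "(-1) ^ card J * (\<Sum>m\<in>lat u (E J). w e m) = (\<Sum>s\<in>max_cones. sg s * (w e (p0 s) * ((-1) ^ card J * (\<Prod>i\<in>J. w e (p i s))) * c e s))"
        unfolding decomp[OF e J] sum_distrib_left wP[OF J] by (intro sum.cong) (auto simp: mult_ac)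
    qed
    also have "\<dots> = (\<Sum>s\<in>max_cones. \<Sum>J\<in>Pow I. sg s * (w e (p0 s) * ((-1) ^ card J * (\<Prod>i\<in>J. w e (p i s))) * c e s))"
      by (rule sum.swap)
    also have "\<dots> = (\<Sum>s\<in>max_cones. sg s * (w e (p0 s) * (\<Prod>i\<in>I. 1 - w e (p i s)) * c e s))"
      by (simp only: prod_one_minus[OF I] sum_distrib_left sum_distrib_right)
    finally show ?thesis .
  qed
  have lim0: "(\<Delta> \<longlongrightarrow> 0) (at_right 0)"
  proof -
    have term0: "((\<lambda>e. sg s * (w e (p0 s) * (\<Prod>i\<in>I. 1 - w e (p i s)) * c e s)) \<longlongrightarrow> 0) (at_right 0)"
      if s: "s \<in> max_cones" for s
    proof -
      define G where "G e = (\<Prod>i\<in>I. \<bar>1 - w e (p i s)\<bar>) * (\<Prod>j\<in>Js s. 1 / (1 - exp (- e * \<bar>coef s x j\<bar>)))" for e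
      have lim1: "((\<lambda>e. \<bar>1 - w e m\<bar> / e) \<longlongrightarrow> \<bar>of_lat m \<bullet> x\<bar>) (at_right 0)" for m
      proof -
        have "((\<lambda>e. (1 - exp (- e * a)) / e) \<longlongrightarrow> a) (at_right 0)" for a :: real
        proof (cases "a = 0")
          case False
          then show ?thesis by real_asymp
        qed simp
        then have "((\<lambda>e. \<bar>(1 - w e m) / e\<bar>) \<longlongrightarrow> \<bar>of_lat m \<bullet> x\<bar>) (at_right 0)"
          unfolding w_def by (intro tendsto_rabs)
        then show ?thesis
          by (rule Lim_transform_eventually) (auto simp: eventually_at_right_less eventually_at_filter abs_divide)
      qed
      have lim2: "((\<lambda>e. e / (1 - exp (- e * b))) \<longlongrightarrow> 1 / b) (at_right 0)" if "b > 0" for b :: real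
        using that unfolding inverse_eq_divide[symmetric] by real_asymp
      have "((\<lambda>e. (\<Prod>i\<in>I. \<bar>1 - w e (p i s)\<bar> / e) * (\<Prod>j\<in>Js s. e / (1 - exp (- e * \<bar>coef s x j\<bar>))) * e ^ (card I - card (Js s)))
         \<longlongrightarrow> (\<Prod>i\<in>I. \<bar>of_lat (p i s) \<bullet> x\<bar>) * (\<Prod>j\<in>Js s. 1 / \<bar>coef s x j\<bar>) * 0 ^ (card I - card (Js s))) (at_right 0)"
      proof (intro tendsto_mult tendsto_prod tendsto_power lim1 lim2)
        fix j assume "j \<in> Js s"
        then have "j \<in> s" using Js(2)[OF s] by blast
        then show "\<bar>coef s x j\<bar> > 0" using generic_coef[OF x s] by auto
      qed (rule tendsto_ident_at)
      moreover have pos: "card I - card (Js s) > 0" using dim Js(1)[OF s] by simp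
      ultimately have "((\<lambda>e. (\<Prod>i\<in>I. \<bar>1 - w e (p i s)\<bar> / e) * (\<Prod>j\<in>Js s. e / (1 - exp (- e * \<bar>coef s x j\<bar>))) * e ^ (card I - card (Js s)))
         \<longlongrightarrow> 0) (at_right 0)" by (simp only: zero_power mult_zero_right)
      moreover have "eventually (\<lambda>e. (\<Prod>i\<in>I. \<bar>1 - w e (p i s)\<bar> / e) * (\<Prod>j\<in>Js s. e / (1 - exp (- e * \<bar>coef s x j\<bar>))) * e ^ (card I - card (Js s)) = G e) (at_right 0)"
        using eventually_at_right_less[of 0]
      proof eventually_elim
        case (elim e)
        have "(\<Prod>i\<in>I. \<bar>1 - w e (p i s)\<bar> / e) = (\<Prod>i\<in>I. \<bar>1 - w e (p i s)\<bar>) / e ^ card I"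
          by (simp add: prod_dividef)
        moreover have "(\<Prod>j\<in>Js s. e / (1 - exp (- e * \<bar>coef s x j\<bar>))) = e ^ card (Js s) * (\<Prod>j\<in>Js s. 1 / (1 - exp (- e * \<bar>coef s x j\<bar>)))"
          by (simp add: prod_dividef)
        moreover have "e ^ card I = e ^ card (Js s) * e ^ (card I - card (Js s))"
          using pos by (simp flip: power_add)
        ultimately show ?case using elim by (simp add: G_def)
      qed
      ultimately have G: "(G \<longlongrightarrow> 0) (at_right 0)" by (rule Lim_transform_eventually)
      have W: "((\<lambda>e. w e (p0 s)) \<longlongrightarrow> 1) (at_right 0)"
        unfolding w_def by real_asymp
      have B: "((\<lambda>e. (\<Prod>i\<in>I. 1 - w e (p i s)) * c e s) \<longlongrightarrow> 0) (at_right 0)"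
      proof (rule Lim_null_comparison[OF _ G])
        show "eventually (\<lambda>e. norm ((\<Prod>i\<in>I. 1 - w e (p i s)) * c e s) \<le> G e) (at_right 0)"
          using eventually_at_right_less[of 0]
        proof eventually_elim
          case (elim e)
          have "norm ((\<Prod>i\<in>I. 1 - w e (p i s)) * c e s) = (\<Prod>i\<in>I. \<bar>1 - w e (p i s)\<bar>) * c e s"
            using c0[OF s elim] by (simp add: abs_mult abs_prod)
          also have "\<dots> \<le> G e" unfolding G_def using cle[OF s elim] by (intro mult_left_mono) (auto intro: prod_nonneg)
          finally show ?case .
        qed
      qed
      have "((\<lambda>e. sg s * (w e (p0 s) * ((\<Prod>i\<in>I. 1 - w e (p i s)) * c e s))) \<longlongrightarrow> sg s * (1 * 0)) (at_right 0)"
        by (intro tendsto_mult tendsto_const W B)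
      then show ?thesis by (simp add: mult.assoc)
    qed
    have "((\<lambda>e. \<Sum>s\<in>max_cones. sg s * (w e (p0 s) * (\<Prod>i\<in>I. 1 - w e (p i s)) * c e s)) \<longlongrightarrow> (\<Sum>s\<in>max_cones. 0)) (at_right 0)"
      by (intro tendsto_sum term0)
    moreover have "eventually (\<lambda>e. (\<Sum>s\<in>max_cones. sg s * (w e (p0 s) * (\<Prod>i\<in>I. 1 - w e (p i s)) * c e s)) = \<Delta> e) (at_right 0)"
      using eventually_at_right_less[of 0] by eventually_elim (simp add: \<Delta>)
    ultimately show ?thesis using Lim_transform_eventually by fastforce
  qed
  \<comment> \<open>The polytopes have finitely many lattice points, so the limit may be taken
    termwise and gives the unweighted count.\<close>
  have "(\<Delta> \<longlongrightarrow> (\<Sum>J\<in>Pow I. (-1) ^ card J * (\<Sum>m\<in>lat u (E J). 1))) (at_right 0)"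
  proof -
    have "((\<lambda>e. w e m) \<longlongrightarrow> 1) (at_right 0)" for m unfolding w_def by real_asymp
    then show ?thesis unfolding \<Delta>_def by (intro tendsto_sum tendsto_mult tendsto_const)
  qed
  then have "(\<Sum>J\<in>Pow I. (-1) ^ card J * (\<Sum>m\<in>lat u (E J). 1)) = (0::real)"
    using lim0 tendsto_unique[OF trivial_limit_at_right_real] by blast
  then show ?thesis by (simp add: E_def)
qed

end

section \<open>Cones and rays of the fan\<close>

definition rays :: "('r::finite \<Rightarrow> int ^ 'n::finite) \<Rightarrow> (real ^ 'n) set \<Rightarrow> 'r set" where
  "rays u \<sigma> = {j. of_lat (u j) \<in> \<sigma>}"

text \<open>The sum \<open>x + y\<close> is the midpoint of \<open>2 *\<^sub>R x\<close> and
  \<open>2 *\<^sub>R y\<close>, which lie in the cone, so the definition of a face applies to their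
  segment. For \<open>x = y\<close> the segment degenerates and scaling suffices.\<close>

lemma face_of_cone_addD:
  assumes F: "F face_of S" and S: "convex_cone S" and F0: "conic F" and xy: "x \<in> S" "y \<in> S" "x + y \<in> F"
  shows "x \<in> F"
proof -
  have half: "(1/2) *\<^sub>R z \<in> F" if "z \<in> F" for z using F0 that by (simp add: conic_def)
  show ?thesis
  proof (cases "x = y")
    case True
    then have "(1/2) *\<^sub>R (x + y) = x" by (simp add: scaleR_2[symmetric])
    then show ?thesis using half[OF xy(3)] by simp
  next
    case False
    have "2 *\<^sub>R x \<in> S" "2 *\<^sub>R y \<in> S" using xy S by (auto intro: convex_cone_scaleR)
    moreover have "x + y \<in> open_segment (2 *\<^sub>R x) (2 *\<^sub>R y)"
      unfolding in_segment using False by (auto intro!: exI[of _ "1/2"])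
    ultimately have "2 *\<^sub>R x \<in> F" using F xy(3) unfolding face_of_def by blast
    then show ?thesis using half[of "2 *\<^sub>R x"] by simp
  qed
qed

lemma convex_cone_hull_singleton: "convex_cone hull {b :: 'a::real_vector} = {t *\<^sub>R b | t. 0 \<le> t}"
proof -
  have "convex_cone hull ((\<lambda>x. x) ` {b}) = {y. \<exists>a. (\<forall>j. 0 \<le> a j) \<and> y = (\<Sum>j\<in>{b}. a j *\<^sub>R j)}"
    by (rule convex_cone_hull_image) simp
  also have "\<dots> = {t *\<^sub>R b | t. 0 \<le> t}"
  proof (intro equalityI subsetI)
    fix y assume "y \<in> {t *\<^sub>R b | t. 0 \<le> t}"
    then obtain t where t: "0 \<le> t" "y = t *\<^sub>R b" by blast
    then show "y \<in> {y. \<exists>a. (\<forall>j. 0 \<le> a j) \<and> y = (\<Sum>j\<in>{b}. a j *\<^sub>R j)}"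
      by (intro CollectI exI[of _ "\<lambda>_. t"]) simp
  qed auto
  finally show ?thesis by simp
qed

lemma convex_cone_hull_finite_eq:
  fixes B :: "'a::real_vector set"
  assumes "finite B"
  shows "convex_cone hull B = {y. \<exists>a. (\<forall>j. 0 \<le> a j) \<and> y = (\<Sum>b\<in>B. a b *\<^sub>R b)}"
  using convex_cone_hull_image[OF assms, of "\<lambda>x. x"] by simp

lemma independent_coeffs_eq:
  fixes B :: "'a::real_vector set"
  assumes "finite B" "independent B" "(\<Sum>b\<in>B. f b *\<^sub>R b) = (\<Sum>b\<in>B. g b *\<^sub>R b)" "b \<in> B"
  shows "f b = g b"
proof -
  have "(\<Sum>b\<in>B. (f b - g b) *\<^sub>R b) = 0"
    using assms(3) by (simp add: scaleR_left_diff_distrib sum_subtractf)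
  then show ?thesis using assms(2) independentD[OF assms(2,1) order_refl _ assms(4), of "\<lambda>b. f b - g b"] by simp
qed

text \<open>By independence, coefficients can be compared: if a proper convex combination has no
  component outside \<open>b\<close>, neither have its endpoints. This makes the generators of a
  simplicial cone span rays of the fan.\<close>

lemma simplicial_ray_face:
  fixes B :: "'a::real_vector set"
  assumes B: "finite B" "independent B" and b: "b \<in> B"
  shows "(convex_cone hull {b}) face_of (convex_cone hull B)"
  unfolding face_of_def
proof (intro conjI ballI impI)
  show "convex_cone hull {b} \<subseteq> convex_cone hull B" using b by (intro hull_mono) auto
  show "convex (convex_cone hull {b})" by (rule convex_convex_cone_hull)
next
  fix x y p
  assume x: "x \<in> convex_cone hull B" and y: "y \<in> convex_cone hull B"
    and p: "p \<in> convex_cone hull {b}" "p \<in> open_segment x y"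
  obtain f where f: "\<forall>j. 0 \<le> f j" "x = (\<Sum>b\<in>B. f b *\<^sub>R b)" using x by (auto simp: convex_cone_hull_finite_eq[OF B(1)])
  obtain g where g: "\<forall>j. 0 \<le> g j" "y = (\<Sum>b\<in>B. g b *\<^sub>R b)" using y by (auto simp: convex_cone_hull_finite_eq[OF B(1)])
  obtain t where t: "p = t *\<^sub>R b" using p by (auto simp: convex_cone_hull_singleton)
  obtain r where r: "0 < r" "r < 1" "p = (1 - r) *\<^sub>R x + r *\<^sub>R y" using p(2) by (auto simp: in_segment)
  have "(\<Sum>c\<in>B. ((1 - r) * f c + r * g c) *\<^sub>R c) = p"
    unfolding r f(2) g(2) by (simp add: scaleR_left_distrib sum.distrib scaleR_right.sum)
  also have "\<dots> = (\<Sum>c\<in>B. (if c = b then t else 0) *\<^sub>R c)"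
    unfolding t using b B(1) by (simp add: if_distrib[of "\<lambda>c. c *\<^sub>R _"] cong: if_cong)
  finally have "(1 - r) * f c + r * g c = (if c = b then t else 0)" if "c \<in> B" for c
    by (rule independent_coeffs_eq[OF B]) (use that in auto)
  then have "(1 - r) * f c + r * g c = 0" if "c \<in> B" "c \<noteq> b" for c using that by simp
  moreover have "(1 - r) * f c \<ge> 0" "r * g c \<ge> 0" for c using r f g by auto
  ultimately have "(1 - r) * f c = 0" "r * g c = 0" if "c \<in> B" "c \<noteq> b" for c
    using that by (metis add_nonneg_eq_0_iff)+
  then have z: "f c = 0" "g c = 0" if "c \<in> B" "c \<noteq> b" for c using that r by auto
  have "x = (\<Sum>c\<in>{b}. f c *\<^sub>R c)" unfolding f(2) using z b B(1) by (intro sum.mono_neutral_right) auto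
  moreover have "y = (\<Sum>c\<in>{b}. g c *\<^sub>R c)" unfolding g(2) using z b B(1) by (intro sum.mono_neutral_right) auto
  ultimately show "x \<in> convex_cone hull {b}" "y \<in> convex_cone hull {b}"
    using f(1) g(1) by (auto simp: convex_cone_hull_singleton)
qed

locale toric =
  fixes \<Sigma> :: "(real ^ 'n::finite) set set" and u :: "'r::finite \<Rightarrow> int ^ 'n"
  assumes fan: "fan \<Sigma>" and complete: "complete_fan \<Sigma>" and simplicial: "simplicial_fan \<Sigma>"
    and ray_gens: "ray_generators \<Sigma> u"
begin

lemma cone_convex: "\<sigma> \<in> \<Sigma> \<Longrightarrow> convex_cone \<sigma>"
  using fan unfolding fan_def rational_polyhedral_cone_def by (metis convex_cone_convex_cone_hull)

lemma zero_in_cone: "\<sigma> \<in> \<Sigma> \<Longrightarrow> 0 \<in> \<sigma>"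
  by (simp add: cone_convex convex_cone_contains_0)

lemma cone_Int: assumes "\<sigma> \<in> \<Sigma>" "\<tau> \<in> \<Sigma>" shows "\<sigma> \<inter> \<tau> \<in> \<Sigma>" "(\<sigma> \<inter> \<tau>) face_of \<sigma>" "(\<sigma> \<inter> \<tau>) face_of \<tau>"
proof -
  show 1: "(\<sigma> \<inter> \<tau>) face_of \<sigma>" "(\<sigma> \<inter> \<tau>) face_of \<tau>" using fan assms unfolding fan_def by blast+
  have "\<sigma> \<inter> \<tau> \<noteq> {}" using zero_in_cone assms by blast
  then show "\<sigma> \<inter> \<tau> \<in> \<Sigma>" using 1(1) fan assms unfolding fan_def by blast
qed

lemma cone_face: assumes "\<sigma> \<in> \<Sigma>" "\<tau> face_of \<sigma>" "\<tau> \<noteq> {}" shows "\<tau> \<in> \<Sigma>"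
proof -
  have "\<forall>\<sigma>\<in>\<Sigma>. \<forall>\<tau>. \<tau> face_of \<sigma> \<and> \<tau> \<noteq> {} \<longrightarrow> \<tau> \<in> \<Sigma>" using fan unfolding fan_def by blast
  then show ?thesis using assms by simp
qed

lemma ray_cone: "convex_cone hull {of_lat (u j)} \<in> \<Sigma>" "dim (convex_cone hull {of_lat (u j)}) = 1"
  using ray_gens unfolding ray_generators_def bij_betw_def by blast+

lemma u_nonzero: "of_lat (u j) \<noteq> (0 :: real ^ 'n)"
proof
  assume "of_lat (u j) = (0 :: real ^ 'n)"
  then have "convex_cone hull {of_lat (u j)} = {0 :: real ^ 'n}" by (simp add: convex_cone_hull_singleton) auto
  then show False using ray_cone(2)[of j] by simp
qed

lemma ray_inj:
  assumes "of_lat (u j) = c *\<^sub>R (b :: real ^ 'n)" "of_lat (u k) = d *\<^sub>R b" "c > 0" "d > 0" shows "j = k"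
proof -
  have eq: "convex_cone hull {c *\<^sub>R b} = convex_cone hull {b}" if "c > 0" for c
    unfolding convex_cone_hull_singleton
  proof (intro equalityI subsetI)
    fix y assume "y \<in> {t *\<^sub>R b | t. 0 \<le> t}"
    then obtain t where "0 \<le> t" "y = t *\<^sub>R b" by blast
    then show "y \<in> {t *\<^sub>R c *\<^sub>R b | t. 0 \<le> t}" using that by (intro CollectI exI[of _ "t / c"]) auto
  next
    fix y assume "y \<in> {t *\<^sub>R c *\<^sub>R b | t. 0 \<le> t}"
    then obtain t where "0 \<le> t" "y = t *\<^sub>R c *\<^sub>R b" by blast
    then show "y \<in> {t *\<^sub>R b | t. 0 \<le> t}" using that by (intro CollectI exI[of _ "t * c"]) auto
  qed
  have "convex_cone hull {of_lat (u j) :: real ^ 'n} = convex_cone hull {of_lat (u k)}"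
    using eq[OF assms(3)] eq[OF assms(4)] assms(1,2) by simp
  then show ?thesis using ray_gens unfolding ray_generators_def bij_betw_def inj_on_def by blast
qed

text \<open>Simpliciality provides some independent generating set \<open>B\<close>, which has to be
  matched with the rays of the fan. Each element of \<open>B\<close> spans a one-dimensional face,
  hence a ray of the fan; conversely a ray inside the cone is a face and therefore spanned by an
  element of \<open>B\<close>. Independence passes to the \<open>u j\<close> because they are
  positive multiples of distinct elements of \<open>B\<close>.\<close>

lemma cone_generated:
  assumes s: "\<sigma> \<in> \<Sigma>"
  shows "\<sigma> = convex_cone hull ((\<lambda>j. of_lat (u j)) ` rays u \<sigma>)"
    and "(\<Sum>j\<in>rays u \<sigma>. a j *\<^sub>R of_lat (u j)) = (0 :: real ^ 'n) \<Longrightarrow> j \<in> rays u \<sigma> \<Longrightarrow> a j = 0"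
proof -
  obtain B where B: "finite B" "independent B" "\<sigma> = convex_cone hull B"
    using simplicial s unfolding simplicial_fan_def by blast
  have Bs: "B \<subseteq> \<sigma>" unfolding B(3) by (rule hull_subset)
  have b_u: "\<exists>j\<in>rays u \<sigma>. \<exists>c\<ge>0. b = c *\<^sub>R of_lat (u j)" if b: "b \<in> B" for b
  proof -
    have b0: "b \<noteq> 0" using B(2) b dependent_zero by blast
    have face: "(convex_cone hull {b}) face_of \<sigma>" unfolding B(3) by (rule simplicial_ray_face[OF B(1,2) b])
    have "convex_cone hull {b} \<in> \<Sigma>" by (rule cone_face[OF s face convex_cone_hull_nonempty])
    moreover have "dim (convex_cone hull {b}) = 1"
    proof -
      have "{b} \<subseteq> convex_cone hull {b}" by (rule hull_subset)
      moreover have "convex_cone hull {b} \<subseteq> span {b}"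
        by (auto simp: convex_cone_hull_singleton span_singleton)
      ultimately have "dim (convex_cone hull {b}) = dim {b}"
        by (metis dim_span dim_subset le_antisym)
      also have "dim {b} = 1" using b0 by (simp add: dim_eq_card_independent)
      finally show ?thesis .
    qed
    ultimately obtain j where j: "convex_cone hull {b} = convex_cone hull {of_lat (u j)}"
      using ray_gens unfolding ray_generators_def bij_betw_def by blast
    then have "of_lat (u j) \<in> convex_cone hull {b}" by (simp add: hull_inc)
    then have "j \<in> rays u \<sigma>" using face by (auto simp: rays_def dest: face_of_imp_subset)
    moreover have "b \<in> convex_cone hull {of_lat (u j)}" using j by (metis hull_inc singletonI)
    ultimately show ?thesis by (auto simp: convex_cone_hull_singleton)
  qed
  have "convex_cone hull ((\<lambda>j. of_lat (u j)) ` rays u \<sigma>) \<subseteq> \<sigma>"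
    by (rule hull_minimal) (auto simp: rays_def cone_convex s)
  moreover have "\<sigma> \<subseteq> convex_cone hull ((\<lambda>j. of_lat (u j)) ` rays u \<sigma>)"
  proof -
    have "B \<subseteq> convex_cone hull ((\<lambda>j. of_lat (u j)) ` rays u \<sigma>)"
    proof
      fix b assume "b \<in> B"
      then obtain j c where "j \<in> rays u \<sigma>" "c \<ge> 0" "b = c *\<^sub>R of_lat (u j)" using b_u by blast
      then show "b \<in> convex_cone hull ((\<lambda>j. of_lat (u j)) ` rays u \<sigma>)"
        by (simp add: convex_cone_hull_mul hull_inc)
    qed
    then show ?thesis unfolding B(3) by (intro hull_minimal) (auto simp: convex_cone_convex_cone_hull B(3))
  qed
  ultimately show "\<sigma> = convex_cone hull ((\<lambda>j. of_lat (u j)) ` rays u \<sigma>)" by blast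
  have u_b: "\<exists>b\<in>B. \<exists>c>0. of_lat (u j) = c *\<^sub>R b" if j: "j \<in> rays u \<sigma>" for j
  proof -
    let ?\<rho> = "convex_cone hull {of_lat (u j) :: real ^ 'n}"
    have uj: "of_lat (u j) \<in> \<sigma>" using j by (simp add: rays_def)
    then have sub: "?\<rho> \<subseteq> \<sigma>" by (intro hull_minimal) (auto simp: cone_convex s)
    \<comment> \<open>The fan axiom on intersections makes a ray contained in the cone one of its
      faces; the face property then isolates a single summand
      \<open>f b *\<^sub>R b\<close>.\<close>
    have "(?\<rho> \<inter> \<sigma>) face_of \<sigma>" using cone_Int(3)[OF ray_cone(1) s] .
    then have face: "?\<rho> face_of \<sigma>" using sub by (simp add: Int_absorb2)
    obtain f where f: "\<forall>b. 0 \<le> f b" "of_lat (u j) = (\<Sum>b\<in>B. f b *\<^sub>R b)"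
      using uj unfolding B(3) convex_cone_hull_finite_eq[OF B(1)] by blast
    have "\<exists>b\<in>B. f b \<noteq> 0"
    proof (rule ccontr)
      assume "\<not> ?thesis"
      then have "of_lat (u j) = (0 :: real ^ 'n)" unfolding f(2) by (intro sum.neutral) simp
      then show False using u_nonzero by blast
    qed
    then obtain b where b: "b \<in> B" "f b > 0" using f(1) by (metis less_eq_real_def)
    have "f b *\<^sub>R b \<in> ?\<rho>"
    proof (rule face_of_cone_addD[OF face cone_convex[OF s] conic_convex_cone_hull])
      show "f b *\<^sub>R b \<in> \<sigma>" using b Bs cone_convex[OF s] by (intro convex_cone_scaleR) auto
      show "(\<Sum>b\<in>B-{b}. f b *\<^sub>R b) \<in> \<sigma>"
        unfolding B(3) convex_cone_hull_finite_eq[OF B(1)]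
        using f(1) B(1) by (intro CollectI exI[of _ "\<lambda>c. if c = b then 0 else f c"] conjI sum.mono_neutral_cong_left) auto
      show "f b *\<^sub>R b + (\<Sum>b\<in>B-{b}. f b *\<^sub>R b) \<in> ?\<rho>"
        using sum.remove[OF B(1) b(1), of "\<lambda>b. f b *\<^sub>R b"] f(2) hull_inc[of "of_lat (u j)" "{of_lat (u j)}"] by simp
    qed
    then obtain t where t: "0 \<le> t" "f b *\<^sub>R b = t *\<^sub>R of_lat (u j)" by (auto simp: convex_cone_hull_singleton)
    have "b \<noteq> 0" using B(2) b dependent_zero by blast
    then have "t \<noteq> 0" using t b by auto
    then have "of_lat (u j) = (f b / t) *\<^sub>R b" using t(2) by (simp add: divide_inverse) (metis scaleR_scaleR inverse_nonzero_iff_nonzero left_inverse mult.commute scaleR_one)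
    moreover have "f b / t > 0" using t \<open>t \<noteq> 0\<close> b by simp
    ultimately show ?thesis using b by blast
  qed
  then obtain bb cc where bc: "\<And>j. j \<in> rays u \<sigma> \<Longrightarrow> bb j \<in> B \<and> cc j > (0::real) \<and> of_lat (u j) = cc j *\<^sub>R bb j" by metis
  have inj: "inj_on bb (rays u \<sigma>)"
    using bc ray_inj by (intro inj_onI) metis
  assume 0: "(\<Sum>j\<in>rays u \<sigma>. a j *\<^sub>R of_lat (u j)) = (0 :: real ^ 'n)" and j: "j \<in> rays u \<sigma>"
  have "(\<Sum>b\<in>bb ` rays u \<sigma>. (a (inv_into (rays u \<sigma>) bb b) * cc (inv_into (rays u \<sigma>) bb b)) *\<^sub>R b) =
     (\<Sum>j\<in>rays u \<sigma>. a j *\<^sub>R of_lat (u j))"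
    unfolding sum.reindex[OF inj] o_def by (intro sum.cong) (auto simp: inj bc)
  then have s0: "(\<Sum>b\<in>bb ` rays u \<sigma>. (a (inv_into (rays u \<sigma>) bb b) * cc (inv_into (rays u \<sigma>) bb b)) *\<^sub>R b) = 0"
    using 0 by simp
  have "a (inv_into (rays u \<sigma>) bb (bb j)) * cc (inv_into (rays u \<sigma>) bb (bb j)) = 0"
    by (rule independentD[OF B(2) _ _ s0]) (use bc j in auto)
  then show "a j = 0" using inj j bc[OF j] by simp
qed

lemma chart_iff:
  assumes "\<sigma> \<in> \<Sigma>"
  shows "f \<in> chart \<sigma> \<longleftrightarrow> (\<forall>m\<in>Poly_Mapping.keys f. \<forall>j\<in>rays u \<sigma>. 0 \<le> char_div u m $ j)"
proof -
  have "(\<forall>v\<in>\<sigma>. 0 \<le> of_lat m \<bullet> v) \<longleftrightarrow> (\<forall>j\<in>rays u \<sigma>. 0 \<le> char_div u m $ j)" for m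
  proof
    assume L: "\<forall>v\<in>\<sigma>. 0 \<le> of_lat m \<bullet> v"
    show "\<forall>j\<in>rays u \<sigma>. 0 \<le> char_div u m $ j"
      using L by (auto simp: rays_def inner_of_lat dest!: bspec)
  next
    assume R: "\<forall>j\<in>rays u \<sigma>. 0 \<le> char_div u m $ j"
    show "\<forall>v\<in>\<sigma>. 0 \<le> of_lat m \<bullet> v"
    proof
      fix v assume "v \<in> \<sigma>"
      then obtain a where a: "\<forall>j. 0 \<le> a j" "v = (\<Sum>j\<in>rays u \<sigma>. a j *\<^sub>R of_lat (u j))"
        using cone_generated(1)[OF assms] by (auto simp: convex_cone_hull_image)
      show "0 \<le> of_lat m \<bullet> v"
        unfolding a(2) inner_sum_right using R a(1) by (intro sum_nonneg) (simp add: inner_of_lat)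
    qed
  qed
  then show ?thesis by (simp add: chart_def)
qed

lemma every_ray: "\<exists>\<sigma>\<in>\<Sigma>. j \<in> rays u \<sigma>"
  using ray_cone(1)[of j] by (intro bexI) (auto simp: rays_def hull_inc)

lemma rays_Int: "rays u (\<sigma> \<inter> \<tau>) = rays u \<sigma> \<inter> rays u \<tau>"
  by (auto simp: rays_def)

sublocale lattice_fan u "rays u ` \<Sigma>"
proof
  show "a j = 0" if "s \<in> rays u ` \<Sigma>" "(\<Sum>j\<in>s. a j *\<^sub>R of_lat (u j)) = (0 :: real ^ 'n)" "j \<in> s" for s a j
    using that cone_generated(2) by blast
next
  fix x :: "real ^ 'n"
  obtain \<sigma> where s: "\<sigma> \<in> \<Sigma>" "x \<in> \<sigma>" using complete unfolding complete_fan_def by blast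
  then obtain a where "\<forall>j. 0 \<le> a j" "x = (\<Sum>j\<in>rays u \<sigma>. a j *\<^sub>R of_lat (u j))"
    using cone_generated(1)[OF s(1)] by (auto simp: convex_cone_hull_image)
  then show "\<exists>s\<in>rays u ` \<Sigma>. \<exists>a. (\<forall>j. 0 \<le> a j) \<and> x = (\<Sum>j\<in>s. a j *\<^sub>R of_lat (u j))" using s by blast
next
  fix s t a b j
  assume st: "s \<in> rays u ` \<Sigma>" "t \<in> rays u ` \<Sigma>" and a: "\<forall>j. 0 \<le> a j" and b: "\<forall>j. 0 \<le> b j"
    and eq: "(\<Sum>j\<in>s. a j *\<^sub>R of_lat (u j)) = (\<Sum>j\<in>t. b j *\<^sub>R of_lat (u j) :: real ^ 'n)" and j: "j \<in> s" "0 < a j"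
  obtain \<sigma> \<tau> where \<sigma>: "\<sigma> \<in> \<Sigma>" "s = rays u \<sigma>" and \<tau>: "\<tau> \<in> \<Sigma>" "t = rays u \<tau>" using st by blast
  have in_cone: "(\<Sum>j\<in>s'. c j *\<^sub>R of_lat (u j)) \<in> \<sigma>" if "\<sigma> \<in> \<Sigma>" "s' \<subseteq> rays u \<sigma>" "\<forall>j. 0 \<le> c j" for s' \<sigma> c
  proof -
    have "(\<Sum>j\<in>s'. c j *\<^sub>R of_lat (u j)) = (\<Sum>j\<in>rays u \<sigma>. (if j \<in> s' then c j else 0) *\<^sub>R of_lat (u j))"
      using that by (intro sum.mono_neutral_cong_left) auto
    then show ?thesis
      using that by (subst cone_generated(1)[OF that(1)])
        (auto simp: convex_cone_hull_image intro!: exI[of _ "\<lambda>j. if j \<in> s' then c j else 0"])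
  qed
  \<comment> \<open>The common point lies in the face \<open>\<sigma> \<inter> \<tau>\<close> of
    \<open>\<sigma>\<close>, and a face contains the summands of its points; so the ray of
    \<open>j\<close> lies in \<open>\<tau>\<close>.\<close>
  have "a j *\<^sub>R of_lat (u j) \<in> \<sigma> \<inter> \<tau>"
  proof (rule face_of_cone_addD[OF cone_Int(2)[OF \<sigma>(1) \<tau>(1)] cone_convex[OF \<sigma>(1)]])
    show "conic (\<sigma> \<inter> \<tau>)" using cone_convex[OF cone_Int(1)[OF \<sigma>(1) \<tau>(1)]] by (simp add: convex_cone_def)
    show "a j *\<^sub>R of_lat (u j) \<in> \<sigma>" using in_cone[OF \<sigma>(1), of "{j}" a] j \<sigma> a by simp
    show "(\<Sum>j\<in>s-{j}. a j *\<^sub>R of_lat (u j)) \<in> \<sigma>" using in_cone[OF \<sigma>(1), of "s-{j}" a] \<sigma> a by auto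
    have "(\<Sum>j\<in>s. a j *\<^sub>R of_lat (u j)) \<in> \<sigma> \<inter> \<tau>"
      using in_cone[OF \<sigma>(1), of s a] in_cone[OF \<tau>(1), of t b] eq a b \<sigma> \<tau> by auto
    then show "a j *\<^sub>R of_lat (u j) + (\<Sum>j\<in>s-{j}. a j *\<^sub>R of_lat (u j)) \<in> \<sigma> \<inter> \<tau>"
      using sum.remove[OF finite j(1), of "\<lambda>j. a j *\<^sub>R of_lat (u j) :: real ^ 'n"] by simp
  qed
  then have "a j *\<^sub>R of_lat (u j) \<in> \<tau>" by blast
  from convex_cone_scaleR[OF cone_convex[OF \<tau>(1)] _ this, of "1 / a j"]
  show "j \<in> t" using j by (simp add: \<tau> rays_def)
qed

text \<open>Global generation expresses the local generator of \<open>O(D)\<close> over the chart,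
  which has exponent \<open>- q\<close>, through global sections. Comparing exponents gives a global
  lattice point \<open>m\<close> that is at most \<open>- q\<close> on the rays of
  \<open>\<sigma>\<close>; the inequalities of \<open>lat\<close> force equality there, so
  \<open>m\<close> is the vertex.\<close>

lemma semi_ample_nef:
  assumes "semi_ample TYPE('k::field) \<Sigma> u \<alpha>"
  obtains D p where "cartier \<Sigma> u D" "\<alpha> = div_class u D" "nef_vertices D p"
proof -
  obtain D where D: "cartier \<Sigma> u D" "globally_generated TYPE('k) \<Sigma> u D" "\<alpha> = div_class u D"
    using assms by (auto simp: semi_ample_def)
  have "\<exists>m. m \<in> lat u D \<and> (\<forall>j\<in>s. char_div u m $ j + D $ j = 0)" if s: "s \<in> max_cones" for s
  proof -
    obtain \<sigma> where \<sigma>: "\<sigma> \<in> \<Sigma>" "s = rays u \<sigma>" using s by (auto simp: max_cones_def)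
    obtain q where q: "\<And>j. j \<in> s \<Longrightarrow> char_div u q $ j = D $ j"
      using D(1) \<sigma> unfolding cartier_def rays_def by blast
    \<comment> \<open>A submodule that keeps only what exponents tell about being generated by
      global sections. It contains the global sections, so global generation puts all sections over
      \<open>\<sigma>\<close> into it.\<close>
    define M where "M = {f :: (int ^ 'n) \<Rightarrow>\<^sub>0 'k. \<forall>k\<in>Poly_Mapping.keys f. \<exists>m\<in>lat u D. \<forall>j\<in>s. 0 \<le> char_div u (k - m) $ j}"
    have "submodule_over (chart \<sigma>) M"
      unfolding submodule_over_def
    proof (intro conjI ballI)
      show "0 \<in> M" by (simp add: M_def)
      show "x + y \<in> M" if "x \<in> M" "y \<in> M" for x y
        using that Poly_Mapping.keys_add[of x y] unfolding M_def by blast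
      show "a * x \<in> M" if ax: "a \<in> chart \<sigma>" "x \<in> M" for a x
        unfolding M_def
      proof (intro CollectI ballI)
        fix k assume "k \<in> Poly_Mapping.keys (a * x)"
        then obtain b c where bc: "b \<in> Poly_Mapping.keys a" "c \<in> Poly_Mapping.keys x" "k = b + c"
          using keys_mult[of a x] by blast
        then obtain m where m: "m \<in> lat u D" "\<forall>j\<in>s. 0 \<le> char_div u (c - m) $ j" using ax(2) by (auto simp: M_def)
        have "0 \<le> char_div u (k - m) $ j" if j: "j \<in> s" for j
        proof -
          have "0 \<le> char_div u b $ j" using ax(1) bc(1) j \<sigma> chart_iff[OF \<sigma>(1)] by blast
          moreover have "k - m = b + (c - m)" using bc by simp
          moreover have "0 \<le> char_div u (c - m) $ j" using m(2) j by blast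
          ultimately show ?thesis by (simp only: char_div_add vector_add_component add_nonneg_nonneg)
        qed
        then show "\<exists>m\<in>lat u D. \<forall>j\<in>s. 0 \<le> char_div u (k - m) $ j" using m(1) by blast
      qed
    qed
    moreover have "(\<Inter>\<tau>\<in>\<Sigma>. sections u D \<tau>) \<subseteq> M"
    proof
      fix f :: "(int ^ 'n) \<Rightarrow>\<^sub>0 'k" assume f: "f \<in> (\<Inter>\<tau>\<in>\<Sigma>. sections u D \<tau>)"
      have "k \<in> lat u D" if k: "k \<in> Poly_Mapping.keys f" for k
        unfolding lat_def
      proof (intro CollectI allI)
        fix j
        obtain \<tau> where "\<tau> \<in> \<Sigma>" "j \<in> rays u \<tau>" using every_ray by blast
        then show "0 \<le> char_div u k $ j + D $ j" using f k by (auto simp: sections_def rays_def)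
      qed
      then show "f \<in> M" unfolding M_def by (auto intro!: bexI)
    qed
    ultimately have "submodule_over (chart \<sigma>) hull (\<Inter>\<tau>\<in>\<Sigma>. sections u D \<tau>) \<subseteq> M" by (intro hull_minimal)
    then have "sections u D \<sigma> \<subseteq> M" using D(2) \<sigma>(1) unfolding globally_generated_def by blast
    moreover have "Poly_Mapping.single (- q) (1::'k) \<in> sections u D \<sigma>"
    proof -
      have "char_div u (- q) $ j = - (D $ j)" if "j \<in> s" for j
        using q[OF that] char_div_diff[of u 0 q] by simp
      then show ?thesis using \<sigma> by (auto simp: sections_def rays_def)
    qed
    ultimately have "Poly_Mapping.single (- q) (1::'k) \<in> M" by blast
    then obtain m where m: "m \<in> lat u D" "\<forall>j\<in>s. 0 \<le> char_div u (- q - m) $ j" by (auto simp: M_def)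
    have "char_div u m $ j + D $ j = 0" if j: "j \<in> s" for j
    proof -
      have "char_div u (- q - m) $ j = - char_div u q $ j - char_div u m $ j"
        using char_div_diff[of u 0 q] by (simp add: char_div_diff)
      moreover have "0 \<le> char_div u (- q - m) $ j" using m(2) j by blast
      ultimately have "0 \<le> - (D $ j) - char_div u m $ j" using q[OF j] by simp
      moreover have "0 \<le> char_div u m $ j + D $ j" using m(1) by (simp add: lat_def)
      ultimately show ?thesis by linarith
    qed
    then show ?thesis using m(1) by blast
  qed
  then have "\<exists>p. \<forall>s\<in>max_cones. p s \<in> lat u D \<and> (\<forall>j\<in>s. char_div u (p s) $ j + D $ j = 0)" by (intro bchoice) blast
  then obtain p where "nef_vertices D p" unfolding nef_vertices_def by blast
  then show thesis using that D by blast
qed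

end

section \<open>Dimensions of quotients\<close>

locale quotient_space = vector_space scale
  for scale :: "'a::field \<Rightarrow> 'b::ab_group_add \<Rightarrow> 'b"
begin

definition indep_mod :: "'b set \<Rightarrow> 'b set \<Rightarrow> bool" where
  "indep_mod W B \<longleftrightarrow> finite B \<and> (\<forall>c. (\<Sum>b\<in>B. scale (c b) b) \<in> W \<longrightarrow> (\<forall>b\<in>B. c b = 0))"

lemma quotient_dim_le: 
  assumes "\<And>B. B \<subseteq> V \<Longrightarrow> indep_mod W B \<Longrightarrow> enat (card B) \<le> d"
  shows "quotient_dim scale V W \<le> d"
  unfolding quotient_dim_def using assms by (intro SUP_least) (auto simp: indep_mod_def)

lemma quotient_dim_ge: 
  assumes "B \<subseteq> V" "indep_mod W B"
  shows "enat (card B) \<le> quotient_dim scale V W"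
  unfolding quotient_dim_def using assms by (intro SUP_upper) (auto simp: indep_mod_def)

text \<open>A nonempty set of extended naturals with a finite supremum is finite and attains
  it.\<close>

lemma quotient_dim_attained:
  assumes "quotient_dim scale V W = enat d"
  obtains B where "B \<subseteq> V" "indep_mod W B" "card B = d"
proof -
  define S where "S = {B. finite B \<and> B \<subseteq> V \<and> (\<forall>c. (\<Sum>b\<in>B. scale (c b) b) \<in> W \<longrightarrow> (\<forall>b\<in>B. c b = 0))}"
  define T where "T = (\<lambda>B. enat (card B)) ` S"
  have "{} \<in> S" by (simp add: S_def)
  then have ne: "T \<noteq> {}" unfolding T_def by blast
  have sup: "Sup T = enat d" using assms unfolding quotient_dim_def T_def S_def .
  then have "finite T" using ne by (auto simp: Sup_enat_def split: if_splits)
  then have "enat d \<in> T" using ne Max_in[of T] sup unfolding Sup_enat_def by (metis (full_types))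
  then obtain B where "B \<in> S" "card B = d" unfolding T_def by auto
  then show ?thesis using that by (auto simp: S_def indep_mod_def)
qed

lemma indep_modD:
  "indep_mod W B \<Longrightarrow> (\<Sum>b\<in>B. scale (c b) b) \<in> W \<Longrightarrow> b \<in> B \<Longrightarrow> c b = 0"
  unfolding indep_mod_def by blast

lemma indep_mod_insert:
  assumes W: "subspace W" and B: "indep_mod W B" and v: "\<And>c. v - (\<Sum>b\<in>B. scale (c b) b) \<notin> W"
  shows "v \<notin> B" "indep_mod W (insert v B)"
proof -
  have fin: "finite B" using B by (simp add: indep_mod_def)
  show vB: "v \<notin> B"
  proof
    assume "v \<in> B"
    have "v - (\<Sum>b\<in>B. scale (if b = v then 1 else 0) b) = 0"
      using \<open>v \<in> B\<close> fin by (simp add: if_distrib[of "\<lambda>c. scale c _"] cong: if_cong)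
    then show False using v[of "\<lambda>b. if b = v then 1 else 0"] W subspace_0 by metis
  qed
  show "indep_mod W (insert v B)"
    unfolding indep_mod_def
  proof (intro conjI allI impI)
    show "finite (insert v B)" using fin by simp
    fix c assume "(\<Sum>b\<in>insert v B. scale (c b) b) \<in> W"
    then have s: "scale (c v) v + (\<Sum>b\<in>B. scale (c b) b) \<in> W" using fin vB by simp
    have cv: "c v = 0"
    proof (rule ccontr)
      assume nz: "c v \<noteq> 0"
      have "scale (inverse (c v)) (scale (c v) v + (\<Sum>b\<in>B. scale (c b) b)) \<in> W"
        using s W by (rule subspace_scale[rotated])
      also have "scale (inverse (c v)) (scale (c v) v + (\<Sum>b\<in>B. scale (c b) b))
          = v - (\<Sum>b\<in>B. scale (- inverse (c v) * c b) b)"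
        using nz by (simp add: scale_right_distrib scale_sum_right sum_negf)
      finally show False using v[of "\<lambda>b. - inverse (c v) * c b"] by simp
    qed
    then have "(\<Sum>b\<in>B. scale (c b) b) \<in> W" using s by simp
    then have "\<forall>b\<in>B. c b = 0" using indep_modD[OF B, of c] by blast
    then show "\<forall>b\<in>insert v B. c b = 0" using cv by simp
  qed
qed

lemma quotient_dim_spanning:
  assumes W: "subspace W" and d: "quotient_dim scale V W = enat (card B)" and B: "B \<subseteq> V" "indep_mod W B"
    and v: "v \<in> V"
  obtains c where "v - (\<Sum>b\<in>B. scale (c b) b) \<in> W"
proof (rule ccontr)
  assume "\<not> thesis"
  then have "\<And>c. v - (\<Sum>b\<in>B. scale (c b) b) \<notin> W" using that by blast
  from indep_mod_insert[OF W B(2) this] have "v \<notin> B" "indep_mod W (insert v B)" by auto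
  then have "enat (card (insert v B)) \<le> enat (card B)"
    using quotient_dim_ge[of "insert v B" V W] B v d by simp
  then show False using \<open>v \<notin> B\<close> B by (simp add: indep_mod_def)
qed

lemma indep_mod_inj:
  assumes "indep_mod W B" "a \<in> B" "b \<in> B" "a \<noteq> b" shows "a - b \<notin> W"
proof
  assume ab: "a - b \<in> W"
  let ?c = "\<lambda>x. if x = a then 1 else if x = b then -1 else 0"
  have "(\<Sum>x\<in>B. scale (?c x) x) = (\<Sum>x\<in>{a,b}. scale (?c x) x)"
    using assms by (intro sum.mono_neutral_right) (auto simp: indep_mod_def)
  also have "\<dots> = a - b" using assms(4) by simp
  finally have "(\<Sum>x\<in>B. scale (?c x) x) \<in> W" using ab by simp
  from indep_modD[OF assms(1) this assms(2)] show False by simp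
qed

text \<open>A basis of \<open>W\<close> is extended to one of \<open>V\<close>. The added vectors
  are independent modulo \<open>W\<close>, and conversely a set that is independent modulo
  \<open>W\<close> stays independent together with the basis of \<open>W\<close>. The finite set
  \<open>T\<close> bounds \<open>V\<close>, as the ambient polynomial space is
  infinite-dimensional.\<close>

lemma quotient_dim_subspaces:
  assumes T: "finite T" "V \<subseteq> span T" and V: "subspace V" and W: "subspace W" "W \<subseteq> V"
  shows "quotient_dim scale V W = enat (dim V - dim W)" "dim W \<le> dim V"
proof -
  obtain C where C: "C \<subseteq> W" "independent C" "W \<subseteq> span C" "card C = dim W"
    using basis_exists by blast
  have CV: "C \<subseteq> V" using C W by blast
  obtain B where B: "C \<subseteq> B" "B \<subseteq> V" "independent B" "V \<subseteq> span B"
    using maximal_independent_subset_extend[OF CV C(2)] by blast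
  have finB: "finite B" using independent_span_bound[OF T(1) B(3)] B(2) T(2) by blast
  have finC: "finite C" using finB B(1) finite_subset by blast
  have dB: "dim V = card B" using basis_card_eq_dim[OF B(2,4,3)] by simp
  then show le: "dim W \<le> dim V" using C(4) card_mono[OF finB B(1)] by simp
  have spC: "span C = W" using C W by (metis span_subspace)
  show "quotient_dim scale V W = enat (dim V - dim W)"
  proof (rule antisym)
    have "indep_mod W (B - C)"
      unfolding indep_mod_def
    proof (intro conjI allI impI)
      show "finite (B - C)" using finB by simp
      fix c assume "(\<Sum>b\<in>B-C. scale (c b) b) \<in> W"
      then obtain d where d: "(\<Sum>b\<in>B-C. scale (c b) b) = (\<Sum>b\<in>C. scale (d b) b)"
        using spC span_finite[OF finC] by auto
      let ?e = "\<lambda>b. if b \<in> C then - d b else c b"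
      have "(\<Sum>b\<in>B. scale (?e b) b) = (\<Sum>b\<in>B-C. scale (?e b) b) + (\<Sum>b\<in>C. scale (?e b) b)"
        by (rule sum.subset_diff[OF B(1) finB])
      also have "\<dots> = (\<Sum>b\<in>B-C. scale (c b) b) - (\<Sum>b\<in>C. scale (d b) b)"
        by (simp add: sum_negf)
      finally have z: "(\<Sum>b\<in>B. scale (?e b) b) = 0" using d by simp
      have "?e b = 0" if "b \<in> B" for b
        using independentD[OF B(3) finB order_refl z that] .
      then show "\<forall>b\<in>B-C. c b = 0" by (metis DiffD1 DiffD2)
    qed
    then have "enat (card (B - C)) \<le> quotient_dim scale V W" using B(2) by (intro quotient_dim_ge) auto
    then show "enat (dim V - dim W) \<le> quotient_dim scale V W"
      using card_Diff_subset[OF finC B(1)] dB C(4) by simp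
    show "quotient_dim scale V W \<le> enat (dim V - dim W)"
    proof (rule quotient_dim_le)
      fix A assume A: "A \<subseteq> V" "indep_mod W A"
      have finA: "finite A" using A by (simp add: indep_mod_def)
      have ind: "(\<Sum>b\<in>A. scale (c b) b) \<in> W \<Longrightarrow> \<forall>b\<in>A. c b = 0" for c using indep_modD[OF A(2), of c] by blast
      have dis: "A \<inter> C = {}"
      proof (rule ccontr)
        assume "A \<inter> C \<noteq> {}" then obtain a where a: "a \<in> A" "a \<in> C" by blast
        have "(\<Sum>b\<in>A. scale (if b = a then 1 else 0) b) = a"
          using a finA by (simp add: if_distrib[of "\<lambda>c. scale c _"] cong: if_cong)
        then have "(\<Sum>b\<in>A. scale (if b = a then 1 else 0) b) \<in> W" using a C by auto
        from indep_modD[OF A(2) this a(1)] show False by simp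
      qed
      have "independent (A \<union> C)"
        unfolding independent_explicit_module
      proof (intro allI impI)
        fix t u v assume t: "finite t" "t \<subseteq> A \<union> C" "(\<Sum>v\<in>t. scale (u v) v) = 0" "v \<in> t"
        let ?u = "\<lambda>v. if v \<in> t then u v else 0"
        have "(\<Sum>v\<in>A. scale (?u v) v) + (\<Sum>v\<in>C. scale (?u v) v) = (\<Sum>v\<in>A \<union> C. scale (?u v) v)"
          by (rule sum.union_disjoint[OF finA finC dis, symmetric])
        also have "\<dots> = (\<Sum>v\<in>t. scale (u v) v)"
          using finA finC t(2) by (intro sum.mono_neutral_cong_right) auto
        finally have eq: "(\<Sum>v\<in>A. scale (?u v) v) = - (\<Sum>v\<in>C. scale (?u v) v)"
          using t(3) by (simp add: eq_neg_iff_add_eq_0)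
        have "(\<Sum>v\<in>C. scale (?u v) v) \<in> W" using C(1) W(1) by (intro subspace_sum subspace_scale) auto
        then have "(\<Sum>v\<in>A. scale (?u v) v) \<in> W" unfolding eq using W(1) by (rule subspace_neg[rotated])
        then have uA: "\<forall>v\<in>A. ?u v = 0" by (rule ind)
        then have "(\<Sum>v\<in>C. scale (?u v) v) = 0" using eq by simp
        from independentD[OF C(2) finC order_refl this] have "\<forall>v\<in>C. ?u v = 0" by blast
        then have "?u v = 0" using uA t(2,4) by blast
        then show "u v = 0" using t(4) by simp
      qed
      moreover have "A \<union> C \<subseteq> span B" using A B CV by blast
      ultimately have "card (A \<union> C) \<le> card B" using independent_span_bound[OF finB] by blast
      then have "card A + card C \<le> card B" using card_Un_disjoint[OF finA finC dis] by simp
      then show "enat (card A) \<le> enat (dim V - dim W)" using dB C(4) by simp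
    qed
  qed
qed

end

text \<open>The last assumption is injectivity of the induced map on quotients. The uses are
  multiplication by a nonzerodivisor and division by \<open>g\<close> into families of local
  functions.\<close>

locale quotient_map = v1: quotient_space s1 + v2: quotient_space s2
  for s1 :: "'k::field \<Rightarrow> 'a::ab_group_add \<Rightarrow> 'a" and s2 :: "'k \<Rightarrow> 'b::ab_group_add \<Rightarrow> 'b" +
  fixes f :: "'a \<Rightarrow> 'b" and V W V' W'
  assumes f_add: "f (x + y) = f x + f y" and f_scale: "f (s1 c x) = s2 c (f x)"
    and V: "v1.subspace V" and W: "v1.subspace W" and V': "v2.subspace V'" and W': "v2.subspace W'"
    and f_V: "x \<in> V \<Longrightarrow> f x \<in> V'"
    and f_inj: "x \<in> V \<Longrightarrow> f x \<in> W' \<Longrightarrow> x \<in> W"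
begin

lemma f_0: "f 0 = 0" using f_add[of 0 0] by simp

lemma f_sum: "f (sum g A) = (\<Sum>x\<in>A. f (g x))"
  by (induction A rule: infinite_finite_induct) (auto simp: f_0 f_add)

lemma f_diff: "f (x - y) = f x - f y"
  using f_add[of "x - y" y] by simp

lemma image_indep_mod:
  assumes "B \<subseteq> V" "v1.indep_mod W B"
  shows "f ` B \<subseteq> V'" "v2.indep_mod W' (f ` B)" "card (f ` B) = card B"
proof -
  show "f ` B \<subseteq> V'" using assms f_V by blast
  have inj: "inj_on f B"
  proof (rule inj_onI, rule ccontr)
    fix a b assume ab: "a \<in> B" "b \<in> B" "f a = f b" "a \<noteq> b"
    have "f (a - b) = 0" using ab by (simp add: f_diff)
    then have "a - b \<in> W"
      using ab assms f_inj[of "a - b"] v1.subspace_diff[OF V, of a b] v2.subspace_0[OF W'] by auto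
    then show False using v1.indep_mod_inj[OF assms(2)] ab by blast
  qed
  then show "card (f ` B) = card B" by (rule card_image)
  show "v2.indep_mod W' (f ` B)"
    unfolding v2.indep_mod_def
  proof (intro conjI allI impI)
    show "finite (f ` B)" using assms by (simp add: v1.indep_mod_def)
    fix c assume c: "(\<Sum>b\<in>f ` B. s2 (c b) b) \<in> W'"
    have "(\<Sum>b\<in>f ` B. s2 (c b) b) = f (\<Sum>b\<in>B. s1 (c (f b)) b)"
      by (simp add: sum.reindex[OF inj] f_sum f_scale)
    moreover have "(\<Sum>b\<in>B. s1 (c (f b)) b) \<in> V"
      using assms(1) V by (intro v1.subspace_sum v1.subspace_scale) auto
    ultimately have "(\<Sum>b\<in>B. s1 (c (f b)) b) \<in> W" using c f_inj by simp
    from v1.indep_modD[OF assms(2) this] have "\<forall>b\<in>B. c (f b) = 0" by blast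
    then show "\<forall>b\<in>f ` B. c b = 0" by blast
  qed
qed

lemma quotient_dim_mono: "quotient_dim s1 V W \<le> quotient_dim s2 V' W'"
proof (rule v1.quotient_dim_le)
  fix B assume B: "B \<subseteq> V" "v1.indep_mod W B"
  show "enat (card B) \<le> quotient_dim s2 V' W'"
    using v2.quotient_dim_ge[OF image_indep_mod(1,2)[OF B]] image_indep_mod(3)[OF B] by simp
qed

lemma quotient_dim_eq:
  assumes f_W: "\<And>x. x \<in> W \<Longrightarrow> f x \<in> W'" and surj: "\<And>y. y \<in> V' \<Longrightarrow> \<exists>x\<in>V. y - f x \<in> W'"
  shows "quotient_dim s1 V W = quotient_dim s2 V' W'"
proof (rule antisym[OF quotient_dim_mono], rule v2.quotient_dim_le)
  fix B assume B: "B \<subseteq> V'" "v2.indep_mod W' B"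
  have "\<exists>g. \<forall>y\<in>B. g y \<in> V \<and> y - f (g y) \<in> W'" using surj B(1) by (intro bchoice) blast
  then obtain g where g: "\<And>y. y \<in> B \<Longrightarrow> g y \<in> V" "\<And>y. y \<in> B \<Longrightarrow> y - f (g y) \<in> W'" by blast
  have fin: "finite B" using B by (simp add: v2.indep_mod_def)
  have inj: "inj_on g B"
  proof (rule inj_onI, rule ccontr)
    fix a b assume ab: "a \<in> B" "b \<in> B" "g a = g b" "a \<noteq> b"
    have "(a - f (g a)) - (b - f (g b)) \<in> W'" by (rule v2.subspace_diff[OF W' g(2)[OF ab(1)] g(2)[OF ab(2)]])
    then have "a - b \<in> W'" using ab by simp
    then show False using v2.indep_mod_inj[OF B(2)] ab by blast
  qed
  have "v1.indep_mod W (g ` B)"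
    unfolding v1.indep_mod_def
  proof (intro conjI allI impI)
    show "finite (g ` B)" using fin by simp
    fix c assume "(\<Sum>b\<in>g ` B. s1 (c b) b) \<in> W"
    then have "f (\<Sum>b\<in>g ` B. s1 (c b) b) \<in> W'" by (rule f_W)
    then have 1: "(\<Sum>y\<in>B. s2 (c (g y)) (f (g y))) \<in> W'"
      by (simp add: sum.reindex[OF inj] f_sum f_scale)
    have "(\<Sum>y\<in>B. s2 (c (g y)) (y - f (g y))) \<in> W'"
      using g W' by (intro v2.subspace_sum v2.subspace_scale) auto
    from v2.subspace_add[OF W' this 1]
    have "(\<Sum>y\<in>B. s2 (c (g y)) y) \<in> W'"
      by (simp add: v2.scale_right_diff_distrib sum_subtractf)
    from v2.indep_modD[OF B(2) this] have "\<forall>y\<in>B. c (g y) = 0" by blast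
    then show "\<forall>b\<in>g ` B. c b = 0" by blast
  qed
  then have "enat (card (g ` B)) \<le> quotient_dim s1 V W" using g by (intro v1.quotient_dim_ge) auto
  then show "enat (card B) \<le> quotient_dim s1 V W" using card_image[OF inj] by simp
qed

text \<open>The image of a maximal independent set is independent of the maximal size, hence
  spanning.\<close>

lemma surj_if_dim_eq:
  assumes d: "quotient_dim s1 V W = enat d" "quotient_dim s2 V' W' = enat d" and y: "y \<in> V'"
  shows "\<exists>x\<in>V. y - f x \<in> W'"
proof -
  obtain B where B: "B \<subseteq> V" "v1.indep_mod W B" "card B = d" using v1.quotient_dim_attained[OF d(1)] by blast
  note fB = image_indep_mod[OF B(1,2)]
  obtain c where c: "y - (\<Sum>b\<in>f ` B. s2 (c b) b) \<in> W'"
    using v2.quotient_dim_spanning[OF W' _ fB(1,2) y] d(2) fB(3) B(3) by metis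
  have inj: "inj_on f B" using fB(3) B(2) by (intro eq_card_imp_inj_on) (auto simp: v1.indep_mod_def)
  have "(\<Sum>b\<in>f ` B. s2 (c b) b) = f (\<Sum>b\<in>B. s1 (c (f b)) b)"
    by (simp add: sum.reindex[OF inj] f_sum f_scale)
  moreover have "(\<Sum>b\<in>B. s1 (c (f b)) b) \<in> V"
    using B(1) V by (intro v1.subspace_sum v1.subspace_scale) auto
  ultimately show ?thesis using c by auto
qed

end

section \<open>The grading of the homogeneous coordinate ring\<close>

lemma poly_mapping_eq_sum: "p = (\<Sum>t\<in>Poly_Mapping.keys p. Poly_Mapping.single t (Poly_Mapping.lookup p t))"
  for p :: "'a \<Rightarrow>\<^sub>0 'b::comm_monoid_add"
proof (rule poly_mapping_eqI)
  fix k
  have "(\<Sum>t\<in>Poly_Mapping.keys p. Poly_Mapping.lookup (Poly_Mapping.single t (Poly_Mapping.lookup p t)) k)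
     = (\<Sum>t\<in>Poly_Mapping.keys p. if t = k then Poly_Mapping.lookup p k else 0)"
    by (intro sum.cong) (auto simp: lookup_single when_def)
  also have "\<dots> = Poly_Mapping.lookup p k" by (simp add: in_keys_iff)
  finally show "Poly_Mapping.lookup p k =
      Poly_Mapping.lookup (\<Sum>t\<in>Poly_Mapping.keys p. Poly_Mapping.single t (Poly_Mapping.lookup p t)) k"
    by (simp add: lookup_sum)
qed

lemma poly_mapping_additive_induct [case_names zero add single]:
  fixes p :: "'a \<Rightarrow>\<^sub>0 'b::comm_monoid_add"
  assumes "P 0" "\<And>p q. P p \<Longrightarrow> P q \<Longrightarrow> P (p + q)" "\<And>t c. P (Poly_Mapping.single t c)"
  shows "P p"
proof -
  have "P (\<Sum>t\<in>A. Poly_Mapping.single t (Poly_Mapping.lookup p t))" if "finite A" for A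
    using that by (induction A rule: finite_induct) (auto intro: assms)
  from this[OF finite_keys[of p]] show ?thesis using poly_mapping_eq_sum[of p] by simp
qed

lemma push_superset:
  assumes "finite A" "Poly_Mapping.keys p \<subseteq> A"
  shows "push h p = (\<Sum>t\<in>A. Poly_Mapping.single (h t) (Poly_Mapping.lookup p t))"
  unfolding push_def using assms by (intro sum.mono_neutral_left) (auto simp: in_keys_iff)

lemma push_add: "push h (p + q) = push h p + push h q"
proof -
  let ?A = "Poly_Mapping.keys p \<union> Poly_Mapping.keys q"
  have "Poly_Mapping.keys (p + q) \<subseteq> ?A" by (rule Poly_Mapping.keys_add)
  then have "push h (p + q) = (\<Sum>t\<in>?A. Poly_Mapping.single (h t) (Poly_Mapping.lookup (p + q) t))"
    by (intro push_superset) auto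
  also have "\<dots> = (\<Sum>t\<in>?A. Poly_Mapping.single (h t) (Poly_Mapping.lookup p t)) +
      (\<Sum>t\<in>?A. Poly_Mapping.single (h t) (Poly_Mapping.lookup q t))"
    by (simp add: lookup_add single_add sum.distrib)
  also have "\<dots> = push h p + push h q" by (simp add: push_superset[of ?A])
  finally show ?thesis .
qed

lemma push_single [simp]: "push h (Poly_Mapping.single t c) = Poly_Mapping.single (h t) c"
  by (simp add: push_superset[of "{t}"] )

lemma push_0 [simp]: "push h 0 = 0" by (simp add: push_def)

lemma push_diff: "push h (p - q) = push h p - push h q"
  using push_add[of h "p - q" q] by simp

lemma push_mult:
  fixes h :: "'a::comm_monoid_add \<Rightarrow> 'b::comm_monoid_add"
  assumes "\<And>x y. h (x + y) = h x + h y"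
  shows "push h (p * q) = push h p * push h q"
proof (induction p rule: poly_mapping_additive_induct)
  case (single t c)
  show ?case
    by (induction q rule: poly_mapping_additive_induct) (auto simp: push_add mult_single assms algebra_simps)
qed (auto simp: push_add algebra_simps)

lemma keys_sum_subset: "Poly_Mapping.keys (sum f A) \<subseteq> (\<Union>i\<in>A. Poly_Mapping.keys (f i))"
proof (induction A rule: infinite_finite_induct)
  case (insert x F)
  then show ?case using Poly_Mapping.keys_add[of "f x" "sum f F"] by auto
qed auto

lemma keys_push: "Poly_Mapping.keys (push h p) \<subseteq> h ` Poly_Mapping.keys p"
proof -
  have "Poly_Mapping.keys (push h p) \<subseteq> (\<Union>t\<in>Poly_Mapping.keys p. Poly_Mapping.keys (Poly_Mapping.single (h t) (Poly_Mapping.lookup p t)))"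
    unfolding push_def by (rule keys_sum_subset)
  also have "\<dots> \<subseteq> h ` Poly_Mapping.keys p" by auto
  finally show ?thesis .
qed

lemma lookup_push_inj:
  assumes "inj h" shows "Poly_Mapping.lookup (push h p) (h t) = Poly_Mapping.lookup p t"
proof (induction p rule: poly_mapping_additive_induct)
  case (single s c)
  then show ?case using assms by (simp add: lookup_single inj_eq)
qed (auto simp: push_add lookup_add)

lemma push_inject: assumes "inj h" "push h p = push h q" shows "p = q"
  by (rule poly_mapping_eqI) (metis lookup_push_inj assms)

lemma push_push: "push g (push h p) = push (\<lambda>t. g (h t)) p"
  by (induction p rule: poly_mapping_additive_induct) (auto simp: push_add)

lemma push_cong: "(\<And>t. t \<in> Poly_Mapping.keys p \<Longrightarrow> h t = g t) \<Longrightarrow> push h p = push g p"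
  unfolding push_def by (intro sum.cong) auto

lemma push_shift:
  fixes p :: "'a \<Rightarrow>\<^sub>0 'k::field" and e :: "'b::comm_monoid_add"
  shows "push (\<lambda>t. e + h t) p = Poly_Mapping.single e 1 * push h p"
  by (induction p rule: poly_mapping_additive_induct) (auto simp: push_add algebra_simps mult_single)

lemma push_pm_scale: "push h (pm_scale c p) = pm_scale c (push h p)"
  by (induction p rule: poly_mapping_additive_induct)
    (auto simp: push_add pm_scale_def algebra_simps mult_single)

interpretation pm: quotient_space "pm_scale :: 'k::field \<Rightarrow> ('e::comm_monoid_add \<Rightarrow>\<^sub>0 'k) \<Rightarrow> _"
  by unfold_locales (auto simp: pm_scale_def algebra_simps single_add mult_single simp flip: mult.assoc)

lemma pm_scale_mult: "pm_scale c (p * q) = p * pm_scale c q" "pm_scale c (p * q) = pm_scale c p * q"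
  by (auto simp: pm_scale_def mult_ac)

lemma lookup_pm_scale: "Poly_Mapping.lookup (pm_scale c p) t = c * Poly_Mapping.lookup p t"
proof (induction p rule: poly_mapping_additive_induct)
  case (single s d)
  then show ?case by (simp add: pm_scale_def mult_single lookup_single when_def)
qed (auto simp: pm_scale_def lookup_add algebra_simps)

lemma keys_pm_scale: "Poly_Mapping.keys (pm_scale c p) \<subseteq> Poly_Mapping.keys p"
  by (auto simp: in_keys_iff lookup_pm_scale)

lemma keys_diff_subset: "Poly_Mapping.keys (p - q :: 'a \<Rightarrow>\<^sub>0 'b::ab_group_add) \<subseteq> Poly_Mapping.keys p \<union> Poly_Mapping.keys q"
  by (auto simp: in_keys_iff lookup_minus)

section \<open>Ideals of the full ring\<close>

lemma ideal_in_UNIV: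
  "ideal_in UNIV I \<longleftrightarrow> 0 \<in> I \<and> (\<forall>x\<in>I. \<forall>y\<in>I. x + y \<in> I) \<and> (\<forall>a. \<forall>x\<in>I. a * x \<in> I)"
  by (auto simp: ideal_in_def submodule_over_def)

lemma ideal_in_ideal_gen: "ideal_in UNIV (ideal_gen G)"
  unfolding hull_def ideal_in_UNIV by auto

lemma ideal_addI: "ideal_in UNIV I \<Longrightarrow> x \<in> I \<Longrightarrow> y \<in> I \<Longrightarrow> x + y \<in> I"
  and ideal_multI: "ideal_in UNIV I \<Longrightarrow> x \<in> I \<Longrightarrow> a * x \<in> I"
  and ideal_multI2: "ideal_in UNIV I \<Longrightarrow> x \<in> I \<Longrightarrow> x * a \<in> I"
  and ideal_0I: "ideal_in UNIV I \<Longrightarrow> 0 \<in> I"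
  by (auto simp: ideal_in_UNIV mult.commute)

lemma ideal_negI: "ideal_in UNIV I \<Longrightarrow> x \<in> I \<Longrightarrow> - x \<in> I"
  using ideal_multI[of I x "-1"] by simp

lemma ideal_diffI: "ideal_in UNIV I \<Longrightarrow> x \<in> I \<Longrightarrow> y \<in> I \<Longrightarrow> x - y \<in> I"
  using ideal_addI[of I x "- y"] ideal_negI by fastforce

lemma ideal_sumI: "ideal_in UNIV I \<Longrightarrow> (\<And>i. i \<in> A \<Longrightarrow> f i \<in> I) \<Longrightarrow> sum f A \<in> I"
  by (induction A rule: infinite_finite_induct) (auto intro: ideal_addI ideal_0I)

lemma ideal_gen_finite:
  assumes "finite A"
  shows "ideal_gen (F ` A) = {\<Sum>i\<in>A. g i * F i | g. True}"
proof
  have "ideal_in UNIV {\<Sum>i\<in>A. g i * F i | g. True}"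
    unfolding ideal_in_UNIV
  proof (intro conjI ballI allI)
    show "0 \<in> {\<Sum>i\<in>A. g i * F i | g. True}" by (auto intro!: exI[of _ "\<lambda>_. 0"])
    fix x assume "x \<in> {\<Sum>i\<in>A. g i * F i | g. True}"
    then obtain g where x: "x = (\<Sum>i\<in>A. g i * F i)" by blast
    show "a * x \<in> {\<Sum>i\<in>A. g i * F i | g. True}" for a
      unfolding x by (auto intro!: exI[of _ "\<lambda>i. a * g i"] simp: sum_distrib_left mult_ac)
    fix y assume "y \<in> {\<Sum>i\<in>A. g i * F i | g. True}"
    then obtain g' where y: "y = (\<Sum>i\<in>A. g' i * F i)" by blast
    show "x + y \<in> {\<Sum>i\<in>A. g i * F i | g. True}"
      unfolding x y by (auto intro!: exI[of _ "\<lambda>i. g i + g' i"] simp: sum.distrib ring_distribs)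
  qed
  moreover have "F ` A \<subseteq> {\<Sum>i\<in>A. g i * F i | g. True}"
  proof
    fix x assume "x \<in> F ` A"
    then obtain i where i: "i \<in> A" "x = F i" by blast
    then have "x = (\<Sum>k\<in>A. (if k = i then 1 else 0) * F k)"
      using assms by (simp add: if_distrib[of "\<lambda>c. c * _"] cong: if_cong)
    then show "x \<in> {\<Sum>i\<in>A. g i * F i | g. True}" by (auto intro!: exI[of _ "\<lambda>k. if k = i then 1 else 0"])
  qed
  ultimately show "ideal_gen (F ` A) \<subseteq> {\<Sum>i\<in>A. g i * F i | g. True}" by (intro hull_minimal)
  show "{\<Sum>i\<in>A. g i * F i | g. True} \<subseteq> ideal_gen (F ` A)"
  proof
    fix x assume "x \<in> {\<Sum>i\<in>A. g i * F i | g. True}"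
    then obtain g where x: "x = (\<Sum>i\<in>A. g i * F i)" by blast
    show "x \<in> ideal_gen (F ` A)"
      unfolding x by (rule ideal_sumI[OF ideal_in_ideal_gen], rule ideal_multI[OF ideal_in_ideal_gen], rule hull_inc) blast
  qed
qed

lemma ideal_subspace: "ideal_in UNIV I \<Longrightarrow> pm.subspace I"
  unfolding pm.subspace_def by (auto simp: pm_scale_def intro: ideal_0I ideal_addI ideal_multI)

section \<open>Exponents, divisor classes and graded pieces\<close>

lemma expo_add: "expo (s + t) = expo s + expo t"
  by (simp add: expo_def vec_eq_iff lookup_add)

lemma expo_0 [simp]: "expo 0 = 0"
  by (simp add: expo_def vec_eq_iff)

lemma expo_nth: "expo t $ j = int (Poly_Mapping.lookup t j)"
  by (simp add: expo_def)

lemma inj_expo: "inj expo"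
  by (intro injI poly_mapping_eqI) (metis expo_nth of_nat_eq_iff)

lemma expo_surj: assumes "\<And>j. 0 \<le> e $ j" obtains t where "expo t = e"
proof
  have "Poly_Mapping.lookup (\<Sum>k\<in>UNIV. Poly_Mapping.single k (nat (e $ k))) j = nat (e $ j)" for j
    by (simp add: lookup_sum lookup_single when_def)
  then show "expo (\<Sum>k\<in>UNIV. Poly_Mapping.single k (nat (e $ k))) = e"
    using assms by (simp add: vec_eq_iff expo_nth)
qed

lemma div_class_eq_iff: "div_class u D = div_class u E \<longleftrightarrow> (\<exists>m. D = E + char_div u m)"
proof
  assume "div_class u D = div_class u E"
  moreover have "D \<in> div_class u D" unfolding div_class_def elt_set_plus_def by (auto intro!: exI[of _ 0])
  ultimately show "\<exists>m. D = E + char_div u m" by (auto simp: div_class_def elt_set_plus_def)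
next
  assume "\<exists>m. D = E + char_div u m"
  then obtain m where m: "D = E + char_div u m" by blast
  show "div_class u D = div_class u E"
    unfolding div_class_def elt_set_plus_def
  proof (intro equalityI subsetI)
    fix x assume "x \<in> {c. \<exists>b\<in>range (char_div u). c = D + b}"
    then obtain k where "x = E + char_div u (m + k)" by (auto simp: m char_div_add add.assoc)
    then show "x \<in> {c. \<exists>b\<in>range (char_div u). c = E + b}" by blast
  next
    fix x assume "x \<in> {c. \<exists>b\<in>range (char_div u). c = E + b}"
    then obtain k where "x = D + char_div u (k - m)" by (auto simp: m char_div_diff)
    then show "x \<in> {c. \<exists>b\<in>range (char_div u). c = D + b}" by blast
  qed
qed

lemma div_class_add: "div_class u D + div_class u E = div_class u (D + E)"
proof (intro equalityI subsetI)
  fix x assume "x \<in> div_class u D + div_class u E"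
  then obtain k l where "x = D + char_div u k + (E + char_div u l)"
    by (auto simp: div_class_def elt_set_plus_def set_plus_def)
  then have "x = D + E + char_div u (k + l)" by (simp add: char_div_add)
  then show "x \<in> div_class u (D + E)" by (auto simp: div_class_def elt_set_plus_def)
next
  fix x assume "x \<in> div_class u (D + E)"
  then obtain k where "x = (D + char_div u k) + (E + char_div u 0)"
    by (auto simp: div_class_def elt_set_plus_def)
  then show "x \<in> div_class u D + div_class u E"
    unfolding div_class_def elt_set_plus_def set_plus_def by blast
qed

lemma div_class_diff_cong:
  "div_class u (D + E) = div_class u F \<longleftrightarrow> div_class u D = div_class u (F - E)"
proof -
  have "D + E = F + x \<longleftrightarrow> D = F - E + x" for x by (auto simp: algebra_simps)
  then show ?thesis unfolding div_class_eq_iff by simp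
qed

text \<open>Graded pieces indexed by divisors instead of classes: degrees can then be added,
  subtracted and scaled as integer vectors, whereas classes are cosets under elementwise
  addition.\<close>

definition S_div :: "('r::finite \<Rightarrow> int ^ 'n::finite) \<Rightarrow> int ^ 'r \<Rightarrow> ('r, 'k::field) cox set" where
  "S_div u D = S_deg u (div_class u D)"

lemma S_div_iff: "F \<in> S_div u D \<longleftrightarrow> (\<forall>t\<in>Poly_Mapping.keys F. div_class u (expo t) = div_class u D)"
  by (simp add: S_div_def S_deg_def)

lemma S_div_subspace: "pm.subspace (S_div u D)"
  unfolding pm.subspace_def
proof (intro conjI ballI allI)
  show "x + y \<in> S_div u D" if "x \<in> S_div u D" "y \<in> S_div u D" for x y
    using that Poly_Mapping.keys_add[of x y] unfolding S_div_iff by blast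
  show "pm_scale c x \<in> S_div u D" if "x \<in> S_div u D" for x c
    using that keys_pm_scale[of c x] unfolding S_div_iff by blast
qed (simp add: S_div_iff)

lemma S_div_0: "0 \<in> S_div u D" by (simp add: S_div_iff)

lemma S_div_add: "F \<in> S_div u D \<Longrightarrow> G \<in> S_div u D \<Longrightarrow> F + G \<in> S_div u D"
  by (rule pm.subspace_add[OF S_div_subspace])

lemma S_div_diff: "F \<in> S_div u D \<Longrightarrow> G \<in> S_div u D \<Longrightarrow> F - G \<in> S_div u D"
  by (rule pm.subspace_diff[OF S_div_subspace])

lemma S_div_sum: "(\<And>i. i \<in> A \<Longrightarrow> f i \<in> S_div u D) \<Longrightarrow> sum f A \<in> S_div u D"
  by (rule pm.subspace_sum[OF S_div_subspace])

lemma S_div_mult: assumes "F \<in> S_div u D" "G \<in> S_div u E" shows "F * G \<in> S_div u (D + E)"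
  unfolding S_div_iff
proof
  fix t assume "t \<in> Poly_Mapping.keys (F * G)"
  then obtain a b where ab: "a \<in> Poly_Mapping.keys F" "b \<in> Poly_Mapping.keys G" "t = a + b"
    using keys_mult[of F G] by blast
  then have "div_class u (expo t) = div_class u (expo a) + div_class u (expo b)"
    by (simp add: expo_add div_class_add)
  also have "\<dots> = div_class u (D + E)" using ab assms by (simp add: S_div_iff div_class_add)
  finally show "div_class u (expo t) = div_class u (D + E)" .
qed

lemma S_div_monom: "Poly_Mapping.single t c \<in> S_div u (expo t)"
  by (simp add: S_div_iff)

lemma S_div_1: "1 \<in> S_div u 0"
  using S_div_monom[of 0 1 u] by simp

lemma S_div_power: "F \<in> S_div u D \<Longrightarrow> F ^ k \<in> S_div u (of_nat k *s D)"
proof (induction k)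
  case (Suc k)
  have "D + of_nat k *s D = of_nat (Suc k) *s D" by (simp add: vec_eq_iff ring_distribs)
  then show ?case using S_div_mult[OF Suc.prems Suc.IH[OF Suc.prems]] by simp
qed (auto simp: S_div_1)

definition hcomp :: "('r::finite \<Rightarrow> int ^ 'n::finite) \<Rightarrow> int ^ 'r \<Rightarrow> ('r, 'k::field) cox \<Rightarrow> ('r, 'k) cox" where
  "hcomp u D F = (\<Sum>t\<in>{t \<in> Poly_Mapping.keys F. div_class u (expo t) = div_class u D}.
      Poly_Mapping.single t (Poly_Mapping.lookup F t))"

lemma lookup_hcomp:
  "Poly_Mapping.lookup (hcomp u D F) t = (if div_class u (expo t) = div_class u D then Poly_Mapping.lookup F t else 0)"
proof -
  have "Poly_Mapping.lookup (hcomp u D F) t =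
    (\<Sum>s\<in>{t \<in> Poly_Mapping.keys F. div_class u (expo t) = div_class u D}. if s = t then Poly_Mapping.lookup F t else 0)"
    unfolding hcomp_def lookup_sum by (intro sum.cong) (auto simp: lookup_single when_def)
  then show ?thesis by (simp add: in_keys_iff)
qed

lemma hcomp_S_div: "hcomp u D F \<in> S_div u D"
  by (auto simp: S_div_iff in_keys_iff lookup_hcomp split: if_splits)

lemma hcomp_id: "F \<in> S_div u D \<Longrightarrow> hcomp u D F = F"
  by (rule poly_mapping_eqI) (auto simp: lookup_hcomp S_div_iff in_keys_iff)

lemma hcomp_add: "hcomp u D (F + G) = hcomp u D F + hcomp u D G"
  by (rule poly_mapping_eqI) (auto simp: lookup_hcomp lookup_add)

lemma hcomp_0 [simp]: "hcomp u D 0 = 0"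
  by (simp add: hcomp_def)

lemma hcomp_sum: "hcomp u D (sum f A) = (\<Sum>i\<in>A. hcomp u D (f i))"
  by (induction A rule: infinite_finite_induct) (auto simp: hcomp_add)

lemma hcomp_single: "hcomp u D (Poly_Mapping.single t c) = (if div_class u (expo t) = div_class u D then Poly_Mapping.single t c else 0)"
  by (rule poly_mapping_eqI) (auto simp: lookup_hcomp lookup_single when_def)

lemma hcomp_mult: assumes "A \<in> S_div u E" shows "hcomp u D (G * A) = hcomp u (D - E) G * A"
proof (induction G rule: poly_mapping_additive_induct)
  case (single t c)
  have A: "A = (\<Sum>a\<in>Poly_Mapping.keys A. Poly_Mapping.single a (Poly_Mapping.lookup A a))" by (rule poly_mapping_eq_sum)
  have "hcomp u D (Poly_Mapping.single t c * A)
     = (\<Sum>a\<in>Poly_Mapping.keys A. hcomp u D (Poly_Mapping.single t c * Poly_Mapping.single a (Poly_Mapping.lookup A a)))"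
    by (subst A) (simp only: sum_distrib_left hcomp_sum)
  also have "\<dots> = (\<Sum>a\<in>Poly_Mapping.keys A. hcomp u (D - E) (Poly_Mapping.single t c) * Poly_Mapping.single a (Poly_Mapping.lookup A a))"
  proof (rule sum.cong[OF refl])
    fix a assume "a \<in> Poly_Mapping.keys A"
    then have "div_class u (expo a) = div_class u E" using assms by (simp add: S_div_iff)
    then have "div_class u (expo (t + a)) = div_class u (expo t + E)"
      by (simp add: expo_add flip: div_class_add)
    then show "hcomp u D (Poly_Mapping.single t c * Poly_Mapping.single a (Poly_Mapping.lookup A a))
       = hcomp u (D - E) (Poly_Mapping.single t c) * Poly_Mapping.single a (Poly_Mapping.lookup A a)"
      by (simp add: mult_single hcomp_single div_class_diff_cong)
  qed
  also have "\<dots> = hcomp u (D - E) (Poly_Mapping.single t c) * A"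
    by (subst (3) A) (simp only: sum_distrib_left)
  finally show ?case .
qed (auto simp: hcomp_add algebra_simps)

text \<open>The coefficients of an arbitrary combination are replaced by their components of the
  complementary degrees.\<close>

lemma homogeneous_combination:
  assumes "finite A" "\<And>i. i \<in> A \<Longrightarrow> F i \<in> S_div u (E i)" "f \<in> ideal_gen (F ` A)" "f \<in> S_div u D"
  obtains g where "\<And>i. i \<in> A \<Longrightarrow> g i \<in> S_div u (D - E i)" "f = (\<Sum>i\<in>A. g i * F i)"
proof -
  have "f \<in> {\<Sum>i\<in>A. g i * F i | g. True}" using assms(3) unfolding ideal_gen_finite[OF assms(1)] .
  then obtain g where g: "f = (\<Sum>i\<in>A. g i * F i)" by auto
  have "f = hcomp u D f" using hcomp_id[OF assms(4)] by simp
  also have "\<dots> = (\<Sum>i\<in>A. hcomp u (D - E i) (g i) * F i)"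
    unfolding g hcomp_sum using assms(2) by (intro sum.cong) (auto simp: hcomp_mult)
  finally show thesis by (rule that[rotated]) (rule hcomp_S_div)
qed

section \<open>Monomials and lattice points\<close>

context lattice_fan begin

text \<open>The rays of a maximal cone span, so a character is determined by its orders along
  them.\<close>

lemma inj_char_div: "inj (char_div u)"
proof (rule injI)
  fix m m' assume eq: "char_div u m = char_div u m'"
  obtain x where "generic x" using exists_generic by blast
  then obtain s where "s \<in> max_cones" using generic_unique_cone by blast
  then have "m - m' = 0" by (rule eq_0_if_char_div_0) (simp add: char_div_diff eq)
  then show "m = m'" by simp
qed

text \<open>A monomial of this degree has exponent \<open>D + char_div u m\<close>, and
  nonnegativity of the exponent is the condition defining \<open>lat\<close>. Uniqueness of the
  character justifies \<open>THE\<close>.\<close>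

lemma bij_monomials_lat:
  "bij_betw (\<lambda>t. THE m. expo t = D + char_div u m) {t. div_class u (expo t) = div_class u D} (lat u D)"
proof (rule bij_betwI')
  have the: "(THE m. expo t = D + char_div u m) = m" if "expo t = D + char_div u m" for t m
    using that inj_char_div by (intro the_equality) (auto simp: inj_eq)
  show "(THE m. expo x = D + char_div u m) = (THE m. expo y = D + char_div u m) \<longleftrightarrow> x = y"
    if xy: "x \<in> {t. div_class u (expo t) = div_class u D}" "y \<in> {t. div_class u (expo t) = div_class u D}" for x y
  proof -
    obtain m where m: "expo x = D + char_div u m" using xy(1) by (auto simp: div_class_eq_iff)
    obtain m' where "expo y = D + char_div u m'" using xy(2) by (auto simp: div_class_eq_iff)
    with m show ?thesis using the inj_expo inj_eq[OF inj_expo] by metis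
  qed
  show "(THE m. expo x = D + char_div u m) \<in> lat u D" if x: "x \<in> {t. div_class u (expo t) = div_class u D}" for x
  proof -
    obtain m where m: "expo x = D + char_div u m" using x by (auto simp: div_class_eq_iff)
    have "0 \<le> char_div u m $ j + D $ j" for j
    proof -
      have "char_div u m $ j + D $ j = expo x $ j" using m by simp
      then show ?thesis by (simp add: expo_nth)
    qed
    then show ?thesis using the[OF m] by (simp add: lat_def)
  qed
  show "\<exists>x\<in>{t. div_class u (expo t) = div_class u D}. m = (THE m. expo x = D + char_div u m)" if "m \<in> lat u D" for m
  proof -
    have "0 \<le> (D + char_div u m) $ j" for j using that by (simp add: lat_def add.commute)
    then obtain t where t: "expo t = D + char_div u m" using expo_surj by metis
    then show ?thesis using the[OF t] by (auto simp: div_class_eq_iff intro!: bexI[of _ t])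
  qed
qed

lemma S_div_dim:
  "finite {t. div_class u (expo t) = div_class u D}"
  "S_div u D = pm.span ((\<lambda>t. Poly_Mapping.single t (1::'k::field)) ` {t. div_class u (expo t) = div_class u D})"
  "pm.dim (S_div u D :: ('r, 'k) cox set) = card (lat u D)"
proof -
  let ?T = "{t :: 'r \<Rightarrow>\<^sub>0 nat. div_class u (expo t) = div_class u D}"
  let ?B = "(\<lambda>t. Poly_Mapping.single t (1::'k)) ` ?T"
  show fin: "finite ?T" using bij_betw_finite[OF bij_monomials_lat[of D]] finite_lat by simp
  have sc: "Poly_Mapping.single t c = pm_scale c (Poly_Mapping.single t (1::'k))" for t c
    by (simp add: pm_scale_def mult_single)
  have sub: "?B \<subseteq> S_div u D" by (auto simp: S_div_iff)
  have "S_div u D \<subseteq> pm.span ?B"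
  proof
    fix F :: "('r, 'k) cox" assume F: "F \<in> S_div u D"
    have "(\<Sum>t\<in>Poly_Mapping.keys F. Poly_Mapping.single t (Poly_Mapping.lookup F t)) \<in> pm.span ?B"
      by (rule pm.span_sum, subst sc, rule pm.span_scale, rule pm.span_base) (use F in \<open>auto simp: S_div_iff\<close>)
    then show "F \<in> pm.span ?B" using poly_mapping_eq_sum[of F] by simp
  qed
  moreover have "pm.span ?B \<subseteq> S_div u D" using sub by (intro pm.span_minimal S_div_subspace)
  ultimately show span: "S_div u D = pm.span ?B" by blast
  have inj: "inj_on (\<lambda>t. Poly_Mapping.single t (1::'k)) ?T"
    by (intro inj_onI) (metis keys_single singleton_inject zero_neq_one)
  have "pm.independent ?B"
    unfolding pm.independent_explicit_module
  proof (intro allI impI)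
    fix t w v assume t: "finite t" "t \<subseteq> ?B" "(\<Sum>v\<in>t. pm_scale (w v) v) = 0" "v \<in> t"
    then obtain e where e: "v = Poly_Mapping.single e 1" by blast
    have "0 = Poly_Mapping.lookup (\<Sum>v\<in>t. pm_scale (w v) v) e" using t(3) by simp
    also have "\<dots> = (\<Sum>v'\<in>t. if v' = v then w v else 0)"
      unfolding lookup_sum
    proof (rule sum.cong[OF refl])
      fix v' assume "v' \<in> t"
      then obtain e' where e': "v' = Poly_Mapping.single e' 1" using t by blast
      have "v' = v \<longleftrightarrow> e' = e" unfolding e e' by (metis keys_single singleton_inject zero_neq_one)
      then show "Poly_Mapping.lookup (pm_scale (w v') v') e = (if v' = v then w v else 0)"
        by (auto simp: lookup_pm_scale e' lookup_single when_def)
    qed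
    also have "\<dots> = w v" using t by simp
    finally show "w v = 0" by simp
  qed
  then have "pm.dim (S_div u D :: ('r, 'k) cox set) = card ?B"
    using pm.basis_card_eq_dim[of ?B "S_div u D"] sub span by simp
  also have "\<dots> = card ?T" using inj by (rule card_image)
  also have "\<dots> = card (lat u D)" by (rule bij_betw_same_card[OF bij_monomials_lat])
  finally show "pm.dim (S_div u D :: ('r, 'k) cox set) = card (lat u D)" .
qed

lemma quotient_dim_S_div:
  assumes "pm.subspace W"
  shows "quotient_dim pm_scale (S_div u D) (W \<inter> S_div u D :: ('r, 'k::field) cox set) = enat (card (lat u D) - pm.dim (W \<inter> S_div u D))"
    "pm.dim (W \<inter> S_div u D) \<le> card (lat u D)"
proof -
  let ?B = "(\<lambda>t. Poly_Mapping.single t (1::'k)) ` {t. div_class u (expo t) = div_class u D}"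
  have "finite ?B" using S_div_dim(1) by simp
  moreover have "S_div u D \<subseteq> pm.span ?B" by (subst S_div_dim(2)) simp
  moreover have "pm.subspace (W \<inter> S_div u D)" using assms S_div_subspace by (rule pm.subspace_inter)
  ultimately show "quotient_dim pm_scale (S_div u D) (W \<inter> S_div u D) = enat (card (lat u D) - pm.dim (W \<inter> S_div u D))"
    "pm.dim (W \<inter> S_div u D) \<le> card (lat u D)"
    using pm.quotient_dim_subspaces[of ?B "S_div u D" "W \<inter> S_div u D", OF _ _ S_div_subspace]
    unfolding S_div_dim(3) by auto
qed

end

section \<open>Hilbert functions of complete intersections\<close>

text \<open>Homogeneity is stated through components instead of generators, so that a congruence
  modulo the ideal can be restricted to a single degree.\<close>

definition homog_closed :: "('r::finite \<Rightarrow> int ^ 'n::finite) \<Rightarrow> ('r, 'k::field) cox set \<Rightarrow> bool" where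
  "homog_closed u I \<longleftrightarrow> ideal_in UNIV I \<and> (\<forall>D. \<forall>f\<in>I. hcomp u D f \<in> I)"

lemma homog_closed_ideal_gen:
  assumes "finite A" "\<And>i. i \<in> A \<Longrightarrow> F i \<in> S_div u (E i)"
  shows "homog_closed u (ideal_gen (F ` A))"
  unfolding homog_closed_def
proof (intro conjI allI ballI ideal_in_ideal_gen)
  fix D f assume "f \<in> ideal_gen (F ` A)"
  then have "f \<in> {\<Sum>i\<in>A. g i * F i | g. True}" unfolding ideal_gen_finite[OF assms(1)] .
  then obtain g where f: "f = (\<Sum>i\<in>A. g i * F i)" by auto
  have "hcomp u D f = (\<Sum>i\<in>A. hcomp u (D - E i) (g i) * F i)"
    unfolding f hcomp_sum using assms(2) by (intro sum.cong) (auto simp: hcomp_mult)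
  then show "hcomp u D f \<in> ideal_gen (F ` A)" unfolding ideal_gen_finite[OF assms(1)] by auto
qed

lemma ideal_gen_insert:
  assumes "finite A" "k \<notin> A"
  shows "f \<in> ideal_gen (F ` insert k A) \<longleftrightarrow> (\<exists>a. f - a * F k \<in> ideal_gen (F ` A))"
proof
  assume "f \<in> ideal_gen (F ` insert k A)"
  then have "f \<in> {\<Sum>i\<in>insert k A. g i * F i | g. True}" using ideal_gen_finite[of "insert k A" F] assms(1) by simp
  then obtain g where "f = (\<Sum>i\<in>insert k A. g i * F i)" by auto
  then have "f - g k * F k = (\<Sum>i\<in>A. g i * F i)" using assms by simp
  then show "\<exists>a. f - a * F k \<in> ideal_gen (F ` A)" unfolding ideal_gen_finite[OF assms(1)] by blast
next
  assume "\<exists>a. f - a * F k \<in> ideal_gen (F ` A)"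
  then obtain a where a: "f - a * F k \<in> ideal_gen (F ` A)" by blast
  have "ideal_gen (F ` A) \<subseteq> ideal_gen (F ` insert k A)" by (intro hull_mono) auto
  moreover have "a * F k \<in> ideal_gen (F ` insert k A)"
    by (rule ideal_multI[OF ideal_in_ideal_gen], rule hull_inc) simp
  ultimately show "f \<in> ideal_gen (F ` insert k A)"
    using a ideal_addI[OF ideal_in_ideal_gen, of "f - a * F k" _ "a * F k"] by auto
qed

text \<open>Regularity puts the last coefficient into the ideal of the earlier elements.
  Substituting its expression there leaves a shorter relation with coefficients
  \<open>c l + d l * G k\<close>, to which induction applies.\<close>

lemma regular_relation:
  fixes G :: "nat \<Rightarrow> 'a::comm_ring_1"
  assumes "\<And>i. i < n \<Longrightarrow> nonzerodivisor_mod (G i) (ideal_gen (G ` {..<i}))"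
    and "k \<le> n" "(\<Sum>l<k. c l * G l) = 0" "l < k"
  shows "c l \<in> ideal_gen (G ` {..<k})"
  using assms(2-)
proof (induction k arbitrary: c l)
  case (Suc k)
  have "c k * G k = - (\<Sum>l<k. c l * G l)" using Suc.prems(2) by (simp add: eq_neg_iff_add_eq_0 add.commute)
  moreover have "(\<Sum>l<k. c l * G l) \<in> ideal_gen (G ` {..<k})" unfolding ideal_gen_finite[OF finite_lessThan] by blast
  ultimately have "c k * G k \<in> ideal_gen (G ` {..<k})"
    using ideal_negI[OF ideal_in_ideal_gen] by fastforce
  then have ck: "c k \<in> ideal_gen (G ` {..<k})"
    using assms(1)[of k] Suc.prems(1) unfolding nonzerodivisor_mod_def by (simp add: mult.commute)
  then have "c k \<in> {\<Sum>i<k. g i * G i | g. True}" unfolding ideal_gen_finite[OF finite_lessThan] .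
  then obtain d where d: "c k = (\<Sum>l<k. d l * G l)" by auto
  have mono: "ideal_gen (G ` {..<k}) \<subseteq> ideal_gen (G ` {..<Suc k})" by (intro hull_mono) auto
  show ?case
  proof (cases "l = k")
    case True
    then show ?thesis using ck mono by blast
  next
    case False
    then have l: "l < k" using Suc.prems by simp
    have "(\<Sum>l<k. (c l + d l * G k) * G l) = 0"
    proof -
      have "(\<Sum>l<k. (c l + d l * G k) * G l) = (\<Sum>l<k. c l * G l) + (\<Sum>l<k. d l * G l) * G k"
        unfolding sum_distrib_right sum.distrib[symmetric] by (intro sum.cong refl) (simp add: ring_distribs mult_ac)
      then show ?thesis using Suc.prems(2) d by simp
    qed
    from Suc.IH[OF _ this l] have "c l + d l * G k \<in> ideal_gen (G ` {..<k})" using Suc.prems by simp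
    moreover have "d l * G k \<in> ideal_gen (G ` {..<Suc k})"
      by (rule ideal_multI[OF ideal_in_ideal_gen], rule hull_inc) simp
    ultimately have "(c l + d l * G k) - d l * G k \<in> ideal_gen (G ` {..<Suc k})"
      using mono by (intro ideal_diffI[OF ideal_in_ideal_gen]) auto
    then show ?thesis by simp
  qed
qed simp

lemma const_mult:
  fixes p q :: "('r \<Rightarrow>\<^sub>0 nat) \<Rightarrow>\<^sub>0 'k::field"
  shows "Poly_Mapping.lookup (p * q) 0 = Poly_Mapping.lookup p 0 * Poly_Mapping.lookup q 0"
proof (induction p rule: poly_mapping_additive_induct)
  case (single t c)
  show ?case
  proof (induction q rule: poly_mapping_additive_induct)
    case (single s d)
    have "t + s = 0 \<longleftrightarrow> t = 0 \<and> s = 0"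
      by (auto simp: poly_mapping_eq_iff fun_eq_iff lookup_add)
    then show ?case by (auto simp: mult_single lookup_single when_def)
  qed (auto simp: lookup_add algebra_simps)
qed (auto simp: lookup_add algebra_simps)

context lattice_fan begin

text \<open>The Hilbert function with integer values, suitable for alternating sums; the lemma of
  the same name identifies it with \<open>quotient_dim\<close>.\<close>

definition hilb :: "('r, 'k::field) cox set \<Rightarrow> int ^ 'r \<Rightarrow> int" where
  "hilb I D = int (card (lat u D)) - int (pm.dim (I \<inter> S_div u D))"

lemma hilb:
  assumes "ideal_in UNIV (I :: ('r, 'k::field) cox set)"
  shows "quotient_dim pm_scale (S_div u D) (I \<inter> S_div u D) = enat (nat (hilb I D))" "hilb I D \<ge> 0"
proof -
  show 1: "hilb I D \<ge> 0" using quotient_dim_S_div(2)[OF ideal_subspace[OF assms]] by (simp add: hilb_def)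
  show "quotient_dim pm_scale (S_div u D) (I \<inter> S_div u D) = enat (nat (hilb I D))"
    unfolding quotient_dim_S_div(1)[OF ideal_subspace[OF assms]] hilb_def by (simp add: nat_diff_distrib)
qed

lemma card_lat_cong:
  assumes "div_class u D = div_class u E" shows "card (lat u D) = card (lat u E)"
proof -
  \<comment> \<open>Any field would do; \<open>rat\<close> serves to express the count as the
    dimension of a space that depends only on the class.\<close>
  have "(S_div u D :: ('r, rat) cox set) = S_div u E" using assms by (simp add: S_div_def)
  then show ?thesis using S_div_dim(3) by metis
qed

lemma hilb_cong:
  assumes "div_class u D = div_class u E" shows "hilb I D = hilb I E"
  using assms card_lat_cong[OF assms] by (simp add: hilb_def S_div_def)

lemma mult_quotient_map:
  assumes I: "ideal_in UNIV (I :: ('r, 'k::field) cox set)" and J: "ideal_in UNIV J" "I \<subseteq> J" "F \<in> S_div u E"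
    and nzd: "nonzerodivisor_mod F I" and FV: "\<And>x. x \<in> S_div u D \<Longrightarrow> x * F \<in> J"
  shows "quotient_map pm_scale pm_scale (\<lambda>x. x * F) (S_div u D) (I \<inter> S_div u D) (J \<inter> S_div u (D + E)) (I \<inter> S_div u (D + E))"
proof unfold_locales
  show "(x + y) * F = x * F + y * F" for x y by (simp add: ring_distribs)
  show "pm_scale c x * F = pm_scale c (x * F)" for c x by (simp add: pm_scale_mult(2))
  show "pm.subspace (S_div u D)" by (rule S_div_subspace)
  show "pm.subspace (I \<inter> S_div u D)" "pm.subspace (J \<inter> S_div u (D + E))" "pm.subspace (I \<inter> S_div u (D + E))"
    using I J S_div_subspace ideal_subspace by (auto intro!: pm.subspace_inter)
  show "x * F \<in> J \<inter> S_div u (D + E)" if "x \<in> S_div u D" for x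
    using that J FV by (auto intro: S_div_mult)
  show "x \<in> I \<inter> S_div u D" if "x \<in> S_div u D" "x * F \<in> I \<inter> S_div u (D + E)" for x
    using that nzd by (auto simp: nonzerodivisor_mod_def mult.commute)
qed

text \<open>Let \<open>?I\<close> and \<open>?J\<close> be the ideals before and after adding
  \<open>F k\<close>. Multiplication by \<open>F k\<close> identifies \<open>S / ?I\<close> in
  degree \<open>D - E k\<close> with \<open>?J / ?I\<close> in degree \<open>D\<close>, and it is
  injective because \<open>F k\<close> is a nonzerodivisor modulo \<open>?I\<close>.\<close>

lemma hilb_regular_step:
  fixes F :: "nat \<Rightarrow> ('r, 'k::field) cox"
  assumes F: "\<And>i. i \<le> k \<Longrightarrow> F i \<in> S_div u (E i)"
    and nzd: "nonzerodivisor_mod (F k) (ideal_gen (F ` {..<k}))"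
  shows "hilb (ideal_gen (F ` {..<Suc k})) D = hilb (ideal_gen (F ` {..<k})) D - hilb (ideal_gen (F ` {..<k})) (D - E k)"
proof -
  let ?I = "ideal_gen (F ` {..<k})" and ?J = "ideal_gen (F ` {..<Suc k})"
  have mono: "?I \<subseteq> ?J" by (intro hull_mono) auto
  have FJ: "x * F k \<in> ?J" for x
    by (rule ideal_multI[OF ideal_in_ideal_gen], rule hull_inc) simp
  interpret q: quotient_map pm_scale pm_scale "\<lambda>x. x * F k" "S_div u (D - E k)" "?I \<inter> S_div u (D - E k)" "?J \<inter> S_div u D" "?I \<inter> S_div u D"
    using mult_quotient_map[OF ideal_in_ideal_gen ideal_in_ideal_gen mono F[of k] nzd FJ, of "D - E k"] by simp
  have hI: "quotient_dim pm_scale (S_div u (D - E k)) (?I \<inter> S_div u (D - E k)) = enat (nat (hilb ?I (D - E k)))"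
    "hilb ?I (D - E k) \<ge> 0" by (rule hilb[OF ideal_in_ideal_gen])+
  have hc: "homog_closed u ?I" using F by (intro homog_closed_ideal_gen[where E = E]) auto
  have "quotient_dim pm_scale (S_div u (D - E k)) (?I \<inter> S_div u (D - E k)) = quotient_dim pm_scale (?J \<inter> S_div u D) (?I \<inter> S_div u D)"
  proof (rule q.quotient_dim_eq)
    show "x * F k \<in> ?I \<inter> S_div u D" if "x \<in> ?I \<inter> S_div u (D - E k)" for x
      using that ideal_multI2[OF ideal_in_ideal_gen] q.f_V by auto
    show "\<exists>x\<in>S_div u (D - E k). y - x * F k \<in> ?I \<inter> S_div u D" if y: "y \<in> ?J \<inter> S_div u D" for y
    proof -
      obtain a where a: "y - a * F k \<in> ?I"
        using y ideal_gen_insert[of "{..<k}" k y F] by (auto simp: lessThan_Suc)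
      have "y = hcomp u D ((y - a * F k) + a * F k)" using y hcomp_id[of y u D] by simp
      also have "\<dots> = hcomp u D (y - a * F k) + hcomp u (D - E k) a * F k"
        unfolding hcomp_add by (simp add: hcomp_mult[OF F[OF order_refl]])
      finally have "y - hcomp u (D - E k) a * F k = hcomp u D (y - a * F k)" by (simp add: diff_eq_eq)
      moreover have "hcomp u D (y - a * F k) \<in> ?I" using hc a unfolding homog_closed_def by blast
      ultimately show ?thesis using hcomp_S_div[of u D] hcomp_S_div[of u "D - E k" a] by (metis IntI)
    qed
  qed
  moreover have "quotient_dim pm_scale (?J \<inter> S_div u D) (?I \<inter> S_div u D) = enat (pm.dim (?J \<inter> S_div u D) - pm.dim (?I \<inter> S_div u D))"
    and le: "pm.dim (?I \<inter> S_div u D) \<le> pm.dim (?J \<inter> S_div u D)"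
  proof -
    let ?B = "(\<lambda>t. Poly_Mapping.single t (1::'k)) ` {t. div_class u (expo t) = div_class u D}"
    have "finite ?B" using S_div_dim(1) by simp
    moreover have "?J \<inter> S_div u D \<subseteq> pm.span ?B" by (subst S_div_dim(2)) simp
    ultimately show "quotient_dim pm_scale (?J \<inter> S_div u D) (?I \<inter> S_div u D) = enat (pm.dim (?J \<inter> S_div u D) - pm.dim (?I \<inter> S_div u D))"
      "pm.dim (?I \<inter> S_div u D) \<le> pm.dim (?J \<inter> S_div u D)"
      using pm.quotient_dim_subspaces[of ?B "?J \<inter> S_div u D" "?I \<inter> S_div u D"] q.V' q.W' mono by auto
  qed
  ultimately have "nat (hilb ?I (D - E k)) = pm.dim (?J \<inter> S_div u D) - pm.dim (?I \<inter> S_div u D)"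
    using hI(1) by simp
  then show ?thesis using hI(2) le by (simp add: hilb_def)
qed

lemma sum_Pow_Suc:
  fixes f :: "nat set \<Rightarrow> 'b::comm_monoid_add"
  shows "(\<Sum>J\<in>Pow {..<Suc k}. f J) = (\<Sum>J\<in>Pow {..<k}. f J) + (\<Sum>J\<in>Pow {..<k}. f (insert k J))"
proof -
  have "(\<Sum>J\<in>Pow {..<Suc k}. f J) = (\<Sum>J\<in>Pow {..<k} \<union> insert k ` Pow {..<k}. f J)"
    by (simp add: lessThan_Suc Pow_insert)
  also have "\<dots> = (\<Sum>J\<in>Pow {..<k}. f J) + (\<Sum>J\<in>insert k ` Pow {..<k}. f J)"
    by (intro sum.union_disjoint) auto
  also have "(\<Sum>J\<in>insert k ` Pow {..<k}. f J) = (\<Sum>J\<in>Pow {..<k}. f (insert k J))"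
  proof (rule sum.reindex[unfolded o_def])
    show "inj_on (insert k) (Pow {..<k})"
    proof (rule inj_onI)
      fix x y assume xy: "x \<in> Pow {..<k}" "y \<in> Pow {..<k}" "insert k x = insert k y"
      have "k \<notin> x" "k \<notin> y" using xy(1,2) by auto
      then show "x = y" using xy(3) by (metis Diff_insert_absorb)
    qed
  qed
  finally show ?thesis .
qed

text \<open>The Euler characteristic of the Koszul complex, obtained without the complex by
  iterating the previous step: subsets containing the new index come from the shifted term.\<close>

lemma hilb_regular:
  fixes F :: "nat \<Rightarrow> ('r, 'k::field) cox"
  assumes F: "\<And>i. i < n \<Longrightarrow> F i \<in> S_div u (E i)"
    and nzd: "\<And>i. i < n \<Longrightarrow> nonzerodivisor_mod (F i) (ideal_gen (F ` {..<i}))"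
    and k: "k \<le> n"
  shows "hilb (ideal_gen (F ` {..<k})) D = (\<Sum>J\<in>Pow {..<k}. (-1) ^ card J * int (card (lat u (D - (\<Sum>i\<in>J. E i)))))"
  using k
proof (induction k arbitrary: D)
  case 0
  have "ideal_gen ({} :: ('r, 'k) cox set) = {0}"
    using ideal_gen_finite[of "{} :: nat set" F] by simp
  moreover have "{0} \<inter> S_div u D = ({0} :: ('r, 'k) cox set)" by (auto simp: S_div_0)
  moreover have "pm.dim ({0} :: ('r, 'k) cox set) = 0"
    using pm.dim_unique[of "{}" "{0}" 0] by (auto simp: pm.dependent_def)
  ultimately show ?case by (simp add: hilb_def)
next
  case (Suc k)
  have step: "hilb (ideal_gen (F ` {..<Suc k})) D = hilb (ideal_gen (F ` {..<k})) D - hilb (ideal_gen (F ` {..<k})) (D - E k)"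
    using Suc.prems by (intro hilb_regular_step F nzd) auto
  have "(\<Sum>J\<in>Pow {..<k}. (-1) ^ card (insert k J) * int (card (lat u (D - (\<Sum>i\<in>insert k J. E i)))))
     = (\<Sum>J\<in>Pow {..<k}. - ((-1) ^ card J * int (card (lat u (D - E k - (\<Sum>i\<in>J. E i))))))"
  proof (rule sum.cong[OF refl])
    fix J assume J: "J \<in> Pow {..<k}"
    then have "finite J" "k \<notin> J" using finite_subset[of J "{..<k}"] by auto
    then show "(-1) ^ card (insert k J) * int (card (lat u (D - (\<Sum>i\<in>insert k J. E i)))) =
      - ((-1) ^ card J * int (card (lat u (D - E k - (\<Sum>i\<in>J. E i)))))" by (simp add: diff_diff_eq)
  qed
  then show ?case unfolding step sum_Pow_Suc using Suc by (simp add: sum_negf)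
qed

text \<open>A complete toric variety has only constant functions. Writing \<open>- of_lat m\<close>
  as a nonnegative combination of rays shows that its pairing with \<open>m\<close> is nonnegative,
  which leaves only \<open>m = 0\<close>.\<close>

lemma lat_0: "lat u 0 = {0}"
proof (intro equalityI subsetI)
  fix m assume m: "m \<in> lat u 0"
  obtain s a where a: "\<forall>j. 0 \<le> a j" "- of_lat m = (\<Sum>j\<in>s. a j *\<^sub>R of_lat (u j))"
    using cover[of "- of_lat m"] by blast
  have "of_lat m \<bullet> (- of_lat m) = (\<Sum>j\<in>s. a j * real_of_int (char_div u m $ j))"
    unfolding a(2) by (simp add: inner_sum_right inner_of_lat)
  also have "\<dots> \<ge> 0" using a(1) m by (intro sum_nonneg) (auto simp: lat_def)
  finally have "of_lat m \<bullet> of_lat m \<le> (0::real)" by simp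
  then have "of_lat m \<bullet> of_lat m = (0::real)" using inner_ge_zero[of "of_lat m"] by linarith
  then have "of_lat m = (0 :: real ^ 'n)" by simp
  then show "m \<in> {0}" using of_lat_inject[of m 0] by simp
qed (simp add: lat_def)

text \<open>A nonzero constant term makes the degree trivial, and by \<open>lat_0\<close> the only
  monomial of trivial degree is 1. This plays the role that positivity of the grading has in graded
  Nakayama arguments.\<close>

lemma homogeneous_const_unit:
  assumes "F \<in> S_div u D" "Poly_Mapping.lookup F 0 \<noteq> 0"
  shows "F = Poly_Mapping.single 0 (Poly_Mapping.lookup F 0)"
proof -
  have "0 \<in> Poly_Mapping.keys F" using assms(2) by (simp add: in_keys_iff)
  then have D: "div_class u D = div_class u 0" using assms(1) unfolding S_div_iff by (metis expo_0)
  have "t = 0" if t: "t \<in> Poly_Mapping.keys F" for t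
  proof -
    have "div_class u (expo t) = div_class u 0" using assms(1) t D by (simp add: S_div_iff)
    then obtain m where m: "expo t = char_div u m" by (auto simp: div_class_eq_iff)
    have "0 \<le> char_div u m $ j" for j unfolding m[symmetric] by (simp add: expo_nth)
    then have "m \<in> lat u 0" by (simp add: lat_def)
    then have "expo t = expo 0" using m lat_0 by simp
    then show ?thesis by (simp only: inj_eq[OF inj_expo])
  qed
  then show ?thesis
    by (intro poly_mapping_eqI) (metis in_keys_iff lookup_single_eq lookup_single_not_eq)
qed

text \<open>
  The constant terms of the two base change matrices are inverse to each other because all relations between the
  \<open>G i\<close> have coefficients in the ideal. A nonzero term of the determinant then matches the degrees.
\<close>

lemma minimal_generators_same_degrees:
  fixes F G :: "nat \<Rightarrow> ('r, 'k::field) cox"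
  assumes F: "\<And>i. i < CARD('n) \<Longrightarrow> F i \<in> S_div u (A i)" and G: "\<And>i. i < CARD('n) \<Longrightarrow> G i \<in> S_div u (E i)"
    and nzd: "\<And>i. i < CARD('n) \<Longrightarrow> nonzerodivisor_mod (G i) (ideal_gen (G ` {..<i}))"
    and eq: "ideal_gen (F ` {..<CARD('n)}) = ideal_gen (G ` {..<CARD('n)})"
    and proper: "ideal_gen (G ` {..<CARD('n)}) \<noteq> UNIV"
  obtains \<pi> where "bij_betw \<pi> {..<CARD('n)} {..<CARD('n)}" "\<And>i. i < CARD('n) \<Longrightarrow> div_class u (A i) = div_class u (E (\<pi> i))"
proof -
  let ?n = "CARD('n)" and ?I = "ideal_gen (G ` {..<CARD('n)})"
  \<comment> \<open>A generator with nonzero constant term would be a nonzero constant, and the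
    ideal would be the whole ring.\<close>
  have G0: "Poly_Mapping.lookup (G i) 0 = 0" if i: "i < ?n" for i
  proof (rule ccontr)
    assume c: "Poly_Mapping.lookup (G i) 0 \<noteq> 0"
    let ?c = "Poly_Mapping.lookup (G i) 0"
    have "G i \<in> ?I" using i by (intro hull_inc) auto
    have "Poly_Mapping.single 0 (inverse ?c) * G i \<in> ?I"
      by (rule ideal_multI[OF ideal_in_ideal_gen \<open>G i \<in> ?I\<close>])
    also have "Poly_Mapping.single 0 (inverse ?c) * G i = 1"
      using c by (subst homogeneous_const_unit[OF G[OF i] c]) (simp add: mult_single)
    finally have "1 \<in> ?I" .
    then have "x \<in> ?I" for x using ideal_multI[OF ideal_in_ideal_gen, of 1 _ x] by simp
    then show False using proper by blast
  qed
  have I0: "Poly_Mapping.lookup f 0 = 0" if f: "f \<in> ?I" for f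
  proof -
    have "f \<in> {\<Sum>i<?n. g i * G i | g. True}" using f unfolding ideal_gen_finite[OF finite_lessThan] .
    then obtain g where "f = (\<Sum>i<?n. g i * G i)" by auto
    then show ?thesis using G0 by (simp add: lookup_sum const_mult)
  qed
  have "\<forall>i\<in>{..<?n}. \<exists>g. (\<forall>j<?n. g j \<in> S_div u (A i - E j)) \<and> F i = (\<Sum>j<?n. g j * G j)"
  proof
    fix i assume i: "i \<in> {..<?n}"
    then have FI: "F i \<in> ?I" using eq by (metis hull_inc imageI)
    show "\<exists>g. (\<forall>j<?n. g j \<in> S_div u (A i - E j)) \<and> F i = (\<Sum>j<?n. g j * G j)"
    proof (rule homogeneous_combination[of "{..<?n}" G u E "F i" "A i"])
      fix g assume g: "\<And>j. j \<in> {..<?n} \<Longrightarrow> g j \<in> S_div u (A i - E j)" "F i = (\<Sum>j<?n. g j * G j)"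
      then show ?thesis by (intro exI[of _ g]) auto
    qed (use G F i FI in auto)
  qed
  from bchoice[OF this] obtain M where M: "\<And>i j. i < ?n \<Longrightarrow> j < ?n \<Longrightarrow> M i j \<in> S_div u (A i - E j)"
      "\<And>i. i < ?n \<Longrightarrow> F i = (\<Sum>j<?n. M i j * G j)" by (auto simp: Ball_def)
  have "\<forall>j\<in>{..<?n}. \<exists>g. G j = (\<Sum>i<?n. g i * F i)"
  proof
    fix j assume j: "j \<in> {..<?n}"
    then have "G j \<in> ideal_gen (F ` {..<?n})" unfolding eq by (auto intro!: hull_inc)
    then have "G j \<in> {\<Sum>i<?n. g i * F i | g. True}" unfolding ideal_gen_finite[OF finite_lessThan] .
    then show "\<exists>g. G j = (\<Sum>i<?n. g i * F i)" by auto
  qed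
  from bchoice[OF this] obtain N where N: "\<And>j. j < ?n \<Longrightarrow> G j = (\<Sum>i<?n. N j i * F i)" by auto
  define m where "m i j = Poly_Mapping.lookup (M i j) 0" for i j
  define n where "n j i = Poly_Mapping.lookup (N j i) 0" for j i
  have id: "(\<Sum>i<?n. n j i * m i l) = (if j = l then 1 else 0)" if jl: "j < ?n" "l < ?n" for j l
  proof -
    \<comment> \<open>The coefficients of the relation among the \<open>G l\<close> that arises from
      expressing \<open>G j\<close> through the \<open>F i\<close> and these through the
      \<open>G l\<close> again, minus the trivial expression of \<open>G j\<close>.\<close>
    define c where "c l = (\<Sum>i<?n. N j i * M i l) - (if j = l then 1 else 0)" for l
    have "(\<Sum>l<?n. c l * G l) = (\<Sum>l<?n. \<Sum>i<?n. N j i * M i l * G l) - (\<Sum>l<?n. (if j = l then 1 else 0) * G l)"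
      by (simp add: c_def left_diff_distrib sum_subtractf sum_distrib_right)
    also have "(\<Sum>l<?n. \<Sum>i<?n. N j i * M i l * G l) = (\<Sum>i<?n. \<Sum>l<?n. N j i * M i l * G l)" by (rule sum.swap)
    also have "\<dots> = (\<Sum>i<?n. N j i * F i)" using M(2) by (intro sum.cong) (auto simp: sum_distrib_left mult.assoc)
    also have "\<dots> = G j" using N jl by simp
    also have "(\<Sum>l<?n. (if j = l then 1 else 0) * G l) = G j"
      using jl by (simp add: if_distrib[of "\<lambda>c. c * _"] cong: if_cong)
    finally have "(\<Sum>l<?n. c l * G l) = 0" by simp
    from regular_relation[OF nzd order_refl this jl(2)] have "Poly_Mapping.lookup (c l) 0 = 0" by (intro I0) auto
    then show ?thesis by (simp add: c_def lookup_minus lookup_sum const_mult n_def m_def split: if_splits)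
  qed
  \<comment> \<open>\<open>det\<close> takes matrices indexed by a finite type, hence the
    identification of \<open>{..<CARD('n)}\<close> with \<open>'n\<close>.\<close>
  obtain b :: "'n \<Rightarrow> nat" where b: "bij_betw b UNIV {..<?n}"
    using ex_bij_betw_finite_nat[of "UNIV :: 'n set"] by (auto simp: atLeast0LessThan)
  have blt: "b i < ?n" for i using b by (auto simp: bij_betw_def)
  define Mc :: "'k ^ 'n ^ 'n" where "Mc = (\<chi> i j. m (b i) (b j))"
  define Nc :: "'k ^ 'n ^ 'n" where "Nc = (\<chi> j i. n (b j) (b i))"
  have "Nc ** Mc = mat 1"
  proof -
    have "(\<Sum>k\<in>UNIV. n (b j) (b k) * m (b k) (b l)) = (if j = l then 1 else 0)" for j l
    proof -
      have "(\<Sum>k\<in>UNIV. n (b j) (b k) * m (b k) (b l)) = (\<Sum>i<?n. n (b j) i * m i (b l))"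
        by (rule sum.reindex_bij_betw[OF b])
      also have "\<dots> = (if b j = b l then 1 else 0)" using id blt by simp
      also have "b j = b l \<longleftrightarrow> j = l" using b by (auto simp: bij_betw_def inj_eq)
      finally show ?thesis .
    qed
    then show ?thesis by (simp add: matrix_matrix_mult_def mat_def Mc_def Nc_def vec_eq_iff)
  qed
  then have "det Nc * det Mc = 1" by (metis det_mul det_I)
  then have "det Mc \<noteq> 0" by auto
  then obtain p where p: "p permutes (UNIV :: 'n set)" "(\<Prod>i\<in>UNIV. Mc $ i $ p i) \<noteq> 0"
    unfolding det_def by (metis (no_types, lifting) mem_Collect_eq mult_zero_right sum.neutral)
  define \<pi> where "\<pi> i = b (p (inv_into UNIV b i))" for i
  have ib: "bij_betw (inv_into UNIV b) {..<?n} UNIV" by (rule bij_betw_inv_into[OF b])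
  have "bij_betw (b \<circ> (p \<circ> inv_into UNIV b)) {..<?n} {..<?n}"
    by (intro bij_betw_trans[OF _ b] bij_betw_trans[OF ib]) (simp add: permutes_bij[OF p(1)])
  then have "bij_betw \<pi> {..<?n} {..<?n}" by (simp add: \<pi>_def o_def cong: bij_betw_cong)
  moreover have "div_class u (A i) = div_class u (E (\<pi> i))" if i: "i < ?n" for i
  proof -
    let ?i = "inv_into UNIV b i"
    have bi: "b ?i = i" using b i by (simp add: bij_betw_inv_into_right)
    have "Mc $ ?i $ p ?i \<noteq> 0" using p(2) by (metis (mono_tags) UNIV_I finite prod_zero_iff)
    then have "m i (\<pi> i) \<noteq> 0" by (simp add: Mc_def bi \<pi>_def)
    then have "0 \<in> Poly_Mapping.keys (M i (\<pi> i))" by (simp add: m_def in_keys_iff)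
    then have "div_class u (expo (0 :: 'r \<Rightarrow>\<^sub>0 nat)) = div_class u (A i - E (\<pi> i))"
      using M(1)[OF i, of "\<pi> i"] blt unfolding S_div_iff \<pi>_def by blast
    then show ?thesis using div_class_diff_cong[of u 0 "E (\<pi> i)" "A i"] by simp
  qed
  ultimately show thesis by (rule that)
qed

lemma div_class_sum_cong:
  assumes "\<And>i. i \<in> J \<Longrightarrow> div_class u (f i) = div_class u (g i)"
  shows "div_class u (\<Sum>i\<in>J. f i) = div_class u (\<Sum>i\<in>J. g i)"
  using assms
  by (induction J rule: infinite_finite_induct) (auto simp flip: div_class_add)

text \<open>Regularity is assumed for \<open>G\<close>, but the formula is wanted in the degrees of
  \<open>F\<close>. It is obtained for \<open>G\<close> and carried over by the permutation of
  degrees, which also permutes the index sets \<open>J\<close>.\<close>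

theorem hilb_complete_intersection:
  fixes F G :: "nat \<Rightarrow> ('r, 'k::field) cox"
  assumes F: "\<And>i. i < CARD('n) \<Longrightarrow> F i \<in> S_div u (A i)" and G: "\<And>i. i < CARD('n) \<Longrightarrow> G i \<in> S_div u (E i)"
    and nzd: "\<And>i. i < CARD('n) \<Longrightarrow> nonzerodivisor_mod (G i) (ideal_gen (G ` {..<i}))"
    and eq: "ideal_gen (F ` {..<CARD('n)}) = ideal_gen (G ` {..<CARD('n)})"
    and proper: "ideal_gen (G ` {..<CARD('n)}) \<noteq> UNIV"
  shows "hilb (ideal_gen (F ` {..<CARD('n)})) D =
    (\<Sum>J\<in>Pow {..<CARD('n)}. (-1) ^ card J * int (card (lat u (D - (\<Sum>i\<in>J. A i)))))"
proof -
  let ?n = "CARD('n)"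
  obtain \<pi> where \<pi>: "bij_betw \<pi> {..<?n} {..<?n}" "\<And>i. i < ?n \<Longrightarrow> div_class u (A i) = div_class u (E (\<pi> i))"
    using minimal_generators_same_degrees[OF F G nzd eq proper] by blast
  have inj: "inj_on \<pi> J" if "J \<in> Pow {..<?n}" for J
    using \<pi>(1) that by (auto simp: bij_betw_def intro: inj_on_subset)
  have "bij_betw ((`) \<pi>) (Pow {..<?n}) (Pow {..<?n})" by (rule bij_betw_Pow[OF \<pi>(1)])
  then have "(\<Sum>J\<in>Pow {..<?n}. (-1) ^ card J * int (card (lat u (D - (\<Sum>i\<in>J. E i))))) =
    (\<Sum>J\<in>Pow {..<?n}. (-1) ^ card (\<pi> ` J) * int (card (lat u (D - (\<Sum>i\<in>\<pi> ` J. E i)))))"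
    by (rule sum.reindex_bij_betw[symmetric])
  also have "\<dots> = (\<Sum>J\<in>Pow {..<?n}. (-1) ^ card J * int (card (lat u (D - (\<Sum>i\<in>J. A i)))))"
  proof (rule sum.cong[OF refl])
    fix J assume J: "J \<in> Pow {..<?n}"
    have "div_class u (\<Sum>i\<in>J. A i) = div_class u (\<Sum>i\<in>J. E (\<pi> i))"
      using J \<pi>(2) by (intro div_class_sum_cong) auto
    also have "(\<Sum>i\<in>J. E (\<pi> i)) = (\<Sum>i\<in>\<pi> ` J. E i)" using inj[OF J] by (simp add: sum.reindex)
    finally have cl: "div_class u (\<Sum>i\<in>J. A i) = div_class u (\<Sum>i\<in>\<pi> ` J. E i)" .
    have "div_class u (D - (\<Sum>i\<in>J. A i)) = div_class u (D - (\<Sum>i\<in>\<pi> ` J. E i))"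
    proof -
      obtain m where "(\<Sum>i\<in>J. A i) = (\<Sum>i\<in>\<pi> ` J. E i) + char_div u m" using cl by (auto simp: div_class_eq_iff)
      then have "D - (\<Sum>i\<in>J. A i) = D - (\<Sum>i\<in>\<pi> ` J. E i) + char_div u (0 - m)"
        by (simp only: char_div_diff char_div_0) simp
      then show ?thesis unfolding div_class_eq_iff by blast
    qed
    then have "card (lat u (D - (\<Sum>i\<in>J. A i))) = card (lat u (D - (\<Sum>i\<in>\<pi> ` J. E i)))" by (rule card_lat_cong)
    then show "(-1) ^ card (\<pi> ` J) * int (card (lat u (D - (\<Sum>i\<in>\<pi> ` J. E i)))) =
      (-1) ^ card J * int (card (lat u (D - (\<Sum>i\<in>J. A i))))"
      using card_image[OF inj[OF J]] by simp
  qed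
  finally show ?thesis using hilb_regular[OF G nzd order_refl, where D = D] eq by simp
qed

end

section \<open>Mixed differences of lattice point counts\<close>

context lattice_fan begin

lemma nef_vertices_scale:
  assumes "nef_vertices D p" shows "nef_vertices (of_nat k *s D) (\<lambda>s. of_nat k *s p s)"
proof -
  have c: "char_div u (of_nat k *s m) $ j = int k * char_div u m $ j" for m j
    by (simp add: char_div_def sum_distrib_left mult.assoc)
  have "char_div u (of_nat k *s m) $ j + (of_nat k *s D) $ j = int k * (char_div u m $ j + D $ j)" for m j
    unfolding c by (simp add: ring_distribs)
  then show ?thesis using assms by (simp add: nef_vertices_def lat_def)
qed

lemma lat_add: "m \<in> lat u D \<Longrightarrow> m' \<in> lat u E \<Longrightarrow> m + m' \<in> lat u (D + E)"
  unfolding lat_def by (simp add: char_div_add) (smt (verit, best))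

lemma lat_sum: "(\<And>i. i \<in> J \<Longrightarrow> m i \<in> lat u (D i)) \<Longrightarrow> (\<Sum>i\<in>J. m i) \<in> lat u (\<Sum>i\<in>J. D i)"
  by (induction J rule: infinite_finite_induct) (auto intro: lat_add simp: lat_0)

text \<open>
  Up to sign, \<open>mixed A 0\<close> is the normalized mixed volume of the polytopes of the \<open>A i\<close>. It vanishes when
  their sum is not big.
\<close>

definition mixed :: "(nat \<Rightarrow> int ^ 'r) \<Rightarrow> int ^ 'r \<Rightarrow> int" where
  "mixed A D = (\<Sum>J\<in>Pow {..<CARD('n)}. (-1) ^ card J * int (card (lat u (D + (\<Sum>i\<in>J. A i)))))"

text \<open>If the sum of the \<open>A i\<close> minus the \<open>k\<close>-th ray divisor has no
  lattice points, all lattice points of the sum satisfy the \<open>k\<close>-th inequality with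
  equality. The same follows for every partial sum, so all polytopes are flat in the direction
  \<open>u k\<close> and \<open>CARD('n)\<close> differences already exceed the dimension.\<close>

lemma mixed_0:
  assumes nef: "\<And>i. i < CARD('n) \<Longrightarrow> nef_vertices (A i) (p i)"
    and empty: "lat u ((\<Sum>i<CARD('n). A i) - axis k 1) = {}"
    and uk: "of_lat (u k) \<noteq> (0 :: real ^ 'n)"
  shows "mixed A 0 = 0"
proof -
  obtain x where x: "generic x" using exists_generic by blast
  obtain s where s: "s \<in> max_cones" using generic_unique_cone[OF x] by blast
  have p: "p i s \<in> lat u (A i)" if "i < CARD('n)" for i using nef[OF that] s by (auto simp: nef_vertices_def)
  have flat: "char_div u m $ k = - (\<Sum>i\<in>J. A i) $ k" if J: "J \<subseteq> {..<CARD('n)}" and m: "m \<in> lat u (\<Sum>i\<in>J. A i)" for J m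
  proof (rule ccontr)
    assume ne: "char_div u m $ k \<noteq> - (\<Sum>i\<in>J. A i) $ k"
    \<comment> \<open>Vertices of the missing summands complete \<open>m\<close> to a lattice point
      of the whole sum. Slacks add up, so a positive slack of \<open>m\<close> at \<open>k\<close>
      would survive and contradict \<open>empty\<close>.\<close>
    let ?q = "m + (\<Sum>i\<in>{..<CARD('n)} - J. p i s)"
    have split: "(\<Sum>i<CARD('n). A i) = (\<Sum>i\<in>J. A i) + (\<Sum>i\<in>{..<CARD('n)} - J. A i)"
      using sum.subset_diff[OF J, of A] by (simp add: add.commute)
    have q1: "(\<Sum>i\<in>{..<CARD('n)} - J. p i s) \<in> lat u (\<Sum>i\<in>{..<CARD('n)} - J. A i)"
      by (rule lat_sum) (use p in auto)
    have q: "?q \<in> lat u (\<Sum>i<CARD('n). A i)" unfolding split by (rule lat_add[OF m q1])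
    have "char_div u ?q $ k + (\<Sum>i<CARD('n). A i) $ k \<noteq> 0"
    proof -
      have "0 \<le> char_div u m $ k + (\<Sum>i\<in>J. A i) $ k" using m by (simp add: lat_def)
      moreover have "0 \<le> char_div u (\<Sum>i\<in>{..<CARD('n)} - J. p i s) $ k + (\<Sum>i\<in>{..<CARD('n)} - J. A i) $ k"
        using q1 by (simp add: lat_def)
      ultimately show ?thesis using ne unfolding split char_div_add vector_add_component by linarith
    qed
    moreover have ge: "0 \<le> char_div u ?q $ j + (\<Sum>i<CARD('n). A i) $ j" for j using q unfolding lat_def by blast
    ultimately have "1 \<le> char_div u ?q $ k + (\<Sum>i<CARD('n). A i) $ k" using ge[of k] by linarith
    then have "0 \<le> char_div u ?q $ j + ((\<Sum>i<CARD('n). A i) - axis k 1) $ j" for j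
      using ge[of j] by (cases "j = k") (simp_all only: vector_minus_component axis_def vec_lambda_beta if_True if_False add_diff_eq, simp_all)
    then have "?q \<in> lat u ((\<Sum>i<CARD('n). A i) - axis k 1)" unfolding lat_def by blast
    then show False using empty by blast
  qed
  have "(\<Sum>J\<in>Pow {..<CARD('n)}. (-1) ^ card J * real (card (lat u (0 + (\<Sum>i\<in>J. A i))))) = 0"
  proof (rule mixed_difference_lattice_points[OF _ nef_vertices_0, of _ _ p "of_lat (u k)"])
    show "CARD('n) - (if of_lat (u k) = (0 :: real ^ 'n) then 0 else 1) < card {..<CARD('n)}" using uk by simp
    show "of_lat m \<bullet> of_lat (u k) = of_lat m' \<bullet> (of_lat (u k) :: real ^ 'n)"
      if "J \<subseteq> {..<CARD('n)}" "m \<in> lat u (0 + (\<Sum>i\<in>J. A i))" "m' \<in> lat u (0 + (\<Sum>i\<in>J. A i))" for J m m'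
      using that flat[of J m] flat[of J m'] by (simp add: inner_of_lat)
  qed (use nef in auto)
  then have "real_of_int (mixed A 0) = 0" by (simp add: mixed_def)
  then show ?thesis by linarith
qed

text \<open>The difference of the two sides is a mixed difference with \<open>E\<close> as an
  additional direction, stored at the index \<open>CARD('n)\<close>; its order exceeds the
  dimension.\<close>

lemma mixed_const:
  assumes nef: "\<And>i. i < CARD('n) \<Longrightarrow> nef_vertices (A i) (p i)" and D: "nef_vertices D q" and E: "nef_vertices E r"
  shows "mixed A (D + E) = mixed A D"
proof -
  let ?n = "CARD('n)"
  define B where "B i = (if i = ?n then E else A i)" for i
  have "(\<Sum>J\<in>Pow {..<Suc ?n}. (-1) ^ card J * real (card (lat u (D + (\<Sum>i\<in>J. B i))))) = 0"
    by (rule mixed_difference_lattice_points[OF _ D, of _ _ "\<lambda>i. if i = ?n then r else p i" 0])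
      (use nef E in \<open>auto simp: B_def less_Suc_eq\<close>)
  then have "(\<Sum>J\<in>Pow {..<?n}. (-1) ^ card J * real (card (lat u (D + (\<Sum>i\<in>J. B i)))))
     + (\<Sum>J\<in>Pow {..<?n}. (-1) ^ card (insert ?n J) * real (card (lat u (D + (\<Sum>i\<in>insert ?n J. B i))))) = 0"
    unfolding sum_Pow_Suc .
  also have "(\<Sum>J\<in>Pow {..<?n}. (-1) ^ card J * real (card (lat u (D + (\<Sum>i\<in>J. B i))))) = real_of_int (mixed A D)"
  proof -
    have "(\<Sum>i\<in>J. B i) = (\<Sum>i\<in>J. A i)" if "J \<in> Pow {..<?n}" for J
      using that by (intro sum.cong) (auto simp: B_def)
    then show ?thesis by (simp add: mixed_def)
  qed
  also have "(\<Sum>J\<in>Pow {..<?n}. (-1) ^ card (insert ?n J) * real (card (lat u (D + (\<Sum>i\<in>insert ?n J. B i)))))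
     = (\<Sum>J\<in>Pow {..<?n}. - ((-1) ^ card J * real (card (lat u (D + E + (\<Sum>i\<in>J. A i))))))"
  proof (rule sum.cong[OF refl])
    fix J assume J: "J \<in> Pow {..<?n}"
    then have fin: "finite J" "?n \<notin> J" using finite_subset[of J "{..<?n}"] by auto
    have "(\<Sum>i\<in>J. B i) = (\<Sum>i\<in>J. A i)" using J by (intro sum.cong) (auto simp: B_def)
    then have "(\<Sum>i\<in>insert ?n J. B i) = E + (\<Sum>i\<in>J. A i)" using fin by (simp add: B_def)
    then show "(-1) ^ card (insert ?n J) * real (card (lat u (D + (\<Sum>i\<in>insert ?n J. B i))))
      = - ((-1) ^ card J * real (card (lat u (D + E + (\<Sum>i\<in>J. A i)))))" using fin by (simp add: add.assoc)
  qed
  also have "\<dots> = - real_of_int (mixed A (D + E))" by (simp add: mixed_def sum_negf)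
  finally show ?thesis by linarith
qed

text \<open>Complementing the subsets turns subtraction from the full sum into addition to
  \<open>D\<close>, at the cost of the sign.\<close>

lemma alternating_eq_mixed:
  "(\<Sum>J\<in>Pow {..<CARD('n)}. (-1) ^ card J * int (card (lat u (D + (\<Sum>i<CARD('n). A i) - (\<Sum>i\<in>J. A i))))) = (-1) ^ CARD('n) * mixed A D"
proof -
  let ?n = "CARD('n)"
  have "(\<Sum>J\<in>Pow {..<?n}. (-1) ^ card J * int (card (lat u (D + (\<Sum>i<?n. A i) - (\<Sum>i\<in>J. A i)))))
     = (\<Sum>J\<in>Pow {..<?n}. (-1) ^ card ({..<?n} - J) * int (card (lat u (D + (\<Sum>i<?n. A i) - (\<Sum>i\<in>{..<?n} - J. A i)))))"
    by (rule sum.reindex_bij_witness[of _ "\<lambda>J. {..<?n} - J" "\<lambda>J. {..<?n} - J"]) (auto simp: double_diff)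
  also have "\<dots> = (\<Sum>J\<in>Pow {..<?n}. (-1) ^ ?n * ((-1) ^ card J * int (card (lat u (D + (\<Sum>i\<in>J. A i))))))"
  proof (rule sum.cong[OF refl])
    fix J assume "J \<in> Pow {..<?n}"
    then have J: "J \<subseteq> {..<?n}" by simp
    have c: "card J \<le> ?n" using card_mono[OF _ J] by simp
    have "card ({..<?n} - J) = ?n - card J" using J by (subst card_Diff_subset) (auto intro: finite_subset)
    then have "((-1)::int) ^ card ({..<?n} - J) = (-1) ^ ?n * (-1) ^ card J"
      using c by (simp add: minus_one_power_iff)
    moreover have "D + (\<Sum>i<?n. A i) - (\<Sum>i\<in>{..<?n} - J. A i) = D + (\<Sum>i\<in>J. A i)"
      using sum.subset_diff[OF J, of A] by (simp add: algebra_simps)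
    ultimately show "(-1) ^ card ({..<?n} - J) * int (card (lat u (D + (\<Sum>i<?n. A i) - (\<Sum>i\<in>{..<?n} - J. A i))))
      = (-1) ^ ?n * ((-1) ^ card J * int (card (lat u (D + (\<Sum>i\<in>J. A i)))))" by (simp only: mult.assoc)
  qed
  finally show ?thesis by (simp add: mixed_def sum_distrib_left)
qed

end

text \<open>\<open>A0\<close> is a divisor of class \<open>\<alpha>\<^sub>1 + \<dots> + \<alpha>\<^sub>n\<close>.\<close>

locale regularity_setup = toric \<Sigma> u
  for \<Sigma> :: "(real ^ 'n::finite) set set" and u :: "'r::finite \<Rightarrow> int ^ 'n" +
  fixes I :: "('r, 'k::field) cox set" and A0 :: "int ^ 'r" and h :: "'r \<Rightarrow> ('r, 'k) cox"
  assumes I: "homog_closed u I" and one_notin: "1 \<notin> I"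
    and h: "h j \<in> S_div u (axis j 1)" "nonzerodivisor_mod (h j) I"
    and stable: "hilb I (of_nat (Suc t) *s A0) = hilb I A0"
    and A0_eff: "lat u A0 \<noteq> {}"
    and big: "hilb I A0 \<noteq> 0 \<Longrightarrow> lat u (A0 - axis j 1) \<noteq> {}"
begin

section \<open>Growth of the Hilbert function along nonzerodivisors\<close>

lemma I_ideal: "ideal_in UNIV I" using I by (simp add: homog_closed_def)

lemma nzd_mult: "nonzerodivisor_mod a I \<Longrightarrow> nonzerodivisor_mod b I \<Longrightarrow> nonzerodivisor_mod (a * b) I"
  unfolding nonzerodivisor_mod_def by (metis mult.assoc)

lemma nzd_1: "nonzerodivisor_mod 1 I" by (simp add: nonzerodivisor_mod_def)

lemma nzd_power: "nonzerodivisor_mod a I \<Longrightarrow> nonzerodivisor_mod (a ^ k) I"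
  by (induction k) (auto intro: nzd_mult nzd_1)

lemma nzd_D: "nonzerodivisor_mod a I \<Longrightarrow> a * f \<in> I \<Longrightarrow> f \<in> I"
  by (simp add: nonzerodivisor_mod_def)

text \<open>The product of the \<open>h j\<close> with the exponents of \<open>t\<close> as
  multiplicities: nonzerodivisors exist in every degree that contains a monomial.\<close>

lemma exists_nzd: "\<exists>a \<in> S_div u (expo t). nonzerodivisor_mod a I"
proof -
  have "\<exists>a \<in> S_div u (\<Sum>j\<in>T. of_nat (Poly_Mapping.lookup t j) *s axis j 1). nonzerodivisor_mod a I" for T
  proof (induction T rule: infinite_finite_induct)
    case (insert j T)
    then obtain a where a: "a \<in> S_div u (\<Sum>j\<in>T. of_nat (Poly_Mapping.lookup t j) *s axis j 1)" "nonzerodivisor_mod a I" by blast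
    have "h j ^ Poly_Mapping.lookup t j * a \<in> S_div u (\<Sum>j\<in>insert j T. of_nat (Poly_Mapping.lookup t j) *s axis j 1)"
      using S_div_mult[OF S_div_power[OF h(1)] a(1)] insert.hyps by simp
    then show ?case using nzd_mult[OF nzd_power[OF h(2)] a(2)] by blast
  qed (auto intro: S_div_1 nzd_1)
  from this[of UNIV] show ?thesis
  proof -
    have "(\<Sum>j\<in>UNIV. of_nat (Poly_Mapping.lookup t j) *s axis j 1) = expo t"
      by (simp add: vec_eq_iff expo_nth axis_def if_distrib[of "\<lambda>c. _ * c"] cong: if_cong)
    then show ?thesis using \<open>\<exists>a \<in> S_div u (\<Sum>j\<in>UNIV. of_nat (Poly_Mapping.lookup t j) *s axis j 1). nonzerodivisor_mod a I\<close> by simp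
  qed
qed

lemma lat_nonempty_monomial: "lat u D \<noteq> {} \<longleftrightarrow> (\<exists>t. div_class u (expo t) = div_class u D)"
  using bij_betw_imp_surj_on[OF bij_monomials_lat[of D]] by blast

lemma exists_nzd_lat: assumes "lat u D \<noteq> {}" shows "\<exists>a \<in> S_div u D. nonzerodivisor_mod a I"
proof -
  obtain t where "div_class u (expo t) = div_class u D" using assms lat_nonempty_monomial by blast
  then have "S_div u (expo t) = (S_div u D :: ('r, 'k) cox set)" by (simp add: S_div_def)
  then show ?thesis using exists_nzd by metis
qed

definition g :: "('r, 'k) cox" where "g = (SOME a. a \<in> S_div u A0 \<and> nonzerodivisor_mod a I)"

lemma g: "g \<in> S_div u A0" "nonzerodivisor_mod g I"
proof -
  have "\<exists>a. a \<in> S_div u A0 \<and> nonzerodivisor_mod a I" using exists_nzd_lat[OF A0_eff] by blast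
  from someI_ex[OF this] show "g \<in> S_div u A0" "nonzerodivisor_mod g I" by (auto simp: g_def)
qed

lemma quotient_map_I:
  assumes "a \<in> S_div u E" "nonzerodivisor_mod a I"
  shows "quotient_map pm_scale pm_scale (\<lambda>x. x * a) (S_div u D) (I \<inter> S_div u D) (UNIV \<inter> S_div u (D + E)) (I \<inter> S_div u (D + E))"
  by (rule mult_quotient_map[OF I_ideal _ _ assms]) (auto simp: ideal_in_UNIV)

lemma hilb_mono:
  assumes "a \<in> S_div u E" "nonzerodivisor_mod a I" shows "hilb I D \<le> hilb I (D + E)"
proof -
  interpret q: quotient_map pm_scale pm_scale "\<lambda>x. x * a" "S_div u D" "I \<inter> S_div u D" "UNIV \<inter> S_div u (D + E)" "I \<inter> S_div u (D + E)"
    by (rule quotient_map_I[OF assms])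
  have "nat (hilb I D) \<le> nat (hilb I (D + E))" using q.quotient_dim_mono hilb(1)[OF I_ideal] by simp
  then show ?thesis using hilb(2)[OF I_ideal, of "D + E"] hilb(2)[OF I_ideal, of D] by linarith
qed

text \<open>Equal values of the Hilbert function upgrade the injective multiplication by a
  nonzerodivisor to a bijection modulo \<open>I\<close>.\<close>

lemma hilb_surj:
  assumes a: "a \<in> S_div u E" "nonzerodivisor_mod a I" and eq: "hilb I D = hilb I (D + E)" and y: "y \<in> S_div u (D + E)"
  shows "\<exists>x\<in>S_div u D. y - x * a \<in> I"
proof -
  interpret q: quotient_map pm_scale pm_scale "\<lambda>x. x * a" "S_div u D" "I \<inter> S_div u D" "UNIV \<inter> S_div u (D + E)" "I \<inter> S_div u (D + E)"
    by (rule quotient_map_I[OF a])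
  show ?thesis using q.surj_if_dim_eq[of "nat (hilb I D)" y] hilb(1)[OF I_ideal] eq y by auto
qed

text \<open>Otherwise the whole graded piece, including \<open>g\<close>, would lie in
  \<open>I\<close>, and cancelling \<open>g\<close> would give \<open>1 \<in> I\<close>.\<close>

lemma hilb_A0_nonzero: "hilb I A0 \<noteq> 0"
proof
  assume 0: "hilb I A0 = 0"
  \<comment> \<open>Zero is written as the cardinality of an empty basis, modulo which
    \<open>g\<close> has to be an empty combination.\<close>
  have "quotient_dim pm_scale (S_div u A0) (I \<inter> S_div u A0) = enat (card ({} :: ('r, 'k) cox set))"
    using hilb(1)[OF I_ideal, of A0] 0 by simp
  then obtain c where "g - (\<Sum>b\<in>{}. pm_scale (c b) b) \<in> I \<inter> S_div u A0"
  proof (rule pm.quotient_dim_spanning[rotated])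
    show "pm.subspace (I \<inter> S_div u A0)" by (intro pm.subspace_inter ideal_subspace I_ideal S_div_subspace)
    show "pm.indep_mod (I \<inter> S_div u A0) {}" by (simp add: pm.indep_mod_def)
  qed (use g in auto)
  then have "g * 1 \<in> I" by simp
  then show False using nzd_D[OF g(2)] one_notin by blast
qed

text \<open>The use of bigness: every variable has a complementary monomial with product in the
  class of \<open>A0\<close>. Hence a monomial of total degree \<open>k\<close> is complemented to
  \<open>k\<close> times that class.\<close>

lemma exists_complement: "\<exists>k. \<exists>t'. div_class u (expo t + expo t') = div_class u (of_nat k *s A0)"
proof -
  have "\<forall>j. \<exists>t. div_class u (expo t) = div_class u (A0 - axis j 1)"
    using big[OF hilb_A0_nonzero] lat_nonempty_monomial by blast
  then obtain c where c: "\<And>j. div_class u (expo (c j)) = div_class u (A0 - axis j 1)" by metis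
  have pure_power: "\<exists>t'. div_class u (expo (Poly_Mapping.single j n) + expo t') = div_class u (of_nat n *s A0)" for j n
  proof (induction n)
    case (Suc n)
    then obtain t' where t': "div_class u (expo (Poly_Mapping.single j n) + expo t') = div_class u (of_nat n *s A0)" by blast
    have e1: "expo (Poly_Mapping.single j 1) = axis j 1" by (simp add: vec_eq_iff expo_nth lookup_single axis_def when_def)
    have e2: "Poly_Mapping.single j (Suc n) = Poly_Mapping.single j n + Poly_Mapping.single j 1" by (simp flip: single_add)
    have "expo (Poly_Mapping.single j (Suc n)) + expo (t' + c j) = (expo (Poly_Mapping.single j n) + expo t') + (axis j 1 + expo (c j))"
      unfolding e2 expo_add e1 by (simp add: add_ac)
    then have "div_class u (expo (Poly_Mapping.single j (Suc n)) + expo (t' + c j))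
       = div_class u (of_nat n *s A0) + div_class u (axis j 1 + (A0 - axis j 1))"
      using t' c[of j] by (metis div_class_add)
    also have "\<dots> = div_class u (of_nat n *s A0 + A0)" by (simp add: div_class_add)
    also have "of_nat n *s A0 + A0 = of_nat (Suc n) *s A0" by (simp add: vec_eq_iff ring_distribs)
    finally show ?case by blast
  qed (auto intro: exI[of _ 0])
  show ?thesis
  proof (induction t rule: poly_mapping_additive_induct)
    case zero
    then show ?case by (intro exI[of _ 0]) auto
  next
    case (add p q)
    then obtain k k' t t' where "div_class u (expo p + expo t) = div_class u (of_nat k *s A0)"
      "div_class u (expo q + expo t') = div_class u (of_nat k' *s A0)" by blast
    then have "div_class u ((expo p + expo t) + (expo q + expo t')) = div_class u (of_nat k *s A0 + of_nat k' *s A0)"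
      by (metis div_class_add)
    moreover have "(expo p + expo t) + (expo q + expo t') = expo (p + q) + expo (t + t')" by (simp add: expo_add add_ac)
    moreover have "of_nat k *s A0 + of_nat k' *s A0 = of_nat (k + k') *s A0" by (simp add: vec_eq_iff ring_distribs)
    ultimately show ?case by metis
  next
    case (single j n)
    show ?case using pure_power[of j n] by (intro exI[of _ n])
  qed
qed

text \<open>A monomial in the class of \<open>A0\<close> lets the multiple grow, so that one
  multiple can serve finitely many monomials.\<close>

lemma exists_complement_large:
  "\<exists>k0. \<forall>k\<ge>k0. \<exists>t'. div_class u (expo t + expo t') = div_class u (of_nat k *s A0)"
proof -
  obtain k0 t0 where t0: "div_class u (expo t + expo t0) = div_class u (of_nat k0 *s A0)" using exists_complement by blast
  obtain a where a: "div_class u (expo a) = div_class u A0" using A0_eff lat_nonempty_monomial by blast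
  have "\<exists>t'. div_class u (expo t + expo t') = div_class u (of_nat (k0 + l) *s A0)" for l
  proof (induction l)
    case 0 then show ?case using t0 by auto
  next
    case (Suc l)
    then obtain t' where "div_class u (expo t + expo t') = div_class u (of_nat (k0 + l) *s A0)" by blast
    then have "div_class u (expo t + expo t' + expo a) = div_class u (of_nat (k0 + l) *s A0 + A0)" using a by (metis div_class_add)
    moreover have "of_nat (k0 + l) *s A0 + A0 = of_nat (k0 + Suc l) *s A0" by (simp add: vec_eq_iff ring_distribs)
    ultimately show ?case by (metis expo_add add.assoc)
  qed
  then show ?thesis by (metis le_Suc_ex)
qed

theorem hilb_A0_plus_effective: "hilb I (A0 + expo t) = hilb I A0"
proof (rule antisym)
  show "hilb I A0 \<le> hilb I (A0 + expo t)" using exists_nzd[of t] hilb_mono by blast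
  obtain k t' where t': "div_class u (expo t + expo t') = div_class u (of_nat k *s A0)" using exists_complement by blast
  have "hilb I (A0 + expo t) \<le> hilb I (A0 + expo t + expo t')" using exists_nzd[of t'] hilb_mono by blast
  also have "\<dots> = hilb I (of_nat (Suc k) *s A0)"
  proof (rule hilb_cong)
    have "div_class u (A0 + expo t + expo t') = div_class u (A0 + of_nat k *s A0)"
      using t' by (metis div_class_add add.assoc)
    also have "A0 + of_nat k *s A0 = of_nat (Suc k) *s A0" by (simp add: vec_eq_iff ring_distribs)
    finally show "div_class u (A0 + expo t + expo t') = div_class u (of_nat (Suc k) *s A0)" .
  qed
  finally show "hilb I (A0 + expo t) \<le> hilb I A0" by (simp only: stable)
qed

end

section \<open>Zero-dimensional rings and saturation\<close>

definition subring_of :: "'a::comm_ring_1 set \<Rightarrow> bool" where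
  "subring_of R \<longleftrightarrow> 1 \<in> R \<and> (\<forall>x\<in>R. \<forall>y\<in>R. x + y \<in> R \<and> x * y \<in> R \<and> x - y \<in> R)"

lemma ideal_in_iff:
  "ideal_in R J \<longleftrightarrow> J \<subseteq> R \<and> 0 \<in> J \<and> (\<forall>x\<in>J. \<forall>y\<in>J. x + y \<in> J) \<and> (\<forall>a\<in>R. \<forall>x\<in>J. a * x \<in> J)"
  by (auto simp: ideal_in_def submodule_over_def)

lemma ideal_adjoin:
  assumes R: "subring_of R" and M: "ideal_in R M" and a: "a \<in> R"
  shows "ideal_in R {m + a * r | m r. m \<in> M \<and> r \<in> R}" (is "ideal_in R ?X")
    and "M \<subseteq> {m + a * r | m r. m \<in> M \<and> r \<in> R}" and "a \<in> {m + a * r | m r. m \<in> M \<and> r \<in> R}"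
proof -
  note M' = M[unfolded ideal_in_iff]
  have R0: "0 \<in> R" "1 \<in> R" using M' R by (auto simp: subring_of_def)
  show "ideal_in R ?X"
    unfolding ideal_in_iff
  proof (intro conjI ballI subsetI)
    show "x \<in> R" if "x \<in> ?X" for x using that M' a R unfolding subring_of_def by blast
    show "0 \<in> ?X" using M' R0 by (intro CollectI exI[of _ 0]) auto
    show "x + y \<in> ?X" if xy: "x \<in> ?X" "y \<in> ?X" for x y
    proof -
      obtain m r m' r' where "x = m + a * r" "y = m' + a * r'" "m \<in> M" "r \<in> R" "m' \<in> M" "r' \<in> R" using xy by blast
      moreover from this have "x + y = (m + m') + a * (r + r')" by (simp add: algebra_simps)
      ultimately show ?thesis using M' R unfolding subring_of_def by blast
    qed
    show "c * x \<in> ?X" if cx: "c \<in> R" "x \<in> ?X" for c x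
    proof -
      obtain m r where "x = m + a * r" "m \<in> M" "r \<in> R" using cx by blast
      moreover from this have "c * x = c * m + a * (c * r)" by (simp add: algebra_simps)
      ultimately show ?thesis using M' R cx(1) unfolding subring_of_def by blast
    qed
  qed
  show "M \<subseteq> ?X"
  proof
    fix m assume m: "m \<in> M"
    have "m = m + a * 0" by simp
    then show "m \<in> ?X" using m R0 by blast
  qed
  have "a = 0 + a * 1" by simp
  moreover have "0 \<in> M" using M' by blast
  ultimately show "a \<in> ?X" using R0 by blast
qed

text \<open>Krull's argument: an ideal that is maximal among those containing \<open>Y\<close> and
  disjoint from a multiplicative set is prime.\<close>

lemma exists_prime_avoiding:
  assumes R: "subring_of R" and Y: "ideal_in R Y"
    and W: "W \<subseteq> R" "1 \<in> W" "\<And>a b. a \<in> W \<Longrightarrow> b \<in> W \<Longrightarrow> a * b \<in> W" "W \<inter> Y = {}"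
  obtains P where "prime_in R P" "Y \<subseteq> P" "P \<inter> W = {}"
proof -
  let ?A = "{J. ideal_in R J \<and> Y \<subseteq> J \<and> J \<inter> W = {}}"
  have "\<exists>M\<in>?A. \<forall>X\<in>?A. M \<subseteq> X \<longrightarrow> X = M"
  proof (rule subset_Zorn_nonempty)
    show "?A \<noteq> {}" using Y W(4) by blast
    fix C assume C: "C \<noteq> {}" "subset.chain ?A C"
    have CA: "C \<subseteq> ?A" and tot: "\<And>x y. x \<in> C \<Longrightarrow> y \<in> C \<Longrightarrow> x \<subseteq> y \<or> y \<subseteq> x"
      using C(2) unfolding subset_chain_def by auto
    have "ideal_in R (\<Union>C)"
      unfolding ideal_in_iff
    proof (intro conjI ballI)
      show "\<Union>C \<subseteq> R" using CA by (auto simp: ideal_in_iff)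
      show "0 \<in> \<Union>C" using C(1) CA by (auto simp: ideal_in_iff)
      show "a * x \<in> \<Union>C" if "a \<in> R" "x \<in> \<Union>C" for a x using that CA by (fastforce simp: ideal_in_iff)
      show "x + y \<in> \<Union>C" if xy: "x \<in> \<Union>C" "y \<in> \<Union>C" for x y
      proof -
        obtain X Z where XZ: "x \<in> X" "X \<in> C" "y \<in> Z" "Z \<in> C" using xy by blast
        obtain V where V: "V \<in> C" "x \<in> V" "y \<in> V" using tot[OF XZ(2,4)] XZ by blast
        then have "x + y \<in> V" using CA by (auto simp: ideal_in_iff)
        then show ?thesis using V by blast
      qed
    qed
    then show "\<Union>C \<in> ?A" using C(1) CA by blast
  qed
  then obtain M where M0: "M \<in> ?A" "\<forall>X\<in>?A. M \<subseteq> X \<longrightarrow> X = M" by (rule bexE)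
  then have M: "ideal_in R M" "Y \<subseteq> M" "M \<inter> W = {}" by simp_all
  note M' = M(1)[unfolded ideal_in_iff]
  \<comment> \<open>By maximality the ideal enlarged by \<open>a\<close> meets \<open>W\<close>. Two
    such elements, for \<open>a\<close> and for \<open>b\<close>, have a product in \<open>W\<close>
    that would lie in \<open>M\<close> if \<open>a * b\<close> did.\<close>
  have meets: "\<exists>m\<in>M. \<exists>r\<in>R. m + a * r \<in> W" if a: "a \<in> R" "a \<notin> M" for a
  proof (rule ccontr)
    assume no: "\<not> ?thesis"
    let ?X = "{m + a * r | m r. m \<in> M \<and> r \<in> R}"
    have "?X \<in> ?A" using ideal_adjoin(1,2)[OF R M(1) a(1)] M(2) no by blast
    then have "?X = M" using M0(2) ideal_adjoin(2)[OF R M(1) a(1)] by simp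
    then show False using ideal_adjoin(3)[OF R M(1) a(1)] a(2) by simp
  qed
  have "prime_in R M"
    unfolding prime_in_def
  proof (intro conjI ballI impI)
    show "ideal_in R M" by (rule M)
    show "M \<noteq> R" using M(3) W(1,2) by blast
    fix a b assume ab: "a \<in> R" "b \<in> R" "a * b \<in> M"
    show "a \<in> M \<or> b \<in> M"
    proof (rule ccontr)
      assume "\<not> (a \<in> M \<or> b \<in> M)"
      then obtain m r m' r' where mr: "m \<in> M" "r \<in> R" "m + a * r \<in> W" "m' \<in> M" "r' \<in> R" "m' + b * r' \<in> W"
        using meets ab by metis
      have "(m + a * r) * (m' + b * r') = (m' + b * r') * m + ((a * r) * m' + (r * r') * (a * b))" by (simp add: algebra_simps)
      moreover have "(m' + b * r') * m \<in> M" "(a * r) * m' \<in> M" "(r * r') * (a * b) \<in> M"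
        using mr ab M' R W(1) unfolding subring_of_def by blast+
      ultimately have "(m + a * r) * (m' + b * r') \<in> M" using M' by metis
      moreover have "(m + a * r) * (m' + b * r') \<in> W" using mr W(3) by blast
      ultimately show False using M(3) by blast
    qed
  qed
  then show thesis using that M by blast
qed

text \<open>In a zero-dimensional ring every prime ideal is minimal and hence consists of zero divisors.\<close>

lemma zero_dimensional_nonzerodivisor_unit:
  assumes R: "subring_of R" and Y: "ideal_in R Y"
    and dim: "\<And>P Q. prime_in R P \<Longrightarrow> prime_in R Q \<Longrightarrow> Y \<subseteq> P \<Longrightarrow> \<not> P \<subset> Q"
    and f: "f \<in> R" "\<And>q. q \<in> R \<Longrightarrow> f * q \<in> Y \<Longrightarrow> q \<in> Y"
  obtains q where "q \<in> R" "f * q - 1 \<in> Y"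
proof (rule ccontr)
  assume no: "\<not> thesis"
  note Y' = Y[unfolded ideal_in_iff]
  have R1: "0 \<in> R" "1 \<in> R" using Y' R by (auto simp: subring_of_def)
  let ?J = "{y + f * r | y r. y \<in> Y \<and> r \<in> R}"
  note J = ideal_adjoin[OF R Y f(1)]
  have "1 \<notin> ?J"
  proof
    assume "1 \<in> ?J"
    then obtain y r where yr: "1 = y + f * r" "y \<in> Y" "r \<in> R" by blast
    have "f * r - 1 = (0 - 1) * y" using yr(1) by (simp add: algebra_simps)
    moreover have "(0 - 1) * y \<in> Y" using Y' R R1 yr(2) unfolding subring_of_def by blast
    ultimately show False using no that yr(3) by metis
  qed
  then obtain m where m: "prime_in R m" "?J \<subseteq> m" "m \<inter> {1} = {}"
    using exists_prime_avoiding[OF R J(1), of "{1}"] R1 by auto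
  note m' = m(1)[unfolded prime_in_def ideal_in_iff]
  have Ym: "Y \<subseteq> m" and fm: "f \<in> m" using subset_trans[OF J(2) m(2)] subsetD[OF m(2) J(3)] by simp_all
  have fk: "f ^ k \<in> R" for k using f(1) R R1(2) by (induction k) (auto simp: subring_of_def)
  \<comment> \<open>The multiplicative set generated by \<open>f\<close> and the complement of
    \<open>m\<close>. It misses \<open>Y\<close> because \<open>f\<close> can be cancelled modulo
    \<open>Y\<close> and \<open>Y \<subseteq> m\<close>. A prime avoiding it lies in
    \<open>m\<close> and does not contain \<open>f \<in> m\<close>, so it is strictly
    smaller.\<close>
  let ?W = "{s * f ^ k | s k. s \<in> R \<and> s \<notin> m}"
  have "?W \<subseteq> R" using fk R unfolding subring_of_def by blast
  moreover have W1: "s \<in> ?W" if "s \<in> R" "s \<notin> m" for s using that by (intro CollectI exI[of _ s] exI[of _ 0]) auto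
  then have "1 \<in> ?W" using R1(2) m(3) by blast
  moreover have "a * b \<in> ?W" if ab: "a \<in> ?W" "b \<in> ?W" for a b
  proof -
    obtain s k s' k' where "a = s * f ^ k" "b = s' * f ^ k'" and s: "s \<in> R" "s \<notin> m" "s' \<in> R" "s' \<notin> m" using ab by blast
    then have "a * b = (s * s') * f ^ (k + k')" by (simp add: power_add mult_ac)
    moreover have "s * s' \<in> R" using s R by (auto simp: subring_of_def)
    moreover have "s * s' \<notin> m" using s m' by blast
    ultimately show ?thesis by blast
  qed
  moreover have "?W \<inter> Y = {}"
  proof -
    have "s \<in> Y" if s: "s \<in> R" "s * f ^ k \<in> Y" for s k
      using s(2)
    proof (induction k)
      case (Suc k)
      have "s * f ^ k \<in> R" using s(1) fk R by (auto simp: subring_of_def)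
      moreover have "f * (s * f ^ k) \<in> Y" using Suc.prems by (simp add: mult_ac)
      ultimately show ?case using f(2) Suc.IH by blast
    qed simp
    then show ?thesis using Ym by blast
  qed
  ultimately obtain P where P: "prime_in R P" "Y \<subseteq> P" "P \<inter> ?W = {}"
    using exists_prime_avoiding[OF R Y, of ?W] by blast
  have PR: "P \<subseteq> R" using P(1) by (simp add: prime_in_def ideal_in_iff)
  have "P \<subseteq> m"
  proof
    fix p assume p: "p \<in> P"
    show "p \<in> m"
    proof (rule ccontr)
      assume "p \<notin> m"
      then have "p \<in> ?W" using W1 p PR by blast
      then show False using P(3) p by blast
    qed
  qed
  moreover have "f \<notin> P"
  proof -
    have "f \<in> ?W" using R1(2) m(3) by (intro CollectI exI[of _ 1]) (auto intro!: exI[of _ 1])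
    then show ?thesis using P(3) by blast
  qed
  ultimately show False using dim[OF P(1) m(1) P(2)] fm by blast
qed

text \<open>Pigeonhole: among sufficiently many factors \<open>G i\<close> one occurs
  \<open>N\<close> times. For the induction the exponents may differ: passing from \<open>F\<close>
  to \<open>F * G i\<close> lowers the exponent of \<open>i\<close> by one, and an exponent 0 means
  that \<open>F\<close> is in \<open>J\<close>.\<close>

lemma saturationI:
  fixes G :: "'i \<Rightarrow> 'a::comm_ring_1"
  assumes J: "ideal_in UNIV J" and A: "finite A" "A \<noteq> {}" and F: "\<And>i. i \<in> A \<Longrightarrow> F * G i ^ N \<in> J"
  shows "F \<in> saturation J (ideal_gen (G ` A))"
proof -
  have "\<forall>H\<in>ideal_power (ideal_gen (G ` A)) K. F * H \<in> J"
    if "sum k A = K" "\<And>i. i \<in> A \<Longrightarrow> F * G i ^ k i \<in> J" for K k F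
    using that
  proof (induction K arbitrary: k F)
    case 0
    \<comment> \<open>The exponents sum to 0 and \<open>A\<close> is nonempty, so some exponent is
      0. The zeroth power of an ideal is the whole ring, hence all multiples of \<open>F\<close> are
      needed.\<close>
    then obtain i where "i \<in> A" "k i = 0" using A by auto
    then have "F \<in> J" using 0(2)[of i] by simp
    then show ?case using ideal_multI2[OF J] by simp
  next
    case (Suc K)
    show ?case
    proof (cases "\<exists>i\<in>A. k i = 0")
      case True
      then obtain i where "i \<in> A" "k i = 0" by blast
      then have "F \<in> J" using Suc.prems(2)[of i] by simp
      then show ?thesis using ideal_multI2[OF J] by blast
    next
      case False
      let ?B = "ideal_gen (G ` A)"
      have gen: "F * G i * H \<in> J" if i: "i \<in> A" and H: "H \<in> ideal_power ?B K" for i H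
      proof -
        let ?k = "k(i := k i - 1)"
        have "sum ?k A = K"
        proof -
          have "sum k A = k i + sum k (A - {i})" "sum ?k A = ?k i + sum ?k (A - {i})"
            by (rule sum.remove[OF A(1) i])+
          moreover have "sum ?k (A - {i}) = sum k (A - {i})" by (intro sum.cong) auto
          moreover have "k i > 0" using False i by auto
          ultimately show ?thesis using Suc.prems(1) by simp
        qed
        moreover have "F * G i * G l ^ ?k l \<in> J" if l: "l \<in> A" for l
        proof (cases "l = i")
          case True
          have "k i > 0" using False i by auto
          then have "F * G i * G i ^ (k i - 1) = F * G i ^ k i" by (simp add: mult.assoc power_Suc[symmetric] del: power_Suc)
          then show ?thesis using True Suc.prems(2)[OF i] by simp
        next
          case False
          have "G i * (F * G l ^ k l) \<in> J" by (rule ideal_multI[OF J Suc.prems(2)[OF l]])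
          then show ?thesis using False by (simp add: mult_ac)
        qed
        ultimately show ?thesis using Suc.IH[of ?k "F * G i"] H by blast
      qed
      have "{f * g | f g. f \<in> ?B \<and> g \<in> ideal_power ?B K} \<subseteq> {H. F * H \<in> J}"
      proof
        fix x assume "x \<in> {f * g | f g. f \<in> ?B \<and> g \<in> ideal_power ?B K}"
        then obtain b H where x: "x = b * H" "b \<in> ?B" "H \<in> ideal_power ?B K" by blast
        have "b \<in> {\<Sum>i\<in>A. c i * G i | c. True}" using x(2) unfolding ideal_gen_finite[OF A(1)] .
        then obtain c where b: "b = (\<Sum>i\<in>A. c i * G i)" by auto
        have "F * x = (\<Sum>i\<in>A. c i * (F * G i * H))"
          unfolding x(1) b by (simp add: sum_distrib_left sum_distrib_right mult_ac)
        also have "\<dots> \<in> J" by (intro ideal_sumI[OF J] ideal_multI[OF J] gen x(3))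
        finally show "x \<in> {H. F * H \<in> J}" by simp
      qed
      moreover have "ideal_in UNIV {H. F * H \<in> J}"
        unfolding ideal_in_UNIV
        using ideal_0I[OF J] ideal_addI[OF J] ideal_multI[OF J]
        by (auto simp: ring_distribs mult.left_commute)
      ultimately have "ideal_power ?B (Suc K) \<subseteq> {H. F * H \<in> J}" by (simp add: hull_minimal)
      then show ?thesis by blast
    qed
  qed
  from this[where k = "\<lambda>_. N", OF refl] F show ?thesis unfolding saturation_def by blast
qed

section \<open>Global sections of the zero-dimensional subscheme\<close>

abbreviation xpow :: "'e \<Rightarrow> ('e::comm_monoid_add \<Rightarrow>\<^sub>0 'k::field)" where
  "xpow e \<equiv> Poly_Mapping.single e 1"

lemma xpow_mult: "xpow a * xpow b = xpow (a + b)" by (simp add: mult_single)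

lemma xpow_mult_left: "xpow a * (xpow b * f) = xpow (a + b) * f" by (simp add: mult_single flip: mult.assoc)

lemma push_expo_mult: "push expo (F * G) = push expo F * push expo G"
  by (rule push_mult) (rule expo_add)

lemma push_char_div_mult: "push (char_div u) (f * g) = push (char_div u) f * push (char_div u) g"
  by (rule push_mult) (rule char_div_add)

definition xhat :: "('r::finite \<Rightarrow> int ^ 'n::finite) \<Rightarrow> (real ^ 'n) set \<Rightarrow> ('r, 'k::field) cox" where
  "xhat u \<sigma> = xpow (hat_expo u \<sigma>)"

lemma expo_hat: "expo (hat_expo u \<sigma>) $ j = (if j \<in> rays u \<sigma> then 0 else 1)"
  by (simp add: expo_nth hat_expo_def lookup_sum lookup_single when_def rays_def)

lemma push_expo_xhat:
  fixes u :: "'r::finite \<Rightarrow> int ^ 'n::finite"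
  shows "push expo (xhat u \<sigma> ^ k :: ('r, 'k::field) cox) = xpow (of_nat k *s expo (hat_expo u \<sigma>))"
proof (induction k)
  case 0
  show ?case using push_single[of expo "0 :: 'r \<Rightarrow>\<^sub>0 nat" "1 :: 'k"] by (simp del: push_single)
next
  case (Suc k)
  have "of_nat (Suc k) *s expo (hat_expo u \<sigma>) = expo (hat_expo u \<sigma>) + of_nat k *s expo (hat_expo u \<sigma>)"
    by (simp add: vec_eq_iff ring_distribs)
  moreover have "push expo (xhat u \<sigma> ^ Suc k) = xpow (expo (hat_expo u \<sigma>)) * push expo (xhat u \<sigma> ^ k :: ('r, 'k) cox)"
    by (simp add: push_expo_mult) (simp add: xhat_def)
  ultimately show ?case by (simp only: Suc xpow_mult)
qed

lemma xhat_S_div: "xhat u \<sigma> ^ k \<in> S_div u (of_nat k *s expo (hat_expo u \<sigma>))"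
  by (rule S_div_power) (simp add: xhat_def S_div_monom)

lemma push_expo_monom: assumes "\<And>j. 0 \<le> e $ j" obtains t where "push expo (xpow t) = xpow e" "expo t = e"
proof -
  obtain t where "expo t = e" using expo_surj[OF assms] .
  then show thesis using that by simp
qed

lemma push_expo_inject: "push expo F = push expo G \<Longrightarrow> F = G"
  by (rule push_inject[OF inj_expo])

lemma S_div_if_push:
  assumes "push expo G = xpow e * push (char_div u) f" shows "G \<in> S_div u e"
  unfolding S_div_iff
proof
  fix t assume "t \<in> Poly_Mapping.keys G"
  then have "expo t \<in> Poly_Mapping.keys (push expo G)"
    by (simp add: in_keys_iff lookup_push_inj[OF inj_expo])
  also have "push expo G = push (\<lambda>m. e + char_div u m) f" using assms by (simp add: push_shift)
  finally have "expo t \<in> (\<lambda>m. e + char_div u m) ` Poly_Mapping.keys f" by (rule subsetD[OF keys_push])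
  then show "div_class u (expo t) = div_class u e" by (auto simp: div_class_eq_iff)
qed

lemma exists_push_preimage:
  assumes "\<And>m j. m \<in> Poly_Mapping.keys f \<Longrightarrow> 0 \<le> e $ j + char_div u m $ j"
  shows "\<exists>G. push expo G = xpow e * push (char_div u) f"
proof -
  have "\<forall>m\<in>Poly_Mapping.keys f. \<exists>t. expo t = e + char_div u m"
    using assms by (metis expo_surj vector_add_component)
  then obtain c where c: "\<And>m. m \<in> Poly_Mapping.keys f \<Longrightarrow> expo (c m) = e + char_div u m" by metis
  have "push expo (push c f) = push (\<lambda>m. e + char_div u m) f"
    unfolding push_push by (rule push_cong) (rule c)
  then show ?thesis by (auto simp: push_shift)
qed

text \<open>\<open>mv \<sigma>\<close> is the character that trivializes the Cartier divisor
  \<open>A0\<close> over the chart of \<open>\<sigma>\<close>. The assumption \<open>sat\<close>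
  speaks of multiples of \<open>A0\<close>, where both normalizations of the ideal provide
  it.\<close>

locale subscheme_setup = regularity_setup \<Sigma> u I A0 h
  for \<Sigma> :: "(real ^ 'n::finite) set set" and u :: "'r::finite \<Rightarrow> int ^ 'n"
    and I :: "('r, 'k::field) cox set" and A0 h +
  fixes Y :: "('n, 'k) subscheme" and mv :: "(real ^ 'n) set \<Rightarrow> int ^ 'n"
  assumes Y: "\<sigma> \<in> \<Sigma> \<Longrightarrow> subscheme_of u I \<sigma> = Y \<sigma>"
    and closed: "closed_subscheme \<Sigma> Y" and dim0: "has_dimension \<Sigma> Y 0"
    and mv: "\<sigma> \<in> \<Sigma> \<Longrightarrow> j \<in> rays u \<sigma> \<Longrightarrow> char_div u (mv \<sigma>) $ j = A0 $ j"
    and sat: "F \<in> S_div u (of_nat k *s A0) \<Longrightarrow> F \<in> saturation I (irrelevant_ideal \<Sigma> u) \<Longrightarrow> F \<in> I"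
begin

abbreviation \<iota> :: "('r, 'k) cox \<Rightarrow> (int ^ 'r) \<Rightarrow>\<^sub>0 'k" where "\<iota> \<equiv> push expo"
abbreviation \<kappa> :: "((int ^ 'n) \<Rightarrow>\<^sub>0 'k) \<Rightarrow> (int ^ 'r) \<Rightarrow>\<^sub>0 'k" where "\<kappa> \<equiv> push (char_div u)"
abbreviation H :: "(real ^ 'n) set \<Rightarrow> int ^ 'r" where "H \<sigma> \<equiv> expo (hat_expo u \<sigma>)"

lemma sigma_finite: "finite \<Sigma>" "\<Sigma> \<noteq> {}" using fan by (auto simp: fan_def)

lemma sat_xhat:
  assumes "F \<in> S_div u (of_nat k *s A0)" "\<And>\<sigma>. \<sigma> \<in> \<Sigma> \<Longrightarrow> F * xhat u \<sigma> ^ N \<in> I" shows "F \<in> I"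
proof (rule sat[OF assms(1)])
  have "{Poly_Mapping.single (hat_expo u \<sigma>) (1::'k) | \<sigma>. \<sigma> \<in> \<Sigma>} = xhat u ` \<Sigma>" by (auto simp: xhat_def)
  then show "F \<in> saturation I (irrelevant_ideal \<Sigma> u)"
    unfolding irrelevant_ideal_def using saturationI[OF I_ideal sigma_finite assms(2)] by simp
qed

lemma chart_subring: assumes "\<sigma> \<in> \<Sigma>" shows "subring_of (chart \<sigma> :: ((int ^ 'n) \<Rightarrow>\<^sub>0 'k) set)"
  unfolding subring_of_def
proof (intro conjI ballI)
  show "1 \<in> (chart \<sigma> :: ((int ^ 'n) \<Rightarrow>\<^sub>0 'k) set)" unfolding chart_iff[OF assms] by simp
  fix x y :: "(int ^ 'n) \<Rightarrow>\<^sub>0 'k" assume xy: "x \<in> chart \<sigma>" "y \<in> chart \<sigma>"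
  show "x + y \<in> chart \<sigma>" using xy Poly_Mapping.keys_add[of x y] unfolding chart_iff[OF assms] by blast
  show "x - y \<in> chart \<sigma>" using xy keys_diff_subset[of x y] unfolding chart_iff[OF assms] by blast
  show "x * y \<in> chart \<sigma>"
    unfolding chart_iff[OF assms]
  proof (intro ballI)
    fix m j assume m: "m \<in> Poly_Mapping.keys (x * y)" and j: "j \<in> rays u \<sigma>"
    then obtain a b where "a \<in> Poly_Mapping.keys x" "b \<in> Poly_Mapping.keys y" "m = a + b" using keys_mult[of x y] by blast
    then show "0 \<le> char_div u m $ j" using xy j unfolding chart_iff[OF assms] by (auto simp: char_div_add)
  qed
qed

lemma Y_ideal: "\<sigma> \<in> \<Sigma> \<Longrightarrow> ideal_in (chart \<sigma>) (Y \<sigma>)"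
  using closed by (simp add: closed_subscheme_def)

lemma Y_addI: "\<sigma> \<in> \<Sigma> \<Longrightarrow> x \<in> Y \<sigma> \<Longrightarrow> y \<in> Y \<sigma> \<Longrightarrow> x + y \<in> Y \<sigma>"
  and Y_multI: "\<sigma> \<in> \<Sigma> \<Longrightarrow> a \<in> chart \<sigma> \<Longrightarrow> x \<in> Y \<sigma> \<Longrightarrow> a * x \<in> Y \<sigma>"
  and Y_0: "\<sigma> \<in> \<Sigma> \<Longrightarrow> 0 \<in> Y \<sigma>"
  and Y_chart: "\<sigma> \<in> \<Sigma> \<Longrightarrow> x \<in> Y \<sigma> \<Longrightarrow> x \<in> chart \<sigma>"
  using Y_ideal[of \<sigma>] unfolding ideal_in_iff by blast+

lemma chart_mult: "\<sigma> \<in> \<Sigma> \<Longrightarrow> x \<in> chart \<sigma> \<Longrightarrow> y \<in> chart \<sigma> \<Longrightarrow> x * y \<in> (chart \<sigma> :: ((int ^ 'n) \<Rightarrow>\<^sub>0 'k) set)"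
  and chart_diff: "\<sigma> \<in> \<Sigma> \<Longrightarrow> x \<in> chart \<sigma> \<Longrightarrow> y \<in> chart \<sigma> \<Longrightarrow> x - y \<in> (chart \<sigma> :: ((int ^ 'n) \<Rightarrow>\<^sub>0 'k) set)"
  and chart_1: "\<sigma> \<in> \<Sigma> \<Longrightarrow> 1 \<in> (chart \<sigma> :: ((int ^ 'n) \<Rightarrow>\<^sub>0 'k) set)"
  using chart_subring[of \<sigma>] by (auto simp: subring_of_def)

lemma Y_negI: "\<sigma> \<in> \<Sigma> \<Longrightarrow> x \<in> Y \<sigma> \<Longrightarrow> - x \<in> Y \<sigma>"
  using Y_multI[of \<sigma> "0 - 1" x] chart_diff[of \<sigma> 0 1] chart_1 Y_chart[OF _ Y_0] by simp

lemma Y_diffI: "\<sigma> \<in> \<Sigma> \<Longrightarrow> x \<in> Y \<sigma> \<Longrightarrow> y \<in> Y \<sigma> \<Longrightarrow> x - y \<in> Y \<sigma>"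
  using Y_addI[of \<sigma> x "- y"] Y_negI by simp

text \<open>\<open>subscheme_of\<close> asks for a power of the monomial
  \<open>hat_expo u \<sigma>\<close> as denominator. Any exponent \<open>e\<close> that vanishes on
  the rays of \<open>\<sigma>\<close> will do, since multiplication by a further monomial in the
  remaining variables reaches such a power.\<close>

lemma Y_if_lift:
  assumes s: "\<sigma> \<in> \<Sigma>" and f: "f \<in> chart \<sigma>" and G: "G \<in> I" "\<iota> G = xpow e * \<kappa> f" and e: "\<And>j. j \<in> rays u \<sigma> \<Longrightarrow> e $ j = 0"
  shows "f \<in> Y \<sigma>"
proof -
  \<comment> \<open>Large enough that \<open>of_nat k *s H \<sigma> - e\<close> has no negative
    entry; on the rays of \<open>\<sigma>\<close> both terms vanish.\<close>
  define k where "k = (\<Sum>j\<in>UNIV. nat \<bar>e $ j\<bar>)"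
  have "0 \<le> (of_nat k *s H \<sigma> - e) $ j" for j
  proof -
    have "nat \<bar>e $ j\<bar> \<le> k" unfolding k_def by (rule member_le_sum) auto
    then show ?thesis using e[of j] by (auto simp: expo_hat)
  qed
  then obtain t where t: "push expo (xpow t :: ('r, 'k) cox) = xpow (of_nat k *s H \<sigma> - e)" by (rule push_expo_monom)
  have "xpow t * G \<in> I" by (rule ideal_multI[OF I_ideal G(1)])
  moreover have "\<iota> (xpow t * G) = xpow (of_nat k *s H \<sigma>) * \<kappa> f"
    by (simp only: push_expo_mult t G(2) xpow_mult_left diff_add_cancel)
  ultimately show ?thesis using f unfolding Y[OF s, symmetric] subscheme_of_def by blast
qed

text \<open>The lift \<open>G\<close> differs from the one in \<open>I\<close> by a Laurent monomial
  whose negative exponents occur only off the rays of \<open>\<sigma>\<close>; a power of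
  \<open>xhat u \<sigma>\<close> clears them.\<close>

lemma lift_if_Y:
  assumes s: "\<sigma> \<in> \<Sigma>" and f: "f \<in> Y \<sigma>" and G: "\<iota> G = xpow e * \<kappa> f" and e: "\<And>j. j \<in> rays u \<sigma> \<Longrightarrow> 0 \<le> e $ j"
  shows "\<exists>l. xhat u \<sigma> ^ l * G \<in> I"
proof -
  obtain F k where F: "F \<in> I" "\<iota> F = xpow (of_nat k *s H \<sigma>) * \<kappa> f"
    using f unfolding Y[OF s, symmetric] subscheme_of_def by blast
  define S where "S = (\<Sum>j\<in>UNIV. nat \<bar>e $ j\<bar>)"
  define l where "l = k + S"
  have "0 \<le> (of_nat l *s H \<sigma> + e - of_nat k *s H \<sigma>) $ j" for j
  proof -
    have "nat \<bar>e $ j\<bar> \<le> S" unfolding S_def by (rule member_le_sum) auto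
    then show ?thesis using e[of j] by (auto simp: expo_hat l_def)
  qed
  then obtain t where t: "push expo (xpow t :: ('r, 'k) cox) = xpow (of_nat l *s H \<sigma> + e - of_nat k *s H \<sigma>)" by (rule push_expo_monom)
  have "\<iota> (xhat u \<sigma> ^ l * G) = \<iota> (xpow t * F)"
    by (simp only: push_expo_mult push_expo_xhat t G F(2) xpow_mult_left) (simp add: algebra_simps)
  then have "xhat u \<sigma> ^ l * G = xpow t * F" by (rule push_expo_inject)
  then show ?thesis using ideal_multI[OF I_ideal F(1)] by metis
qed

text \<open>High powers of \<open>xhat u \<sigma>\<close> clear the denominators. All large
  \<open>k\<close> are offered so that one \<open>k\<close> can serve every cone.\<close>

lemma exists_lift:
  assumes s: "\<sigma> \<in> \<Sigma>" and f: "f \<in> chart \<sigma>" and e: "\<And>j. j \<in> rays u \<sigma> \<Longrightarrow> e $ j = 0"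
  shows "\<exists>k0. \<forall>k\<ge>k0. \<exists>G. \<iota> G = xpow (of_nat k *s H \<sigma> + e) * \<kappa> f"
proof -
  define k0 where "k0 = (\<Sum>m\<in>Poly_Mapping.keys f. \<Sum>j\<in>UNIV. nat \<bar>e $ j + char_div u m $ j\<bar>)"
  have "\<exists>G. \<iota> G = xpow (of_nat k *s H \<sigma> + e) * \<kappa> f" if k: "k \<ge> k0" for k
  proof (rule exists_push_preimage)
    fix m j assume m: "m \<in> Poly_Mapping.keys f"
    have "nat \<bar>e $ j + char_div u m $ j\<bar> \<le> (\<Sum>j\<in>UNIV. nat \<bar>e $ j + char_div u m $ j\<bar>)"
      by (rule member_le_sum) auto
    also have "\<dots> \<le> k0" unfolding k0_def using m by (intro member_le_sum[of m]) auto
    finally have "nat \<bar>e $ j + char_div u m $ j\<bar> \<le> k" using k by simp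
    moreover have "j \<in> rays u \<sigma> \<Longrightarrow> 0 \<le> char_div u m $ j" using f m unfolding chart_iff[OF s] by blast
    ultimately show "0 \<le> (of_nat k *s H \<sigma> + e) $ j + char_div u m $ j" using e[of j] by (auto simp: expo_hat)
  qed
  then show ?thesis by blast
qed

text \<open>The exponent of \<open>x\<close> in the trivialization of \<open>O(A0)\<close> over \<open>U\<^sub>\<sigma>\<close>.\<close>

definition local_exp :: "(real ^ 'n) set \<Rightarrow> int ^ 'r" where "local_exp \<sigma> = A0 - char_div u (mv \<sigma>)"

lemma local_exp_0: "\<sigma> \<in> \<Sigma> \<Longrightarrow> j \<in> rays u \<sigma> \<Longrightarrow> local_exp \<sigma> $ j = 0"
  by (simp add: local_exp_def mv)

lemma local_exp_class: "div_class u (local_exp \<sigma> + D) = div_class u (A0 + D)"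
proof -
  have "local_exp \<sigma> + D = A0 + D + char_div u (0 - mv \<sigma>)"
    unfolding local_exp_def by (simp only: char_div_diff char_div_0) simp
  then show ?thesis unfolding div_class_eq_iff by blast
qed

text \<open>The section of \<open>O(A0)\<close> given by \<open>F\<close> of degree \<open>A0\<close>, in the trivialization over \<open>U\<^sub>\<sigma>\<close>.\<close>

definition local_section :: "(real ^ 'n) set \<Rightarrow> ('r, 'k) cox \<Rightarrow> (int ^ 'n) \<Rightarrow>\<^sub>0 'k" where
  "local_section \<sigma> F = push (\<lambda>t. mv \<sigma> + (THE m. expo t = A0 + char_div u m)) F"

lemma local_section_add: "local_section \<sigma> (F + G) = local_section \<sigma> F + local_section \<sigma> G" by (simp add: local_section_def push_add)

lemma local_section_pm_scale: "local_section \<sigma> (pm_scale c F) = pm_scale c (local_section \<sigma> F)" by (simp add: local_section_def push_pm_scale)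

text \<open>Dehomogenization: \<open>local_exp \<sigma>\<close> is linearly equivalent to
  \<open>A0\<close> and vanishes on the rays of \<open>\<sigma>\<close>. On these rays the pairing
  with a character of the local section is an exponent of a monomial of \<open>F\<close>, hence
  nonnegative.\<close>

lemma local_section_keys:
  assumes F: "F \<in> S_div u A0"
  shows "\<iota> F = xpow (local_exp \<sigma>) * \<kappa> (local_section \<sigma> F)" and "\<sigma> \<in> \<Sigma> \<Longrightarrow> local_section \<sigma> F \<in> chart \<sigma>"
proof -
  have *: "expo t = A0 + char_div u (THE m. expo t = A0 + char_div u m)" if "t \<in> Poly_Mapping.keys F" for t
  proof -
    have "div_class u (expo t) = div_class u A0" using F that by (simp add: S_div_iff)
    then obtain m where m: "expo t = A0 + char_div u m" by (auto simp: div_class_eq_iff)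
    then show ?thesis by (rule theI) (metis m add_left_cancel inj_char_div inj_eq)
  qed
  have "xpow (local_exp \<sigma>) * \<kappa> (local_section \<sigma> F) = push (\<lambda>t. local_exp \<sigma> + char_div u (mv \<sigma> + (THE m. expo t = A0 + char_div u m))) F"
    by (simp only: local_section_def push_push push_shift[of "local_exp \<sigma>" "\<lambda>t. char_div u (mv \<sigma> + (THE m. expo t = A0 + char_div u m))", symmetric])
  also have "\<dots> = \<iota> F"
    by (rule push_cong) (simp add: local_exp_def char_div_add *[symmetric])
  finally show "\<iota> F = xpow (local_exp \<sigma>) * \<kappa> (local_section \<sigma> F)" by simp
  assume s: "\<sigma> \<in> \<Sigma>"
  show "local_section \<sigma> F \<in> chart \<sigma>"
    unfolding chart_iff[OF s]
  proof (intro ballI)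
    fix m j assume m: "m \<in> Poly_Mapping.keys (local_section \<sigma> F)" and j: "j \<in> rays u \<sigma>"
    from m have "m \<in> (\<lambda>t. mv \<sigma> + (THE m. expo t = A0 + char_div u m)) ` Poly_Mapping.keys F"
      unfolding local_section_def by (rule subsetD[OF keys_push])
    then obtain t where t: "t \<in> Poly_Mapping.keys F" "m = mv \<sigma> + (THE m. expo t = A0 + char_div u m)" by blast
    have "char_div u m $ j = expo t $ j"
      unfolding t(2) char_div_add using *[OF t(1)] mv[OF s j] by (metis vector_add_component)
    then show "0 \<le> char_div u m $ j" by (simp add: expo_nth)
  qed
qed

lemma local_section_in_Y_iff:
  assumes s: "\<sigma> \<in> \<Sigma>" and F: "F \<in> S_div u A0"
  shows "local_section \<sigma> F \<in> Y \<sigma> \<longleftrightarrow> (\<exists>l. xhat u \<sigma> ^ l * F \<in> I)"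
proof
  assume "local_section \<sigma> F \<in> Y \<sigma>"
  then show "\<exists>l. xhat u \<sigma> ^ l * F \<in> I" using lift_if_Y[OF s _ local_section_keys(1)[OF F]] local_exp_0[OF s] by simp
next
  assume "\<exists>l. xhat u \<sigma> ^ l * F \<in> I"
  then obtain l where l: "xhat u \<sigma> ^ l * F \<in> I" by blast
  have "\<iota> (xhat u \<sigma> ^ l * F) = xpow (of_nat l *s H \<sigma> + local_exp \<sigma>) * \<kappa> (local_section \<sigma> F)"
    by (simp only: push_expo_mult push_expo_xhat local_section_keys(1)[OF F, of \<sigma>] xpow_mult_left)
  then show "local_section \<sigma> F \<in> Y \<sigma>" by (rule Y_if_lift[OF s local_section_keys(2)[OF F s] l]) (simp add: local_exp_0[OF s] expo_hat)
qed

text \<open>The cancellation takes place in \<open>S\<close>: after clearing denominators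
  \<open>g\<close> is a nonzerodivisor modulo \<open>I\<close>, and the result is carried back to
  the chart.\<close>

lemma local_section_g_nzd:
  assumes s: "\<sigma> \<in> \<Sigma>" and q: "q \<in> chart \<sigma>" "local_section \<sigma> g * q \<in> Y \<sigma>" shows "q \<in> Y \<sigma>"
proof -
  obtain k Q where Q: "\<iota> Q = xpow (of_nat k *s H \<sigma> + 0) * \<kappa> q" using exists_lift[OF s q(1), of 0] by auto
  have "\<iota> (g * Q) = xpow (local_exp \<sigma> + of_nat k *s H \<sigma>) * \<kappa> (local_section \<sigma> g * q)"
  proof -
    have "\<iota> (g * Q) = (xpow (local_exp \<sigma>) * \<kappa> (local_section \<sigma> g)) * (xpow (of_nat k *s H \<sigma>) * \<kappa> q)"
      using Q by (simp only: push_expo_mult local_section_keys(1)[OF g(1), of \<sigma>] add_0_right)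
    also have "\<dots> = (xpow (local_exp \<sigma>) * xpow (of_nat k *s H \<sigma>)) * (\<kappa> (local_section \<sigma> g) * \<kappa> q)" by (simp only: mult_ac)
    finally show ?thesis by (simp only: xpow_mult push_char_div_mult)
  qed
  then obtain l where "xhat u \<sigma> ^ l * (g * Q) \<in> I"
    using lift_if_Y[OF s q(2)] local_exp_0[OF s] by (fastforce simp: expo_hat)
  then have "g * (xhat u \<sigma> ^ l * Q) \<in> I" by (simp add: mult_ac)
  then have lQ: "xhat u \<sigma> ^ l * Q \<in> I" by (rule nzd_D[OF g(2)])
  have "\<iota> (xhat u \<sigma> ^ l * Q) = xpow (of_nat l *s H \<sigma> + of_nat k *s H \<sigma>) * \<kappa> q"
    by (simp add: push_expo_mult push_expo_xhat Q xpow_mult_left)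
  then show ?thesis by (rule Y_if_lift[OF s q(1) lQ]) (simp add: expo_hat)
qed

lemma no_prime_chain:
  assumes "\<sigma> \<in> \<Sigma>" "prime_in (chart \<sigma>) P" "prime_in (chart \<sigma>) Q" "Y \<sigma> \<subseteq> P"
  shows "\<not> P \<subset> Q"
proof
  assume PQ: "P \<subset> Q"
  let ?P = "\<lambda>i::nat. if i = 0 then P else Q"
  have "1 \<in> prime_chain_lengths \<Sigma> Y"
    unfolding prime_chain_lengths_def using assms PQ
    by (intro CollectI bexI[of _ \<sigma>] exI[of _ ?P]) auto
  then show False using dim0 by (auto simp: has_dimension_def)
qed

lemma local_section_g_unit: assumes "\<sigma> \<in> \<Sigma>" shows "\<exists>q\<in>chart \<sigma>. local_section \<sigma> g * q - 1 \<in> Y \<sigma>"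
proof (rule zero_dimensional_nonzerodivisor_unit[OF chart_subring[OF assms] Y_ideal[OF assms] _ local_section_keys(2)[OF g(1) assms]])
  show "\<not> P \<subset> Q" if "prime_in (chart \<sigma>) P" "prime_in (chart \<sigma>) Q" "Y \<sigma> \<subseteq> P" for P Q
    by (rule no_prime_chain[OF assms that])
  show "q \<in> Y \<sigma>" if "q \<in> chart \<sigma>" "local_section \<sigma> g * q \<in> Y \<sigma>" for q by (rule local_section_g_nzd[OF assms that])
qed blast

definition g_inv :: "(real ^ 'n) set \<Rightarrow> (int ^ 'n) \<Rightarrow>\<^sub>0 'k" where
  "g_inv \<sigma> = (SOME q. q \<in> chart \<sigma> \<and> local_section \<sigma> g * q - 1 \<in> Y \<sigma>)"

lemma g_inv: assumes "\<sigma> \<in> \<Sigma>" shows "g_inv \<sigma> \<in> chart \<sigma>" "local_section \<sigma> g * g_inv \<sigma> - 1 \<in> Y \<sigma>"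
proof -
  have "\<exists>q. q \<in> chart \<sigma> \<and> local_section \<sigma> g * q - 1 \<in> Y \<sigma>" using local_section_g_unit[OF assms] by blast
  from someI_ex[OF this] show "g_inv \<sigma> \<in> chart \<sigma>" "local_section \<sigma> g * g_inv \<sigma> - 1 \<in> Y \<sigma>" by (auto simp: g_inv_def)
qed

lemma restrict:
  assumes "\<sigma> \<in> \<Sigma>" "\<tau> \<in> \<Sigma>"
  shows "chart \<sigma> \<subseteq> (chart (\<sigma> \<inter> \<tau>) :: ((int ^ 'n) \<Rightarrow>\<^sub>0 'k) set)" "Y \<sigma> \<subseteq> Y (\<sigma> \<inter> \<tau>)"
    "chart \<tau> \<subseteq> (chart (\<sigma> \<inter> \<tau>) :: ((int ^ 'n) \<Rightarrow>\<^sub>0 'k) set)" "Y \<tau> \<subseteq> Y (\<sigma> \<inter> \<tau>)"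
proof -
  note c = cone_Int[OF assms]
  show "chart \<sigma> \<subseteq> (chart (\<sigma> \<inter> \<tau>) :: ((int ^ 'n) \<Rightarrow>\<^sub>0 'k) set)" "chart \<tau> \<subseteq> (chart (\<sigma> \<inter> \<tau>) :: ((int ^ 'n) \<Rightarrow>\<^sub>0 'k) set)"
    by (auto simp: chart_def)
  have hull: "Y \<tau>' = ideal_in (chart \<tau>') hull (Y \<sigma>')" if "\<sigma>' \<in> \<Sigma>" "\<tau>' \<in> \<Sigma>" "\<tau>' face_of \<sigma>'" for \<sigma>' \<tau>'
    using closed that unfolding closed_subscheme_def by blast
  show "Y \<sigma> \<subseteq> Y (\<sigma> \<inter> \<tau>)" using hull[OF assms(1) c(1,2)] hull_subset[of "Y \<sigma>" "ideal_in (chart (\<sigma> \<inter> \<tau>))"] by simp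
  show "Y \<tau> \<subseteq> Y (\<sigma> \<inter> \<tau>)" using hull[OF assms(2) c(1,3)] hull_subset[of "Y \<tau>" "ideal_in (chart (\<sigma> \<inter> \<tau>))"] by simp
qed

text \<open>The transition function of \<open>O(A0)\<close> between two charts. It does not depend
  on \<open>F\<close>, so it cancels in quotients of two sections.\<close>

lemma transition:
  "local_section \<tau> F = xpow (mv \<tau> - mv \<sigma>) * local_section \<sigma> F"
proof -
  have "local_section \<tau> F = push (\<lambda>t. (mv \<tau> - mv \<sigma>) + (mv \<sigma> + (THE m. expo t = A0 + char_div u m))) F"
    by (simp add: local_section_def)
  also have "\<dots> = xpow (mv \<tau> - mv \<sigma>) * local_section \<sigma> F" by (simp only: push_shift local_section_def)
  finally show ?thesis .
qed

lemma transition_chart: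
  assumes "\<sigma> \<in> \<Sigma>" "\<tau> \<in> \<Sigma>" shows "xpow (mv \<tau> - mv \<sigma>) \<in> (chart (\<sigma> \<inter> \<tau>) :: ((int ^ 'n) \<Rightarrow>\<^sub>0 'k) set)"
  unfolding chart_iff[OF cone_Int(1)[OF assms]] using mv[OF assms(1)] mv[OF assms(2)]
  by (auto simp: rays_Int char_div_diff)

end

section \<open>Comparison of the Hilbert function with global sections\<close>

context subscheme_setup begin

lemma g_power: "g ^ k \<in> S_div u (of_nat k *s A0)" "nonzerodivisor_mod (g ^ k) I"
  by (intro S_div_power nzd_power g)+

text \<open>By \<open>stable\<close> the Hilbert function takes the same value at all positive
  multiples of \<open>A0\<close>, so \<open>hilb_surj\<close> applies to the powers of
  \<open>g\<close>.\<close>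

lemma surj_g:
  assumes "y \<in> S_div u (A0 + of_nat k *s A0)" shows "\<exists>x\<in>S_div u A0. y - x * g ^ k \<in> I"
proof (rule hilb_surj[OF g_power _ assms])
  have "A0 + of_nat k *s A0 = of_nat (Suc k) *s A0" by (simp add: vec_eq_iff ring_distribs)
  then show "hilb I A0 = hilb I (A0 + of_nat k *s A0)" by (simp only: stable)
qed

lemma I_mult_eq: "x \<in> I \<Longrightarrow> a * x = y \<Longrightarrow> y \<in> I"
  using ideal_multI[OF I_ideal] by metis

text \<open>Fitting's lemma for multiplication by \<open>e / g ^ s\<close> on the finite-dimensional space \<open>(S / I)\<close> in degree \<open>A0\<close>.\<close>

lemma fitting:
  assumes e: "e \<in> S_div u (of_nat s *s A0)"
  shows "\<exists>N0. \<forall>N\<ge>N0. \<exists>c\<in>S_div u A0. e ^ N * (g ^ Suc (s * N) - e ^ N * c) \<in> I"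
proof -
  \<comment> \<open>Let \<phi> be multiplication by \<open>e / g ^ s\<close>. Then
    \<open>M N\<close> represents the image of the \<open>N\<close>-th power of \<phi>, with
    division by \<open>g\<close> replaced by cross-multiplication.\<close>
  define M where "M N = {y \<in> S_div u A0. \<exists>c\<in>S_div u A0. g ^ (s * N) * y - e ^ N * c \<in> I}" for N
  have sub: "pm.subspace (M N)" for N
    unfolding pm.subspace_def
  proof (intro conjI ballI allI)
    show "0 \<in> M N" using S_div_0 ideal_0I[OF I_ideal] by (auto simp: M_def intro!: bexI[of _ 0])
    fix x assume "x \<in> M N"
    then obtain c where x: "x \<in> S_div u A0" "c \<in> S_div u A0" "g ^ (s * N) * x - e ^ N * c \<in> I" by (auto simp: M_def)
    show "pm_scale a x \<in> M N" for a
    proof -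
      have "g ^ (s * N) * pm_scale a x - e ^ N * pm_scale a c = pm_scale a (g ^ (s * N) * x - e ^ N * c)"
        by (simp add: pm.scale_right_diff_distrib pm_scale_mult(1))
      then show ?thesis using x pm.subspace_scale[OF S_div_subspace] pm.subspace_scale[OF ideal_subspace[OF I_ideal]]
        unfolding M_def by (metis (mono_tags, lifting) mem_Collect_eq)
    qed
    fix y assume "y \<in> M N"
    then obtain d where y: "y \<in> S_div u A0" "d \<in> S_div u A0" "g ^ (s * N) * y - e ^ N * d \<in> I" by (auto simp: M_def)
    have "g ^ (s * N) * (x + y) - e ^ N * (c + d) \<in> I"
      using ideal_addI[OF I_ideal x(3) y(3)] by (simp add: algebra_simps)
    then show "x + y \<in> M N" using x y S_div_add unfolding M_def by blast
  qed
  have step: "M (Suc N) \<subseteq> M N" for N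
  proof
    fix y assume "y \<in> M (Suc N)"
    then obtain c where y: "y \<in> S_div u A0" "c \<in> S_div u A0" "g ^ (s * Suc N) * y - e ^ Suc N * c \<in> I" by (auto simp: M_def)
    \<comment> \<open>Here \<phi> is applied: \<open>surj_g\<close> divides \<open>e * c\<close> by
      \<open>g ^ s\<close> modulo \<open>I\<close>.\<close>
    have "e * c \<in> S_div u (A0 + of_nat s *s A0)" using S_div_mult[OF e y(2)] by (simp add: add.commute)
    then obtain c' where c': "c' \<in> S_div u A0" "e * c - c' * g ^ s \<in> I" using surj_g by blast
    have "(g ^ (s * Suc N) * y - e ^ Suc N * c) + e ^ N * (e * c - c' * g ^ s) \<in> I"
      by (intro ideal_addI[OF I_ideal] ideal_multI[OF I_ideal] y c')
    also have "(g ^ (s * Suc N) * y - e ^ Suc N * c) + e ^ N * (e * c - c' * g ^ s) = g ^ s * (g ^ (s * N) * y - e ^ N * c')"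
      by (simp add: algebra_simps power_add)
    finally have "g ^ (s * N) * y - e ^ N * c' \<in> I" by (rule nzd_D[OF g_power(2)])
    then show "y \<in> M N" using y c' by (auto simp: M_def)
  qed
  have anti: "M N' \<subseteq> M N" if "N \<le> N'" for N N'
    using that by (induction rule: dec_induct) (use step in blast)+
  \<comment> \<open>The images decrease, so their dimension is constant once it is minimal, and then
    \<open>M (2 * N) = M N\<close>.\<close>
  obtain N0 where N0: "\<And>N. pm.dim (M N0) \<le> pm.dim (M N)"
    using ex_has_least_nat[of "\<lambda>_. True" 0 "\<lambda>N. pm.dim (M N)"] by auto
  show ?thesis
  proof (intro exI[of _ N0] allI impI)
    fix N assume N: "N0 \<le> N"
    let ?B = "(\<lambda>t. Poly_Mapping.single t (1::'k)) ` {t. div_class u (expo t) = div_class u A0}"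
    have fin: "finite ?B" "M K \<subseteq> pm.span ?B" for K
      using S_div_dim(1) by (simp, subst S_div_dim(2)[symmetric]) (auto simp: M_def)
    have le: "M (2 * N) \<subseteq> M N" by (rule anti) simp
    have "pm.dim (M N) \<le> pm.dim (M N0)" by (rule pm.quotient_dim_subspaces(2)[OF fin sub sub anti[OF N]])
    then have "pm.dim (M N) \<le> pm.dim (M (2 * N))" using N0[of "2 * N"] by simp
    then have qd: "quotient_dim pm_scale (M N) (M (2 * N)) = enat (card ({} :: ('r, 'k) cox set))"
      using pm.quotient_dim_subspaces(1)[OF fin sub sub le] by simp
    have eq: "y \<in> M (2 * N)" if y: "y \<in> M N" for y
    proof (rule pm.quotient_dim_spanning[OF sub qd _ _ y])
      show "pm.indep_mod (M (2 * N)) {}" by (simp add: pm.indep_mod_def)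
    qed auto
    \<comment> \<open>\<open>g\<close> stands for the unit section, and \<open>y\<close> is its
      image under the \<open>N\<close>-th power of \<phi>. As \<open>y\<close> is also an image
      under the power \<open>2 * N\<close>, cross-multiplication yields the required
      \<open>c\<close>.\<close>
    have "e ^ N * g \<in> S_div u (A0 + of_nat (s * N) *s A0)"
    proof -
      have "of_nat N *s (of_nat s *s A0) + A0 = A0 + of_nat (s * N) *s A0" by (simp add: vec_eq_iff)
      then show ?thesis using S_div_mult[OF S_div_power[OF e, of N] g(1)] by (simp only:)
    qed
    then obtain y where y: "y \<in> S_div u A0" "e ^ N * g - y * g ^ (s * N) \<in> I" using surj_g by blast
    have "g ^ (s * N) * y - e ^ N * g \<in> I" using ideal_negI[OF I_ideal y(2)] by (simp add: mult.commute)
    then have "y \<in> M N" using y(1) g(1) by (auto simp: M_def)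
    then have "y \<in> M (2 * N)" by (rule eq)
    then obtain c where c: "c \<in> S_div u A0" "g ^ (s * (2 * N)) * y - e ^ (2 * N) * c \<in> I" by (auto simp: M_def)
    have "g ^ (s * N) * (e ^ N * g - y * g ^ (s * N)) + (g ^ (s * (2 * N)) * y - e ^ (2 * N) * c) \<in> I"
      by (intro ideal_addI[OF I_ideal] ideal_multI[OF I_ideal] y c)
    also have "g ^ (s * N) * (e ^ N * g - y * g ^ (s * N)) + (g ^ (s * (2 * N)) * y - e ^ (2 * N) * c)
       = e ^ N * (g ^ Suc (s * N) - e ^ N * c)"
    proof -
      have "g ^ (s * (2 * N)) = g ^ (s * N) * g ^ (s * N)" by (simp flip: power_add add: mult_2 ring_distribs)
      moreover have "e ^ (2 * N) = e ^ N * e ^ N" by (simp flip: power_add add: mult_2)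
      ultimately show ?thesis by (simp only: power_Suc) (simp only: ring_distribs mult_ac, simp add: algebra_simps)
    qed
    finally show "\<exists>c\<in>S_div u A0. e ^ N * (g ^ Suc (s * N) - e ^ N * c) \<in> I" using c(1) by blast
  qed
qed

text \<open>
  By Fitting's lemma, \<open>g ^ w - e \<sigma> ^ N * c \<sigma>\<close> is annihilated by \<open>e \<sigma> ^ N\<close>. The product over all
  \<open>\<sigma>\<close> is annihilated by a power of the irrelevant ideal, so it lies in \<open>I\<close>.
\<close>

lemma partition_of_unity:
  "\<exists>T C. (\<forall>\<sigma>\<in>\<Sigma>. C \<sigma> \<in> S_div u (of_nat T *s A0 - of_nat k *s H \<sigma>)) \<and> g ^ T - (\<Sum>\<sigma>\<in>\<Sigma>. C \<sigma> * xhat u \<sigma> ^ k) \<in> I"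
proof -
  have "\<forall>\<sigma>\<in>\<Sigma>. \<exists>k0. \<forall>k\<ge>k0. \<exists>t'. div_class u (H \<sigma> + expo t') = div_class u (of_nat k *s A0)"
    by (intro ballI exists_complement_large)
  from bchoice[OF this] obtain k0 where k0: "\<And>\<sigma> k. \<sigma> \<in> \<Sigma> \<Longrightarrow> k0 \<sigma> \<le> k \<Longrightarrow> \<exists>t'. div_class u (H \<sigma> + expo t') = div_class u (of_nat k *s A0)"
    by blast
  \<comment> \<open>The sum over all cones bounds every \<open>k0 \<sigma>\<close> and gives one
    multiple for all of them; \<open>N\<close> below is found in the same way.\<close>
  define s where "s = (\<Sum>\<sigma>\<in>\<Sigma>. k0 \<sigma>)"
  have "\<forall>\<sigma>\<in>\<Sigma>. \<exists>\<eta>. \<eta> \<in> S_div u (of_nat s *s A0 - H \<sigma>) \<and> nonzerodivisor_mod \<eta> I"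
  proof
    fix \<sigma> assume \<sigma>: "\<sigma> \<in> \<Sigma>"
    have "k0 \<sigma> \<le> s" unfolding s_def using \<sigma> sigma_finite by (intro member_le_sum) auto
    then obtain t' where "div_class u (H \<sigma> + expo t') = div_class u (of_nat s *s A0)" using k0[OF \<sigma>] by blast
    then have "div_class u (expo t') = div_class u (of_nat s *s A0 - H \<sigma>)"
      using div_class_diff_cong[of u "expo t'" "H \<sigma>"] by (simp add: add.commute)
    then have "S_div u (expo t') = (S_div u (of_nat s *s A0 - H \<sigma>) :: ('r, 'k) cox set)" by (simp add: S_div_def)
    then show "\<exists>\<eta>. \<eta> \<in> S_div u (of_nat s *s A0 - H \<sigma>) \<and> nonzerodivisor_mod \<eta> I" using exists_nzd[of t'] by auto
  qed
  from bchoice[OF this] obtain \<eta> where \<eta>: "\<And>\<sigma>. \<sigma> \<in> \<Sigma> \<Longrightarrow> \<eta> \<sigma> \<in> S_div u (of_nat s *s A0 - H \<sigma>)"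
    "\<And>\<sigma>. \<sigma> \<in> \<Sigma> \<Longrightarrow> nonzerodivisor_mod (\<eta> \<sigma>) I" by blast
  \<comment> \<open>\<open>\<eta> \<sigma>\<close> raises the degree of
    \<open>xhat u \<sigma>\<close> to a multiple of \<open>A0\<close>. It is a nonzerodivisor, so it
    can be cancelled again later.\<close>
  define e where "e \<sigma> = xhat u \<sigma> * \<eta> \<sigma>" for \<sigma>
  have eSD: "e \<sigma> \<in> S_div u (of_nat s *s A0)" if "\<sigma> \<in> \<Sigma>" for \<sigma>
  proof -
    have "xhat u \<sigma> \<in> S_div u (H \<sigma>)" by (simp add: xhat_def S_div_monom)
    from S_div_mult[OF this \<eta>(1)[OF that]] show ?thesis by (simp add: e_def)
  qed
  have "\<forall>\<sigma>\<in>\<Sigma>. \<exists>N0. \<forall>N\<ge>N0. \<exists>c\<in>S_div u A0. e \<sigma> ^ N * (g ^ Suc (s * N) - e \<sigma> ^ N * c) \<in> I"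
    using fitting[OF eSD] by blast
  from bchoice[OF this] obtain N0 where N0: "\<And>\<sigma> N. \<sigma> \<in> \<Sigma> \<Longrightarrow> N0 \<sigma> \<le> N \<Longrightarrow> \<exists>c\<in>S_div u A0. e \<sigma> ^ N * (g ^ Suc (s * N) - e \<sigma> ^ N * c) \<in> I"
    by blast
  \<comment> \<open>The summand \<open>k\<close> ensures that \<open>xhat u \<sigma> ^ k\<close>
    splits off from \<open>e \<sigma> ^ N\<close>.\<close>
  define N where "N = k + (\<Sum>\<sigma>\<in>\<Sigma>. N0 \<sigma>)"
  define w where "w = Suc (s * N)"
  have "\<forall>\<sigma>\<in>\<Sigma>. \<exists>c. c \<in> S_div u A0 \<and> e \<sigma> ^ N * (g ^ w - e \<sigma> ^ N * c) \<in> I"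
  proof
    fix \<sigma> assume \<sigma>: "\<sigma> \<in> \<Sigma>"
    have "N0 \<sigma> \<le> (\<Sum>\<sigma>\<in>\<Sigma>. N0 \<sigma>)" using \<sigma> sigma_finite by (intro member_le_sum) auto
    then have "N0 \<sigma> \<le> N" by (simp add: N_def)
    from N0[OF \<sigma> this] show "\<exists>c. c \<in> S_div u A0 \<and> e \<sigma> ^ N * (g ^ w - e \<sigma> ^ N * c) \<in> I" unfolding w_def by blast
  qed
  from bchoice[OF this] obtain c where c: "\<And>\<sigma>. \<sigma> \<in> \<Sigma> \<Longrightarrow> c \<sigma> \<in> S_div u A0"
    "\<And>\<sigma>. \<sigma> \<in> \<Sigma> \<Longrightarrow> e \<sigma> ^ N * (g ^ w - e \<sigma> ^ N * c \<sigma>) \<in> I" by blast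
  define a where "a \<sigma> = g ^ w - e \<sigma> ^ N * c \<sigma>" for \<sigma>
  have aSD: "a \<sigma> \<in> S_div u (of_nat w *s A0)" if "\<sigma> \<in> \<Sigma>" for \<sigma>
  proof -
    have "of_nat N *s (of_nat s *s A0) + A0 = of_nat w *s A0" by (simp add: vec_eq_iff w_def ring_distribs)
    then have "e \<sigma> ^ N * c \<sigma> \<in> S_div u (of_nat w *s A0)" using S_div_mult[OF S_div_power[OF eSD[OF that], of N] c(1)[OF that]] by simp
    then show ?thesis unfolding a_def by (intro S_div_diff g_power)
  qed
  have prodSD: "(\<Prod>\<sigma>\<in>Z. a \<sigma>) \<in> S_div u (of_nat (card Z * w) *s A0)" if "finite Z" "Z \<subseteq> \<Sigma>" for Z
    using that
  proof (induction Z rule: finite_induct)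
    case (insert x F)
    have "of_nat w *s A0 + of_nat (card F * w) *s A0 = of_nat (card (insert x F) * w) *s A0"
      using insert.hyps by (simp add: vec_eq_iff ring_distribs)
    moreover have "a x * (\<Prod>\<sigma>\<in>F. a \<sigma>) \<in> S_div u (of_nat w *s A0 + of_nat (card F * w) *s A0)"
      using insert by (intro S_div_mult aSD) auto
    ultimately show ?case using insert.hyps by simp
  qed (simp add: S_div_1)
  have "(\<Prod>\<sigma>\<in>\<Sigma>. a \<sigma>) \<in> I"
  proof (rule sat_xhat[OF prodSD[OF sigma_finite(1) order_refl]])
    fix \<sigma> assume \<sigma>: "\<sigma> \<in> \<Sigma>"
    have "\<eta> \<sigma> ^ N * (xhat u \<sigma> ^ N * a \<sigma>) \<in> I"
      using c(2)[OF \<sigma>] by (simp add: a_def e_def power_mult_distrib mult_ac)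
    then have "xhat u \<sigma> ^ N * a \<sigma> \<in> I" by (rule nzd_D[OF nzd_power[OF \<eta>(2)[OF \<sigma>]]])
    moreover have "(\<Prod>\<sigma>\<in>\<Sigma>-{\<sigma>}. a \<sigma>) * (xhat u \<sigma> ^ N * a \<sigma>) = (\<Prod>\<sigma>\<in>\<Sigma>. a \<sigma>) * xhat u \<sigma> ^ N"
      using prod.remove[OF sigma_finite(1) \<sigma>, of a] by (simp add: mult_ac)
    ultimately show "(\<Prod>\<sigma>\<in>\<Sigma>. a \<sigma>) * xhat u \<sigma> ^ N \<in> I" by (rule I_mult_eq)
  qed
  define b where "b \<sigma> = xhat u \<sigma> ^ (N - k) * \<eta> \<sigma> ^ N * c \<sigma>" for \<sigma>
  have kN: "k \<le> N" by (simp add: N_def)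
  have bSD: "b \<sigma> \<in> S_div u (of_nat w *s A0 - of_nat k *s H \<sigma>)" if "\<sigma> \<in> \<Sigma>" for \<sigma>
  proof -
    have "of_nat (N - k) *s H \<sigma> + of_nat N *s (of_nat s *s A0 - H \<sigma>) + A0 = of_nat w *s A0 - of_nat k *s H \<sigma>"
      using kN by (simp add: vec_eq_iff w_def of_nat_diff algebra_simps)
    moreover have "b \<sigma> \<in> S_div u (of_nat (N - k) *s H \<sigma> + of_nat N *s (of_nat s *s A0 - H \<sigma>) + A0)"
      unfolding b_def by (intro S_div_mult xhat_S_div S_div_power \<eta> c that)
    ultimately show ?thesis by simp
  qed
  have ab: "a \<sigma> = g ^ w - b \<sigma> * xhat u \<sigma> ^ k" for \<sigma>
  proof -
    have "xhat u \<sigma> ^ N = (xhat u \<sigma> ^ (N - k) * xhat u \<sigma> ^ k :: ('r, 'k) cox)" using kN by (simp flip: power_add)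
    then show ?thesis by (simp add: a_def e_def b_def power_mult_distrib mult_ac)
  qed
  \<comment> \<open>In the expanded product of all
    \<open>g ^ w - b \<sigma> * xhat u \<sigma> ^ k\<close>, every term except a power of
    \<open>g\<close> contains one of the \<open>xhat u \<sigma> ^ k\<close>. The degrees of the
    coefficients are carried along the induction.\<close>
  have "\<exists>C. (\<forall>\<sigma>\<in>Z. C \<sigma> \<in> S_div u (of_nat (card Z * w) *s A0 - of_nat k *s H \<sigma>)) \<and>
      (\<Prod>\<sigma>\<in>Z. a \<sigma>) = g ^ (card Z * w) - (\<Sum>\<sigma>\<in>Z. C \<sigma> * xhat u \<sigma> ^ k)" if "finite Z" "Z \<subseteq> \<Sigma>" for Z
    using that
  proof (induction Z rule: finite_induct)
    case (insert x F)
    then obtain C where C: "\<And>\<sigma>. \<sigma> \<in> F \<Longrightarrow> C \<sigma> \<in> S_div u (of_nat (card F * w) *s A0 - of_nat k *s H \<sigma>)"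
      "(\<Prod>\<sigma>\<in>F. a \<sigma>) = g ^ (card F * w) - (\<Sum>\<sigma>\<in>F. C \<sigma> * xhat u \<sigma> ^ k)" by auto
    define C' where "C' \<sigma> = (if \<sigma> = x then b x * (\<Prod>\<sigma>\<in>F. a \<sigma>) else g ^ w * C \<sigma>)" for \<sigma>
    have card: "card (insert x F) * w = w + card F * w" using insert.hyps by simp
    have "C' \<sigma> \<in> S_div u (of_nat (card (insert x F) * w) *s A0 - of_nat k *s H \<sigma>)" if \<sigma>: "\<sigma> \<in> insert x F" for \<sigma>
    proof (cases "\<sigma> = x")
      case True
      have "of_nat (card (insert x F) * w) *s A0 - of_nat k *s H \<sigma> = (of_nat w *s A0 - of_nat k *s H \<sigma>) + of_nat (card F * w) *s A0"
        unfolding card by (simp add: vec_eq_iff algebra_simps)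
      moreover have "b x * (\<Prod>\<sigma>\<in>F. a \<sigma>) \<in> S_div u ((of_nat w *s A0 - of_nat k *s H \<sigma>) + of_nat (card F * w) *s A0)"
        unfolding True using insert by (intro S_div_mult bSD prodSD) auto
      ultimately have "b x * (\<Prod>\<sigma>\<in>F. a \<sigma>) \<in> S_div u (of_nat (card (insert x F) * w) *s A0 - of_nat k *s H \<sigma>)" by (simp only:)
      then show ?thesis by (simp only: C'_def True refl if_True)
    next
      case False
      have "of_nat (card (insert x F) * w) *s A0 - of_nat k *s H \<sigma> = of_nat w *s A0 + (of_nat (card F * w) *s A0 - of_nat k *s H \<sigma>)"
        unfolding card by (simp add: vec_eq_iff algebra_simps)
      moreover have "g ^ w * C \<sigma> \<in> S_div u (of_nat w *s A0 + (of_nat (card F * w) *s A0 - of_nat k *s H \<sigma>))"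
        using \<sigma> False by (intro S_div_mult g_power C) auto
      ultimately have "g ^ w * C \<sigma> \<in> S_div u (of_nat (card (insert x F) * w) *s A0 - of_nat k *s H \<sigma>)" by (simp only:)
      then show ?thesis by (simp only: C'_def False if_False)
    qed
    moreover have "(\<Prod>\<sigma>\<in>insert x F. a \<sigma>) = g ^ (card (insert x F) * w) - (\<Sum>\<sigma>\<in>insert x F. C' \<sigma> * xhat u \<sigma> ^ k)"
    proof -
      have "(\<Sum>\<sigma>\<in>F. C' \<sigma> * xhat u \<sigma> ^ k) = g ^ w * (\<Sum>\<sigma>\<in>F. C \<sigma> * xhat u \<sigma> ^ k)"
        unfolding sum_distrib_left using insert.hyps by (intro sum.cong) (auto simp: C'_def mult.assoc)
      then have S: "(\<Sum>\<sigma>\<in>insert x F. C' \<sigma> * xhat u \<sigma> ^ k) = b x * (\<Prod>\<sigma>\<in>F. a \<sigma>) * xhat u x ^ k + g ^ w * (\<Sum>\<sigma>\<in>F. C \<sigma> * xhat u \<sigma> ^ k)"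
        using insert.hyps by (simp add: C'_def)
      have "(\<Prod>\<sigma>\<in>insert x F. a \<sigma>) = (g ^ w - b x * xhat u x ^ k) * (\<Prod>\<sigma>\<in>F. a \<sigma>)"
        using insert.hyps by (simp add: ab[symmetric])
      also have "\<dots> = g ^ w * (\<Prod>\<sigma>\<in>F. a \<sigma>) - b x * (\<Prod>\<sigma>\<in>F. a \<sigma>) * xhat u x ^ k"
        by (simp add: algebra_simps)
      also have "g ^ w * (\<Prod>\<sigma>\<in>F. a \<sigma>) = g ^ (w + card F * w) - g ^ w * (\<Sum>\<sigma>\<in>F. C \<sigma> * xhat u \<sigma> ^ k)"
        unfolding C(2) by (simp add: right_diff_distrib power_add)
      finally show ?thesis unfolding S card by (simp add: diff_diff_eq add.commute)
    qed
    ultimately show ?case by blast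
  qed simp
  from this[OF sigma_finite(1) order_refl] obtain C
    where C: "\<forall>\<sigma>\<in>\<Sigma>. C \<sigma> \<in> S_div u (of_nat (card \<Sigma> * w) *s A0 - of_nat k *s H \<sigma>)"
      "(\<Prod>\<sigma>\<in>\<Sigma>. a \<sigma>) = g ^ (card \<Sigma> * w) - (\<Sum>\<sigma>\<in>\<Sigma>. C \<sigma> * xhat u \<sigma> ^ k)" by blast
  have "g ^ (card \<Sigma> * w) - (\<Sum>\<sigma>\<in>\<Sigma>. C \<sigma> * xhat u \<sigma> ^ k) \<in> I"
    using \<open>(\<Prod>\<sigma>\<in>\<Sigma>. a \<sigma>) \<in> I\<close> unfolding C(2) .
  with C(1) show ?thesis by (intro exI[of _ "card \<Sigma> * w"] exI[of _ C] conjI)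
qed

lemma xhat_Int_dvd: "\<exists>t. xhat u \<sigma> * xhat u \<tau> = (xpow t * xhat u (\<sigma> \<inter> \<tau>) :: ('r, 'k) cox)"
proof -
  have "0 \<le> (H \<sigma> + H \<tau> - H (\<sigma> \<inter> \<tau>)) $ j" for j by (simp add: expo_hat rays_Int)
  then obtain t where t: "push expo (xpow t :: ('r, 'k) cox) = xpow (H \<sigma> + H \<tau> - H (\<sigma> \<inter> \<tau>))" by (rule push_expo_monom)
  have "push expo (xhat u \<sigma> * xhat u \<tau>) = push expo (xpow t * xhat u (\<sigma> \<inter> \<tau>) :: ('r, 'k) cox)"
    by (simp only: push_expo_mult t) (simp add: xhat_def mult_single)
  then show ?thesis using push_expo_inject by blast
qed

text \<open>Each \<open>f \<sigma>\<close> is multiplied by the local section of \<open>g\<close>,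
  which gives its lift the degree \<open>A0 + of_nat k *s H \<sigma>\<close>. Agreement on overlaps
  makes the cross-multiplied lifts congruent modulo \<open>I\<close> once the common exponent
  \<open>k\<close> is large enough.\<close>

lemma exists_compatible_lifts:
  assumes f: "f \<in> section_families \<Sigma> Y"
  obtains F k where "\<And>\<sigma>. \<sigma> \<in> \<Sigma> \<Longrightarrow> \<iota> (F \<sigma>) = xpow (of_nat k *s H \<sigma> + local_exp \<sigma>) * \<kappa> (f \<sigma> * local_section \<sigma> g)"
    "\<And>\<sigma> \<tau>. \<sigma> \<in> \<Sigma> \<Longrightarrow> \<tau> \<in> \<Sigma> \<Longrightarrow> xhat u \<tau> ^ k * F \<sigma> - xhat u \<sigma> ^ k * F \<tau> \<in> I"
proof -
  have fc: "f \<sigma> \<in> chart \<sigma>" if "\<sigma> \<in> \<Sigma>" for \<sigma> using f that by (simp add: section_families_def)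
  have fY: "f \<sigma> - f \<tau> \<in> Y (\<sigma> \<inter> \<tau>)" if "\<sigma> \<in> \<Sigma>" "\<tau> \<in> \<Sigma>" for \<sigma> \<tau> using f that by (simp add: section_families_def)
  have "\<forall>\<sigma>\<in>\<Sigma>. \<exists>k0. \<forall>k\<ge>k0. \<exists>G. \<iota> G = xpow (of_nat k *s H \<sigma> + local_exp \<sigma>) * \<kappa> (f \<sigma> * local_section \<sigma> g)"
    by (intro ballI exists_lift chart_mult fc local_section_keys(2) g(1) local_exp_0)
  from bchoice[OF this] obtain k0 where k0: "\<And>\<sigma> k. \<sigma> \<in> \<Sigma> \<Longrightarrow> k0 \<sigma> \<le> k \<Longrightarrow> \<exists>G. \<iota> G = xpow (of_nat k *s H \<sigma> + local_exp \<sigma>) * \<kappa> (f \<sigma> * local_section \<sigma> g)"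
    by blast
  define k1 where "k1 = (\<Sum>\<sigma>\<in>\<Sigma>. k0 \<sigma>)"
  have "\<forall>\<sigma>\<in>\<Sigma>. \<exists>G. \<iota> G = xpow (of_nat k1 *s H \<sigma> + local_exp \<sigma>) * \<kappa> (f \<sigma> * local_section \<sigma> g)"
  proof
    fix \<sigma> assume \<sigma>: "\<sigma> \<in> \<Sigma>"
    have "k0 \<sigma> \<le> k1" unfolding k1_def using \<sigma> sigma_finite by (intro member_le_sum) auto
    then show "\<exists>G. \<iota> G = xpow (of_nat k1 *s H \<sigma> + local_exp \<sigma>) * \<kappa> (f \<sigma> * local_section \<sigma> g)" using k0[OF \<sigma>] by blast
  qed
  from bchoice[OF this] obtain F1 where F1: "\<And>\<sigma>. \<sigma> \<in> \<Sigma> \<Longrightarrow> \<iota> (F1 \<sigma>) = xpow (of_nat k1 *s H \<sigma> + local_exp \<sigma>) * \<kappa> (f \<sigma> * local_section \<sigma> g)" by blast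
  have "\<exists>l. (xhat u \<sigma> * xhat u \<tau>) ^ l * (xhat u \<tau> ^ k1 * F1 \<sigma> - xhat u \<sigma> ^ k1 * F1 \<tau>) \<in> I" if \<sigma>: "\<sigma> \<in> \<Sigma>" and \<tau>: "\<tau> \<in> \<Sigma>" for \<sigma> \<tau>
  proof -
    let ?D = "xhat u \<tau> ^ k1 * F1 \<sigma> - xhat u \<sigma> ^ k1 * F1 \<tau>" and ?e = "of_nat k1 *s H \<sigma> + of_nat k1 *s H \<tau> + local_exp \<sigma>"
    have "\<iota> (xhat u \<tau> ^ k1 * F1 \<sigma>) = xpow ?e * \<kappa> (f \<sigma> * local_section \<sigma> g)"
      by (simp only: push_expo_mult push_expo_xhat F1[OF \<sigma>] xpow_mult_left) (simp add: add_ac)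
    moreover have "\<iota> (xhat u \<sigma> ^ k1 * F1 \<tau>) = xpow ?e * \<kappa> (f \<tau> * local_section \<sigma> g)"
    proof -
      \<comment> \<open>Replacing the section over \<open>\<tau>\<close> by the one over
        \<open>\<sigma>\<close> introduces the transition monomial, which is exactly the difference
        between \<open>local_exp \<tau>\<close> and \<open>local_exp \<sigma>\<close>.\<close>
      have "\<kappa> (f \<tau> * local_section \<tau> g) = xpow (char_div u (mv \<tau> - mv \<sigma>)) * \<kappa> (f \<tau> * local_section \<sigma> g)"
        unfolding transition[of \<tau> g \<sigma>] push_char_div_mult push_single by (simp only: mult_ac)
      moreover have "of_nat k1 *s H \<sigma> + (of_nat k1 *s H \<tau> + local_exp \<tau> + char_div u (mv \<tau> - mv \<sigma>)) = ?e"
        by (simp add: local_exp_def char_div_diff)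
      ultimately show ?thesis by (simp only: push_expo_mult push_expo_xhat F1[OF \<tau>] xpow_mult_left add.assoc)
    qed
    ultimately have "\<iota> ?D = xpow ?e * (\<kappa> (f \<sigma> * local_section \<sigma> g) - \<kappa> (f \<tau> * local_section \<sigma> g))"
      by (simp only: push_diff right_diff_distrib)
    also have "\<dots> = xpow ?e * \<kappa> ((f \<sigma> - f \<tau>) * local_section \<sigma> g)"
      by (simp only: push_diff[symmetric] left_diff_distrib)
    finally have iD: "\<iota> ?D = xpow ?e * \<kappa> ((f \<sigma> - f \<tau>) * local_section \<sigma> g)" .
    note \<rho> = cone_Int(1)[OF \<sigma> \<tau>]
    have "local_section \<sigma> g \<in> chart (\<sigma> \<inter> \<tau>)" using restrict(1)[OF \<sigma> \<tau>] local_section_keys(2)[OF g(1) \<sigma>] by blast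
    then have "local_section \<sigma> g * (f \<sigma> - f \<tau>) \<in> Y (\<sigma> \<inter> \<tau>)" by (rule Y_multI[OF \<rho> _ fY[OF \<sigma> \<tau>]])
    then have "(f \<sigma> - f \<tau>) * local_section \<sigma> g \<in> Y (\<sigma> \<inter> \<tau>)" by (simp only: mult.commute)
    from lift_if_Y[OF \<rho> this iD] obtain l where l: "xhat u (\<sigma> \<inter> \<tau>) ^ l * ?D \<in> I"
      using local_exp_0[OF \<sigma>] by (force simp: expo_hat rays_Int)
    obtain t where t: "xhat u \<sigma> * xhat u \<tau> = (xpow t * xhat u (\<sigma> \<inter> \<tau>) :: ('r, 'k) cox)" using xhat_Int_dvd by blast
    have "xpow t ^ l * (xhat u (\<sigma> \<inter> \<tau>) ^ l * ?D) = (xhat u \<sigma> * xhat u \<tau>) ^ l * ?D"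
      unfolding t power_mult_distrib by (simp only: mult.assoc)
    then show ?thesis using I_mult_eq[OF l] by blast
  qed
  then obtain L where L: "\<And>\<sigma> \<tau>. \<sigma> \<in> \<Sigma> \<Longrightarrow> \<tau> \<in> \<Sigma> \<Longrightarrow> (xhat u \<sigma> * xhat u \<tau>) ^ L \<sigma> \<tau> * (xhat u \<tau> ^ k1 * F1 \<sigma> - xhat u \<sigma> ^ k1 * F1 \<tau>) \<in> I"
    by metis
  define l where "l = (\<Sum>\<sigma>\<in>\<Sigma>. \<Sum>\<tau>\<in>\<Sigma>. L \<sigma> \<tau>)"
  have Ll: "L \<sigma> \<tau> \<le> l" if "\<sigma> \<in> \<Sigma>" "\<tau> \<in> \<Sigma>" for \<sigma> \<tau>
  proof -
    have "L \<sigma> \<tau> \<le> (\<Sum>\<tau>\<in>\<Sigma>. L \<sigma> \<tau>)" using that sigma_finite by (intro member_le_sum) auto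
    also have "\<dots> \<le> l" unfolding l_def using that sigma_finite by (intro member_le_sum[of \<sigma>]) auto
    finally show ?thesis .
  qed
  show thesis
  \<comment> \<open>Multiplying each lift by the \<open>l\<close>-th power of its
    \<open>xhat\<close> absorbs the annihilating power into the new exponent
    \<open>k1 + l\<close>.\<close>
  proof (rule that[of "\<lambda>\<sigma>. xhat u \<sigma> ^ l * F1 \<sigma>" "k1 + l"])
    fix \<sigma> assume \<sigma>: "\<sigma> \<in> \<Sigma>"
    have "of_nat l *s H \<sigma> + (of_nat k1 *s H \<sigma> + local_exp \<sigma>) = of_nat (k1 + l) *s H \<sigma> + local_exp \<sigma>"
      by (simp add: vec_eq_iff ring_distribs)
    then show "\<iota> (xhat u \<sigma> ^ l * F1 \<sigma>) = xpow (of_nat (k1 + l) *s H \<sigma> + local_exp \<sigma>) * \<kappa> (f \<sigma> * local_section \<sigma> g)"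
      by (simp only: push_expo_mult push_expo_xhat F1[OF \<sigma>] xpow_mult_left)
    fix \<tau> assume \<tau>: "\<tau> \<in> \<Sigma>"
    have "(xhat u \<sigma> * xhat u \<tau>) ^ (l - L \<sigma> \<tau>) * ((xhat u \<sigma> * xhat u \<tau>) ^ L \<sigma> \<tau> * (xhat u \<tau> ^ k1 * F1 \<sigma> - xhat u \<sigma> ^ k1 * F1 \<tau>))
      = (xhat u \<sigma> * xhat u \<tau>) ^ l * (xhat u \<tau> ^ k1 * F1 \<sigma> - xhat u \<sigma> ^ k1 * F1 \<tau>)"
      using Ll[OF \<sigma> \<tau>] by (simp flip: power_add mult.assoc)
    also have "\<dots> = xhat u \<tau> ^ (k1 + l) * (xhat u \<sigma> ^ l * F1 \<sigma>) - xhat u \<sigma> ^ (k1 + l) * (xhat u \<tau> ^ l * F1 \<tau>)"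
      by (simp add: power_mult_distrib power_add right_diff_distrib mult_ac)
    finally show "xhat u \<tau> ^ (k1 + l) * (xhat u \<sigma> ^ l * F1 \<sigma>) - xhat u \<sigma> ^ (k1 + l) * (xhat u \<tau> ^ l * F1 \<tau>) \<in> I"
      using I_mult_eq[OF L[OF \<sigma> \<tau>]] by blast
  qed
qed

text \<open>Gluing by the partition of unity: modulo \<open>I\<close>, the element \<open>F'\<close>
  satisfies \<open>xhat u \<tau> ^ k * F' = g ^ T * F \<tau>\<close> for every
  \<open>\<tau>\<close>. Dividing \<open>F'\<close> by \<open>g ^ T\<close> with
  \<open>surj_g\<close> returns to degree \<open>A0\<close>.\<close>

lemma surjective_on_sections:
  assumes f: "f \<in> section_families \<Sigma> Y"
  shows "\<exists>F\<in>S_div u A0. \<forall>\<sigma>\<in>\<Sigma>. f \<sigma> - local_section \<sigma> F * g_inv \<sigma> \<in> Y \<sigma>"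
proof -
  obtain F k where F: "\<And>\<sigma>. \<sigma> \<in> \<Sigma> \<Longrightarrow> \<iota> (F \<sigma>) = xpow (of_nat k *s H \<sigma> + local_exp \<sigma>) * \<kappa> (f \<sigma> * local_section \<sigma> g)"
    and comp: "\<And>\<sigma> \<tau>. \<sigma> \<in> \<Sigma> \<Longrightarrow> \<tau> \<in> \<Sigma> \<Longrightarrow> xhat u \<tau> ^ k * F \<sigma> - xhat u \<sigma> ^ k * F \<tau> \<in> I"
    by (rule exists_compatible_lifts[OF f]) (rule that)
  obtain T C where C: "\<And>\<sigma>. \<sigma> \<in> \<Sigma> \<Longrightarrow> C \<sigma> \<in> S_div u (of_nat T *s A0 - of_nat k *s H \<sigma>)"
    and one: "g ^ T - (\<Sum>\<sigma>\<in>\<Sigma>. C \<sigma> * xhat u \<sigma> ^ k) \<in> I"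
    using partition_of_unity[of k] by blast
  define F' where "F' = (\<Sum>\<sigma>\<in>\<Sigma>. C \<sigma> * F \<sigma>)"
  have "F' \<in> S_div u (A0 + of_nat T *s A0)"
    unfolding F'_def
  proof (rule S_div_sum)
    fix \<sigma> assume \<sigma>: "\<sigma> \<in> \<Sigma>"
    have "S_div u (local_exp \<sigma> + of_nat k *s H \<sigma>) = (S_div u (A0 + of_nat k *s H \<sigma>) :: ('r, 'k) cox set)" by (simp add: S_div_def local_exp_class)
    then have "F \<sigma> \<in> S_div u (A0 + of_nat k *s H \<sigma>)" using S_div_if_push[OF F[OF \<sigma>]] by (simp add: add.commute)
    from S_div_mult[OF C[OF \<sigma>] this] show "C \<sigma> * F \<sigma> \<in> S_div u (A0 + of_nat T *s A0)" by (simp add: algebra_simps)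
  qed
  then obtain x where x: "x \<in> S_div u A0" "F' - x * g ^ T \<in> I" using surj_g by blast
  have "f \<tau> - local_section \<tau> x * g_inv \<tau> \<in> Y \<tau>" if \<tau>: "\<tau> \<in> \<Sigma>" for \<tau>
  proof -
    have "(\<Sum>\<sigma>\<in>\<Sigma>. C \<sigma> * (xhat u \<tau> ^ k * F \<sigma> - xhat u \<sigma> ^ k * F \<tau>)) \<in> I"
      by (intro ideal_sumI[OF I_ideal] ideal_multI[OF I_ideal] comp \<tau>)
    also have "(\<Sum>\<sigma>\<in>\<Sigma>. C \<sigma> * (xhat u \<tau> ^ k * F \<sigma> - xhat u \<sigma> ^ k * F \<tau>)) = xhat u \<tau> ^ k * F' - (\<Sum>\<sigma>\<in>\<Sigma>. C \<sigma> * xhat u \<sigma> ^ k) * F \<tau>"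
      unfolding F'_def sum_distrib_left sum_distrib_right sum_subtractf[symmetric]
      by (intro sum.cong refl) (simp add: right_diff_distrib mult_ac)
    finally have 1: "xhat u \<tau> ^ k * F' - (\<Sum>\<sigma>\<in>\<Sigma>. C \<sigma> * xhat u \<sigma> ^ k) * F \<tau> \<in> I" .
    have "(xhat u \<tau> ^ k * F' - (\<Sum>\<sigma>\<in>\<Sigma>. C \<sigma> * xhat u \<sigma> ^ k) * F \<tau>) - F \<tau> * (g ^ T - (\<Sum>\<sigma>\<in>\<Sigma>. C \<sigma> * xhat u \<sigma> ^ k))
        - xhat u \<tau> ^ k * (F' - x * g ^ T) \<in> I"
      by (intro ideal_diffI[OF I_ideal] ideal_multI[OF I_ideal] 1 one x)
    also have "(xhat u \<tau> ^ k * F' - (\<Sum>\<sigma>\<in>\<Sigma>. C \<sigma> * xhat u \<sigma> ^ k) * F \<tau>) - F \<tau> * (g ^ T - (\<Sum>\<sigma>\<in>\<Sigma>. C \<sigma> * xhat u \<sigma> ^ k))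
        - xhat u \<tau> ^ k * (F' - x * g ^ T) = g ^ T * (xhat u \<tau> ^ k * x - F \<tau>)"
      by (simp add: algebra_simps)
    finally have 2: "xhat u \<tau> ^ k * x - F \<tau> \<in> I" by (rule nzd_D[OF g_power(2)])
    note a = local_section_keys(2)[OF g(1) \<tau>] and lx = local_section_keys(2)[OF x(1) \<tau>] and qt = g_inv[OF \<tau>]
    have fc: "f \<tau> \<in> chart \<tau>" using f \<tau> by (simp add: section_families_def)
    have "local_section \<tau> x - f \<tau> * local_section \<tau> g \<in> Y \<tau>"
    proof (rule Y_if_lift[OF \<tau> _ 2])
      show "local_section \<tau> x - f \<tau> * local_section \<tau> g \<in> chart \<tau>" by (intro chart_diff[OF \<tau>] chart_mult[OF \<tau>] lx fc a)
      show "\<iota> (xhat u \<tau> ^ k * x - F \<tau>) = xpow (of_nat k *s H \<tau> + local_exp \<tau>) * \<kappa> (local_section \<tau> x - f \<tau> * local_section \<tau> g)"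
        by (simp only: push_diff push_expo_mult push_expo_xhat local_section_keys(1)[OF x(1), of \<tau>] F[OF \<tau>] xpow_mult_left right_diff_distrib)
      show "(of_nat k *s H \<tau> + local_exp \<tau>) $ j = 0" if "j \<in> rays u \<tau>" for j using that local_exp_0[OF \<tau>] by (simp add: expo_hat)
    qed
    then have "g_inv \<tau> * (local_section \<tau> x - f \<tau> * local_section \<tau> g) \<in> Y \<tau>" by (rule Y_multI[OF \<tau> qt(1)])
    moreover have "f \<tau> * (local_section \<tau> g * g_inv \<tau> - 1) \<in> Y \<tau>" by (rule Y_multI[OF \<tau> fc qt(2)])
    ultimately have "- (g_inv \<tau> * (local_section \<tau> x - f \<tau> * local_section \<tau> g) + f \<tau> * (local_section \<tau> g * g_inv \<tau> - 1)) \<in> Y \<tau>"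
      by (intro Y_negI[OF \<tau>] Y_addI[OF \<tau>])
    also have "- (g_inv \<tau> * (local_section \<tau> x - f \<tau> * local_section \<tau> g) + f \<tau> * (local_section \<tau> g * g_inv \<tau> - 1)) = f \<tau> - local_section \<tau> x * g_inv \<tau>"
      by (simp add: algebra_simps)
    finally show ?thesis .
  qed
  then show ?thesis using x(1) by blast
qed

text \<open>Numerator and denominator change by the same transition monomial. As
  \<open>g_inv\<close> inverts only modulo \<open>Y\<close>, the difference over an overlap is
  written as a combination of the two errors
  \<open>local_section \<sigma> g * g_inv \<sigma> - 1\<close> and
  \<open>local_section \<tau> g * g_inv \<tau> - 1\<close>.\<close>

lemma division_by_g_section:
  assumes F: "F \<in> S_div u A0" shows "(\<lambda>\<sigma>. local_section \<sigma> F * g_inv \<sigma>) \<in> section_families \<Sigma> Y"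
  unfolding section_families_def
proof (intro CollectI conjI ballI)
  fix \<sigma> assume \<sigma>: "\<sigma> \<in> \<Sigma>"
  show "local_section \<sigma> F * g_inv \<sigma> \<in> chart \<sigma>" by (intro chart_mult[OF \<sigma>] local_section_keys(2)[OF F \<sigma>] g_inv(1)[OF \<sigma>])
  fix \<tau> assume \<tau>: "\<tau> \<in> \<Sigma>"
  note \<rho> = cone_Int(1)[OF \<sigma> \<tau>] and r = restrict[OF \<sigma> \<tau>]
  let ?w = "xpow (mv \<tau> - mv \<sigma>) :: (int ^ 'n) \<Rightarrow>\<^sub>0 'k"
  have ch: "local_section \<sigma> F \<in> chart (\<sigma> \<inter> \<tau>)" "g_inv \<sigma> \<in> chart (\<sigma> \<inter> \<tau>)" "g_inv \<tau> \<in> chart (\<sigma> \<inter> \<tau>)" "?w \<in> chart (\<sigma> \<inter> \<tau>)"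
    using r local_section_keys(2)[OF F \<sigma>] g_inv(1)[OF \<sigma>] g_inv(1)[OF \<tau>] transition_chart[OF \<sigma> \<tau>] by blast+
  have "(local_section \<sigma> F * g_inv \<tau> * ?w) * (local_section \<sigma> g * g_inv \<sigma> - 1) \<in> Y (\<sigma> \<inter> \<tau>)"
    by (rule Y_multI[OF \<rho>]) (use ch chart_mult[OF \<rho>] g_inv(2)[OF \<sigma>] r(2) in auto)
  moreover have "(local_section \<sigma> F * g_inv \<sigma>) * (local_section \<tau> g * g_inv \<tau> - 1) \<in> Y (\<sigma> \<inter> \<tau>)"
    by (rule Y_multI[OF \<rho>]) (use ch chart_mult[OF \<rho>] g_inv(2)[OF \<tau>] r(4) in auto)
  ultimately have "(local_section \<sigma> F * g_inv \<tau> * ?w) * (local_section \<sigma> g * g_inv \<sigma> - 1) - (local_section \<sigma> F * g_inv \<sigma>) * (local_section \<tau> g * g_inv \<tau> - 1) \<in> Y (\<sigma> \<inter> \<tau>)"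
    by (rule Y_diffI[OF \<rho>])
  also have "(local_section \<sigma> F * g_inv \<tau> * ?w) * (local_section \<sigma> g * g_inv \<sigma> - 1) - (local_section \<sigma> F * g_inv \<sigma>) * (local_section \<tau> g * g_inv \<tau> - 1)
      = local_section \<sigma> F * g_inv \<sigma> - local_section \<tau> F * g_inv \<tau>"
    unfolding transition[of \<tau> g \<sigma>] transition[of \<tau> F \<sigma>] by (simp only: right_diff_distrib mult_ac mult_1_right mult_1) (simp add: algebra_simps)
  finally show "local_section \<sigma> F * g_inv \<sigma> - local_section \<tau> F * g_inv \<tau> \<in> Y (\<sigma> \<inter> \<tau>)" .
qed

text \<open>Since \<open>g\<close> is locally invertible, vanishing can be tested on the numerator.
  Vanishing on all charts means that powers of every \<open>xhat u \<sigma>\<close> carry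
  \<open>F\<close> into \<open>I\<close>, and saturation in degree \<open>A0\<close> removes
  them.\<close>

lemma division_by_g_zero_iff:
  assumes F: "F \<in> S_div u A0" shows "(\<lambda>\<sigma>. local_section \<sigma> F * g_inv \<sigma>) \<in> zero_families \<Sigma> Y \<longleftrightarrow> F \<in> I"
proof -
  have local_section_iff: "local_section \<sigma> F * g_inv \<sigma> \<in> Y \<sigma> \<longleftrightarrow> local_section \<sigma> F \<in> Y \<sigma>" if \<sigma>: "\<sigma> \<in> \<Sigma>" for \<sigma>
  proof
    assume "local_section \<sigma> F \<in> Y \<sigma>"
    then show "local_section \<sigma> F * g_inv \<sigma> \<in> Y \<sigma>" using Y_multI[OF \<sigma> g_inv(1)[OF \<sigma>]] by (simp add: mult.commute)
  next
    assume "local_section \<sigma> F * g_inv \<sigma> \<in> Y \<sigma>"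
    then have "local_section \<sigma> g * (local_section \<sigma> F * g_inv \<sigma>) \<in> Y \<sigma>" by (rule Y_multI[OF \<sigma> local_section_keys(2)[OF g(1) \<sigma>]])
    moreover have "local_section \<sigma> F * (local_section \<sigma> g * g_inv \<sigma> - 1) \<in> Y \<sigma>" by (rule Y_multI[OF \<sigma> local_section_keys(2)[OF F \<sigma>] g_inv(2)[OF \<sigma>]])
    ultimately have "local_section \<sigma> g * (local_section \<sigma> F * g_inv \<sigma>) - local_section \<sigma> F * (local_section \<sigma> g * g_inv \<sigma> - 1) \<in> Y \<sigma>" by (rule Y_diffI[OF \<sigma>])
    also have "local_section \<sigma> g * (local_section \<sigma> F * g_inv \<sigma>) - local_section \<sigma> F * (local_section \<sigma> g * g_inv \<sigma> - 1) = local_section \<sigma> F" by (simp add: algebra_simps)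
    finally show "local_section \<sigma> F \<in> Y \<sigma>" .
  qed
  have "(\<forall>\<sigma>\<in>\<Sigma>. local_section \<sigma> F \<in> Y \<sigma>) \<longleftrightarrow> F \<in> I"
  proof
    assume "F \<in> I"
    then have "xhat u \<sigma> ^ 0 * F \<in> I" for \<sigma> by simp
    then show "\<forall>\<sigma>\<in>\<Sigma>. local_section \<sigma> F \<in> Y \<sigma>" using local_section_in_Y_iff[OF _ F] by blast
  next
    assume "\<forall>\<sigma>\<in>\<Sigma>. local_section \<sigma> F \<in> Y \<sigma>"
    then have "\<forall>\<sigma>\<in>\<Sigma>. \<exists>l. xhat u \<sigma> ^ l * F \<in> I" using local_section_in_Y_iff[OF _ F] by blast
    from bchoice[OF this] obtain l where l: "\<And>\<sigma>. \<sigma> \<in> \<Sigma> \<Longrightarrow> xhat u \<sigma> ^ l \<sigma> * F \<in> I" by blast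
    show "F \<in> I"
    proof (rule sat_xhat[of _ 1])
      show "F \<in> S_div u (of_nat 1 *s A0)" using F by simp
      fix \<sigma> assume \<sigma>: "\<sigma> \<in> \<Sigma>"
      let ?N = "\<Sum>\<sigma>\<in>\<Sigma>. l \<sigma>"
      have "l \<sigma> \<le> ?N" using \<sigma> sigma_finite by (intro member_le_sum) auto
      then have "xhat u \<sigma> ^ (?N - l \<sigma>) * (xhat u \<sigma> ^ l \<sigma> * F) = F * xhat u \<sigma> ^ ?N"
        by (simp only: mult.assoc[symmetric] power_add[symmetric]) (simp add: mult.commute)
      then show "F * xhat u \<sigma> ^ ?N \<in> I" by (rule I_mult_eq[OF l[OF \<sigma>]])
    qed
  qed
  then show ?thesis using local_section_iff by (simp add: zero_families_def)
qed

lemma vector_space_families: "quotient_space (\<lambda>c (f :: (real ^ 'n) set \<Rightarrow> (int ^ 'n) \<Rightarrow>\<^sub>0 'k) \<sigma>. pm_scale c (f \<sigma>))"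
  by unfold_locales (auto simp: fun_eq_iff pm.scale_right_distrib pm.scale_left_distrib)

theorem degree_eq_hf: "degree_of \<Sigma> Y = quotient_dim pm_scale (S_div u A0) (I \<inter> S_div u A0)"
proof -
  interpret fam: quotient_space "\<lambda>c (f :: (real ^ 'n) set \<Rightarrow> (int ^ 'n) \<Rightarrow>\<^sub>0 'k) \<sigma>. pm_scale c (f \<sigma>)"
    by (rule vector_space_families)
  have sc: "pm_scale c y \<in> Y \<sigma>" if \<sigma>: "\<sigma> \<in> \<Sigma>" and y: "y \<in> Y \<sigma>" for c y \<sigma>
  proof -
    have "Poly_Mapping.single 0 c \<in> chart \<sigma>" unfolding chart_iff[OF \<sigma>] by simp
    then show ?thesis unfolding pm_scale_def by (rule Y_multI[OF \<sigma> _ y])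
  qed
  interpret m: quotient_map pm_scale "\<lambda>c f \<sigma>. pm_scale c (f \<sigma>)" "\<lambda>F \<sigma>. local_section \<sigma> F * g_inv \<sigma>" "S_div u A0" "I \<inter> S_div u A0"
    "section_families \<Sigma> Y" "zero_families \<Sigma> Y"
  proof unfold_locales
    show "(\<lambda>\<sigma>. local_section \<sigma> (x + y) * g_inv \<sigma>) = (\<lambda>\<sigma>. local_section \<sigma> x * g_inv \<sigma>) + (\<lambda>\<sigma>. local_section \<sigma> y * g_inv \<sigma>)" for x y
      by (simp add: fun_eq_iff local_section_add ring_distribs)
    show "(\<lambda>\<sigma>. local_section \<sigma> (pm_scale c x) * g_inv \<sigma>) = (\<lambda>\<sigma>. pm_scale c (local_section \<sigma> x * g_inv \<sigma>))" for c x
      by (simp add: fun_eq_iff local_section_pm_scale pm_scale_mult(2))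
    show "pm.subspace (S_div u A0)" by (rule S_div_subspace)
    show "pm.subspace (I \<inter> S_div u A0)" by (rule pm.subspace_inter[OF ideal_subspace[OF I_ideal] S_div_subspace])
    show "fam.subspace (zero_families \<Sigma> Y)"
      unfolding fam.subspace_def zero_families_def using Y_0 Y_addI sc by (auto simp: zero_fun_def)
    show "fam.subspace (section_families \<Sigma> Y)"
      unfolding fam.subspace_def
    proof (intro conjI ballI allI)
      show "0 \<in> section_families \<Sigma> Y"
        using Y_0 cone_Int(1) Y_chart[OF _ Y_0] by (auto simp: section_families_def zero_fun_def)
      fix x assume x: "x \<in> section_families \<Sigma> Y"
      show "(\<lambda>\<sigma>. pm_scale c (x \<sigma>)) \<in> section_families \<Sigma> Y" for c
        unfolding section_families_def
      proof (intro CollectI conjI ballI)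
        fix \<sigma> assume \<sigma>: "\<sigma> \<in> \<Sigma>"
        show "pm_scale c (x \<sigma>) \<in> chart \<sigma>"
        proof -
          have "x \<sigma> \<in> chart \<sigma>" using x \<sigma> by (simp add: section_families_def)
          then show ?thesis using keys_pm_scale[of c "x \<sigma>"] unfolding chart_iff[OF \<sigma>] by blast
        qed
        fix \<tau> assume \<tau>: "\<tau> \<in> \<Sigma>"
        have "pm_scale c (x \<sigma> - x \<tau>) \<in> Y (\<sigma> \<inter> \<tau>)"
          using x \<sigma> \<tau> by (intro sc cone_Int) (auto simp: section_families_def)
        then show "pm_scale c (x \<sigma>) - pm_scale c (x \<tau>) \<in> Y (\<sigma> \<inter> \<tau>)" by (simp add: pm.scale_right_diff_distrib)
      qed
      fix y assume y: "y \<in> section_families \<Sigma> Y"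
      show "x + y \<in> section_families \<Sigma> Y"
        unfolding section_families_def
      proof (intro CollectI conjI ballI)
        fix \<sigma> assume \<sigma>: "\<sigma> \<in> \<Sigma>"
        show "(x + y) \<sigma> \<in> chart \<sigma>"
          using x y \<sigma> chart_subring[OF \<sigma>] unfolding section_families_def subring_of_def by simp
        fix \<tau> assume \<tau>: "\<tau> \<in> \<Sigma>"
        have "(x \<sigma> - x \<tau>) + (y \<sigma> - y \<tau>) \<in> Y (\<sigma> \<inter> \<tau>)"
          using x y \<sigma> \<tau> by (intro Y_addI cone_Int) (auto simp: section_families_def)
        then show "(x + y) \<sigma> - (x + y) \<tau> \<in> Y (\<sigma> \<inter> \<tau>)" by (simp add: algebra_simps)
      qed
    qed
    show "(\<lambda>\<sigma>. local_section \<sigma> x * g_inv \<sigma>) \<in> section_families \<Sigma> Y" if "x \<in> S_div u A0" for x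
      using that by (rule division_by_g_section)
    show "x \<in> I \<inter> S_div u A0" if "x \<in> S_div u A0" "(\<lambda>\<sigma>. local_section \<sigma> x * g_inv \<sigma>) \<in> zero_families \<Sigma> Y" for x
      using that division_by_g_zero_iff by blast
  qed
  have "quotient_dim pm_scale (S_div u A0) (I \<inter> S_div u A0) = quotient_dim (\<lambda>c f \<sigma>. pm_scale c (f \<sigma>)) (section_families \<Sigma> Y) (zero_families \<Sigma> Y)"
  proof (rule m.quotient_dim_eq)
    show "(\<lambda>\<sigma>. local_section \<sigma> x * g_inv \<sigma>) \<in> zero_families \<Sigma> Y" if "x \<in> I \<inter> S_div u A0" for x
      using that division_by_g_zero_iff by blast
    show "\<exists>x\<in>S_div u A0. y - (\<lambda>\<sigma>. local_section \<sigma> x * g_inv \<sigma>) \<in> zero_families \<Sigma> Y" if "y \<in> section_families \<Sigma> Y" for y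
      using surjective_on_sections[OF that] by (simp add: zero_families_def)
  qed
  then show ?thesis by (simp add: degree_of_def)
qed

end

section \<open>The regularity theorem\<close>

lemma expo_single: "expo (Poly_Mapping.single j n) = of_nat n *s axis j 1"
  by (simp add: vec_eq_iff expo_nth lookup_single axis_def when_def)

lemma N_beta_iff: "\<gamma> \<in> N_beta u \<longleftrightarrow> (\<exists>t. \<gamma> = div_class u (expo t))"
proof
  assume "\<gamma> \<in> N_beta u"
  then show "\<exists>t. \<gamma> = div_class u (expo t)"
  proof induction
    case zero
    have "div_class u 0 = div_class u (expo 0)" by simp
    then show ?case by blast
  next
    case (add \<gamma> j)
    then obtain t where "\<gamma> = div_class u (expo t)" by blast
    then have "\<gamma> + beta u j = div_class u (expo (t + Poly_Mapping.single j 1))"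
      by (simp add: beta_def div_class_add expo_add expo_single)
    then show ?case by blast
  qed
next
  have "\<forall>D. div_class u D \<in> N_beta u \<longrightarrow> div_class u (D + expo t) \<in> N_beta u" for t
  proof (induction t rule: poly_mapping_additive_induct)
    case (add p q)
    then show ?case by (simp add: expo_add flip: add.assoc)
  next
    case (single j n)
    show ?case
    proof (induction n)
      case (Suc n)
      have step: "div_class u (D + expo (Poly_Mapping.single j (Suc n))) = div_class u (D + expo (Poly_Mapping.single j n)) + beta u j" for D
        unfolding beta_def div_class_add expo_single by (simp add: ring_distribs add_ac vec_eq_iff flip: div_class_add)
      show ?case unfolding step using Suc N_beta.add by blast
    qed simp
  qed simp
  from this[rule_format, of 0] show "\<exists>t. \<gamma> = div_class u (expo t) \<Longrightarrow> \<gamma> \<in> N_beta u" using N_beta.zero by auto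
qed

text \<open>The empty sum of sets is \<open>{0}\<close>, whereas the trivial class is the coset of
  all principal divisors; hence the restriction to nonempty \<open>J\<close>.\<close>

lemma div_class_sum:
  "finite J \<Longrightarrow> J \<noteq> {} \<Longrightarrow> (\<Sum>i\<in>J. div_class u (A i)) = div_class u (\<Sum>i\<in>J. A i)"
  by (induction J rule: finite_ne_induct) (auto simp: div_class_add)

lemma cartier_sum:
  assumes "\<And>i. i \<in> J \<Longrightarrow> cartier \<Sigma> u (A i)" shows "cartier \<Sigma> u (\<Sum>i\<in>J. A i)"
  unfolding cartier_def
proof
  fix \<sigma> assume \<sigma>: "\<sigma> \<in> \<Sigma>"
  have "\<forall>i\<in>J. \<exists>m. \<forall>j. of_lat (u j) \<in> \<sigma> \<longrightarrow> char_div u m $ j = A i $ j"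
    using assms \<sigma> unfolding cartier_def by blast
  from bchoice[OF this] obtain m where "\<And>i j. i \<in> J \<Longrightarrow> of_lat (u j) \<in> \<sigma> \<Longrightarrow> char_div u (m i) $ j = A i $ j" by blast
  then have "\<forall>j. of_lat (u j) \<in> \<sigma> \<longrightarrow> char_div u (\<Sum>i\<in>J. m i) $ j = (\<Sum>i\<in>J. A i) $ j"
    by (auto simp: char_div_sum sum_component intro!: sum.cong)
  then show "\<exists>m. \<forall>j. of_lat (u j) \<in> \<sigma> \<longrightarrow> char_div u m $ j = (\<Sum>i\<in>J. A i) $ j" by blast
qed

lemma of_nat_smult_eq_sum: "of_nat k *s (D :: int ^ 'r) = (\<Sum>i<k. D)"
  by (induction k) (simp_all add: vec_eq_iff ring_distribs)

theorem theorem3p16: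
  fixes \<Sigma> :: "(real ^ 'n::finite) set set"
    and u :: "'r::finite \<Rightarrow> int ^ 'n"
    and Y :: "('n, 'k::alg_closed_field) subscheme"
    and I_Y :: "('r, 'k) cox set"
    and \<alpha> :: "nat \<Rightarrow> (int ^ 'r) set"
    and F :: "nat \<Rightarrow> ('r, 'k) cox"
  assumes "fan \<Sigma>" and "complete_fan \<Sigma>" and "simplicial_fan \<Sigma>"
    and "ray_generators \<Sigma> u"
    and "torsion_free_Cl u"
    and "closed_subscheme \<Sigma> Y"
    and "has_dimension \<Sigma> Y 0"
    and "is_ideal_of \<Sigma> u Y I_Y"
    and "complete_intersection \<Sigma> u Y I_Y"
    and "I_Y = ideal_gen (F ` {..<CARD('n)})"
    and "\<And>i. i < CARD('n) \<Longrightarrow> F i \<in> S_deg u (\<alpha> i)"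
    and "\<And>i. i < CARD('n) \<Longrightarrow> semi_ample TYPE('k) \<Sigma> u (\<alpha> i)"
    and "\<And>j. \<exists>h \<in> S_deg u (beta u j). nonzerodivisor_mod h I_Y"
  shows "{(\<Sum>i<CARD('n). \<alpha> i) + \<gamma> | \<gamma>. \<gamma> \<in> N_beta u} \<subseteq> reg \<Sigma> u Y I_Y"
proof -
  let ?n = "CARD('n)"
  note complete_int = assms(9) and gen = assms(10) and degF = assms(11) and ample = assms(12) and nzd = assms(13)
  interpret toric \<Sigma> u by unfold_locales (rule assms)+
  have "\<forall>i\<in>{..<?n}. \<exists>Dp. cartier \<Sigma> u (fst Dp) \<and> \<alpha> i = div_class u (fst Dp) \<and> nef_vertices (fst Dp) (snd Dp)"
  proof
    fix i assume "i \<in> {..<?n}"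
    then have "semi_ample TYPE('k) \<Sigma> u (\<alpha> i)" using ample by simp
    then obtain D p where "cartier \<Sigma> u D" "\<alpha> i = div_class u D" "nef_vertices D p" by (rule semi_ample_nef)
    then show "\<exists>Dp. cartier \<Sigma> u (fst Dp) \<and> \<alpha> i = div_class u (fst Dp) \<and> nef_vertices (fst Dp) (snd Dp)"
      by (intro exI[of _ "(D, p)"]) simp
  qed
  from bchoice[OF this] obtain Dp where Dp: "\<And>i. i < ?n \<Longrightarrow> cartier \<Sigma> u (fst (Dp i)) \<and> \<alpha> i = div_class u (fst (Dp i)) \<and> nef_vertices (fst (Dp i)) (snd (Dp i))"
    by auto
  define A where "A i = fst (Dp i)" for i
  define p where "p i = snd (Dp i)" for i
  have A: "cartier \<Sigma> u (A i)" "\<alpha> i = div_class u (A i)" "nef_vertices (A i) (p i)" if "i < ?n" for i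
    using Dp[OF that] by (auto simp: A_def p_def)
  have FA: "F i \<in> S_div u (A i)" if "i < ?n" for i
    using degF[OF that] A(2)[OF that] by (simp add: S_div_def)
  define A0 where "A0 = (\<Sum>i<?n. A i)"
  have nefA0: "nef_vertices A0 (\<lambda>s. \<Sum>i<?n. p i s)" unfolding A0_def by (intro nef_vertices_sum A) simp
  have cartA0: "cartier \<Sigma> u (of_nat k *s A0)" for k
    unfolding of_nat_smult_eq_sum A0_def by (intro cartier_sum A) simp
  obtain d Fs where Fs: "has_dimension \<Sigma> Y d" "length Fs + d = ?n" "\<forall>G \<in> set Fs. homogeneous u G"
    "regular_sequence Fs" "I_Y = ideal_gen (set Fs)"
    using complete_int unfolding complete_intersection_def by blast
  \<comment> \<open>The dimension is unique, so the regular sequence has exactly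
    \<open>CARD('n)\<close> members.\<close>
  have "d = 0" using Fs(1) assms(7) by (auto simp: has_dimension_def)
  then have len: "length Fs = ?n" using Fs(2) by simp
  have take: "set (take i Fs) = (!) Fs ` {..<i}" if "i \<le> ?n" for i
    using nth_image[of i Fs] that len by (simp add: atLeast0LessThan)
  have IG: "I_Y = ideal_gen ((!) Fs ` {..<?n})" using Fs(5) take[of ?n] len by simp
  have "\<forall>i\<in>{..<?n}. \<exists>E. Fs ! i \<in> S_div u E"
  proof
    fix i assume "i \<in> {..<?n}"
    then have "homogeneous u (Fs ! i)" using Fs(3) len by simp
    then show "\<exists>E. Fs ! i \<in> S_div u E" by (auto simp: homogeneous_def Cl_def S_div_def)
  qed
  from bchoice[OF this] obtain E where E: "\<And>i. i < ?n \<Longrightarrow> Fs ! i \<in> S_div u (E i)" by auto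
  have regular: "nonzerodivisor_mod (Fs ! i) (ideal_gen ((!) Fs ` {..<i}))" if "i < ?n" for i
  proof -
    have "nonzerodivisor_mod (Fs ! i) (ideal_gen (set (take i Fs)))"
      using Fs(4) that len by (simp add: regular_sequence_def)
    then show ?thesis using take[of i] that by simp
  qed
  have proper: "ideal_gen ((!) Fs ` {..<?n}) \<noteq> UNIV"
    using Fs(4,5) IG by (simp add: regular_sequence_def)
  have hilb_I: "hilb I_Y D = (\<Sum>J\<in>Pow {..<?n}. (-1) ^ card J * int (card (lat u (D - (\<Sum>i\<in>J. A i)))))" for D
    unfolding gen by (rule hilb_complete_intersection[OF FA E regular _ proper]) (use gen IG in simp_all)
  \<comment> \<open>For nef \<open>D\<close> the shift by \<open>A0\<close> leaves only nef divisors
    inside \<open>lat\<close>, to which the vanishing of mixed differences applies.\<close>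
  have hilb_mixed: "hilb I_Y (D + A0) = (-1) ^ ?n * mixed A D" for D
    unfolding hilb_I A0_def by (rule alternating_eq_mixed)
  have mixed_mult: "mixed A (of_nat t *s A0) = mixed A 0" for t
  proof (induction t)
    case (Suc t)
    have "of_nat (Suc t) *s A0 = of_nat t *s A0 + A0" by (simp add: vec_eq_iff ring_distribs)
    moreover have "mixed A (of_nat t *s A0 + A0) = mixed A (of_nat t *s A0)"
      by (rule mixed_const[OF A(3) nef_vertices_scale[OF nefA0] nefA0])
    ultimately show ?case using Suc by (simp only:)
  next
    case 0
    have "of_nat 0 *s A0 = 0" by (simp add: vec_eq_iff)
    then show ?case by simp
  qed
  have hilb_A0: "hilb I_Y A0 = (-1) ^ ?n * mixed A 0" using hilb_mixed[of 0] by simp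
  have stable: "hilb I_Y (of_nat (Suc t) *s A0) = hilb I_Y A0" for t
  proof -
    have "of_nat (Suc t) *s A0 = of_nat t *s A0 + A0" by (simp add: vec_eq_iff ring_distribs)
    then show ?thesis using hilb_mixed[of "of_nat t *s A0"] hilb_A0 mixed_mult by (simp only:)
  qed
  have "\<exists>h. \<forall>j. h j \<in> S_div u (axis j 1) \<and> nonzerodivisor_mod (h j) I_Y"
    using nzd unfolding beta_def S_div_def by (intro choice) blast
  then obtain h where h: "\<And>j. h j \<in> S_div u (axis j 1)" "\<And>j. nonzerodivisor_mod (h j) I_Y" by blast
  have "\<forall>\<sigma>\<in>\<Sigma>. \<exists>m. \<forall>j\<in>rays u \<sigma>. char_div u m $ j = A0 $ j"
    using cartA0[of 1] by (simp add: cartier_def rays_def)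
  from bchoice[OF this] obtain mv where mv: "\<And>\<sigma> j. \<sigma> \<in> \<Sigma> \<Longrightarrow> j \<in> rays u \<sigma> \<Longrightarrow> char_div u (mv \<sigma>) $ j = A0 $ j"
    by blast
  have I_ideal: "ideal_in UNIV I_Y" unfolding gen by (rule ideal_in_ideal_gen)
  interpret subscheme_setup \<Sigma> u I_Y A0 h Y mv
  proof unfold_locales
    show "homog_closed u I_Y" unfolding gen by (rule homog_closed_ideal_gen) (use FA in auto)
    show "1 \<notin> I_Y"
    proof
      assume "1 \<in> I_Y"
      then have "x \<in> I_Y" for x using ideal_multI[OF I_ideal, of 1 x] by simp
      then show False using proper IG by blast
    qed
    show "h j \<in> S_div u (axis j 1)" "nonzerodivisor_mod (h j) I_Y" for j by (rule h)+
    show "hilb I_Y (of_nat (Suc t) *s A0) = hilb I_Y A0" for t by (rule stable)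
    obtain x where "generic x" using exists_generic by blast
    then obtain s where "s \<in> max_cones" using generic_unique_cone by blast
    then show "lat u A0 \<noteq> {}" using nefA0 by (auto simp: nef_vertices_def)
    show "lat u (A0 - axis j 1) \<noteq> {}" if "hilb I_Y A0 \<noteq> 0" for j
    proof
      assume "lat u (A0 - axis j 1) = {}"
      then have "mixed A 0 = 0" unfolding A0_def by (intro mixed_0[OF A(3) _ u_nonzero])
      then show False using that hilb_A0 by simp
    qed
    show "subscheme_of u I_Y \<sigma> = Y \<sigma>" if "\<sigma> \<in> \<Sigma>" for \<sigma>
      using assms(8) that by (simp add: is_ideal_of_def defines_subscheme_def)
    show "char_div u (mv \<sigma>) $ j = A0 $ j" if "\<sigma> \<in> \<Sigma>" "j \<in> rays u \<sigma>" for \<sigma> j by (rule mv[OF that])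
    show "f \<in> I_Y" if f: "f \<in> S_div u (of_nat k *s A0)" "f \<in> saturation I_Y (irrelevant_ideal \<Sigma> u)" for f k
    proof -
      have Pic: "div_class u (of_nat k *s A0) \<in> Pic \<Sigma> u" using cartA0 by (auto simp: Pic_def)
      \<comment> \<open>The first normalization is saturated in every degree, the second one in the
        classes of Cartier divisors; multiples of \<open>A0\<close> are covered by both.\<close>
      consider "saturation I_Y (irrelevant_ideal \<Sigma> u) = I_Y" | "Pic_saturated \<Sigma> u I_Y"
        using assms(8) by (auto simp: is_ideal_of_def)
      then show ?thesis
      proof cases
        case 1 then show ?thesis using f by simp
      next
        case 2 then show ?thesis using f Pic unfolding Pic_saturated_def S_div_def by blast
      qed
    qed
  qed (rule assms)+
  show ?thesis
  proof
    fix \<beta> assume "\<beta> \<in> {(\<Sum>i<?n. \<alpha> i) + \<gamma> | \<gamma>. \<gamma> \<in> N_beta u}"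
    then obtain t where t: "\<beta> = (\<Sum>i<?n. \<alpha> i) + div_class u (expo t)" by (auto simp: N_beta_iff)
    have "(\<Sum>i<?n. \<alpha> i) = (\<Sum>i<?n. div_class u (A i))" using A(2) by (intro sum.cong) auto
    also have "\<dots> = div_class u A0" unfolding A0_def by (intro div_class_sum) (auto simp: lessThan_empty_iff)
    finally have \<beta>: "\<beta> = div_class u (A0 + expo t)" using t by (simp add: div_class_add)
    \<comment> \<open>Membership in \<open>N_beta\<close> needs a monomial in the class of
      \<open>A0\<close> as well, which a vertex of its polytope provides.\<close>
    obtain t0 where "div_class u (expo t0) = div_class u A0" using A0_eff lat_nonempty_monomial by blast
    then have "\<beta> = div_class u (expo (t0 + t))" unfolding \<beta> expo_add by (metis div_class_add)
    then have "\<beta> \<in> N_beta u" by (auto simp: N_beta_iff)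
    moreover have "hilbert_function u I_Y \<beta> = degree_of \<Sigma> Y"
    proof -
      have "hilbert_function u I_Y \<beta> = enat (nat (hilb I_Y (A0 + expo t)))"
        using hilb(1)[OF I_ideal, of "A0 + expo t"] by (simp add: hilbert_function_def \<beta> S_div_def)
      also have "\<dots> = degree_of \<Sigma> Y"
        unfolding hilb_A0_plus_effective degree_eq_hf hilb(1)[OF I_ideal] ..
      finally show ?thesis .
    qed
    ultimately show "\<beta> \<in> reg \<Sigma> u Y I_Y" by (simp add: reg_def)
  qed
qed

end
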